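(* Let $(v,d,E)$ be an energy-variational solution of the Ericksen--Leslie equations (as defined in the context) with regularity weight $\mathcal K(\tilde v)=2\|(\nabla\tilde v)_{sym,-}\|_{\mathcal C(\overline\Omega)}$ (and its associated Ericksen stress $T^E=T^E_2$), such that $E(0)=\mathcal E(v_0,d_0)$. Then there exists a measure-valued solution $(v,d,m)$ (as defined in the context) with $$\frac12\langle m,I\rangle=\frac12\int_{\overline\Omega}I:dm=\frac12\int_{\overline\Omega}d\operatorname{tr}(m)\le E-\mathcal E(v,d)\qquad\text{a.e. in }(0,T).$$
   Context: Setting. $\Omega\subset\mathbb{R}^3$ is the spatial domain, $T>0$, and $\lambda,\mu_1,\mu_4,\mu_5,\mu_6\in\mathbb{R}$ satisfy $\mu_4>0$, $\mu_5+\mu_6-\lambda^2\ge0$, $\mu_1+\lambda^2\ge0$. The data are an initial velocity $v_0$, an initial director $d_0$ with $|d_0|=1$ in $\Omega$, and a boundary director $d_\Gamma$ with $|d_\Gamma|=1$ on $\partial\Omega$. Notation. $L^2_\sigma(\Omega)$ and $H^1_{0,\sigma}(\Omega)$ are the closures of the smooth compactly supported solenoidal vector fields $\Omega\to\mathbb{R}^3$ in $L^2(\Omega)$ and $H^1(\Omega)$. $H^1(\Omega;\mathbb S^2)$ is the set of $d\in H^1(\Omega;\mathbb{R}^3)$ with $|d|=1$ a.e. in $\Omega$. $\mathcal C_w([0,T];X)$ denotes weakly continuous functions with values in $X$; $BV([0,T])$ denotes bounded functions of bounded variation on $[0,T]$. $(\nabla v)_{ij}=\partial_jv_i$; $A_{sym}$,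 $A_{skw}$ are the symmetric and skew-symmetric parts of a matrix; $A_{sym,-}$ is the negative semi-definite part of the symmetric part, measured in the spectral norm; $A:B$ is the Frobenius product; $(a\otimes b)_{ij}=a_ib_j$; $[d]_x$ is the matrix with $[d]_xy=d\times y$; $I$ is the identity matrix. $\mathcal M(\overline\Omega;\mathbb{R}^{3\times3}_{sym,+})$ is the set of Radon measures $\mu$ on $\overline\Omega$ with values in the symmetric matrices such that $\xi\otimes\xi:\mu$ is nonnegative for every $\xi\in\mathbb{R}^3$; $L^\infty_{w^*}(0,T;\cdot)$ denotes weakly-$*$ measurable, essentially bounded functions. For a function $g$ of time, $g|_{s-}^t=g(t)-g(s-)$ with the left limit at $s$. The total energy is $\mathcal E(v,d)=\frac12\|v\|_{L^2(\Omega)}^2+\frac12\|\nabla d\|_{L^2(\Omega)}^2$. The term $d\times\Delta d$ is understood as the weak divergence of $d\times\nabla d$; for $|d|=1$, $[d]_x^T[d]_x\Delta d=(I-d\otimes d)\Delta d$ is understood as $-d\times(d\times\Delta d)$, and $[d\otimes\Delta d]_{skw}$ as $[d\otimes([d]_x^T[d]_x\Delta d)]_{skw}$. Set $$T^D=(\mu_1+\lambda^2)(d\cdot(\nabla v)_{sym}d)(d\otimes d)+\mu_4(\nabla v)_{sym}+(\mu_5+\mu_6-\lambda^2)(d\otimes(\nabla v)_{sym}d)_{sym},$$ $$T^L=T^D+\lambda\big[d\otimes[d]_x^T[d]_x\Delta d\big]_{sym}+[d\otimes\Delta d]_{skw}.$$ Energy-variational solution. A triple $(v,d,E)$ is an energy-variational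 solution (with weight $\mathcal K$ and associated Ericksen stress $T^E$) if - $v\in\mathcal C_w([0,T];L^2_\sigma(\Omega))\cap L^2(0,T;H^1_{0,\sigma}(\Omega))$, $E\in BV([0,T])$, - $d\in\mathcal C_w([0,T];H^1(\Omega;\mathbb S^2))\cap H^1(0,T;L^{3/2}(\Omega;\mathbb{R}^3))$ with $d\times\Delta d\in L^2(0,T;L^2(\Omega;\mathbb{R}^3))$, - $E\ge\mathcal E(v,d)$ on $[0,T]$ and $|d|=1$ a.e. in $\Omega\times(0,T)$, - the initial values $v(0)=v_0$, $d(0)=d_0$ are fulfilled in a weak sense, and $\operatorname{tr}(d(t))=\operatorname{tr}(d_\Gamma)$ for a.e. $t\in(0,T)$, - the energy-variational inequality $$\begin{aligned}&\Big[E-\int_\Omega v\cdot\tilde v\,dx\Big]\Big|_{s-}^t+\int_s^t\int_\Omega v\cdot\partial_t\tilde v-(v\cdot\nabla)v\cdot\tilde v\,dx\,d\tau+\int_s^t\langle T^E(d),\tilde v\rangle\,d\tau\\&+\int_s^t\int_\Omega\big((\mu_1+\lambda^2)(d\cdot(\nabla v)_{sym}d)(d\otimes d)+\mu_4(\nabla v)_{sym}\big):(\nabla v-\nabla\tilde v)\,dx\,d\tau\\&+\int_s^t\int_\Omega(\mu_5+\mu_6-\lambda^2)(d\otimes(\nabla v)_{sym}d)_{sym}:(\nabla v-\nabla\tilde v)+|d\times\Delta d|^2\,dx\,d\tau\\&+\int_s^t\int_\Omega\big(\lambda[d\otimes[d]_x^T[d]_x\Delta d]_{sym}+[d\otimes\Delta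 d]_{skw}\big):\nabla\tilde v\,dx\,d\tau+\int_s^t\mathcal K(\tilde v)\big[\mathcal E(v,d)-E\big]d\tau\le0\end{aligned}$$ holds for all $s,t\in(0,T)$, $s<t$, and all $\tilde v\in\mathcal C^1([0,T];(H^1_{0,\sigma}(\Omega))^* )\cap L^2(0,T;H^1_{0,\sigma}(\Omega))$ with $\mathcal K(\tilde v)\in L^1(0,T)$, - the director equation $$\partial_td+(v\cdot\nabla)d-(\nabla v)_{skw}d+(I-d\otimes d)\big(\lambda(\nabla v)_{sym}d-\Delta d\big)=0\qquad(\mathrm D)$$ holds a.e. in $\Omega\times(0,T)$. For $\mathcal K(\tilde v)=2\|(\nabla\tilde v)_{sym,-}\|_{\mathcal C(\overline\Omega)}$ the associated Ericksen stress is $\langle T^E_2(d),\tilde v\rangle=-\int_\Omega(\nabla d^T\nabla d):\nabla\tilde v\,dx$. Measure-valued solution. A tuple $(v,d,m)$ is a measure-valued solution if $v\in\mathcal C_w([0,T];L^2_\sigma(\Omega))\cap L^2(0,T;H^1_{0,\sigma}(\Omega))$, $d\in\mathcal C_w([0,T];H^1(\Omega;\mathbb S^2))$, $m\in L^\infty_{w^*}(0,T;\mathcal M(\overline\Omega;\mathbb{R}^{3\times3}_{sym,+}))$, if (D) is fulfilled, if $$\int_0^T\Big[\int_\Omega T^L:(\nabla\tilde v)_{sym}-(v\otimes v+\nabla d^T\nabla d):\nabla\tilde v-v\cdot\partial_t\tilde v\,dx-2\int_{\overline\Omega}(\nabla\tilde v)_{sym}:dm(x)\Big]ds=0$$ for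 all $\tilde v\in\mathcal C_c^\infty(\Omega\times(0,T))$ (vector-valued), and if the energy inequality $$\frac12\Big(\|v\|_{L^2(\Omega)}^2+\|\nabla d\|_{L^2(\Omega)}^2+\int_{\overline\Omega}I:dm(x)\Big)\Big|_0^t+\int_0^t\int_\Omega T^D:(\nabla v)_{sym}+|d\times\Delta d|^2\,dx\,ds\le0$$ holds for a.e. $t\in(0,T)$.
   Formalization: In the energy-variational inequality the signs of the Ericksen and elastic terms are reversed and s=0 is admitted with E(0-)=E(0); momentum test fields are solenoidal and T^L is paired with the full gradient; the trace bound is also shown at t=0, which fixes m(0)=0. *)

theory Defs
  imports "HOL-Analysis.Analysis"
begin

type_synonym vec3 = "real^3"
type_synonym mat3 = "real^3^3"
type_synonym field3 = "vec3 \<Rightarrow> vec3"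

section \<open>Matrices\<close>

text \<open>The inner product of \<^typ>\<open>real^3^3\<close> is the Frobenius product and its norm is the Frobenius norm.\<close>

definition msym :: "mat3 \<Rightarrow> mat3" where
  "msym A = (1/2) *\<^sub>R (A + transpose A)"

definition mskw :: "mat3 \<Rightarrow> mat3" where
  "mskw A = (1/2) *\<^sub>R (A - transpose A)"

definition tensor :: "vec3 \<Rightarrow> vec3 \<Rightarrow> mat3" where
  "tensor a b = (\<chi> i j. a $ i * b $ j)"

definition psd :: "mat3 \<Rightarrow> bool" where
  "psd A \<longleftrightarrow> transpose A = A \<and> (\<forall>\<xi>. 0 \<le> \<xi> \<bullet> (A *v \<xi>))"

text \<open>The decomposition of the symmetric part of a matrix into a positive and a negative
  semi-definite part with product zero, that is, the one obtained by diagonalisation.\<close>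

definition neg_part :: "mat3 \<Rightarrow> mat3" where
  "neg_part A = (THE N. psd (- N) \<and> psd (msym A - N) \<and> N ** (msym A - N) = 0)"

definition spectral_norm :: "mat3 \<Rightarrow> real" where
  "spectral_norm A = onorm (\<lambda>x. A *v x)"

section \<open>Test functions and weak derivatives\<close>

text \<open>Functions on subsets of the space are total functions, read only on the subset and up to null sets.\<close>

primrec Ck :: "nat \<Rightarrow> ('a::euclidean_space \<Rightarrow> 'b::real_normed_vector) \<Rightarrow> bool" where
  "Ck 0 f \<longleftrightarrow> continuous_on UNIV f"
| "Ck (Suc n) f \<longleftrightarrow> (\<forall>x. f differentiable (at x)) \<and>
     (\<forall>b\<in>Basis. Ck n (\<lambda>x. frechet_derivative f (at x) b))"

definition test_fun :: "'a::euclidean_space set \<Rightarrow> ('a \<Rightarrow> 'b::real_normed_vector) set" where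
  "test_fun U = {\<phi>. (\<forall>n. Ck n \<phi>) \<and> compact (closure {x. \<phi> x \<noteq> 0}) \<and> closure {x. \<phi> x \<noteq> 0} \<subseteq> U}"

text \<open>\<^term>\<open>jacobian u (at x)\<close> has entry \<open>\<partial>\<^sub>j u\<^sub>i\<close> in row \<open>i\<close> and column \<open>j\<close>,
  so its trace is the divergence of \<open>u\<close>.\<close>

definition test_fun_sol :: "vec3 set \<Rightarrow> field3 set" where
  "test_fun_sol \<Omega> = {\<phi> \<in> test_fun \<Omega>. \<forall>x. trace (jacobian \<phi> (at x)) = 0}"

definition loc_int :: "vec3 set \<Rightarrow> (vec3 \<Rightarrow> 'b::euclidean_space) \<Rightarrow> bool" where
  "loc_int \<Omega> f \<longleftrightarrow> (\<forall>C. compact C \<and> C \<subseteq> \<Omega> \<longrightarrow> integrable (lebesgue_on C) f)"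

definition has_weak_grad :: "vec3 set \<Rightarrow> field3 \<Rightarrow> (vec3 \<Rightarrow> mat3) \<Rightarrow> bool" where
  "has_weak_grad \<Omega> u G \<longleftrightarrow> loc_int \<Omega> u \<and> loc_int \<Omega> G \<and>
     (\<forall>\<phi>\<in>test_fun \<Omega>. \<forall>i j.
        (LINT x|lebesgue_on \<Omega>. u x $ i * frechet_derivative \<phi> (at x) (axis j 1))
        = - (LINT x|lebesgue_on \<Omega>. G x $ i $ j * \<phi> x))"

definition wgrad :: "vec3 set \<Rightarrow> field3 \<Rightarrow> vec3 \<Rightarrow> mat3" where
  "wgrad \<Omega> u = (SOME G. has_weak_grad \<Omega> u G)"

definition has_weak_div :: "vec3 set \<Rightarrow> (vec3 \<Rightarrow> mat3) \<Rightarrow> field3 \<Rightarrow> bool" where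
  "has_weak_div \<Omega> M f \<longleftrightarrow> loc_int \<Omega> M \<and> loc_int \<Omega> f \<and>
     (\<forall>\<phi>\<in>test_fun \<Omega>.
        (LINT x|lebesgue_on \<Omega>. M x \<bullet> jacobian \<phi> (at x)) = - (LINT x|lebesgue_on \<Omega>. f x \<bullet> \<phi> x))"

definition cross_columns :: "vec3 \<Rightarrow> mat3 \<Rightarrow> mat3" where
  "cross_columns a G = (\<chi> i j. cross3 a (column j G) $ i)"

definition has_cross_lap :: "vec3 set \<Rightarrow> field3 \<Rightarrow> field3 \<Rightarrow> bool" where
  "has_cross_lap \<Omega> d f \<longleftrightarrow> has_weak_div \<Omega> (\<lambda>x. cross_columns (d x) (wgrad \<Omega> d x)) f"

definition cross_lap :: "vec3 set \<Rightarrow> field3 \<Rightarrow> field3" where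
  "cross_lap \<Omega> d = (SOME f. has_cross_lap \<Omega> d f)"

text \<open>For \<open>|d| = 1\<close> this is the projected Laplacian
  \<open>[d]\<^sub>x\<^sup>T[d]\<^sub>x \<Delta>d = (I - d \<otimes> d) \<Delta>d = - d \<times> (d \<times> \<Delta>d)\<close>.\<close>

definition proj_lap :: "vec3 set \<Rightarrow> field3 \<Rightarrow> field3" where
  "proj_lap \<Omega> d x = - cross3 (d x) (cross_lap \<Omega> d x)"

section \<open>Function spaces\<close>

definition Lp :: "vec3 set \<Rightarrow> real \<Rightarrow> (vec3 \<Rightarrow> 'b::euclidean_space) set" where
  "Lp \<Omega> p = {u. u \<in> borel_measurable (lebesgue_on \<Omega>) \<and>
                 integrable (lebesgue_on \<Omega>) (\<lambda>x. norm (u x) powr p)}"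

definition Lp_norm :: "vec3 set \<Rightarrow> real \<Rightarrow> (vec3 \<Rightarrow> 'b::euclidean_space) \<Rightarrow> real" where
  "Lp_norm \<Omega> p u = (LINT x|lebesgue_on \<Omega>. norm (u x) powr p) powr (1 / p)"

definition H1 :: "vec3 set \<Rightarrow> field3 set" where
  "H1 \<Omega> = {u \<in> Lp \<Omega> 2. \<exists>G\<in>Lp \<Omega> 2. has_weak_grad \<Omega> u G}"

definition H1_norm :: "vec3 set \<Rightarrow> field3 \<Rightarrow> real" where
  "H1_norm \<Omega> u = sqrt ((Lp_norm \<Omega> 2 u)\<^sup>2 + (Lp_norm \<Omega> 2 (wgrad \<Omega> u))\<^sup>2)"

definition H1_sphere :: "vec3 set \<Rightarrow> field3 set" where
  "H1_sphere \<Omega> = {d \<in> H1 \<Omega>. AE x in lebesgue_on \<Omega>. norm (d x) = 1}"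

definition L2_sol :: "vec3 set \<Rightarrow> field3 set" where
  "L2_sol \<Omega> = {u \<in> Lp \<Omega> 2. \<forall>\<epsilon>>0. \<exists>\<phi>\<in>test_fun_sol \<Omega>. Lp_norm \<Omega> 2 (\<lambda>x. u x - \<phi> x) < \<epsilon>}"

definition H10_sol :: "vec3 set \<Rightarrow> field3 set" where
  "H10_sol \<Omega> = {u \<in> H1 \<Omega>. \<forall>\<epsilon>>0. \<exists>\<phi>\<in>test_fun_sol \<Omega>. H1_norm \<Omega> (\<lambda>x. u x - \<phi> x) < \<epsilon>}"

text \<open>Bounded linear functionals on a space \<open>X\<close> of functions with (semi)norm \<open>N\<close>; boundedness
  makes them independent of the representative.\<close>

definition dual :: "field3 set \<Rightarrow> (field3 \<Rightarrow> real) \<Rightarrow> (field3 \<Rightarrow> real) set" where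
  "dual X N = {F. (\<forall>u\<in>X. \<forall>w\<in>X. F (\<lambda>x. u x + w x) = F u + F w) \<and>
                  (\<forall>u\<in>X. \<forall>c. F (\<lambda>x. c *\<^sub>R u x) = c * F u) \<and>
                  (\<exists>C. \<forall>u\<in>X. \<bar>F u\<bar> \<le> C * N u)}"

definition dual_norm :: "field3 set \<Rightarrow> (field3 \<Rightarrow> real) \<Rightarrow> (field3 \<Rightarrow> real) \<Rightarrow> real" where
  "dual_norm X N F = (SUP u\<in>{u\<in>X. N u \<le> 1}. \<bar>F u\<bar>)"

definition weak_cont ::
  "real \<Rightarrow> field3 set \<Rightarrow> (field3 \<Rightarrow> real) \<Rightarrow> field3 set \<Rightarrow> (real \<Rightarrow> field3) set" where
  "weak_cont T X N Y = {u. (\<forall>t\<in>{0..T}. u t \<in> Y) \<and>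
                           (\<forall>F\<in>dual X N. continuous_on {0..T} (\<lambda>t. F (u t)))}"

text \<open>\<open>L\<^sup>2(0,T;X)\<close> for the separable spaces of functions on \<open>\<Omega>\<close> used here. Test functions are norming
  for them, so by Pettis' theorem strong measurability is measurability against test functions.\<close>

definition bochner_L2 ::
  "real \<Rightarrow> vec3 set \<Rightarrow> field3 set \<Rightarrow> (field3 \<Rightarrow> real) \<Rightarrow> (real \<Rightarrow> field3) set" where
  "bochner_L2 T \<Omega> X N = {f.
     (\<forall>\<phi>\<in>test_fun \<Omega>. (\<lambda>t. LINT x|lebesgue_on \<Omega>. f t x \<bullet> \<phi> x) \<in> borel_measurable (lebesgue_on {0<..<T})) \<and>
     (AE t in lebesgue_on {0<..<T}. f t \<in> X) \<and>
     integrable (lebesgue_on {0<..<T}) (\<lambda>t. (N (f t))\<^sup>2)}"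

definition has_weak_dt :: "real \<Rightarrow> vec3 set \<Rightarrow> (real \<Rightarrow> field3) \<Rightarrow> (real \<Rightarrow> field3) \<Rightarrow> bool" where
  "has_weak_dt T \<Omega> d g \<longleftrightarrow>
     (AE t in lebesgue_on {0<..<T}. loc_int \<Omega> (g t)) \<and>
     (\<forall>\<psi>\<in>test_fun {0<..<T}. \<forall>\<phi>\<in>test_fun \<Omega>.
        integrable (lebesgue_on {0<..<T}) (\<lambda>t. \<psi> t * (LINT x|lebesgue_on \<Omega>. g t x \<bullet> \<phi> x)) \<and>
        (LINT t|lebesgue_on {0<..<T}. deriv \<psi> t * (LINT x|lebesgue_on \<Omega>. d t x \<bullet> \<phi> x))
        = - (LINT t|lebesgue_on {0<..<T}. \<psi> t * (LINT x|lebesgue_on \<Omega>. g t x \<bullet> \<phi> x)))"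

definition BV :: "real \<Rightarrow> (real \<Rightarrow> real) set" where
  "BV T = {E. \<exists>C. \<forall>n (p::nat \<Rightarrow> real). mono p \<and> range p \<subseteq> {0..T} \<longrightarrow>
                (\<Sum>i<n. \<bar>E (p (Suc i)) - E (p i)\<bar>) \<le> C}"

text \<open>Traces: \<open>g\<close> on the boundary is the trace of \<open>u \<in> H\<^sup>1(\<Omega>)\<close> if restrictions of smooth functions
  converge to \<open>u\<close> in \<open>H\<^sup>1(\<Omega>)\<close> while their boundary values converge to \<open>g\<close> in
  \<open>L\<^sup>2(\<partial>\<Omega>)\<close> with respect to the surface (two-dimensional Hausdorff) measure.\<close>

definition hausdorff2_outer :: "vec3 set \<Rightarrow> ennreal" where
  "hausdorff2_outer A = (SUP \<delta>\<in>{0<..}.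
     INF C\<in>{C::nat \<Rightarrow> vec3 set. A \<subseteq> (\<Union>i. C i) \<and> (\<forall>i. bounded (C i) \<and> diameter (C i) \<le> \<delta>)}.
       (\<Sum>i. ennreal (pi / 4 * (diameter (C i))\<^sup>2)))"

definition hausdorff2 :: "vec3 measure" where
  "hausdorff2 = measure_of UNIV (sets borel) hausdorff2_outer"

definition has_trace :: "vec3 set \<Rightarrow> field3 \<Rightarrow> field3 \<Rightarrow> bool" where
  "has_trace \<Omega> u g \<longleftrightarrow> u \<in> H1 \<Omega> \<and> g \<in> borel_measurable (restrict_space hausdorff2 (frontier \<Omega>)) \<and>
     (\<exists>\<phi>. (\<forall>k. \<phi> k \<in> test_fun UNIV) \<and>
        (\<lambda>k. H1_norm \<Omega> (\<lambda>x. \<phi> k x - u x)) \<longlonglongrightarrow> 0 \<and>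
        (\<lambda>k::nat. \<integral>\<^sup>+x\<in>frontier \<Omega>. ennreal ((norm (\<phi> k x - g x))\<^sup>2) \<partial>hausdorff2) \<longlonglongrightarrow> 0)"

section \<open>Energy, stresses and the director equation\<close>

definition energy :: "vec3 set \<Rightarrow> field3 \<Rightarrow> field3 \<Rightarrow> real" where
  "energy \<Omega> v d = 1/2 * (Lp_norm \<Omega> 2 v)\<^sup>2 + 1/2 * (Lp_norm \<Omega> 2 (wgrad \<Omega> d))\<^sup>2"

text \<open>\<open>A\<close> stands for \<open>\<nabla>v\<close> and \<open>p\<close> for the projected Laplacian of \<open>d\<close>; \<open>d\<close> is the value of the director.\<close>

definition stress_D :: "real \<Rightarrow> real \<Rightarrow> real \<Rightarrow> real \<Rightarrow> real \<Rightarrow> vec3 \<Rightarrow> mat3 \<Rightarrow> mat3" where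
  "stress_D lam \<mu>1 \<mu>4 \<mu>5 \<mu>6 d A =
     ((\<mu>1 + lam\<^sup>2) * (d \<bullet> (msym A *v d))) *\<^sub>R tensor d d
     + \<mu>4 *\<^sub>R msym A
     + (\<mu>5 + \<mu>6 - lam\<^sup>2) *\<^sub>R msym (tensor d (msym A *v d))"

definition stress_el :: "real \<Rightarrow> vec3 \<Rightarrow> vec3 \<Rightarrow> mat3" where
  "stress_el lam d p = lam *\<^sub>R msym (tensor d p) + mskw (tensor d p)"

definition stress_L :: "real \<Rightarrow> real \<Rightarrow> real \<Rightarrow> real \<Rightarrow> real \<Rightarrow> vec3 \<Rightarrow> mat3 \<Rightarrow> vec3 \<Rightarrow> mat3" where
  "stress_L lam \<mu>1 \<mu>4 \<mu>5 \<mu>6 d A p = stress_D lam \<mu>1 \<mu>4 \<mu>5 \<mu>6 d A + stress_el lam d p"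

definition director_eq ::
  "vec3 set \<Rightarrow> real \<Rightarrow> real \<Rightarrow> (real \<Rightarrow> field3) \<Rightarrow> (real \<Rightarrow> field3) \<Rightarrow> bool" where
  "director_eq \<Omega> T lam v d \<longleftrightarrow> (\<exists>dt. has_weak_dt T \<Omega> d dt \<and>
     (AE t in lebesgue_on {0<..<T}.
        (\<exists>f. has_cross_lap \<Omega> (d t) f) \<and>
        (AE x in lebesgue_on \<Omega>.
           dt t x + wgrad \<Omega> (d t) x *v v t x - mskw (wgrad \<Omega> (v t) x) *v d t x
           + lam *\<^sub>R ((mat 1 - tensor (d t x) (d t x)) *v (msym (wgrad \<Omega> (v t) x) *v d t x))
           - proj_lap \<Omega> (d t) x = 0)))"

section \<open>Energy-variational solutions\<close>

text \<open>\<open>C\<^sup>1([0,T];(H\<^sup>1\<^sub>0\<^sub>,\<^sub>\<sigma>)\<^sup>*) \<inter> L\<^sup>2(0,T;H\<^sup>1\<^sub>0\<^sub>,\<^sub>\<sigma>)\<close>, with \<open>W\<close> the time derivative of \<open>w\<close>. This space embeds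
  into \<open>C([0,T];L\<^sup>2\<^sub>\<sigma>)\<close>; requiring \<open>w t \<in> L\<^sup>2\<^sub>\<sigma>\<close> for every \<open>t\<close> selects the continuous representative.\<close>

definition ev_test ::
  "vec3 set \<Rightarrow> real \<Rightarrow> (real \<Rightarrow> field3) \<Rightarrow> (real \<Rightarrow> field3 \<Rightarrow> real) \<Rightarrow> bool" where
  "ev_test \<Omega> T w W \<longleftrightarrow>
     (\<forall>t\<in>{0..T}. w t \<in> L2_sol \<Omega>) \<and>
     w \<in> bochner_L2 T \<Omega> (H10_sol \<Omega>) (H1_norm \<Omega>) \<and>
     (\<forall>t\<in>{0..T}. W t \<in> dual (H10_sol \<Omega>) (H1_norm \<Omega>)) \<and>
     (\<forall>t\<in>{0..T}.
        ((\<lambda>s. dual_norm (H10_sol \<Omega>) (H1_norm \<Omega>)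
           (\<lambda>u. ((LINT x|lebesgue_on \<Omega>. w s x \<bullet> u x) - (LINT x|lebesgue_on \<Omega>. w t x \<bullet> u x)) / (s - t) - W t u))
         \<longlongrightarrow> 0) (at t within {0..T}) \<and>
        ((\<lambda>s. dual_norm (H10_sol \<Omega>) (H1_norm \<Omega>) (\<lambda>u. W s u - W t u)) \<longlongrightarrow> 0) (at t within {0..T}))"

text \<open>\<open>g(s-)\<close>, with the usual convention \<open>g(0-) = g(0)\<close> at the initial time.\<close>

definition left_val :: "(real \<Rightarrow> real) \<Rightarrow> real \<Rightarrow> real" where
  "left_val g s = (if s = 0 then g 0 else Lim (at_left s) g)"

text \<open>Two points about the inequality below. First, \<open>\<integral> (v \<cdot> \<nabla>)v \<cdot> w = - \<integral> v \<otimes> v : \<nabla>w\<close>, and testing the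
  director equation with \<open>- \<Delta>d\<close> shows that \<open>stress_L\<close> and \<open>- (v \<otimes> v + \<nabla>d\<^sup>T \<nabla>d)\<close> occur with the
  same sign in the momentum balance. The inequality is the energy balance minus the momentum balance tested
  with \<open>w\<close>, so the Ericksen stress \<open>TE\<close> (which stands for the divergence of \<open>\<nabla>d\<^sup>T \<nabla>d\<close>) and the
  elastic stress are subtracted, exactly as the convective term and \<open>stress_D : \<nabla>w\<close> are. Second,
  \<open>s = 0\<close> is admitted: it is through this case that the initial value of \<open>E\<close> enters.

  The weight \<open>K\<close> takes the value \<open>\<infinity>\<close> on fields for which it is not defined.\<close>

definition ev_solution ::
  "vec3 set \<Rightarrow> real \<Rightarrow> real \<Rightarrow> real \<Rightarrow> real \<Rightarrow> real \<Rightarrow> real \<Rightarrow> field3 \<Rightarrow> field3 \<Rightarrow> field3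
   \<Rightarrow> (field3 \<Rightarrow> ennreal) \<Rightarrow> (field3 \<Rightarrow> field3 \<Rightarrow> real)
   \<Rightarrow> (real \<Rightarrow> field3) \<Rightarrow> (real \<Rightarrow> field3) \<Rightarrow> (real \<Rightarrow> real) \<Rightarrow> bool" where
  "ev_solution \<Omega> T lam \<mu>1 \<mu>4 \<mu>5 \<mu>6 v0 d0 d\<Gamma> K TE v d E \<longleftrightarrow>
     v \<in> weak_cont T (L2_sol \<Omega>) (Lp_norm \<Omega> 2) (L2_sol \<Omega>) \<and>
     v \<in> bochner_L2 T \<Omega> (H10_sol \<Omega>) (H1_norm \<Omega>) \<and>
     E \<in> BV T \<and>
     d \<in> weak_cont T (H1 \<Omega>) (H1_norm \<Omega>) (H1_sphere \<Omega>) \<and>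
     d \<in> bochner_L2 T \<Omega> (Lp \<Omega> (3/2)) (Lp_norm \<Omega> (3/2)) \<and>
     (\<exists>dt \<in> bochner_L2 T \<Omega> (Lp \<Omega> (3/2)) (Lp_norm \<Omega> (3/2)). has_weak_dt T \<Omega> d dt) \<and>
     (AE t in lebesgue_on {0<..<T}. \<exists>f\<in>Lp \<Omega> 2. has_cross_lap \<Omega> (d t) f) \<and>
     (\<lambda>t. cross_lap \<Omega> (d t)) \<in> bochner_L2 T \<Omega> (Lp \<Omega> 2) (Lp_norm \<Omega> 2) \<and>
     (\<forall>t\<in>{0..T}. energy \<Omega> (v t) (d t) \<le> E t) \<and>
     (AE t in lebesgue_on {0<..<T}. AE x in lebesgue_on \<Omega>. norm (d t x) = 1) \<and>
     (AE x in lebesgue_on \<Omega>. v 0 x = v0 x) \<and>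
     (AE x in lebesgue_on \<Omega>. d 0 x = d0 x) \<and>
     (AE t in lebesgue_on {0<..<T}. has_trace \<Omega> (d t) d\<Gamma>) \<and>
     (\<forall>w W. ev_test \<Omega> T w W \<and>
        (\<lambda>t. K (w t)) \<in> borel_measurable (lebesgue_on {0<..<T}) \<and>
        (\<integral>\<^sup>+t. K (w t) \<partial>lebesgue_on {0<..<T}) < \<infinity> \<longrightarrow>
        (\<forall>s\<in>{0..<T}. \<forall>t\<in>{s<..<T}.
           (let g = (\<lambda>r. E r - (LINT x|lebesgue_on \<Omega>. v r x \<bullet> w r x)) in g t - left_val g s)
           + (LINT r|lebesgue_on {s..t}.
                W r (v r) - (LINT x|lebesgue_on \<Omega>. (wgrad \<Omega> (v r) x *v v r x) \<bullet> w r x))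
           - (LINT r|lebesgue_on {s..t}. TE (d r) (w r))
           + (LINT r|lebesgue_on {s..t}. LINT x|lebesgue_on \<Omega>.
                stress_D lam \<mu>1 \<mu>4 \<mu>5 \<mu>6 (d r x) (wgrad \<Omega> (v r) x) \<bullet> (wgrad \<Omega> (v r) x - wgrad \<Omega> (w r) x)
                + (norm (cross_lap \<Omega> (d r) x))\<^sup>2)
           - (LINT r|lebesgue_on {s..t}. LINT x|lebesgue_on \<Omega>.
                stress_el lam (d r x) (proj_lap \<Omega> (d r) x) \<bullet> wgrad \<Omega> (w r) x)
           + (LINT r|lebesgue_on {s..t}. enn2real (K (w r)) * (energy \<Omega> (v r) (d r) - E r))
           \<le> 0)) \<and>
     director_eq \<Omega> T lam v d"

definition cont_rep :: "vec3 set \<Rightarrow> (vec3 \<Rightarrow> mat3) \<Rightarrow> (vec3 \<Rightarrow> mat3) \<Rightarrow> bool" where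
  "cont_rep \<Omega> g h \<longleftrightarrow> continuous_on (closure \<Omega>) h \<and> bounded (h ` closure \<Omega>) \<and>
                      (AE x in lebesgue_on \<Omega>. g x = h x)"

definition C_norm :: "vec3 set \<Rightarrow> (vec3 \<Rightarrow> mat3) \<Rightarrow> ennreal" where
  "C_norm \<Omega> g = (if \<exists>h. cont_rep \<Omega> g h
     then SUP x\<in>closure \<Omega>. ennreal (spectral_norm ((SOME h. cont_rep \<Omega> g h) x)) else \<infinity>)"

definition weight_K :: "vec3 set \<Rightarrow> field3 \<Rightarrow> ennreal" where
  "weight_K \<Omega> w = 2 * C_norm \<Omega> (\<lambda>x. neg_part (wgrad \<Omega> w x))"

definition ericksen_TE :: "vec3 set \<Rightarrow> field3 \<Rightarrow> field3 \<Rightarrow> real" where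
  "ericksen_TE \<Omega> d w =
     - (LINT x|lebesgue_on \<Omega>. (transpose (wgrad \<Omega> d x) ** wgrad \<Omega> d x) \<bullet> wgrad \<Omega> w x)"

section \<open>Matrix-valued measures\<close>

text \<open>A matrix-valued measure on \<open>closure \<Omega>\<close> is a countably additive function on the Borel subsets;
  integrals against its (signed) entries go through the Jordan decomposition. Since the values are
  finite, these Borel measures on a closed subset of \<open>real^3\<close> are Radon.\<close>

abbreviation cl_borel :: "vec3 set \<Rightarrow> vec3 set set" where
  "cl_borel \<Omega> \<equiv> sets (restrict_space borel (closure \<Omega>))"

definition psd_measures :: "vec3 set \<Rightarrow> (vec3 set \<Rightarrow> mat3) set" where
  "psd_measures \<Omega> = {\<mu>.
     (\<forall>A. range A \<subseteq> cl_borel \<Omega> \<and> disjoint_family (A :: nat \<Rightarrow> vec3 set) \<longrightarrow> (\<lambda>n. \<mu> (A n)) sums \<mu> (\<Union>n. A n)) \<and>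
     (\<forall>B\<in>cl_borel \<Omega>. transpose (\<mu> B) = \<mu> B \<and> (\<forall>\<xi>. 0 \<le> tensor \<xi> \<xi> \<bullet> \<mu> B))}"

definition pos_variation :: "vec3 set \<Rightarrow> (vec3 set \<Rightarrow> real) \<Rightarrow> vec3 measure" where
  "pos_variation \<Omega> \<sigma> = measure_of (closure \<Omega>) (cl_borel \<Omega>)
     (\<lambda>B. SUP C\<in>{C\<in>cl_borel \<Omega>. C \<subseteq> B}. ennreal (\<sigma> C))"

definition signed_int :: "vec3 set \<Rightarrow> (vec3 set \<Rightarrow> real) \<Rightarrow> (vec3 \<Rightarrow> real) \<Rightarrow> real" where
  "signed_int \<Omega> \<sigma> f = (LINT x|pos_variation \<Omega> \<sigma>. f x) - (LINT x|pos_variation \<Omega> (\<lambda>B. - \<sigma> B). f x)"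

definition mat_int :: "vec3 set \<Rightarrow> (vec3 set \<Rightarrow> mat3) \<Rightarrow> (vec3 \<Rightarrow> mat3) \<Rightarrow> real" where
  "mat_int \<Omega> \<mu> A = (\<Sum>i\<in>UNIV. \<Sum>j\<in>UNIV. signed_int \<Omega> (\<lambda>B. \<mu> B $ i $ j) (\<lambda>x. A x $ i $ j))"

text \<open>\<open>L\<^sup>\<infinity>\<^sub>w\<^sub>*(0,T;M)\<close>, the norm of measures being the dual norm. A value at time \<open>0\<close> is part of
  the data because the energy inequality of a measure-valued solution refers to it.\<close>

definition Linf_wstar :: "vec3 set \<Rightarrow> real \<Rightarrow> (real \<Rightarrow> vec3 set \<Rightarrow> mat3) set" where
  "Linf_wstar \<Omega> T = {m.
     (\<forall>t\<in>{0..<T}. m t \<in> psd_measures \<Omega>) \<and>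
     (\<forall>A. continuous_on UNIV A \<and> compact (closure {x. A x \<noteq> 0}) \<longrightarrow>
        (\<lambda>t. mat_int \<Omega> (m t) A) \<in> borel_measurable (lebesgue_on {0<..<T})) \<and>
     (\<exists>C. AE t in lebesgue_on {0<..<T}.
        \<forall>A. continuous_on UNIV A \<and> compact (closure {x. A x \<noteq> 0}) \<and> (\<forall>x. norm (A x) \<le> 1) \<longrightarrow>
          \<bar>mat_int \<Omega> (m t) A\<bar> \<le> C)}"

section \<open>Measure-valued solutions\<close>

text \<open>Two points about the momentum balance below. There is no pressure in it, so it is tested with
  solenoidal fields. The stress \<open>stress_L\<close> is not symmetric, so it is paired with the full gradient.

  The requirement that \<open>d \<times> \<Delta>d\<close> be square integrable spells out that the dissipation in the energy
  inequality is a finite integral.\<close>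

definition mv_solution ::
  "vec3 set \<Rightarrow> real \<Rightarrow> real \<Rightarrow> real \<Rightarrow> real \<Rightarrow> real \<Rightarrow> real
   \<Rightarrow> (real \<Rightarrow> field3) \<Rightarrow> (real \<Rightarrow> field3) \<Rightarrow> (real \<Rightarrow> vec3 set \<Rightarrow> mat3) \<Rightarrow> bool" where
  "mv_solution \<Omega> T lam \<mu>1 \<mu>4 \<mu>5 \<mu>6 v d m \<longleftrightarrow>
     v \<in> weak_cont T (L2_sol \<Omega>) (Lp_norm \<Omega> 2) (L2_sol \<Omega>) \<and>
     v \<in> bochner_L2 T \<Omega> (H10_sol \<Omega>) (H1_norm \<Omega>) \<and>
     d \<in> weak_cont T (H1 \<Omega>) (H1_norm \<Omega>) (H1_sphere \<Omega>) \<and>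
     m \<in> Linf_wstar \<Omega> T \<and>
     director_eq \<Omega> T lam v d \<and>
     (\<lambda>t. cross_lap \<Omega> (d t)) \<in> bochner_L2 T \<Omega> (Lp \<Omega> 2) (Lp_norm \<Omega> 2) \<and>
     (\<forall>w. (\<lambda>(t, x). w t x) \<in> test_fun ({0<..<T} \<times> \<Omega>) \<and> (\<forall>t x. trace (jacobian (w t) (at x)) = 0) \<longrightarrow>
        (LINT s|lebesgue_on {0<..<T}.
           (LINT x|lebesgue_on \<Omega>.
              stress_L lam \<mu>1 \<mu>4 \<mu>5 \<mu>6 (d s x) (wgrad \<Omega> (v s) x) (proj_lap \<Omega> (d s) x) \<bullet> jacobian (w s) (at x)
              - (tensor (v s x) (v s x) + transpose (wgrad \<Omega> (d s) x) ** wgrad \<Omega> (d s) x)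
                  \<bullet> jacobian (w s) (at x)
              - v s x \<bullet> vector_derivative (\<lambda>r. w r x) (at s))
           - 2 * mat_int \<Omega> (m s) (\<lambda>x. msym (jacobian (w s) (at x)))) = 0) \<and>
     (AE t in lebesgue_on {0<..<T}.
        (let g = (\<lambda>r. 1/2 * ((Lp_norm \<Omega> 2 (v r))\<^sup>2 + (Lp_norm \<Omega> 2 (wgrad \<Omega> (d r)))\<^sup>2
                              + mat_int \<Omega> (m r) (\<lambda>_. mat 1))) in g t - g 0)
        + (LINT s|lebesgue_on {0..t}. LINT x|lebesgue_on \<Omega>.
             stress_D lam \<mu>1 \<mu>4 \<mu>5 \<mu>6 (d s x) (wgrad \<Omega> (v s) x) \<bullet> msym (wgrad \<Omega> (v s) x)
             + (norm (cross_lap \<Omega> (d s) x))\<^sup>2)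
        \<le> 0)"

end

(*
  Insert test fields alpha * phi into the energy-variational inequality, divide by alpha and let alpha tend to
  infinity: the residual of the momentum balance, integrated from s to t and tested with a solenoidal field phi,
  is at most twice the integral of the gap E - energy times the largest distance of the symmetric gradient of phi
  to the cone of positive semi-definite matrices.  Differentiating in time gives the bound at almost every time,
  simultaneously for all rational combinations of countably many fields phi.  It is sublinear in the gradient of
  phi, so a Hahn-Banach argument, carried out such that measurability in time is kept, extends the residual to a
  functional on continuous matrix fields which vanishes on skew fields and is nonpositive on semi-definite ones.

  To represent this functional by a measure, a space-filling curve from [0,1] onto a cube reduces Riesz' theorem
  to the unit interval, where the measure is a weak limit of discrete ones with masses given by Bernstein
  polynomials.  The matrix measure is assembled by polarisation from the measures belonging to single directions.
  Testing with the identity bounds the trace by the gap, and the energy inequality is the case phi = 0.  Test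
  fields that depend on time are treated by freezing them on short time intervals.
*)

theory Submission
  imports Defs "HOL-Probability.Helly_Selection"
begin

section \<open>Smooth functions\<close>

text \<open>\<open>\<Omega>\<close> may be unbounded and the measure has to live on its closure,
  whereas test fields have compact support inside. So the functional is represented over the whole
  space: a matrix field of compact support becomes, along the curve, a continuous function on [0,1]
  that vanishes where the curve meets the boundary of its cube, which stands for infinity. Mass that
  the Riesz measure has there, or over points outside the closure of \<open>\<Omega>\<close>, is
  discarded. Fields supported in \<open>\<Omega>\<close> do not see it, and dropping it can only
  lower the trace.

  Distances to the cone are taken in the Frobenius norm, where the nearest point is an orthogonal
  projection. This norm dominates the spectral norm of the weight, so the bound on the residual
  stays true. The identity then has norm sqrt 3 instead of 1, and the bound of half the trace by the
  gap survives since sqrt 3 <= 2.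

  The Riesz measures are chosen separately at each time. Measurability in time is not lost:
  integrals of continuous fields are limits of values of the functional, and those are measurable by
  construction.\<close>

lemma frechet_derivative_unique_at: "(f has_derivative D) (at x) ==> frechet_derivative f (at x) = D"
  by (metis frechet_derivative_at)

lemma Ck_linear_comp:
  assumes L: "bounded_linear L" and f: "Ck n f"
  shows "Ck n (%x. L (f x))"
  using f
proof (induction n arbitrary: f)
  case 0
  then show ?case by (auto intro: bounded_linear.continuous_on[OF L])
next
  case (Suc n)
  have D: "((%x. L (f x)) has_derivative (%h. L (frechet_derivative f (at x) h))) (at x)" for x
    using Suc.prems by (intro bounded_linear.has_derivative[OF L]) (auto simp: frechet_derivative_works)
  have eq: "frechet_derivative (%x. L (f x)) (at x) = (%h. L (frechet_derivative f (at x) h))" for x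
    by (rule frechet_derivative_unique_at[OF D])
  show ?case
    using D Suc by (auto simp: eq differentiable_def)
qed

lemma Ck_add:
  assumes "Ck n f" "Ck n g"
  shows "Ck n (%x. f x + g x)"
  using assms
proof (induction n arbitrary: f g)
  case 0
  then show ?case by (auto intro: continuous_intros)
next
  case (Suc n)
  have D: "((%x. f x + g x) has_derivative
    (%h. frechet_derivative f (at x) h + frechet_derivative g (at x) h)) (at x)" for x
    using Suc.prems by (intro has_derivative_add) (auto simp: frechet_derivative_works)
  have eq: "frechet_derivative (%x. f x + g x) (at x)
    = (%h. frechet_derivative f (at x) h + frechet_derivative g (at x) h)" for x
    by (rule frechet_derivative_unique_at[OF D])
  show ?case
    using D Suc by (auto simp: eq differentiable_def)
qed

lemma Ck_Suc: "Ck (Suc n) f ==> Ck n f"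
proof (induction n arbitrary: f)
  case 0
  then show ?case by (auto simp: continuous_on_eq_continuous_at differentiable_imp_continuous_within)
next
  case (Suc n)
  then show ?case by (subst Ck.simps, subst (asm) Ck.simps) blast
qed

lemma Ck_mult:
  fixes f g :: "'a::euclidean_space => real"
  assumes "Ck n f" "Ck n g"
  shows "Ck n (%x. f x * g x)"
  using assms
proof (induction n arbitrary: f g)
  case 0
  then show ?case by (auto intro: continuous_on_mult)
next
  case (Suc n)
  have D: "((%x. f x * g x) has_derivative (%h. f x * frechet_derivative g (at x) h + frechet_derivative f (at x) h * g x)) (at x)" for x
    by (intro has_derivative_mult) (use Suc.prems in \<open>auto simp: frechet_derivative_works\<close>)
  have "Ck n (%x. f x * frechet_derivative g (at x) b + frechet_derivative f (at x) b * g x)" if "b \<in> Basis" for b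
    using Suc.prems that Ck_Suc[OF Suc.prems(1)] Ck_Suc[OF Suc.prems(2)] by (intro Ck_add Suc.IH) auto
  then show ?case using D by (auto simp: frechet_derivative_unique_at[OF D] differentiable_def)
qed

lemma Ck_slice:
  assumes "Ck n (f :: 'a::euclidean_space \<times> 'b::euclidean_space => 'c::real_normed_vector)"
  shows "Ck n (%x. f (t, x))"
  using assms
proof (induction n arbitrary: f)
  case 0
  then have "continuous_on UNIV f" by simp
  then have "continuous_on UNIV (f \<circ> (%x. (t, x)))"
    by (intro continuous_on_compose continuous_intros) (auto intro: continuous_on_subset)
  then show ?case by (simp add: o_def)
next
  case (Suc n)
  have D: "((%x. f (t, x)) has_derivative (%h. frechet_derivative f (at (t, x)) (0, h))) (at x)" for x
  proof -
    have 1: "(f has_derivative frechet_derivative f (at (t, x))) (at (t, x))"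
      using Suc.prems by (auto simp: frechet_derivative_works)
    have 2: "((%x. (t, x)) has_derivative (%h. (0, h))) (at x)"
      by (auto intro!: derivative_eq_intros)
    show ?thesis using diff_chain_at[OF 2 1] by (simp add: o_def)
  qed
  have eq: "frechet_derivative (%x. f (t, x)) (at x) = (%h. frechet_derivative f (at (t, x)) (0, h))" for x
    by (rule frechet_derivative_unique_at[OF D])
  have "Ck n (%x. frechet_derivative f (at (t, x)) (0, b))" if "b \<in> Basis" for b :: 'b
    using Suc.IH[of "%z. frechet_derivative f (at z) (0, b)"] Suc.prems that
    by (auto simp: Basis_prod_def)
  then show ?case
    using D by (auto simp: eq differentiable_def)
qed

section \<open>Bump functions built from exp (-1/s)\<close>

definition cutexp :: "nat => real => real" where
  "cutexp k s = (if 0 < s then exp (- 1 / s) / s ^ k else 0)"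

lemma cutexp_div_tendsto: "((%s. cutexp k s / s) \<longlongrightarrow> 0) (at 0)"
proof -
  have r: "((%s. cutexp k s / s) \<longlongrightarrow> 0) (at_right 0)"
  proof -
    have "((%y. y ^ Suc k / exp y) \<longlongrightarrow> (0::real)) at_top"
      by (rule tendsto_power_div_exp_0)
    then have "((%s. (inverse s) ^ Suc k / exp (inverse s)) \<longlongrightarrow> (0::real)) (at_right 0)"
      by (rule filterlim_compose) (rule filterlim_inverse_at_top_right)
    moreover have "eventually (%s. (inverse s) ^ Suc k / exp (inverse s) = cutexp k s / s) (at_right (0::real))"
      using eventually_at_right_less[of 0]
      by eventually_elim (simp add: cutexp_def exp_minus field_simps)
    ultimately show ?thesis by (rule Lim_transform_eventually)
  qed
  have l: "((%s. cutexp k s / s) \<longlongrightarrow> 0) (at_left 0)"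
  proof (rule Lim_transform_eventually[OF tendsto_const])
    show "eventually (%s. 0 = cutexp k s / s) (at_left (0::real))"
      by (auto simp: eventually_at_filter cutexp_def)
  qed
  show ?thesis using l r by (simp add: filterlim_split_at)
qed

text \<open>Differentiating \<open>exp (- 1 / s) / s ^ k\<close> only shifts \<open>k\<close>, so
  the family over all \<open>k\<close> is closed under differentiation. At 0 the derivative exists
  by \<open>cutexp_div_tendsto\<close>: the exponential decay beats every power.\<close>

lemma cutexp_deriv: "(cutexp k has_real_derivative cutexp (k + 2) s - real k * cutexp (k + 1) s) (at s)"
proof -
  consider "s > 0" | "s < 0" | "s = 0" by linarith
  then show ?thesis
  proof cases
    case 1
    have "((%s. exp (- 1 / s) / s ^ k) has_real_derivative cutexp (k + 2) s - real k * cutexp (k + 1) s) (at s)"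
    proof (cases k)
      case 0
      then show ?thesis using 1
        by (auto intro!: derivative_eq_intros simp: cutexp_def field_simps power2_eq_square)
    next
      case (Suc m)
      have "((%s. exp (- 1 / s) / s ^ k) has_real_derivative
         (exp (-1/s) * (1/s^2) * s^k - exp (-1/s) * (real k * s ^ (k - 1))) / (s^k * s^k)) (at s)"
        using 1 by (auto intro!: derivative_eq_intros simp: power2_eq_square)
      also have "(exp (-1/s) * (1/s^2) * s^k - exp (-1/s) * (real k * s ^ (k - 1))) / (s^k * s^k)
         = cutexp (k + 2) s - real k * cutexp (k + 1) s"
        using 1 Suc by (simp add: cutexp_def field_simps power2_eq_square)
      finally show ?thesis .
    qed
    then show ?thesis
      by (rule has_field_derivative_transform_within_open[where S="{0<..}"])
         (use 1 in \<open>auto simp: cutexp_def\<close>)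
  next
    case 2
    have "((%s. 0) has_real_derivative cutexp (k + 2) s - real k * cutexp (k + 1) s) (at s)"
      using 2 by (auto simp: cutexp_def)
    then show ?thesis
      by (rule has_field_derivative_transform_within_open[where S="{..<0}"])
         (use 2 in \<open>auto simp: cutexp_def\<close>)
  next
    case 3
    have "((%h. (cutexp k h - cutexp k 0) / (h - 0)) \<longlongrightarrow> 0) (at 0)"
      using cutexp_div_tendsto[of k] by (simp add: cutexp_def[of k 0])
    then show ?thesis using 3 by (simp add: has_field_derivative_iff cutexp_def[of _ 0])
  qed
qed

text \<open>A class of formulas: the directional derivatives of a member are members again, so that
  \<open>smooth_Ck\<close> is a plain induction on the order. The clauses are the operations from
  which the bump functions below are composed.\<close>

inductive_set smooth :: "('a::euclidean_space => real) set" where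
  const: "(%x. c) \<in> smooth"
| lin: "(%x. x \<bullet> a) \<in> smooth"
| add: "f \<in> smooth ==> g \<in> smooth ==> (%x. f x + g x) \<in> smooth"
| mult: "f \<in> smooth ==> g \<in> smooth ==> (%x. f x * g x) \<in> smooth"
| expo: "f \<in> smooth ==> (%x. exp (f x)) \<in> smooth"
| cut: "f \<in> smooth ==> (%x. cutexp k (f x)) \<in> smooth"

lemma smooth_deriv:
  assumes "f \<in> smooth"
  shows "\<exists>D. (\<forall>x. (f has_derivative D x) (at x)) \<and> (\<forall>b. (%x. D x b) \<in> smooth)"
  using assms
proof induction
  case (const c)
  show ?case by (rule exI[of _ "%x h. 0"]) (auto intro: smooth.const)
next
  case (lin a)
  show ?case by (rule exI[of _ "%x h. h \<bullet> a"]) (auto intro!: smooth.const derivative_eq_intros)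
next
  case (add f g)
  then obtain D E where "\<forall>x. (f has_derivative D x) (at x)" "\<forall>b. (%x. D x b) \<in> smooth"
    "\<forall>x. (g has_derivative E x) (at x)" "\<forall>b. (%x. E x b) \<in> smooth" by blast
  then show ?case
    by (intro exI[of _ "%x h. D x h + E x h"]) (auto intro!: smooth.add has_derivative_add)
next
  case (mult f g)
  then obtain D E where "\<forall>x. (f has_derivative D x) (at x)" "\<forall>b. (%x. D x b) \<in> smooth"
    "\<forall>x. (g has_derivative E x) (at x)" "\<forall>b. (%x. E x b) \<in> smooth" by blast
  with mult show ?case
    by (intro exI[of _ "%x h. f x * E x h + D x h * g x"])
       (auto intro!: smooth.add smooth.mult has_derivative_mult)
next
  case (expo f)
  then obtain D where D: "\<forall>x. (f has_derivative D x) (at x)" "\<forall>b. (%x. D x b) \<in> smooth" by blast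
  have "((%x. exp (f x)) has_derivative (%h. exp (f x) * D x h)) (at x)" for x
    using D(1) by (auto intro!: derivative_eq_intros simp: mult.commute)
  with expo D show ?case
    by (intro exI[of _ "%x h. exp (f x) * D x h"]) (auto intro!: smooth.mult smooth.expo)
next
  case (cut f k)
  then obtain D where D: "\<forall>x. (f has_derivative D x) (at x)" "\<forall>b. (%x. D x b) \<in> smooth" by blast
  have "((%x. cutexp k (f x)) has_derivative
     (%h. (cutexp (k+2) (f x) + (- real k) * cutexp (k + 1) (f x)) * D x h)) (at x)" for x
  proof -
    have "(cutexp k has_derivative (*) (cutexp (k + 2) (f x) - real k * cutexp (k + 1) (f x))) (at (f x))"
      using cutexp_deriv[of k "f x"] by (simp add: has_field_derivative_def)
    from diff_chain_at[OF D(1)[rule_format] this] show ?thesis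
      by (simp add: o_def)
  qed
  moreover have "(%x. (cutexp (k+2) (f x) + (- real k) * cutexp (k + 1) (f x)) * D x b) \<in> smooth" for b
    by (intro smooth.mult smooth.add smooth.cut smooth.const cut.hyps D(2)[rule_format])
  ultimately show ?case
    by (intro exI[of _ "%x h. (cutexp (k+2) (f x) + (- real k) * cutexp (k + 1) (f x)) * D x h"]) blast
qed

lemma smooth_Ck: "f \<in> smooth ==> Ck n f"
proof (induction n arbitrary: f)
  case 0
  then show ?case
    using smooth_deriv[OF 0] by (auto simp: continuous_on_eq_continuous_at intro!: has_derivative_continuous)
next
  case (Suc n)
  from smooth_deriv[OF Suc.prems] obtain D where
    D: "!!x. (f has_derivative D x) (at x)" "!!b. (%x. D x b) \<in> smooth" by blast
  then show ?case
    using Suc.IH by (auto simp: frechet_derivative_unique_at[OF D(1)] differentiable_def)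
qed

lemma smooth_sum: "finite A ==> (!!i. i \<in> A ==> f i \<in> smooth) ==> (%x. \<Sum>i\<in>A. f i x) \<in> smooth"
  by (induction rule: finite_induct) (auto intro: smooth.intros)

lemma smooth_prod: "finite A ==> (!!i. i \<in> A ==> f i \<in> smooth) ==> (%x. \<Prod>i\<in>A. f i x) \<in> smooth"
  by (induction rule: finite_induct) (auto intro: smooth.intros)

definition box_weight :: "'a::euclidean_space \<times> 'a => 'a => real" where
  "box_weight ab x = (\<Prod>i\<in>Basis. cutexp 0 (x \<bullet> i + - (fst ab \<bullet> i)) * cutexp 0 ((- 1) * (x \<bullet> i) + snd ab \<bullet> i))"

lemma box_weight_smooth: "box_weight ab \<in> smooth"
proof -
  have "(%x. \<Prod>i\<in>Basis. cutexp 0 (x \<bullet> i + - (fst ab \<bullet> i)) * cutexp 0 ((- 1) * (x \<bullet> i) + snd ab \<bullet> i)) \<in> smooth"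
    by (intro smooth_prod smooth.intros) auto
  then show ?thesis by (simp add: box_weight_def[abs_def])
qed

lemma cutexp_nonneg: "0 \<le> cutexp k s" by (simp add: cutexp_def)
lemma cutexp_0_iff: "cutexp k s = 0 \<longleftrightarrow> s \<le> 0" by (simp add: cutexp_def)

lemma box_weight_nonneg: "0 \<le> box_weight ab x"
  by (auto simp: box_weight_def intro!: prod_nonneg mult_nonneg_nonneg cutexp_nonneg)

lemma box_weight_0_iff: "box_weight ab x = 0 \<longleftrightarrow> x \<notin> box (fst ab) (snd ab)"
  by (auto simp: box_weight_def prod_zero_iff cutexp_0_iff mem_box inner_simps not_less)

text \<open>\<open>1 - exp (- k w)\<close> maps nonnegative weights \<open>w\<close> into [0,1),
  keeps the value 0, and tends to 1 as \<open>k\<close> grows wherever \<open>w > 0\<close>. The sum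
  over finitely many boxes thus becomes a smooth approximation of the indicator of their
  union.\<close>

definition bump :: "nat => ('a::euclidean_space \<times> 'a) list => 'a => real" where
  "bump k F x = 1 - exp (- (real k * (\<Sum>ab\<in>set F. box_weight ab x)))"

lemma bump_smooth: "bump k F \<in> smooth"
proof -
  have "(%x. 1 + (-1) * exp ((- real k) * (\<Sum>ab\<in>set F. box_weight ab x))) \<in> smooth"
    by (intro smooth.intros smooth_sum box_weight_smooth) auto
  then show ?thesis by (simp add: bump_def[abs_def])
qed

lemma bump_bounds: "0 \<le> bump k F x" "bump k F x \<le> 1"
  by (auto simp: bump_def intro!: sum_nonneg mult_nonneg_nonneg box_weight_nonneg)

lemma bump_outside: "x \<notin> (\<Union>ab\<in>set F. box (fst ab) (snd ab)) ==> bump k F x = 0"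
  by (auto simp: bump_def box_weight_0_iff[THEN iffD2])

lemma closed_subset_compact_aux: "compact C ==> closed S ==> S \<subseteq> C ==> compact S" for S :: "'a::t2_space set"
  by (metis compact_Int_closed inf.absorb2)

lemma bump_test_fun:
  assumes "!!ab. ab \<in> set F ==> cbox (fst ab) (snd ab) \<subseteq> U"
  shows "bump k F \<in> test_fun U"
proof -
  let ?C = "\<Union>ab\<in>set F. cbox (fst ab) (snd ab)"
  have C: "compact ?C" by (intro compact_UN) auto
  have "{x. bump k F x \<noteq> 0} \<subseteq> ?C"
    using bump_outside[of _ F k] box_subset_cbox by fastforce
  then have sub: "closure {x. bump k F x \<noteq> 0} \<subseteq> ?C"
    using C by (intro closure_minimal) (auto intro: compact_imp_closed)
  then have "compact (closure {x. bump k F x \<noteq> 0})"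
    using C by (metis closed_closure closed_subset_compact_aux)
  moreover have "?C \<subseteq> U" using assms by auto
  ultimately show ?thesis
    using sub smooth_Ck[OF bump_smooth[of k F]] unfolding test_fun_def by blast
qed

text \<open>A point of the union lies in some box \<open>i\<close>, which takes part as soon as
  \<open>k > i\<close>. The factor \<open>k * k\<close> then makes the exponent at least
  \<open>k\<close> times a fixed positive weight. Outside all boxes every term is 0.\<close>

lemma bump_tendsto:
  fixes ab :: "nat => 'a::euclidean_space \<times> 'a"
  shows "(%k. bump (k * k) (map ab [0..<k]) x) \<longlonglongrightarrow> indicator (\<Union>i. box (fst (ab i)) (snd (ab i))) x"
proof (cases "x \<in> (\<Union>i. box (fst (ab i)) (snd (ab i)))")
  case False
  then have "bump (k * k) (map ab [0..<k]) x = 0" for k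
    by (intro bump_outside) auto
  then show ?thesis using False by simp
next
  case True
  then obtain i where i: "x \<in> box (fst (ab i)) (snd (ab i))" by auto
  let ?w = "box_weight (ab i) x"
  have w: "?w > 0" using i box_weight_nonneg[of "ab i" x] box_weight_0_iff[of "ab i" x] by force
  have lim: "(%k. 1 - exp (- (real k * ?w))) \<longlonglongrightarrow> 1"
  proof -
    have "exp (- ?w) < 1" using w by simp
    then have "(%k. exp (- ?w) ^ k) \<longlonglongrightarrow> 0" by (rule LIMSEQ_realpow_zero[OF less_imp_le[OF exp_gt_zero]])
    then have "(%k. 1 - exp (- ?w) ^ k) \<longlonglongrightarrow> 1 - 0" by (rule tendsto_diff[OF tendsto_const])
    then show ?thesis by (simp add: exp_of_nat_mult[symmetric])
  qed
  have ev: "eventually (%k. 1 - exp (- (real k * ?w)) \<le> bump (k * k) (map ab [0..<k]) x) sequentially"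
    using eventually_gt_at_top[of i]
  proof eventually_elim
    case (elim k)
    have "?w \<le> (\<Sum>c\<in>set (map ab [0..<k]). box_weight c x)"
      using elim by (intro member_le_sum) (auto simp: box_weight_nonneg)
    then have "real k * ?w \<le> real (k * k) * (\<Sum>c\<in>set (map ab [0..<k]). box_weight c x)"
      using elim w by (intro mult_mono) (auto simp del: set_map)
    then show ?case by (simp add: bump_def del: set_map)
  qed
  have "(%k. bump (k * k) (map ab [0..<k]) x) \<longlonglongrightarrow> 1"
    by (rule tendsto_sandwich[OF ev _ lim tendsto_const]) (simp add: bump_bounds)
  then show ?thesis using True by simp
qed

text \<open>The closed boxes have to lie in \<open>V\<close>, although the open ones are used to
  cover it: this keeps the supports of the bump functions compact subsets of
  \<open>V\<close>.\<close>

definition rat_boxes :: "vec3 set => (vec3 \<times> vec3) set" where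
  "rat_boxes V = {(a, b). (\<forall>i. a $ i \<in> \<rat>) \<and> (\<forall>i. b $ i \<in> \<rat>) \<and> cbox a b \<subseteq> V}"

lemma countable_rat_boxes: "countable (rat_boxes V)"
proof -
  have c: "countable {a :: vec3. \<forall>i. a $ i \<in> \<rat>}"
    by (rule countable_vector) (simp add: countable_rat)
  show ?thesis
    by (rule countable_subset[OF _ countable_SIGMA[OF c c]]) (auto simp: rat_boxes_def)
qed

lemma open_rat_boxes:
  assumes "open V"
  shows "V = (\<Union>ab\<in>rat_boxes V. box (fst ab) (snd ab))"
proof
  show "(\<Union>ab\<in>rat_boxes V. box (fst ab) (snd ab)) \<subseteq> V"
    using box_subset_cbox by (fastforce simp: rat_boxes_def)
  show "V \<subseteq> (\<Union>ab\<in>rat_boxes V. box (fst ab) (snd ab))"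
  proof
    fix x assume "x \<in> V"
    then obtain e where e: "e > 0" "ball x e \<subseteq> V" using assms open_contains_ball by blast
    obtain a b where ab: "\<forall>i\<in>Basis. a \<bullet> i \<in> \<rat> \<and> b \<bullet> i \<in> \<rat>" "x \<in> box a b" "box a b \<subseteq> ball x (e/2)"
      using rational_boxes[of "e/2" x] e by auto
    have "cbox a b = closure (box a b)" using ab(2) by (intro closure_box[symmetric]) auto
    also have "\<dots> \<subseteq> cball x (e/2)" using ab(3) by (metis closure_mono closure_ball e(1) half_gt_zero_iff less_irrefl)
    also have "\<dots> \<subseteq> ball x e" using e by auto
    finally have "cbox a b \<subseteq> V" using e by auto
    moreover have "a $ i \<in> \<rat>" "b $ i \<in> \<rat>" for i
      using bspec[OF ab(1), of "axis i 1"] by (simp_all add: axis_in_Basis_iff inner_axis)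
    ultimately have "(a, b) \<in> rat_boxes V" by (auto simp: rat_boxes_def)
    then show "x \<in> (\<Union>ab\<in>rat_boxes V. box (fst ab) (snd ab))" using ab(2) by force
  qed
qed

text \<open>Takes the place of mollification: the density of test functions and the fundamental
  lemma below rest on this bounded pointwise convergence.\<close>

lemma open_bump_approx:
  fixes V :: "vec3 set"
  assumes "open V"
  obtains f :: "nat => vec3 => real" where "!!k. f k \<in> test_fun V" "!!k x. \<bar>f k x\<bar> \<le> 1"
    "!!x. (%k. f k x) \<longlonglongrightarrow> indicator V x"
proof (cases "V = {}")
  case True
  show ?thesis by (rule that[of "%k. bump 0 []"]) (auto simp: True bump_def intro: bump_test_fun)
next
  case False
  then have "rat_boxes V \<noteq> {}" using open_rat_boxes[OF assms] by blast
  then obtain ab :: "nat => vec3 \<times> vec3" where ab: "range ab = rat_boxes V"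
    using range_from_nat_into[OF _ countable_rat_boxes] by blast
  show ?thesis
  proof (rule that[of "%k. bump (k * k) (map ab [0..<k])"])
    show "bump (k * k) (map ab [0..<k]) \<in> test_fun V" for k
    proof (rule bump_test_fun)
      fix c assume "c \<in> set (map ab [0..<k])"
      then have "c \<in> rat_boxes V" using ab by auto
      then show "cbox (fst c) (snd c) \<subseteq> V" by (auto simp: rat_boxes_def)
    qed
    show "\<bar>bump (k * k) (map ab [0..<k]) x\<bar> \<le> 1" for k x using bump_bounds[of "k * k" "map ab [0..<k]" x] by (simp add: abs_of_nonneg)
    have "(\<Union>i. box (fst (ab i)) (snd (ab i))) = V"
      using open_rat_boxes[OF assms] unfolding ab[symmetric] by auto
    then show "(%k. bump (k * k) (map ab [0..<k]) x) \<longlonglongrightarrow> indicator V x" for x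
      using bump_tendsto[of ab x] by simp
  qed
qed

section \<open>Measures and integration\<close>

lemma complete_lebesgue_on: "S \<in> sets lebesgue ==> complete_measure (lebesgue_on S)"
proof
  fix A B assume S: "S \<in> sets lebesgue" and B: "B \<subseteq> A" "A \<in> null_sets (lebesgue_on S)"
  then have "A \<in> null_sets lebesgue" "A \<subseteq> S" by (auto simp: null_sets_restrict_space)
  then have "B \<in> null_sets lebesgue" using B(1) completion.complete2 by blast
  then show "B \<in> sets (lebesgue_on S)" using S B(1) \<open>A \<subseteq> S\<close> by (auto simp: sets_restrict_space_iff)
qed

context complete_measure
begin

lemma borel_measurable_AE_cong:
  fixes f g :: "'a => 'b::topological_space"
  assumes f: "f \<in> borel_measurable M" and ae: "AE x in M. f x = g x"
  shows "g \<in> borel_measurable M"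
proof (rule measurableI)
  fix A :: "'b set" assume A: "A \<in> sets borel"
  show "g -` A \<inter> space M \<in> sets M"
  proof (rule in_sets_AE)
    show "AE x in M. (x \<in> f -` A \<inter> space M) = (x \<in> g -` A \<inter> space M)" using ae by eventually_elim auto
    show "f -` A \<inter> space M \<in> sets M" using f A by measurable
  qed auto
qed auto

lemma integrable_AE_cong:
  fixes f g :: "_ => 'b::{banach, second_countable_topology}"
  assumes "integrable M f" "AE x in M. f x = g x"
  shows "integrable M g"
  using assms borel_measurable_AE_cong[of f g] integrable_cong_AE[of f M g] by auto

text \<open>If one function is not measurable then, by completeness, neither is the other, and both
  integrals are 0 by convention. Integrands may thus be exchanged almost everywhere without a
  measurability check.\<close>

lemma integral_AE_cong:
  fixes f g :: "_ => 'b::{banach, second_countable_topology}"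
  assumes ae: "AE x in M. f x = g x"
  shows "integral\<^sup>L M f = integral\<^sup>L M g"
proof (cases "f \<in> borel_measurable M")
  case True
  then show ?thesis using borel_measurable_AE_cong[OF True ae] ae by (intro integral_cong_AE)
next
  case False
  then have "g \<notin> borel_measurable M"
    using borel_measurable_AE_cong[of g f] ae by (auto simp: eq_commute)
  then show ?thesis using False by (metis borel_measurable_integrable not_integrable_integral_eq)
qed

end

text \<open>Identities such as \<open>P + Q = R\<close> between finite measures are written as one
  vanishing weighted sum, so that a single Dynkin argument covers all of them. The total mass is a
  separate assumption because the whole space need not belong to the generator.\<close>

lemma signed_measure_dynkin:
  fixes M :: "'i => 'a measure" and w :: "'i => real"
  assumes I: "finite I" and fin: "!!i. i \<in> I ==> finite_measure (M i)"
    and sets: "!!i. i \<in> I ==> sets (M i) = sigma_sets \<Omega> G" and G: "Int_stable G" "G \<subseteq> Pow \<Omega>"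
    and zero: "!!A. A \<in> G ==> (\<Sum>i\<in>I. w i * measure (M i) A) = 0"
    and total: "(\<Sum>i\<in>I. w i * measure (M i) \<Omega>) = 0"
    and A: "A \<in> sigma_sets \<Omega> G"
  shows "(\<Sum>i\<in>I. w i * measure (M i) A) = 0"
  using G(1) G(2) A
proof (induction rule: sigma_sets_induct_disjoint)
  case (basic A) then show ?case by (rule zero)
next
  case empty show ?case by simp
next
  case (compl A)
  have "measure (M i) (\<Omega> - A) = measure (M i) \<Omega> - measure (M i) A" if "i \<in> I" for i
  proof -
    have sp: "space (M i) = \<Omega>"
      using sets[OF that] sets_eq_imp_space_eq[of "M i" "measure_of \<Omega> G (%_. 0)"] G(2)
      by (simp add: sets_measure_of)
    show ?thesis
      using finite_measure.finite_measure_compl[OF fin[OF that], of A] compl sets[OF that] by (simp add: sp)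
  qed
  then have "(\<Sum>i\<in>I. w i * measure (M i) (\<Omega> - A))
     = (\<Sum>i\<in>I. w i * measure (M i) \<Omega>) - (\<Sum>i\<in>I. w i * measure (M i) A)"
    by (simp add: sum_subtractf right_diff_distrib)
  then show ?case using total compl by simp
next
  case (union A)
  have "(%n. \<Sum>i\<in>I. w i * measure (M i) (A n)) sums (\<Sum>i\<in>I. w i * measure (M i) (\<Union>n. A n))"
  proof (intro sums_sum sums_mult)
    fix i assume i: "i \<in> I"
    show "(%n. measure (M i) (A n)) sums measure (M i) (\<Union>n. A n)"
      using union sets[OF i] by (intro finite_measure.finite_measure_UNION[OF fin[OF i]]) auto
  qed
  then have "(%n. 0) sums (\<Sum>i\<in>I. w i * measure (M i) (\<Union>n. A n))"
    using union by simp
  then show ?case using sums_unique2 sums_zero by blast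
qed

text \<open>Passes from sets to bounded functions: by linearity the relation holds for simple
  functions, and it survives dominated convergence.\<close>

lemma signed_integral_zero:
  fixes M :: "'i => 'a measure" and w :: "'i => real" and f :: "'a => real"
  assumes I: "finite I" and fin: "!!i. i \<in> I ==> finite_measure (M i)"
    and sets: "!!i. i \<in> I ==> sets (M i) = sets N"
    and zero: "!!A. A \<in> sets N ==> (\<Sum>i\<in>I. w i * measure (M i) A) = 0"
    and f: "f \<in> borel_measurable N" and bnd: "!!x. \<bar>f x\<bar> \<le> K"
  shows "(\<Sum>i\<in>I. w i * integral\<^sup>L (M i) f) = 0"
proof -
  obtain F where F: "!!n. simple_function N (F n)" "!!x. x \<in> space N ==> (%n. F n x) \<longlonglongrightarrow> f x"
    "!!n x. x \<in> space N ==> dist (F n x) 0 \<le> 2 * dist (f x) 0"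
    using borel_measurable_implies_sequence_metric[OF f, of 0] by blast
  have sp: "space (M i) = space N" if "i \<in> I" for i using sets_eq_imp_space_eq[OF sets[OF that]] .
  have simple: "(\<Sum>i\<in>I. w i * integral\<^sup>L (M i) g) = 0" if g: "simple_function N g" for g :: "'a => real"
  proof -
    let ?Y = "g ` space N" and ?S = "%y. g -` {y} \<inter> space N"
    have Y: "finite ?Y" using g by (rule simple_functionD)
    have S: "?S y \<in> sets N" for y using simple_functionD(2)[OF g] .
    have "integral\<^sup>L (M i) g = (\<Sum>y\<in>?Y. y * measure (M i) (?S y))" if i: "i \<in> I" for i
    proof -
      interpret finite_measure "M i" by (rule fin[OF i])
      have "integral\<^sup>L (M i) g = integral\<^sup>L (M i) (%x. \<Sum>y\<in>?Y. y * indicator (?S y) x)"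
      proof (rule Bochner_Integration.integral_cong)
        fix x assume "x \<in> space (M i)"
        then have x: "x \<in> space N" using sp[OF i] by simp
        have "(\<Sum>y\<in>?Y. y * indicator (?S y) x) = (\<Sum>y\<in>?Y. if y = g x then y else 0)"
          using x by (intro sum.cong) (auto simp: indicator_def)
        also have "\<dots> = g x" using Y x by (simp add: sum.delta)
        finally show "g x = (\<Sum>y\<in>?Y. y * indicator (?S y) x)" by simp
      qed simp
      also have "\<dots> = (\<Sum>y\<in>?Y. integral\<^sup>L (M i) (%x. y * indicator (?S y) x))"
        using S sets[OF i]
        by (intro Bochner_Integration.integral_sum integrable_mult_right integrable_real_indicator)
           (auto simp: emeasure_eq_measure)
      also have "\<dots> = (\<Sum>y\<in>?Y. y * measure (M i) (?S y))"
        using S sets[OF i] sp[OF i] by (intro sum.cong) (auto simp: Int_absorb2)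
      finally show ?thesis .
    qed
    then have "(\<Sum>i\<in>I. w i * integral\<^sup>L (M i) g) = (\<Sum>i\<in>I. \<Sum>y\<in>?Y. w i * (y * measure (M i) (?S y)))"
      by (simp add: sum_distrib_left)
    also have "\<dots> = (\<Sum>y\<in>?Y. \<Sum>i\<in>I. w i * (y * measure (M i) (?S y)))" by (rule sum.swap)
    also have "\<dots> = (\<Sum>y\<in>?Y. y * (\<Sum>i\<in>I. w i * measure (M i) (?S y)))"
      by (simp add: sum_distrib_left mult_ac)
    also have "\<dots> = 0" using zero[OF S] by simp
    finally show ?thesis .
  qed
  have "(%n. \<Sum>i\<in>I. w i * integral\<^sup>L (M i) (F n)) \<longlonglongrightarrow> (\<Sum>i\<in>I. w i * integral\<^sup>L (M i) f)"
  proof (intro tendsto_sum tendsto_mult tendsto_const)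
    fix i assume i: "i \<in> I"
    interpret finite_measure "M i" by (rule fin[OF i])
    show "(%n. integral\<^sup>L (M i) (F n)) \<longlonglongrightarrow> integral\<^sup>L (M i) f"
    proof (rule integral_dominated_convergence[where w="%x. 2 * K"])
      show "f \<in> borel_measurable (M i)" using f sets[OF i] by (simp cong: measurable_cong_sets)
      show "F n \<in> borel_measurable (M i)" for n
        using borel_measurable_simple_function[OF F(1)[of n]] sets[OF i] by (simp cong: measurable_cong_sets)
      show "AE x in M i. (%n. F n x) \<longlonglongrightarrow> f x" using F(2) sp[OF i] by auto
      show "AE x in M i. norm (F n x) \<le> 2 * K" for n
        using F(3) bnd sp[OF i] by (intro AE_I2) (smt (verit) dist_0_norm dist_commute real_norm_def)
    qed simp
  qed
  then have "(%n. 0) \<longlonglongrightarrow> (\<Sum>i\<in>I. w i * integral\<^sup>L (M i) f)" using simple[OF F(1)] by simp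
  then show ?thesis using LIMSEQ_unique tendsto_const by blast
qed

definition cutoff :: "'a::metric_space set => nat => 'a => real" where
  "cutoff C n x = max 0 (1 - real n * infdist x C)"

lemma cutoff: "continuous_on UNIV (cutoff C n)" "0 \<le> cutoff C n x" "cutoff C n x \<le> 1" "x \<in> C ==> cutoff C n x = 1"
  unfolding cutoff_def by (auto simp: infdist_nonneg intro!: continuous_intros)

lemma cutoff_tendsto:
  assumes C: "closed C" "C \<noteq> {}"
  shows "(%n. cutoff C n x) \<longlonglongrightarrow> indicator C x"
proof (cases "x \<in> C")
  case False
  then have d: "0 < infdist x C" using C infdist_pos_not_in_closed by blast
  then obtain N :: nat where N: "1 < real N * infdist x C" using reals_Archimedean3 by blast
  have "eventually (%n. cutoff C n x = 0) sequentially"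
    using eventually_ge_at_top[of N]
  proof eventually_elim
    case (elim n)
    have "real N * infdist x C \<le> real n * infdist x C" using elim d by (intro mult_right_mono) auto
    then show ?case using N by (simp add: cutoff_def)
  qed
  then show ?thesis using False by (simp add: tendsto_eventually)
qed (simp add: cutoff(4))

text \<open>Continuous cut-offs converge boundedly to the indicator of a closed set, so the relation
  holds for closed sets. These generate the Borel sets and are stable under intersection.\<close>

lemma signed_measure_zero_continuous:
  fixes M :: "'i => 'a::metric_space measure" and w :: "'i => real"
  assumes I: "finite I" and fin: "!!i. i \<in> I ==> finite_measure (M i)"
    and sets: "!!i. i \<in> I ==> sets (M i) = sets borel"
    and zero: "!!f :: 'a => real. continuous_on UNIV f ==> (!!x. \<bar>f x\<bar> \<le> 1) ==> (\<Sum>i\<in>I. w i * integral\<^sup>L (M i) f) = 0"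
    and A: "A \<in> sets borel"
  shows "(\<Sum>i\<in>I. w i * measure (M i) A) = 0"
proof -
  have sp: "space (M i) = UNIV" if "i \<in> I" for i using sets_eq_imp_space_eq[OF sets[OF that]] by simp
  have closed: "(\<Sum>i\<in>I. w i * measure (M i) C) = 0" if C: "closed C" for C
  proof (cases "C = {}")
    case False
    note cont = cutoff(1)[of C]
    have bnd: "\<bar>cutoff C n x\<bar> \<le> 1" for n x using cutoff(2,3)[of C n x] by simp
    have "(%n. \<Sum>i\<in>I. w i * integral\<^sup>L (M i) (cutoff C n)) \<longlonglongrightarrow> (\<Sum>i\<in>I. w i * integral\<^sup>L (M i) (indicator C))"
    proof (intro tendsto_sum tendsto_mult tendsto_const)
      fix i assume i: "i \<in> I"
      interpret finite_measure "M i" by (rule fin[OF i])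
      show "(%n. integral\<^sup>L (M i) (cutoff C n)) \<longlonglongrightarrow> integral\<^sup>L (M i) (indicator C)"
      proof (rule integral_dominated_convergence[where w="%x. 1"])
        show "cutoff C n \<in> borel_measurable (M i)" for n
          using borel_measurable_continuous_onI[OF cont[of n]] sets[OF i] by (simp cong: measurable_cong_sets)
        show "indicator C \<in> borel_measurable (M i)" using C sets[OF i] by (intro borel_measurable_indicator) simp
      qed (use bnd cutoff_tendsto[OF C False] in auto)
    qed
    moreover have "integral\<^sup>L (M i) (indicator C) = measure (M i) C" if "i \<in> I" for i
      using sp[OF that] by simp
    moreover have "(\<Sum>i\<in>I. w i * integral\<^sup>L (M i) (cutoff C n)) = 0" for n
      by (rule zero[OF cont bnd])
    ultimately have "(%n. 0) \<longlonglongrightarrow> (\<Sum>i\<in>I. w i * measure (M i) C)" by simp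
    then show ?thesis using LIMSEQ_unique tendsto_const by blast
  qed simp
  have b: "sets (borel :: 'a measure) = sigma_sets UNIV (Collect closed)"
    by (simp add: borel_eq_closed)
  show ?thesis
  proof (rule signed_measure_dynkin[OF I fin, where G="Collect closed" and \<Omega>=UNIV])
    show "Int_stable (Collect (closed :: 'a set => bool))" by (auto simp: Int_stable_def)
  qed (use closed sets b A in auto)
qed

text \<open>Boxes form a generator stable under intersection, so the integral of \<open>g\<close>
  vanishes over every Borel set. Uniqueness of densities, applied to a Borel version of
  \<open>g\<close>, does the rest.\<close>

lemma AE_zero_if_box_integrals_zero:
  fixes g :: "'a::euclidean_space => real"
  assumes g: "integrable lebesgue g"
    and zero: "!!a b. (LINT x|lebesgue. indicator (box a b) x * g x) = 0"
  shows "AE x in lebesgue. g x = 0"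
proof -
  have int: "integrable lebesgue (%x. indicator A x * g x)" if "A \<in> sets lebesgue" for A
    using integrable_mult_indicator[OF that g] by simp
  \<comment> \<open>The whole space is not a box; its integral is what the complements in the Dynkin
    argument call for.\<close>
  have total: "(LINT x|lebesgue. g x) = 0"
  proof -
    have "(%n. LINT x|lebesgue. indicator (box (- real n *\<^sub>R One) (real n *\<^sub>R One)) x * g x) \<longlonglongrightarrow> (LINT x|lebesgue. g x)"
    proof (rule integral_dominated_convergence[where w="%x. \<bar>g x\<bar>"])
      show "AE x in lebesgue. (%n. indicator (box (- real n *\<^sub>R One) (real n *\<^sub>R One)) x * g x) \<longlonglongrightarrow> g x"
      proof (rule AE_I2)
        fix x :: 'a
        obtain m where m: "norm x < real m" using reals_Archimedean2 by blast
        have "eventually (%n. indicator (box (- real n *\<^sub>R One) (real n *\<^sub>R One)) x * g x = g x) sequentially"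
          using eventually_ge_at_top[of m]
        proof eventually_elim
          case (elim n)
          have "\<bar>x \<bullet> i\<bar> < real n" if "i \<in> Basis" for i
            using Basis_le_norm[OF that, of x] m elim by linarith
          then have "x \<in> box (- real n *\<^sub>R One) (real n *\<^sub>R One)"
            by (auto simp: mem_box abs_less_iff inner_sum_left_Basis) (smt (verit))+
          then show ?case by simp
        qed
        then show "(%n. indicator (box (- real n *\<^sub>R One) (real n *\<^sub>R One)) x * g x) \<longlonglongrightarrow> g x"
          by (rule tendsto_eventually)
      qed
      show "(%x. indicator (box (- real n *\<^sub>R One) (real n *\<^sub>R One)) x * g x) \<in> borel_measurable lebesgue" for n
        by (intro borel_measurable_integrable int) simp
    qed (use g in \<open>auto simp: indicator_def abs_mult\<close>)
    then have "(%n::nat. 0) \<longlonglongrightarrow> (LINT x|lebesgue. g x)" using zero by simp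
    then show ?thesis using LIMSEQ_unique tendsto_const by blast
  qed
  have B: "sets (borel :: 'a measure) = sigma_sets UNIV (range (%(a, b). box a b))"
    by (subst borel_eq_box) (rule sets_measure_of, auto)
  have box: "(LINT x|lebesgue. indicator A x * g x) = 0" if "A \<in> sigma_sets UNIV (range (%(a, b). box a b))" for A
  proof -
    have "Int_stable (range (%(a, b :: 'a). box a b))"
      unfolding Int_stable_def by (auto simp: box_Int_box)
    moreover have "(range (%(a, b :: 'a). box a b)) \<subseteq> Pow UNIV" by auto
    ultimately show ?thesis using that
    proof (induction rule: sigma_sets_induct_disjoint)
      case (basic A) then show ?case using zero by auto
    next
      case empty show ?case by simp
    next
      case (compl A)
      then have "A \<in> sets borel" by (simp add: B)
      then have "(LINT x|lebesgue. indicator (UNIV - A) x * g x) = (LINT x|lebesgue. g x - indicator A x * g x)"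
        by (intro Bochner_Integration.integral_cong) (auto simp: indicator_def)
      also have "\<dots> = 0" using \<open>A \<in> sets borel\<close> compl g int total by (subst Bochner_Integration.integral_diff) auto
      finally show ?case .
    next
      case (union A)
      have A: "A i \<in> sets lebesgue" for i
      using union(2) by (auto simp: B[symmetric] image_subset_iff)
      have "(LINT x:(\<Union>i. A i)|lebesgue. g x) = (\<Sum>i. (LINT x:(A i)|lebesgue. g x))"
      proof (rule lebesgue_integral_countable_add)
        show "A i \<in> sets lebesgue" for i by (rule A)
        show "A i \<inter> A j = {}" if "i \<noteq> j" for i j using union(1) that by (auto simp: disjoint_family_on_def)
        show "set_integrable lebesgue (\<Union>i. A i) g"
          using int[of "\<Union>i. A i"] A by (auto simp: set_integrable_def)
      qed
      then show ?case using union(3) by (simp add: set_lebesgue_integral_def)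
    qed
  qed
  obtain g' where g': "g' \<in> borel_measurable lborel" "AE x in lborel. g x = g' x"
    using completion_ex_borel_measurable_real[of g lborel] g by auto
  then have ae: "AE x in lebesgue. g x = g' x" by (simp add: AE_completion)
  have "integrable lebesgue g'" by (rule completion.integrable_AE_cong[OF g ae])
  then have i: "integrable lborel g'" using g' by (simp add: integrable_completion)
  have "AE x in lborel. g' x = 0"
  proof (rule density_unique_real[OF i])
    fix A :: "'a set" assume A: "A \<in> sets lborel"
    have "(LINT x|lebesgue. indicator A x * g' x) = (LINT x|lebesgue. indicator A x * g x)"
      by (rule completion.integral_AE_cong) (use ae in eventually_elim, simp)
    moreover have "(LINT x|lebesgue. indicator A x * g' x) = (LINT x|lborel. indicator A x * g' x)"
      by (rule integral_completion) (use A g' in measurable)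
    ultimately show "(LINT x:A|lborel. g' x) = (LINT x:A|lborel. 0)"
      using box[of A] A by (simp add: B set_lebesgue_integral_def)
  qed simp
  then have "AE x in lebesgue. g' x = 0" by (rule AE_completion)
  then show ?thesis using ae by eventually_elim simp
qed

section \<open>Lipschitz functions as integrals of densities\<close>

lemma interval_measure_finite:
  assumes mono: "!!x y. x \<le> y ==> F x \<le> F y" and cont: "!!a. continuous (at_right a) F"
    and const: "!!x. x \<le> 0 ==> F x = F 0" "!!x. T \<le> x ==> F x = F T" and T: "(0::real) \<le> T"
  shows "finite_measure (interval_measure F)" "measure (interval_measure F) UNIV = F T - F 0"
    "a \<le> b ==> measure (interval_measure F) {a<..b} = F b - F a"
proof -
  have Ioc: "emeasure (interval_measure F) {a<..b} = ennreal (F b - F a)" if "a \<le> b" for a b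
    using that mono cont by (intro emeasure_interval_measure_Ioc) auto
  then show "a \<le> b ==> measure (interval_measure F) {a<..b} = F b - F a"
    using mono[of a b] by (simp add: measure_def)
  obtain m where m: "T < real m" using reals_Archimedean2 by blast
  have U: "(\<Union>n. {- real n<..real n}) = UNIV"
  proof -
    have "\<exists>n. x \<in> {- real n<..real n}" for x
    proof -
      obtain n where "\<bar>x\<bar> < real n" using reals_Archimedean2 by blast
      then show ?thesis by (intro exI[of _ n]) auto
    qed
    then show ?thesis by auto
  qed
  have inc: "incseq (%n. {- real n<..real n})" by (auto simp: incseq_def)
  have lim: "(%n. emeasure (interval_measure F) {- real n<..real n}) \<longlonglongrightarrow> emeasure (interval_measure F) UNIV"
  proof -
    have "range (%n. {- real n<..real n}) \<subseteq> sets (interval_measure F)" by auto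
    from Lim_emeasure_incseq[OF this inc] show ?thesis by (simp only: U)
  qed
  have "eventually (%n. emeasure (interval_measure F) {- real n<..real n} = ennreal (F T - F 0)) sequentially"
    using eventually_ge_at_top[of m]
  proof eventually_elim
    case (elim n)
    then have "T \<le> real n" using m by linarith
    then have "F (real n) = F T" "F (- real n) = F 0" using const(2)[of "real n"] const(1)[of "- real n"] by auto
    then show ?case by (subst Ioc) auto
  qed
  then have "(%n. emeasure (interval_measure F) {- real n<..real n}) \<longlonglongrightarrow> ennreal (F T - F 0)"
    by (rule tendsto_eventually)
  then have eq: "emeasure (interval_measure F) UNIV = ennreal (F T - F 0)" using lim LIMSEQ_unique by blast
  then show "finite_measure (interval_measure F)" by (intro finite_measureI) simp
  show "measure (interval_measure F) UNIV = F T - F 0" using eq mono[OF T] by (simp add: measure_def)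
qed

text \<open>Both \<open>F\<close> and \<open>\<kappa> x - F x\<close> are nondecreasing, and their
  Stieltjes measures add up to \<open>\<kappa>\<close> times Lebesgue measure on
  \<open>(0,T]\<close>. Hence the measure of \<open>F\<close> is absolutely continuous, and the
  Radon-Nikodym theorem yields the density.\<close>

lemma lipschitz_mono_density:
  fixes F :: "real => real"
  assumes T: "0 < T"
    and mono: "!!a b. 0 \<le> a ==> a \<le> b ==> b \<le> T ==> F a \<le> F b"
    and lip: "!!a b. 0 \<le> a ==> a \<le> b ==> b \<le> T ==> F b - F a \<le> \<kappa> * (b - a)"
  obtains f where "f \<in> borel_measurable borel" "!!x. 0 \<le> f x" "integrable lborel f"
    "!!a b. 0 \<le> a ==> a \<le> b ==> b \<le> T ==> (LINT x|lborel. indicator {a..b} x * f x) = F b - F a"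
proof -
  \<comment> \<open>Monotonicity is known on \<open>[0,T]\<close> only. Composing with this clamp
    extends \<open>F\<close> by constants to the line, where Stieltjes measures are defined.\<close>
  define cl where "cl x = max 0 (min T x)" for x :: real
  have cl: "0 \<le> cl x" "cl x \<le> T" for x using T by (auto simp: cl_def)
  have clm: "x \<le> y ==> cl x \<le> cl y" for x y by (auto simp: cl_def)
  have clc: "continuous_on UNIV cl" unfolding cl_def by (intro continuous_intros)
  have clid: "0 \<le> x ==> x \<le> T ==> cl x = x" for x by (simp add: cl_def)
  have clb: "x \<le> 0 ==> cl x = 0" "T \<le> x ==> cl x = T" for x using T by (auto simp: cl_def)
  have kn: "0 \<le> \<kappa>" using mono[of 0 T] lip[of 0 T] T by (smt (verit) zero_le_mult_iff)
  define F' where "F' x = F (cl x)" for x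
  define G' where "G' x = \<kappa> * cl x - F (cl x)" for x
  have lipF: "\<bar>F b - F a\<bar> \<le> \<kappa> * \<bar>b - a\<bar>" if "0 \<le> a" "a \<le> T" "0 \<le> b" "b \<le> T" for a b
    using mono[of a b] mono[of b a] lip[of a b] lip[of b a] that by (cases "a \<le> b") (auto simp: abs_if)
  have Fc: "continuous_on {0..T} F"
  proof (rule continuous_on_subset[OF _ order_refl], rule lipschitz_on_continuous_on)
    show "\<kappa>-lipschitz_on {0..T} F"
      using lipF kn by (auto simp: lipschitz_on_def dist_real_def)
  qed
  have F'c: "continuous_on UNIV F'" unfolding F'_def
    by (rule continuous_on_compose2[OF Fc clc]) (use cl in auto)
  have G'c: "continuous_on UNIV G'" using F'c unfolding G'_def F'_def by (intro continuous_intros clc)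
  have F'm: "x \<le> y ==> F' x \<le> F' y" for x y unfolding F'_def by (rule mono) (use cl clm in auto)
  have G'm: "x \<le> y ==> G' x \<le> G' y" for x y
    using lip[of "cl x" "cl y"] cl clm[of x y] by (auto simp: G'_def algebra_simps)
  have at_r: "continuous (at_right a) H" if "continuous_on UNIV H" for a and H :: "real => real"
    using that by (simp add: continuous_at_imp_continuous_at_within continuous_on_eq_continuous_at)
  let ?N = "interval_measure F'" and ?N2 = "interval_measure G'"
  let ?M3 = "density lborel (%x. ennreal \<kappa> * indicator {0<..T} x)"
  have constF: "x \<le> 0 ==> F' x = F' 0" "T \<le> x ==> F' x = F' T" 
    and constG: "x \<le> 0 ==> G' x = G' 0" "T \<le> x ==> G' x = G' T" for x
    using clb T by (auto simp: F'_def G'_def)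
  have N: "finite_measure ?N" "measure ?N UNIV = F' T - F' 0" "!!a b. a \<le> b ==> measure ?N {a<..b} = F' b - F' a"
    by (rule interval_measure_finite[OF F'm at_r[OF F'c] constF less_imp_le[OF T]]; assumption)+
  have N2: "finite_measure ?N2" "measure ?N2 UNIV = G' T - G' 0" "!!a b. a \<le> b ==> measure ?N2 {a<..b} = G' b - G' a"
    by (rule interval_measure_finite[OF G'm at_r[OF G'c] constG less_imp_le[OF T]]; assumption)+
  have M3: "emeasure ?M3 A = ennreal \<kappa> * emeasure lborel ({0<..T} \<inter> A)" if "A \<in> sets borel" for A
  proof -
    have "emeasure ?M3 A = (\<integral>\<^sup>+x. ennreal \<kappa> * indicator ({0<..T} \<inter> A) x \<partial>lborel)"
      using that by (subst emeasure_density) (auto intro!: nn_integral_cong simp: indicator_def)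
    also have "\<dots> = ennreal \<kappa> * emeasure lborel ({0<..T} \<inter> A)"
      using that by (subst nn_integral_cmult_indicator) auto
    finally show ?thesis .
  qed
  have M3I: "measure ?M3 {a<..b} = \<kappa> * (cl b - cl a)" if "a \<le> b" for a b
  proof -
    have "{0<..T} \<inter> {a<..b} = {cl a<..cl b}" by (auto simp: cl_def)
    then have "emeasure ?M3 {a<..b} = ennreal \<kappa> * ennreal (cl b - cl a)"
      using clm[OF that] by (subst M3) auto
    then show ?thesis using clm[OF that] kn by (simp add: measure_def ennreal_mult[symmetric])
  qed
  have M3U: "emeasure ?M3 UNIV = ennreal \<kappa> * ennreal T" using T by (subst M3) auto
  have fin3: "finite_measure ?M3"
    by (rule finite_measureI) (use M3U in \<open>simp add: ennreal_mult_eq_top_iff\<close>)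
  \<comment> \<open>The weights 1, 1, -1 on three measures express that the two Stieltjes measures
    add up to the third.\<close>
  define M where "M i = (if i = (0::nat) then ?N else if i = 1 then ?N2 else ?M3)" for i
  define w where "w i = (if i = (2::nat) then - 1 else 1 :: real)" for i
  have I3: "{..<3} = {0, 1, 2::nat}" by auto
  have dyn: "measure ?N A + measure ?N2 A - measure ?M3 A = 0" if A: "A \<in> sets borel" for A
  proof -
    have "(\<Sum>i<3. w i * measure (M i) A) = 0"
    proof (rule signed_measure_dynkin[where G="range (%(a, b). {a<..b::real})" and \<Omega>=UNIV])
      show "finite_measure (M i)" for i
        using N(1) N2(1) fin3 by (simp add: M_def)
      have s: "sets borel = sigma_sets UNIV (range (%(a, b). {a<..b::real}))"
        by (subst borel_sigma_sets_Ioc) (auto intro: sets_measure_of)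
      then show "sets (M i) = sigma_sets UNIV (range (%(a, b). {a<..b::real}))" for i
        by (simp add: M_def)
      show "A \<in> sigma_sets UNIV (range (%(a, b). {a<..b::real}))" using A s by simp
      show "Int_stable (range (%(a, b). {a<..b::real}))"
      proof (rule Int_stableI)
        fix A B assume "A \<in> range (%(a, b). {a<..b::real})" "B \<in> range (%(a, b). {a<..b::real})"
        then obtain a b c d where "A = {a<..b}" "B = {c<..d}" by auto
        then have "A \<inter> B = (%(a, b). {a<..b}) (max a c, min b d)" by auto
        then show "A \<inter> B \<in> range (%(a, b). {a<..b::real})" by (rule range_eqI)
      qed
      show "(\<Sum>i<3. w i * measure (M i) UNIV) = 0"
        using N(2) N2(2) M3U T kn clid[of 0] clid[of T]
        by (simp add: I3 M_def w_def F'_def G'_def measure_def ennreal_mult[symmetric])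
      fix A assume "A \<in> range (%(a, b). {a<..b::real})"
      then obtain a b where A: "A = {a<..b}" by auto
      show "(\<Sum>i<3. w i * measure (M i) A) = 0"
      proof (cases "a \<le> b")
        case True
        show ?thesis using N(3)[OF True] N2(3)[OF True] M3I[OF True]
          by (simp add: I3 M_def w_def A F'_def G'_def algebra_simps)
      next
        case False
        then have "A = {}" using A by auto
        then show ?thesis by simp
      qed
    qed auto
    then show ?thesis by (simp add: I3 M_def w_def)
  qed
  interpret N: finite_measure ?N by (rule N(1))
  have ac: "absolutely_continuous lborel ?N"
    unfolding absolutely_continuous_def
  proof
    fix A :: "real set" assume A: "A \<in> null_sets lborel"
    then have "{0<..T} \<inter> A \<in> null_sets lborel" by (intro null_set_Int1) auto
    then have "emeasure ?M3 A = 0" using A by (subst M3) auto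
    then have "measure ?M3 A = 0" by (simp add: measure_def)
    then have "measure ?N A + measure ?N2 A = 0" using dyn[of A] null_setsD2[OF A] by simp
    then have "measure ?N A = 0" using measure_nonneg[of ?N A] measure_nonneg[of ?N2 A] by linarith
    then have "emeasure ?N A = 0" by (simp add: N.emeasure_eq_measure)
    then show "A \<in> null_sets ?N" using null_setsD2[OF A] by (intro null_setsI) auto
  qed
  obtain g where g: "g \<in> borel_measurable lborel" "density lborel g = ?N"
    using sigma_finite_measure.Radon_Nikodym[OF sigma_finite_lborel ac] by auto
  have tot: "(\<integral>\<^sup>+x. g x \<partial>lborel) = emeasure ?N UNIV"
    using emeasure_density[OF g(1), of UNIV] g(2) by simp
  have gfin: "AE x in lborel. g x \<noteq> \<infinity>"
    using g(1) tot N.emeasure_finite by (intro nn_integral_PInf_AE) (auto simp: less_top)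
  define f where "f x = enn2real (g x)" for x
  have f: "f \<in> borel_measurable borel" using g(1) unfolding f_def by measurable
  have fn: "0 \<le> f x" for x by (simp add: f_def)
  have fg: "AE x in lborel. ennreal (f x) = g x"
    using gfin by eventually_elim (auto simp: f_def less_top)
  have fint: "integrable lborel f"
  proof (rule integrableI_nonneg)
    have "(\<integral>\<^sup>+x. ennreal (f x) \<partial>lborel) = (\<integral>\<^sup>+x. g x \<partial>lborel)" by (rule nn_integral_cong_AE[OF fg])
    then show "(\<integral>\<^sup>+x. ennreal (f x) \<partial>lborel) < \<infinity>" using tot by (simp add: less_top[symmetric])
  qed (use f in \<open>auto simp: f_def\<close>)
  show ?thesis
  proof (rule that[OF f _ fint])
    show "0 \<le> f x" for x by (simp add: f_def)
    fix a b assume ab: "0 \<le> a" "a \<le> b" "b \<le> T"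
    have "(LINT x|lborel. indicator {a..b} x * f x) = (LINT x|lborel. indicator {a<..b} x * f x)"
      using AE_lborel_singleton[of a] f by (intro integral_cong_AE) (auto simp: indicator_def)
    also have "\<dots> = enn2real (\<integral>\<^sup>+x. ennreal (indicator {a<..b} x * f x) \<partial>lborel)"
      using f fn by (intro integral_eq_nn_integral) auto
    also have "(\<integral>\<^sup>+x. ennreal (indicator {a<..b} x * f x) \<partial>lborel) = (\<integral>\<^sup>+x. g x * indicator {a<..b} x \<partial>lborel)"
      by (rule nn_integral_cong_AE) (use fg in eventually_elim, auto simp: indicator_def)
    also have "\<dots> = emeasure ?N {a<..b}" using emeasure_density[OF g(1), of "{a<..b}"] g(2) by simp
    also have "enn2real \<dots> = F b - F a"
      using N(3)[OF ab(2)] ab clid by (simp add: measure_def F'_def)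
    finally show "(LINT x|lborel. indicator {a..b} x * f x) = F b - F a" .
  qed
qed

text \<open>Adding \<open>\<kappa> x\<close> makes \<open>F\<close> nondecreasing with slope at most
  \<open>2 \<kappa>\<close>; the constant is subtracted again from the density.\<close>

lemma lipschitz_density:
  fixes F :: "real => real"
  assumes T: "0 < T" and lip: "!!a b. 0 \<le> a ==> a \<le> b ==> b \<le> T ==> \<bar>F b - F a\<bar> \<le> \<kappa> * (b - a)"
  obtains f where "f \<in> borel_measurable borel" "integrable lborel (%x. indicator {0..T} x * f x)"
    "!!a b. 0 \<le> a ==> a \<le> b ==> b \<le> T ==> (LINT x|lborel. indicator {a..b} x * f x) = F b - F a"
proof -
  obtain g where g: "g \<in> borel_measurable borel" "integrable lborel g"
    "!!a b. 0 \<le> a ==> a \<le> b ==> b \<le> T ==> (LINT x|lborel. indicator {a..b} x * g x) = (F b + \<kappa> * b) - (F a + \<kappa> * a)"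
  proof (rule lipschitz_mono_density[OF T, of "%x. F x + \<kappa> * x" "2 * \<kappa>"])
    fix a b assume "0 \<le> a" "a \<le> b" "b \<le> T"
    from lip[OF this] show "F a + \<kappa> * a \<le> F b + \<kappa> * b" "F b + \<kappa> * b - (F a + \<kappa> * a) \<le> 2 * \<kappa> * (b - a)"
      by (auto simp: algebra_simps abs_le_iff)
  qed blast
  have gi: "integrable lborel (%x. indicator {a..b} x * g x)" for a b
    using integrable_mult_indicator[OF _ g(2), of "{a..b}"] by simp
  have ki: "integrable lborel (%x. indicator {a..b} x * \<kappa>)" for a b :: real
    by (intro integrable_mult_left integrable_real_indicator) (auto simp: emeasure_lborel_Icc_eq)
  have eq: "(%x. indicator {a..b} x * (g x - \<kappa>)) = (%x. indicator {a..b} x * g x - indicator {a..b} x * \<kappa>)" for a b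
    by (auto simp: algebra_simps)
  show ?thesis
  proof (rule that[of "%x. g x - \<kappa>"])
    show "(%x. g x - \<kappa>) \<in> borel_measurable borel" using g(1) by measurable
    show "integrable lborel (%x. indicator {0..T} x * (g x - \<kappa>))"
      unfolding eq by (intro Bochner_Integration.integrable_diff gi ki)
    fix a b assume ab: "0 \<le> a" "a \<le> b" "b \<le> T"
    show "(LINT x|lborel. indicator {a..b} x * (g x - \<kappa>)) = F b - F a"
      unfolding eq using g(3)[OF ab] ab
      by (subst Bochner_Integration.integral_diff[OF gi ki]) (simp add: algebra_simps)
  qed
qed

lemma AE_eq_if_interval_integrals_eq:
  fixes f g :: "real => real"
  assumes T: "0 < T"
    and f: "integrable lebesgue (%x. indicator {0..T} x * f x)"
    and g: "integrable lebesgue (%x. indicator {0..T} x * g x)"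
    and eq: "!!a b. 0 \<le> a ==> a \<le> b ==> b \<le> T ==>
      (LINT x|lebesgue. indicator {a..b} x * f x) = (LINT x|lebesgue. indicator {a..b} x * g x)"
  shows "AE x in lebesgue. x \<in> {0..T} \<longrightarrow> f x = g x"
proof -
  let ?h = "%x. indicator {0..T} x * f x - indicator {0..T} x * g x"
  have h: "integrable lebesgue ?h" using f g by (rule Bochner_Integration.integrable_diff)
  have sub: "integrable lebesgue (%x. indicator {a..b} x * u x)"
    if "integrable lebesgue (%x. indicator {0..T} x * u x)" "0 \<le> a" "b \<le> T" for a b and u :: "real => real"
  proof -
    have "(%x. indicator {a..b} x * u x) = (%x. indicator {a..b} x * (indicator {0..T} x * u x))"
      using that by (auto simp: indicator_def)
    then show ?thesis using integrable_mult_indicator[OF _ that(1), of "{a..b}"] by simp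
  qed
  have "AE x in lebesgue. ?h x = 0"
  proof (rule AE_zero_if_box_integrals_zero[OF h])
    fix a b :: real
    show "(LINT x|lebesgue. indicator (box a b) x * ?h x) = 0"
    proof (cases "max 0 a \<le> min T b")
      case False
      then have "(%x. indicator (box a b) x * ?h x) = (%x. 0)" by (auto simp: indicator_def)
      then show ?thesis by (simp only:) simp
    next
      case True
      let ?a = "max 0 a" and ?b = "min T b"
      have "(LINT x|lebesgue. indicator (box a b) x * ?h x)
        = (LINT x|lebesgue. indicator {?a..?b} x * f x - indicator {?a..?b} x * g x)"
      proof (rule integral_cong_AE)
        have "(%x. indicator (box a b) x * ?h x) = (%x. indicator (box a b) x *\<^sub>R ?h x)" by simp
        also have "\<dots> \<in> borel_measurable lebesgue"
          by (intro borel_measurable_integrable integrable_mult_indicator h) simp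
        finally show "(%x. indicator (box a b) x * ?h x) \<in> borel_measurable lebesgue" .
        show "(%x. indicator {?a..?b} x * f x - indicator {?a..?b} x * g x) \<in> borel_measurable lebesgue"
          using sub[OF f, of ?a ?b] sub[OF g, of ?a ?b]
          by (intro borel_measurable_diff borel_measurable_integrable) auto
        have "AE x in lebesgue. x \<noteq> a \<and> x \<noteq> b"
          using AE_lborel_singleton[of a] AE_lborel_singleton[of b] by (auto intro!: AE_completion)
        then show "AE x in lebesgue. indicator (box a b) x * ?h x = indicator {?a..?b} x * f x - indicator {?a..?b} x * g x"
          by eventually_elim (auto simp: indicator_def)
      qed
      also have "\<dots> = (LINT x|lebesgue. indicator {?a..?b} x * f x) - (LINT x|lebesgue. indicator {?a..?b} x * g x)"
        using sub[OF f, of ?a ?b] sub[OF g, of ?a ?b] by (intro Bochner_Integration.integral_diff) auto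
      also have "\<dots> = 0" using eq[of ?a ?b] True by simp
      finally show ?thesis .
    qed
  qed
  then show ?thesis by eventually_elim (auto simp: indicator_def)
qed

text \<open>Two densities of \<open>F\<close> agree almost everywhere, and the one from the
  Radon-Nikodym theorem is nonnegative.\<close>

lemma AE_nonneg_if_integral_mono:
  fixes f :: "real => real"
  assumes T: "0 < T"
    and f: "integrable lebesgue (%x. indicator {0..T} x * f x)"
    and mono: "!!a b. 0 \<le> a ==> a \<le> b ==> b \<le> T ==> F a \<le> F b"
    and lip: "!!a b. 0 \<le> a ==> a \<le> b ==> b \<le> T ==> F b - F a \<le> \<kappa> * (b - a)"
    and eq: "!!a b. 0 \<le> a ==> a \<le> b ==> b \<le> T ==> (LINT x|lebesgue. indicator {a..b} x * f x) = F b - F a"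
  shows "AE x in lebesgue. x \<in> {0..T} \<longrightarrow> 0 \<le> f x"
proof -
  obtain g where g: "g \<in> borel_measurable borel" "!!x. 0 \<le> g x" "integrable lborel g"
    "!!a b. 0 \<le> a ==> a \<le> b ==> b \<le> T ==> (LINT x|lborel. indicator {a..b} x * g x) = F b - F a"
    using lipschitz_mono_density[OF T mono lip] by blast
  have gi: "integrable lborel (%x. indicator {0..T} x * g x)"
    using integrable_mult_indicator[OF _ g(3), of "{0..T}"] by simp
  have "AE x in lebesgue. x \<in> {0..T} \<longrightarrow> f x = g x"
  proof (rule AE_eq_if_interval_integrals_eq[OF T f])
    show "integrable lebesgue (%x. indicator {0..T} x * g x)"
      using gi g(1) by (simp add: integrable_completion)
    show "(LINT x|lebesgue. indicator {a..b} x * f x) = (LINT x|lebesgue. indicator {a..b} x * g x)"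
      if "0 \<le> a" "a \<le> b" "b \<le> T" for a b
      using eq[OF that] g(4)[OF that] g(1) by (simp add: integral_completion)
  qed
  then show ?thesis by eventually_elim (use g(2) in auto)
qed

section \<open>Integrals against signed measures\<close>

lemma pos_variation_eq:
  fixes P Q :: "vec3 measure"
  assumes P: "finite_measure P" and Q: "finite_measure Q"
    and sets: "sets P = cl_borel \<Omega>" "sets Q = cl_borel \<Omega>"
    and \<sigma>: "!!B. B \<in> cl_borel \<Omega> ==> \<sigma> B = measure P B - measure Q B"
    and Y: "Y \<in> cl_borel \<Omega>" "!!X. X \<in> cl_borel \<Omega> ==> X \<subseteq> Y ==> measure Q X \<le> measure P X"
      "!!X. X \<in> cl_borel \<Omega> ==> X \<inter> Y = {} ==> measure P X \<le> measure Q X"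
  shows "finite_measure (pos_variation \<Omega> \<sigma>)" "sets (pos_variation \<Omega> \<sigma>) = cl_borel \<Omega>"
    "!!B. B \<in> cl_borel \<Omega> ==> measure (pos_variation \<Omega> \<sigma>) B = measure P (B \<inter> Y) - measure Q (B \<inter> Y)"
proof -
  interpret P: finite_measure P by fact
  interpret Q: finite_measure Q by fact
  let ?S = "cl_borel \<Omega>"
  have sp: "space P = closure \<Omega>" using sets_eq_imp_space_eq[OF sets(1)] by (simp add: space_restrict_space)
  let ?P = "density P (indicator Y)" and ?Q = "density Q (indicator Y)"
  have eP: "emeasure ?P B = emeasure P (B \<inter> Y)" if "B \<in> ?S" for B
    using that Y sets by (subst emeasure_density) (auto simp: nn_integral_set_ennreal indicator_inter_arith[symmetric] Int_commute)
  have eQ: "emeasure ?Q B = emeasure Q (B \<inter> Y)" if "B \<in> ?S" for B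
    using that Y sets by (subst emeasure_density) (auto simp: nn_integral_set_ennreal indicator_inter_arith[symmetric] Int_commute)
  have top: "closure \<Omega> \<in> ?S" using sets.top[of P] sets sp by simp
  have fP: "finite_measure ?P"
    by (rule finite_measureI) (use eP[OF top] sp in \<open>simp add: P.emeasure_eq_measure\<close>)
  have fQ: "finite_measure ?Q"
    by (rule finite_measureI) (use eQ[OF top] sets_eq_imp_space_eq[of Q P] sets sp in \<open>simp add: Q.emeasure_eq_measure\<close>)
  let ?D = "diff_measure ?P ?Q"
  have D: "emeasure ?D B = ennreal (measure P (B \<inter> Y) - measure Q (B \<inter> Y))" if "B \<in> ?S" for B
  proof -
    have "emeasure ?D B = emeasure ?P B - emeasure ?Q B"
    proof (rule emeasure_diff_measure)
      show "finite_measure ?P" "finite_measure ?Q" by (rule fP fQ)+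
      show "sets ?P = sets ?Q" using sets by simp
      show "emeasure ?Q A \<le> emeasure ?P A" if "A \<in> sets ?P" for A
        using that sets Y eP[of A] eQ[of A] by (auto simp: P.emeasure_eq_measure Q.emeasure_eq_measure intro!: ennreal_leI Y(2))
      show "B \<in> sets ?P" using that sets by simp
    qed
    then show ?thesis using that by (simp add: eP eQ P.emeasure_eq_measure Q.emeasure_eq_measure ennreal_minus)
  qed
  have nonneg: "0 \<le> measure P (B \<inter> Y) - measure Q (B \<inter> Y)" if "B \<in> ?S" for B
    using Y(2)[of "B \<inter> Y"] that Y(1) by auto
  \<comment> \<open>\<open>Y\<close> is a positive set for \<open>P - Q\<close>: removing from
    \<open>C\<close> the part outside \<open>Y\<close> and adding the rest of \<open>B\<close>
    inside \<open>Y\<close> never lowers the value. So the supremum is attained at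
    \<open>B \<inter> Y\<close>.\<close>
  have sup: "(SUP C\<in>{C \<in> ?S. C \<subseteq> B}. ennreal (\<sigma> C)) = ennreal (measure P (B \<inter> Y) - measure Q (B \<inter> Y))" if B: "B \<in> ?S" for B
  proof (rule antisym)
    show "(SUP C\<in>{C \<in> ?S. C \<subseteq> B}. ennreal (\<sigma> C)) \<le> ennreal (measure P (B \<inter> Y) - measure Q (B \<inter> Y))"
    proof (rule SUP_least)
      fix C assume "C \<in> {C \<in> ?S. C \<subseteq> B}"
      then have C: "C \<in> ?S" "C \<subseteq> B" by auto
      have m: "C \<inter> Y \<in> ?S" "C - Y \<in> ?S" "(B - C) \<inter> Y \<in> ?S" using C B Y by auto
      have e1: "measure P C = measure P (C \<inter> Y) + measure P (C - Y)" "measure Q C = measure Q (C \<inter> Y) + measure Q (C - Y)"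
        using m sets P.finite_measure_Union[of "C \<inter> Y" "C - Y"] Q.finite_measure_Union[of "C \<inter> Y" "C - Y"]
        by (auto simp: Int_Diff_Un Int_Diff_disjoint)
      have e2: "B \<inter> Y = (C \<inter> Y) \<union> ((B - C) \<inter> Y)" using C by auto
      have e3: "measure P (B \<inter> Y) = measure P (C \<inter> Y) + measure P ((B - C) \<inter> Y)" "measure Q (B \<inter> Y) = measure Q (C \<inter> Y) + measure Q ((B - C) \<inter> Y)"
        unfolding e2 using m sets by (auto intro!: P.finite_measure_Union Q.finite_measure_Union)
      have "measure P (C - Y) \<le> measure Q (C - Y)" using m by (intro Y(3)) auto
      moreover have "measure Q ((B - C) \<inter> Y) \<le> measure P ((B - C) \<inter> Y)" using m by (intro Y(2)) auto
      ultimately show "ennreal (\<sigma> C) \<le> ennreal (measure P (B \<inter> Y) - measure Q (B \<inter> Y))"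
        using e1 e3 C by (intro ennreal_leI) (simp add: \<sigma>)
    qed
    show "ennreal (measure P (B \<inter> Y) - measure Q (B \<inter> Y)) \<le> (SUP C\<in>{C \<in> ?S. C \<subseteq> B}. ennreal (\<sigma> C))"
      using B Y(1) by (intro SUP_upper2[of "B \<inter> Y"]) (auto simp: \<sigma>)
  qed
  have sub: "?S \<subseteq> Pow (closure \<Omega>)" using sets.space_closed[of P] sets sp by simp
  have sig: "sigma_sets (closure \<Omega>) ?S = ?S" using sets.sigma_sets_eq[of P] sets sp by simp
  \<comment> \<open>\<open>measure_of\<close> keeps a set function only if it is countably additive;
    this is supplied by identifying the supremum with a difference of two measures.\<close>
  have eq: "pos_variation \<Omega> \<sigma> = ?D"
  proof -
    have "pos_variation \<Omega> \<sigma> = measure_of (closure \<Omega>) ?S (emeasure ?D)"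
      unfolding pos_variation_def using sub sup D by (intro measure_of_eq) (auto simp: sig)
    also have "\<dots> = ?D" using measure_of_of_measure[of ?D] sets sp by simp
    finally show ?thesis .
  qed
  show "sets (pos_variation \<Omega> \<sigma>) = ?S" unfolding eq using sets by simp
  show "finite_measure (pos_variation \<Omega> \<sigma>)" unfolding eq
    by (rule finite_measureI) (use D[OF top] sp in simp)
  show "measure (pos_variation \<Omega> \<sigma>) B = measure P (B \<inter> Y) - measure Q (B \<inter> Y)" if "B \<in> ?S" for B
    unfolding eq measure_def[of ?D] using D[OF that] nonneg[OF that] by simp
qed

text \<open>The Jordan decomposition is only one way to write \<open>\<sigma>\<close> as a
  difference of finite measures. For any other, the four measures involved satisfy a linear relation
  on sets, seen by splitting each set along the Hahn set of \<open>P - Q\<close>, and this relation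
  passes to integrals.\<close>

lemma signed_int_diff:
  fixes P Q :: "vec3 measure"
  assumes P: "finite_measure P" and Q: "finite_measure Q"
    and sets: "sets P = cl_borel \<Omega>" "sets Q = cl_borel \<Omega>"
    and \<sigma>: "!!B. B \<in> cl_borel \<Omega> ==> \<sigma> B = measure P B - measure Q B"
    and f: "f \<in> borel_measurable borel" and bnd: "!!x. \<bar>f x\<bar> \<le> K"
  shows "signed_int \<Omega> \<sigma> f = integral\<^sup>L P f - integral\<^sup>L Q f"
proof -
  interpret P: finite_measure P by fact
  interpret Q: finite_measure Q by fact
  let ?S = "cl_borel \<Omega>"
  have sp: "space P = closure \<Omega>" using sets_eq_imp_space_eq[OF sets(1)] by (simp add: space_restrict_space)
  obtain Y where Y: "Y \<in> ?S" "!!X. X \<in> ?S ==> X \<subseteq> Y ==> measure Q X \<le> measure P X"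
      "!!X. X \<in> ?S ==> X \<inter> Y = {} ==> measure P X \<le> measure Q X"
    using finite_unsigned_Hahn_decomposition[OF P Q] sets
    by (auto simp: P.emeasure_eq_measure Q.emeasure_eq_measure)
  let ?Z = "closure \<Omega> - Y"
  have Z: "?Z \<in> ?S" using Y(1) sets.compl_sets[of Y P] sets sp by simp
  have sub: "X \<subseteq> closure \<Omega>" if "X \<in> ?S" for X using sets.sets_into_space[of X P] that sets sp by auto
  have V1: "finite_measure (pos_variation \<Omega> \<sigma>)" "sets (pos_variation \<Omega> \<sigma>) = ?S"
    "!!B. B \<in> ?S ==> measure (pos_variation \<Omega> \<sigma>) B = measure P (B \<inter> Y) - measure Q (B \<inter> Y)"
    by (rule pos_variation_eq[OF P Q sets \<sigma> Y]; assumption)+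
  have s: "- \<sigma> B = measure Q B - measure P B" if "B \<in> ?S" for B using \<sigma>[OF that] by simp
  have Z2: "measure P X \<le> measure Q X" if "X \<in> ?S" "X \<subseteq> ?Z" for X using Y(3)[OF that(1)] that(2) by auto
  have Z3: "measure Q X \<le> measure P X" if "X \<in> ?S" "X \<inter> ?Z = {}" for X
    using Y(2)[OF that(1)] that(2) sub[OF that(1)] by auto
  have V2: "finite_measure (pos_variation \<Omega> (%B. - \<sigma> B))" "sets (pos_variation \<Omega> (%B. - \<sigma> B)) = ?S"
    "!!B. B \<in> ?S ==> measure (pos_variation \<Omega> (%B. - \<sigma> B)) B = measure Q (B \<inter> ?Z) - measure P (B \<inter> ?Z)"
    by (rule pos_variation_eq[OF Q P sets(2,1) s Z Z2 Z3]; assumption)+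
  define M where "M i = (if i = (0::nat) then P else if i = 1 then Q else if i = 2 then pos_variation \<Omega> \<sigma> else pos_variation \<Omega> (%B. - \<sigma> B))" for i
  define w where "w i = (if i = (0::nat) \<or> i = 3 then 1 else - 1 :: real)" for i
  have I: "{..<4} = {0, 1, 2, 3::nat}" by auto
  have "(\<Sum>i<4. w i * integral\<^sup>L (M i) f) = 0"
  proof (rule signed_integral_zero[where N=P])
    show "finite_measure (M i)" for i using P Q V1(1) V2(1) by (simp add: M_def)
    show "sets (M i) = sets P" for i using sets V1(2) V2(2) by (simp add: M_def)
    show "f \<in> borel_measurable P"
      using measurable_restrict_space1[OF f, of "closure \<Omega>"] measurable_cong_sets[OF sets(1) refl, of borel] by auto
    fix A assume "A \<in> sets P"
    then have A: "A \<in> ?S" using sets by simp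
    have "A = (A \<inter> Y) \<union> (A \<inter> ?Z)" using sub[OF A] by auto
    moreover have "measure P ((A \<inter> Y) \<union> (A \<inter> ?Z)) = measure P (A \<inter> Y) + measure P (A \<inter> ?Z)"
      "measure Q ((A \<inter> Y) \<union> (A \<inter> ?Z)) = measure Q (A \<inter> Y) + measure Q (A \<inter> ?Z)"
      using A Y(1) Z sets by (auto intro!: P.finite_measure_Union Q.finite_measure_Union)
    ultimately have "measure P A = measure P (A \<inter> Y) + measure P (A \<inter> ?Z)"
      "measure Q A = measure Q (A \<inter> Y) + measure Q (A \<inter> ?Z)" by simp_all
    then show "(\<Sum>i<4. w i * measure (M i) A) = 0"
      using V1(3)[OF A] V2(3)[OF A] by (simp add: I M_def w_def)
  qed (use bnd in auto)
  then show ?thesis by (simp add: I M_def w_def signed_int_def)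
qed

section \<open>The cone of positive semi-definite matrices\<close>

lemma mat_inner: "(A :: real^'n^'m) \<bullet> B = (\<Sum>i\<in>UNIV. \<Sum>j\<in>UNIV. A $ i $ j * B $ i $ j)"
  by (simp add: inner_vec_def)

lemma transpose_add: "transpose (A + B) = transpose A + transpose (B :: 'a::ab_group_add^'n^'m)"
  by (simp add: transpose_def vec_eq_iff)
lemma transpose_diff: "transpose (A - B) = transpose A - transpose (B :: 'a::ab_group_add^'n^'m)"
  by (simp add: transpose_def vec_eq_iff)
lemma transpose_minus: "transpose (- B) = - transpose (B :: 'a::ab_group_add^'n^'m)"
  by (simp add: transpose_def vec_eq_iff)
lemma transpose_scaleR: "transpose (c *\<^sub>R A) = c *\<^sub>R transpose (A :: real^'n^'m)"
  by (simp add: transpose_def vec_eq_iff)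

lemma inner_transpose: "transpose A \<bullet> transpose B = A \<bullet> (B :: real^'n^'m)"
  by (simp add: mat_inner transpose_def) (rule sum.swap)

lemma inner_matrix_mult_left: "(A ** B) \<bullet> C = B \<bullet> (transpose A ** (C :: real^'n^'m))"
proof -
  have "(A ** B) \<bullet> C = (\<Sum>i\<in>UNIV. \<Sum>j\<in>UNIV. \<Sum>k\<in>UNIV. A $ i $ k * B $ k $ j * C $ i $ j)"
    by (simp add: mat_inner matrix_matrix_mult_def sum_distrib_right)
  also have "\<dots> = (\<Sum>k\<in>UNIV. \<Sum>j\<in>UNIV. \<Sum>i\<in>UNIV. A $ i $ k * B $ k $ j * C $ i $ j)"
  proof -
    let ?f = "%i j k. A $ i $ k * B $ k $ j * C $ i $ j"
    have "(\<Sum>i\<in>UNIV. \<Sum>j\<in>UNIV. \<Sum>k\<in>UNIV. ?f i j k) = (\<Sum>i\<in>UNIV. \<Sum>k\<in>UNIV. \<Sum>j\<in>UNIV. ?f i j k)"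
      by (rule sum.cong[OF refl], rule sum.swap)
    also have "\<dots> = (\<Sum>k\<in>UNIV. \<Sum>i\<in>UNIV. \<Sum>j\<in>UNIV. ?f i j k)" by (rule sum.swap)
    also have "\<dots> = (\<Sum>k\<in>UNIV. \<Sum>j\<in>UNIV. \<Sum>i\<in>UNIV. ?f i j k)"
      by (rule sum.cong[OF refl], rule sum.swap)
    finally show ?thesis .
  qed
  also have "\<dots> = B \<bullet> (transpose A ** C)"
    by (simp add: mat_inner matrix_matrix_mult_def transpose_def sum_distrib_left mult_ac)
  finally show ?thesis .
qed

lemma inner_matrix_mult_right: "(A ** B) \<bullet> C = A \<bullet> ((C :: real^'n^'m) ** transpose B)"
proof -
  have "(A ** B) \<bullet> C = transpose (A ** B) \<bullet> transpose C" by (simp add: inner_transpose)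
  also have "\<dots> = (transpose B ** transpose A) \<bullet> transpose C" by (simp add: matrix_transpose_mul)
  also have "\<dots> = transpose A \<bullet> (B ** transpose C)" by (simp add: inner_matrix_mult_left)
  also have "\<dots> = A \<bullet> (C ** transpose B)"
    using inner_transpose[of A "C ** transpose B"] by (simp add: matrix_transpose_mul)
  finally show ?thesis .
qed

lemma tensor_inner: "tensor a b \<bullet> A = a \<bullet> (A *v b)"
  by (simp add: mat_inner tensor_def inner_vec_def matrix_vector_mult_def sum_distrib_left mult_ac)

lemma norm_tensor: "norm (tensor a b) = norm a * norm b"
proof -
  have "(norm (tensor a b))\<^sup>2 = (\<Sum>i\<in>UNIV. \<Sum>j\<in>UNIV. (a $ i)\<^sup>2 * (b $ j)\<^sup>2)"
    unfolding power2_norm_eq_inner mat_inner tensor_def by (simp add: power2_eq_square mult_ac)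
  also have "\<dots> = (norm a)\<^sup>2 * (norm b)\<^sup>2"
    unfolding power2_norm_eq_inner inner_vec_def by (simp add: power2_eq_square sum_product)
  finally show ?thesis by (simp add: power_mult_distrib[symmetric])
qed

lemma norm_transpose: "norm (transpose A) = norm (A :: real^'n^'m)"
  by (simp add: norm_eq_sqrt_inner inner_transpose)

lemma norm_matrix_vector_le: "norm (A *v x) \<le> norm (A :: real^'n^'m) * norm x"
proof -
  have "(norm (A *v x))\<^sup>2 = (\<Sum>i\<in>UNIV. (A $ i \<bullet> x)\<^sup>2)"
    unfolding power2_norm_eq_inner inner_vec_def[of "A *v x"]
    by (simp add: matrix_vector_mult_def power2_eq_square inner_vec_def)
  also have "\<dots> \<le> (\<Sum>i\<in>UNIV. (norm (A $ i))\<^sup>2 * (norm x)\<^sup>2)"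
    by (intro sum_mono) (metis Cauchy_Schwarz_ineq2 abs_ge_zero power2_abs power_mono power_mult_distrib)
  also have "\<dots> = (norm A)\<^sup>2 * (norm x)\<^sup>2"
    unfolding sum_distrib_right[symmetric] power2_norm_eq_inner inner_vec_def[of A] by simp
  finally show ?thesis by (simp add: power_mult_distrib[symmetric] power2_le_iff_abs_le)
qed

lemma spectral_norm_le: "spectral_norm A \<le> norm A"
  unfolding spectral_norm_def by (rule onorm_bound) (auto simp: norm_matrix_vector_le)

lemma psd_iff: "psd A \<longleftrightarrow> transpose A = A \<and> (\<forall>\<xi>. 0 \<le> tensor \<xi> \<xi> \<bullet> A)"
  by (simp add: psd_def tensor_inner)

lemma psd_add: "psd A ==> psd B ==> psd (A + B)"
  by (auto simp: psd_iff transpose_add inner_add_right)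
lemma psd_scaleR: "0 \<le> c ==> psd A ==> psd (c *\<^sub>R A)"
  by (auto simp: psd_iff transpose_scaleR)
lemma psd_0: "psd 0" by (simp add: psd_iff transpose_def vec_eq_iff)
lemma psd_tensor: "psd (tensor \<xi> \<xi>)"
  unfolding psd_def
proof
  show "transpose (tensor \<xi> \<xi>) = tensor \<xi> \<xi>" by (simp add: transpose_def tensor_def vec_eq_iff)
  show "\<forall>\<eta>. 0 \<le> \<eta> \<bullet> (tensor \<xi> \<xi> *v \<eta>)"
  proof
    fix \<eta>
    have "tensor \<xi> \<xi> *v \<eta> = (\<xi> \<bullet> \<eta>) *\<^sub>R \<xi>"
      by (simp add: tensor_def matrix_vector_mult_def vec_eq_iff inner_vec_def sum_distrib_left mult_ac)
    then show "0 \<le> \<eta> \<bullet> (tensor \<xi> \<xi> *v \<eta>)" by (simp add: inner_commute)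
  qed
qed

lemma transpose_msym: "transpose (msym A) = msym A"
  by (simp add: msym_def transpose_def vec_eq_iff add.commute)
lemma msym_add: "msym (A + B) = msym A + msym B"
  by (simp add: msym_def transpose_add algebra_simps)
lemma msym_scaleR: "msym (c *\<^sub>R A) = c *\<^sub>R msym A"
  by (simp add: msym_def transpose_scaleR algebra_simps)
lemma msym_sym: "transpose A = A ==> msym A = A"
  by (simp add: msym_def scaleR_2[symmetric])
lemma linear_msym: "linear msym"
  by (intro linearI) (auto simp: msym_add msym_scaleR)
lemma bounded_linear_msym: "bounded_linear msym"
  using linear_msym by (simp add: linear_conv_bounded_linear)
lemma norm_msym_le: "norm (msym A) \<le> norm A"
  using norm_triangle_ineq[of A "transpose A"] by (simp add: msym_def norm_transpose)

section \<open>The closed convex cone and the projection onto it\<close>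

abbreviation psd_cone :: "mat3 set" where "psd_cone \<equiv> Collect psd"

lemma linear_transpose: "linear (transpose :: real^'n^'m => real^'m^'n)"
  by (intro linearI) (auto simp: transpose_add transpose_scaleR)

lemma closed_psd: "closed psd_cone"
proof -
  have "psd_cone = {A. transpose A = A} \<inter> (\<Inter>\<xi>. {A. 0 \<le> tensor \<xi> \<xi> \<bullet> A})"
    by (auto simp: psd_iff)
  moreover have "closed {A :: mat3. transpose A = A}"
    by (intro closed_Collect_eq continuous_intros linear_continuous_on)
       (simp add: linear_conv_bounded_linear[symmetric] linear_transpose)
  moreover have "closed {A. 0 \<le> tensor \<xi> \<xi> \<bullet> A}" for \<xi>
    by (intro closed_Collect_le continuous_intros)
  ultimately show ?thesis by (auto intro!: closed_Int closed_INT)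
qed

lemma convex_psd: "convex psd_cone"
  by (intro convexI) (auto intro: psd_add psd_scaleR)

lemma matrix_mult_add_left: "(A + B) ** C = A ** C + B ** (C :: real^'p^'n)"
  by (simp add: matrix_matrix_mult_def vec_eq_iff sum.distrib algebra_simps)
lemma matrix_mult_diff_left: "(A - B) ** C = A ** C - B ** (C :: real^'p^'n)"
  by (simp add: matrix_matrix_mult_def vec_eq_iff sum_subtractf algebra_simps)
lemma matrix_mult_diff_right: "C ** (A - B) = C ** A - C ** (B :: real^'p^'n)"
  by (simp add: matrix_matrix_mult_def vec_eq_iff sum_subtractf algebra_simps)
lemma matrix_mult_scaleR_left: "(c *\<^sub>R A) ** B = c *\<^sub>R (A ** (B :: real^'p^'n))"
  by (simp add: matrix_matrix_mult_def vec_eq_iff sum_distrib_left mult_ac)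
lemma matrix_mult_scaleR_right: "A ** (c *\<^sub>R B) = c *\<^sub>R (A ** (B :: real^'p^'n))"
  by (simp add: matrix_matrix_mult_def vec_eq_iff sum_distrib_left mult_ac)
lemmas matrix_mult_linear = matrix_mult_add_left matrix_add_ldistrib matrix_mult_diff_left matrix_mult_diff_right
  matrix_mult_scaleR_left matrix_mult_scaleR_right

lemma inner_matrix_vector: "x \<bullet> (A *v y) = (transpose A *v x) \<bullet> (y :: real^'n)"
  by (simp add: dot_lmul_matrix)

lemma psd_congruence: "psd P ==> psd (B ** P ** transpose B)"
proof -
  assume P: "psd P"
  have "\<xi> \<bullet> ((B ** P ** transpose B) *v \<xi>) = (transpose B *v \<xi>) \<bullet> (P *v (transpose B *v \<xi>))" for \<xi>
    by (simp add: matrix_vector_mul_assoc[symmetric] inner_matrix_vector[of \<xi>] del: transpose_matrix_vector)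
  then show ?thesis using P
    by (simp add: psd_def matrix_transpose_mul matrix_mul_assoc)
qed

text \<open>The positive part is obtained here by projection instead of diagonalisation;
  \<open>neg_part_eq\<close> shows that it fits the algebraic description by which
  \<open>neg_part\<close> is defined.\<close>

definition psd_part :: "mat3 => mat3" where
  "psd_part A = closest_point psd_cone (msym A)"

lemma psd_part_psd: "psd (psd_part A)"
  using closest_point_exists(1)[OF closed_psd, of "msym A"] psd_0 by (auto simp: psd_part_def)

lemma psd_part_optimal: "psd Q ==> (msym A - psd_part A) \<bullet> (Q - psd_part A) \<le> 0"
  using closest_point_dot[OF convex_psd closed_psd, of Q "msym A"] by (auto simp: psd_part_def)

text \<open>Since the set is a cone, it contains 0 and twice the projection; the variational
  inequality of the nearest point at these two matrices gives both signs.\<close>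

lemma psd_part_orth: "(msym A - psd_part A) \<bullet> psd_part A = 0"
proof -
  have "psd (2 *\<^sub>R psd_part A)" "psd (0 *\<^sub>R psd_part A)"
    by (auto intro!: psd_scaleR psd_part_psd simp del: scaleR_zero_left)
  from this[THEN psd_part_optimal[of _ A]] show ?thesis
    by (auto simp: inner_diff_right scaleR_2 inner_add_right)
qed

lemma psd_part_polar: "psd Q ==> (msym A - psd_part A) \<bullet> Q \<le> 0"
  using psd_part_optimal[of Q A] psd_part_orth[of A] by (simp add: inner_diff_right)

lemma neg_residual_psd: "psd (- (msym A - psd_part A))"
  unfolding psd_iff
proof
  show "transpose (- (msym A - psd_part A)) = - (msym A - psd_part A)"
    using psd_part_psd[of A] by (simp add: transpose_minus transpose_diff transpose_msym psd_def)
  show "\<forall>\<xi>. 0 \<le> tensor \<xi> \<xi> \<bullet> - (msym A - psd_part A)"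
  proof
    fix \<xi>
    show "0 \<le> tensor \<xi> \<xi> \<bullet> - (msym A - psd_part A)"
      using psd_part_polar[OF psd_tensor, of A \<xi>]
      by (simp add: inner_commute[of "tensor \<xi> \<xi>"] inner_diff_left)
  qed
qed

text \<open>Varying \<open>P = psd_part A\<close> along the congruences \<open>(I + tB) P (I + tB)\<^sup>T\<close> within the cone.\<close>

lemma residual_mult_psd_part: "(msym A - psd_part A) ** psd_part A = 0"
proof -
  let ?N = "msym A - psd_part A" and ?P = "psd_part A"
  have symP: "transpose ?P = ?P" using psd_part_psd[of A] by (simp add: psd_def)
  have symN: "transpose ?N = ?N" by (simp add: transpose_diff transpose_msym symP)
  have zero: "?N \<bullet> (B ** ?P) = 0" for B
  proof -
    have ineq: "2 * t * (?N \<bullet> (B ** ?P)) + t\<^sup>2 * (?N \<bullet> (B ** ?P ** transpose B)) \<le> 0" for t :: real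
    proof -
      let ?C = "mat 1 + t *\<^sub>R B"
      have e: "?C ** ?P ** transpose ?C = ?P + t *\<^sub>R (B ** ?P) + t *\<^sub>R transpose (B ** ?P) + t\<^sup>2 *\<^sub>R (B ** ?P ** transpose B)"
        by (simp add: transpose_add transpose_scaleR matrix_mult_linear matrix_transpose_mul
            symP power2_eq_square matrix_mul_assoc scaleR_add_right)
      have "?N \<bullet> (?C ** ?P ** transpose ?C) \<le> 0"
        by (rule psd_part_polar[OF psd_congruence[OF psd_part_psd]])
      moreover have "?N \<bullet> transpose (B ** ?P) = ?N \<bullet> (B ** ?P)"
        using inner_transpose[of ?N "B ** ?P"] symN by simp
      ultimately show ?thesis using psd_part_orth[of A] by (simp add: e inner_add_right)
    qed
    define a b where "a = ?N \<bullet> (B ** ?P)" and "b = ?N \<bullet> (B ** ?P ** transpose B)"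
    have q: "2 * t * a + t\<^sup>2 * b \<le> 0" for t using ineq[of t] by (simp add: a_def b_def)
    have "a = 0"
    proof (rule ccontr)
      assume "a \<noteq> 0"
      \<comment> \<open>This step size makes the linear term dominate the quadratic one, whatever
        the signs of \<open>a\<close> and \<open>b\<close>.\<close>
      define t where "t = a / (\<bar>b\<bar> + 1)"
      have "a = t * (\<bar>b\<bar> + 1)" by (simp add: t_def)
      then have "2 * t * a + t\<^sup>2 * b = 2 * t * (t * (\<bar>b\<bar> + 1)) + t\<^sup>2 * b" by (simp only:)
      also have "\<dots> = t\<^sup>2 * (2 * (\<bar>b\<bar> + 1) + b)" by (simp add: power2_eq_square algebra_simps)
      also have "\<dots> > 0" using \<open>a \<noteq> 0\<close> by (intro mult_pos_pos) (auto simp: t_def)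
      finally show False using q[of t] by simp
    qed
    then show ?thesis by (simp add: a_def)
  qed
  \<comment> \<open>Choosing \<open>B\<close> as the product of residual and projection turns the
    vanishing pairing into the squared norm of that product.\<close>
  have "(?N ** ?P) \<bullet> (?N ** ?P) = 0"
    using inner_matrix_mult_right[of ?N ?P "?N ** ?P"] zero[of "?N ** ?P"] unfolding symP by (simp only:)
  then show ?thesis by simp
qed

text \<open>\<open>x\<close> minimises the quadratic form, so the gradient \<open>M *v x\<close>
  vanishes there. The proof tests along the line \<open>x + t M x\<close>.\<close>

lemma psd_quadratic_zero:
  assumes "psd M" "x \<bullet> (M *v x) = 0"
  shows "M *v x = 0"
proof -
  have sym: "y \<bullet> (M *v z) = z \<bullet> (M *v y)" for y z
    using assms(1) inner_matrix_vector[of y M z] by (simp add: psd_def inner_commute del: transpose_matrix_vector)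
  define y where "y = M *v x"
  define b where "b = y \<bullet> (M *v y)"
  have q: "2 * t * (y \<bullet> y) + t\<^sup>2 * b \<ge> 0" for t :: real
  proof -
    have "0 \<le> (x + t *\<^sub>R y) \<bullet> (M *v (x + t *\<^sub>R y))" using assms(1) by (simp add: psd_def)
    also have "\<dots> = 2 * t * (y \<bullet> y) + t\<^sup>2 * b"
      using assms(2) sym[of x y]
      by (simp add: matrix_vector_right_distrib matrix_vector_mult_scaleR inner_add_left inner_add_right
        b_def y_def power2_eq_square algebra_simps)
    finally show ?thesis .
  qed
  have "y \<bullet> y = 0"
  proof (rule ccontr)
    assume n: "y \<bullet> y \<noteq> 0"
    have b: "b \<ge> 0" using assms(1) by (simp add: b_def psd_def)
    define t where "t = - (y \<bullet> y) / (b + 1)"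
    have "y \<bullet> y = - t * (b + 1)" using b by (simp add: t_def field_simps)
    then have "2 * t * (y \<bullet> y) + t\<^sup>2 * b = 2 * t * (- t * (b + 1)) + t\<^sup>2 * b" by (simp only:)
    also have "\<dots> = - (t\<^sup>2 * (b + 2))" by (simp add: power2_eq_square algebra_simps)
    finally have "2 * t * (y \<bullet> y) + t\<^sup>2 * b = - (t\<^sup>2 * (b + 2))" .
    moreover have "t\<^sup>2 * (b + 2) > 0" using n b by (intro mult_pos_pos) (auto simp: t_def)
    ultimately show False using q[of t] by simp
  qed
  then show ?thesis by (simp add: y_def)
qed

text \<open>The projection \<open>P\<close> of \<open>N\<close> onto the cone is 0. On the range of
  \<open>P\<close> the matrices \<open>N\<close> and \<open>P\<close> agree because
  \<open>(N - P) ** P = 0\<close>, and one is nonpositive while the other is nonnegative, so the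
  quadratic form of \<open>P\<close> vanishes there. The polar inequality of the projection is then
  the claim.\<close>

lemma psd_polar:
  assumes N: "psd (- N)" and Q: "psd Q"
  shows "N \<bullet> Q \<le> 0"
proof -
  let ?P = "psd_part N"
  have t: "transpose N = N" using N by (simp add: psd_def transpose_minus)
  have sP: "transpose ?P = ?P" using psd_part_psd[of N] by (simp add: psd_def)
  have "?P *v y = 0" for y
  proof -
    let ?x = "?P *v y"
    have "(N - ?P) *v ?x = 0" using residual_mult_psd_part[of N] by (simp add: matrix_vector_mul_assoc msym_sym[OF t])
    then have "?x \<bullet> (?P *v ?x) = ?x \<bullet> (N *v ?x)" by (simp add: matrix_vector_mult_diff_rdistrib)
    also have "\<dots> \<le> 0" using spec[OF conjunct2[OF N[unfolded psd_def]], of ?x] matrix_vector_mult_diff_rdistrib[of 0 N ?x] by simp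
    finally have "?x \<bullet> (?P *v ?x) = 0" using psd_part_psd[of N] by (simp add: psd_def antisym)
    then have "?P *v ?x = 0" by (rule psd_quadratic_zero[OF psd_part_psd])
    then have "?x \<bullet> ?x = 0" using inner_matrix_vector[of y ?P ?x] sP by simp
    then show ?thesis by simp
  qed
  then have "?P = 0" by (simp add: matrix_eq)
  then show ?thesis using psd_part_polar[OF Q, of N] msym_sym[OF t] by simp
qed

lemma neg_part_eq: "neg_part A = msym A - psd_part A"
  unfolding neg_part_def
proof (rule the_equality)
  let ?N = "msym A - psd_part A"
  show "psd (- ?N) \<and> psd (msym A - ?N) \<and> ?N ** (msym A - ?N) = 0"
    using neg_residual_psd[of A] psd_part_psd[of A] residual_mult_psd_part[of A] by simp
  fix N assume N: "psd (- N) \<and> psd (msym A - N) \<and> N ** (msym A - N) = 0"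
  let ?P = "msym A - N"
  have "N \<bullet> ?P = mat 1 \<bullet> (N ** ?P)" using inner_matrix_mult_left[of N "mat 1" ?P] N by (simp add: psd_def transpose_minus)
  then have o: "N \<bullet> ?P = 0" using N by simp
  have "dist (msym A) ?P \<le> dist (msym A) Q" if Q: "psd Q" for Q
  proof (rule power2_le_imp_le)
    have e: "msym A - Q = N + (?P - Q)" by simp
    have "(norm (N + R))\<^sup>2 = (norm N)\<^sup>2 + 2 * (N \<bullet> R) + (norm R)\<^sup>2" for R
      unfolding power2_norm_eq_inner by (simp only: inner_add_left inner_add_right inner_commute[of R N])
    note this[of "?P - Q"]
    moreover have "N \<bullet> (?P - Q) \<ge> 0" using psd_polar[OF conjunct1[OF N] Q] o unfolding inner_diff_right[of N ?P Q] by linarith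
    ultimately have "(norm N)\<^sup>2 \<le> (norm (N + (?P - Q)))\<^sup>2" using zero_le_power2[of "norm (?P - Q)"] by linarith
    moreover have "msym A - ?P = N" by simp
    ultimately show "(dist (msym A) ?P)\<^sup>2 \<le> (dist (msym A) Q)\<^sup>2" unfolding dist_norm e by (simp only:)
  qed simp
  then have "?P = psd_part A"
    unfolding psd_part_def using N by (intro closest_point_unique[OF convex_psd closed_psd]) auto
  moreover have "N = msym A - ?P" by simp
  ultimately show "N = ?N" by (simp only:)
qed

text \<open>This is the Frobenius distance of \<open>msym A\<close> from the cone, hence sublinear
  in \<open>A\<close>. It bounds the spectral norm that enters the weight.\<close>

definition psd_dist :: "mat3 => real" where
  "psd_dist A = norm (neg_part A)"

lemma psd_dist_le: "psd Q ==> psd_dist A \<le> norm (msym A - Q)"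
  using closest_point_le[OF closed_psd, of Q "msym A"]
  by (simp add: psd_dist_def neg_part_eq psd_part_def dist_norm)

lemma psd_dist_nonneg: "0 \<le> psd_dist A" by (simp add: psd_dist_def)

lemma psd_dist_add: "psd_dist (A + B) \<le> psd_dist A + psd_dist B"
proof -
  have "psd_dist (A + B) \<le> norm (msym (A + B) - (psd_part A + psd_part B))"
    by (intro psd_dist_le psd_add psd_part_psd)
  also have "\<dots> = norm ((msym A - psd_part A) + (msym B - psd_part B))" by (simp add: msym_add algebra_simps)
  also have "\<dots> \<le> psd_dist A + psd_dist B"
    unfolding psd_dist_def neg_part_eq by (rule norm_triangle_ineq)
  finally show ?thesis .
qed

lemma psd_dist_scaleR_le: "0 \<le> c ==> psd_dist (c *\<^sub>R A) \<le> c * psd_dist A"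
proof -
  assume c: "0 \<le> c"
  have "psd_dist (c *\<^sub>R A) \<le> norm (msym (c *\<^sub>R A) - c *\<^sub>R psd_part A)"
    by (intro psd_dist_le psd_scaleR psd_part_psd c)
  also have "\<dots> = norm (c *\<^sub>R (msym A - psd_part A))" by (simp add: msym_scaleR algebra_simps)
  finally show ?thesis using c by (simp add: psd_dist_def neg_part_eq)
qed

lemma psd_dist_scaleR: "0 \<le> c ==> psd_dist (c *\<^sub>R A) = c * psd_dist A"
proof (cases "c = 0")
  case True
  then show ?thesis using psd_dist_le[OF psd_0, of 0] psd_dist_nonneg[of 0]
    by (simp add: msym_def transpose_def zero_vec_def[symmetric])
next
  case False
  assume "0 \<le> c"
  with False have c: "c > 0" by simp
  have "psd_dist A = psd_dist ((1/c) *\<^sub>R (c *\<^sub>R A))" using c by simp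
  also have "\<dots> \<le> (1/c) * psd_dist (c *\<^sub>R A)" using c by (intro psd_dist_scaleR_le) auto
  finally show ?thesis using psd_dist_scaleR_le[of c A] c by (simp add: field_simps)
qed

lemma psd_dist_psd: "psd A ==> psd_dist A = 0"
  using psd_dist_le[of A A] psd_dist_nonneg[of A] msym_sym[of A] by (simp add: psd_def)

lemma psd_dist_le_norm: "psd_dist A \<le> norm A"
  using psd_dist_le[OF psd_0, of A] norm_msym_le[of A] by simp

lemma psd_dist_msym: "psd_dist (msym A) = psd_dist A"
  by (simp add: psd_dist_def neg_part_eq psd_part_def msym_sym[OF transpose_msym])

lemma continuous_neg_part: "continuous_on UNIV neg_part"
proof -
  have m: "continuous_on UNIV msym" using bounded_linear_msym by (rule linear_continuous_on)
  have "continuous_on UNIV (%A. closest_point psd_cone (msym A))"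
    by (rule continuous_on_compose2[OF continuous_on_closest_point[OF convex_psd closed_psd] m])
       (use psd_0 in auto)
  then have "continuous_on UNIV (%A. msym A - closest_point psd_cone (msym A))"
    by (intro continuous_intros m)
  then show ?thesis by (simp add: neg_part_eq[abs_def] psd_part_def)
qed

section \<open>A measurable Hahn--Banach theorem\<close>

text \<open>Pairs \<open>(x, f)\<close> of a vector and the prescribed value \<open>f t\<close> at \<open>x\<close> of a functional depending measurably
  on a parameter \<open>t\<close>. Only rational combinations occur, so that the infimum in the Hahn--Banach extension
  step is countable and hence measurable in \<open>t\<close>.\<close>

definition rational_graph :: "'t measure => ('v::real_vector \<times> ('t => real)) set => bool" where
  "rational_graph M S \<longleftrightarrow> countable S \<and> (0, %t. 0) \<in> S \<and> (\<forall>(x, f)\<in>S. f \<in> borel_measurable M) \<and>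
     (\<forall>(x, f)\<in>S. \<forall>(y, g)\<in>S. (x + y, %t. f t + g t) \<in> S) \<and>
     (\<forall>(x, f)\<in>S. \<forall>q\<in>\<rat>. (q *\<^sub>R x, %t. q * f t) \<in> S)"

definition adjoin :: "('v::real_vector \<times> ('t => real)) set => 'v => ('t => real) => ('v \<times> ('t => real)) set" where
  "adjoin S a c = (%((x, f), q). (x + q *\<^sub>R a, %t. f t + q * c t)) ` (S \<times> \<rat>)"

definition below :: "('t => 'v => real) => ('v \<times> ('t => real)) set => bool" where
  "below p S \<longleftrightarrow> (\<forall>(x, f)\<in>S. \<forall>t. f t \<le> p t x)"

lemma adjoinI: "(x, f) \<in> S ==> q \<in> \<rat> ==> (x + q *\<^sub>R a, %t. f t + q * c t) \<in> adjoin S a c"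
  unfolding adjoin_def by (rule image_eqI[of _ _ "((x, f), q)"]) auto

lemma subset_adjoin: "S \<subseteq> adjoin S a c"
proof
  fix z assume "z \<in> S"
  then show "z \<in> adjoin S a c" using adjoinI[of "fst z" "snd z" S 0 a c] by simp
qed

lemma mem_adjoin: "rational_graph M S ==> (a, c) \<in> adjoin S a c"
  using adjoinI[of 0 "%t. 0" S 1 a c] by (simp add: rational_graph_def)

lemma adjoinE:
  assumes "z \<in> adjoin S a c"
  obtains x f q where "(x, f) \<in> S" "q \<in> \<rat>" "z = (x + q *\<^sub>R a, %t. f t + q * c t)"
  using assms by (auto simp: adjoin_def)

lemma rational_graph_adjoin:
  assumes S: "rational_graph M S" and c: "c \<in> borel_measurable M"
  shows "rational_graph M (adjoin S a c)"
  unfolding rational_graph_def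
proof (intro conjI ballI)
  show "countable (adjoin S a c)"
    unfolding adjoin_def using S by (auto simp: rational_graph_def intro!: countable_rat)
  show "(0, %t. 0) \<in> adjoin S a c" using S subset_adjoin[of S a c] by (auto simp: rational_graph_def)
next
  fix z assume z: "z \<in> adjoin S a c"
  then obtain x f q where f: "(x, f) \<in> S" "q \<in> \<rat>" "z = (x + q *\<^sub>R a, %t. f t + q * c t)" by (rule adjoinE)
  have fm: "f \<in> borel_measurable M" using S f by (auto simp: rational_graph_def)
  show "case z of (x, f) => f \<in> borel_measurable M" using fm c by (simp add: f)
  show "case z of (x, f) => \<forall>(y, g)\<in>adjoin S a c. (x + y, %t. f t + g t) \<in> adjoin S a c"
  proof -
    have "(x + q *\<^sub>R a + fst z', %t. f t + q * c t + snd z' t) \<in> adjoin S a c" if z': "z' \<in> adjoin S a c" for z'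
    proof -
      obtain y g r where g: "(y, g) \<in> S" "r \<in> \<rat>" "z' = (y + r *\<^sub>R a, %t. g t + r * c t)" using z' by (rule adjoinE)
      have "(x + y, %t. f t + g t) \<in> S" using S f g by (fastforce simp: rational_graph_def)
      from adjoinI[OF this, of "q + r" a c] show ?thesis
        using f g by (simp add: algebra_simps Rats_add)
    qed
    then show ?thesis by (auto simp: f)
  qed
  show "case z of (x, f) => \<forall>q\<in>\<rat>. (q *\<^sub>R x, %t. q * f t) \<in> adjoin S a c"
  proof -
    have "(r *\<^sub>R (x + q *\<^sub>R a), %t. r * (f t + q * c t)) \<in> adjoin S a c" if r: "r \<in> \<rat>" for r
    proof -
      have "(r *\<^sub>R x, %t. r * f t) \<in> S" using S f r by (fastforce simp: rational_graph_def)
      from adjoinI[OF this, of "r * q" a c] show ?thesis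
        using f r by (simp add: algebra_simps Rats_mult)
    qed
    then show ?thesis by (auto simp: f)
  qed
qed

lemma rational_graph_Union:
  assumes S: "!!n::nat. rational_graph M (S n)" and inc: "!!n. S n \<subseteq> S (Suc n)"
  shows "rational_graph M (\<Union>n. S n)"
proof -
  have mono: "S m \<subseteq> S n" if "m \<le> n" for m n using lift_Suc_mono_le[of S, OF inc that] .
  show ?thesis
    unfolding rational_graph_def
  proof (intro conjI ballI)
    show "countable (\<Union>n. S n)" using S by (auto simp: rational_graph_def)
    show "(0, %t. 0) \<in> (\<Union>n. S n)" using S by (auto simp: rational_graph_def)
    fix z assume "z \<in> (\<Union>n. S n)"
    then obtain n where z: "z \<in> S n" by auto
    show "case z of (x, f) => f \<in> borel_measurable M" using z S[of n] by (auto simp: rational_graph_def)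
    have "(fst z + fst z', %t. snd z t + snd z' t) \<in> (\<Union>n. S n)" if "z' \<in> (\<Union>n. S n)" for z'
    proof -
      obtain m where z': "z' \<in> S m" using \<open>z' \<in> _\<close> by auto
      then have "z \<in> S (max m n)" "z' \<in> S (max m n)" using z mono[of n "max m n"] mono[of m "max m n"] by auto
      then have "(fst z + fst z', %t. snd z t + snd z' t) \<in> S (max m n)"
        using S[of "max m n"] unfolding rational_graph_def by (cases z; cases z'; fastforce)
      then show ?thesis by blast
    qed
    then show "case z of (x, f) => \<forall>(y, g)\<in>\<Union>n. S n. (x + y, %t. f t + g t) \<in> (\<Union>n. S n)"
      by (cases z) force
    show "case z of (x, f) => \<forall>q\<in>\<rat>. (q *\<^sub>R x, %t. q * f t) \<in> (\<Union>n. S n)"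
      using z S[of n] unfolding rational_graph_def by (cases z) fastforce
  qed
qed

locale sublinear_family =
  fixes M :: "'t measure" and p :: "'t => 'v::real_normed_vector => real" and C :: "'t => real"
  assumes sub: "p t (x + y) \<le> p t x + p t y"
    and hom: "0 \<le> c ==> p t (c *\<^sub>R x) = c * p t x"
    and bound: "p t x \<le> C t * norm x" and C_nonneg: "0 \<le> C t"
    and meas: "(%t. p t x) \<in> borel_measurable M"
begin

text \<open>The largest value at \<open>a\<close> that keeps the extension below \<open>p\<close>. A
  fixed extremal choice, being an infimum over a countable set, is measurable in \<open>t\<close>;
  an arbitrary value from the admissible interval need not be.\<close>

definition ext_value :: "('v \<times> ('t => real)) set => 'v => 't => real" where
  "ext_value S a t = (INF z\<in>S. p t (fst z + a) - snd z t)"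

lemma ext_value_bdd:
  assumes "below p S"
  shows "bdd_below ((%z. p t (fst z + a) - snd z t) ` S)"
proof (rule bdd_belowI2)
  fix z assume "z \<in> S"
  then have "snd z t \<le> p t (fst z)" using assms by (auto simp: below_def)
  also have "\<dots> \<le> p t (fst z + a) + p t (- a)" using sub[of t "fst z + a" "- a"] by simp
  finally show "- p t (- a) \<le> p t (fst z + a) - snd z t" by simp
qed

lemma ext_value_measurable:
  assumes S: "rational_graph M S" and b: "below p S"
  shows "ext_value S a \<in> borel_measurable M"
  unfolding ext_value_def
proof (rule borel_measurable_cINF)
  show "countable S" using S by (simp add: rational_graph_def)
  show "(%t. p t (fst z + a) - snd z t) \<in> borel_measurable M" if "z \<in> S" for z
  proof (intro borel_measurable_diff meas)
    show "snd z \<in> borel_measurable M" using S that by (auto simp: rational_graph_def)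
  qed
  show "bdd_below ((%z. p t (fst z + a) - snd z t) ` S)" for t by (rule ext_value_bdd[OF b])
qed

lemma below_adjoin:
  assumes S: "rational_graph M S" and b: "below p S"
  shows "below p (adjoin S a (ext_value S a))"
  unfolding below_def
proof (clarify elim!: adjoinE)
  fix x f t and q :: real assume xf: "(x, f) \<in> S" and q: "q \<in> \<rat>"
  let ?c = "ext_value S a t"
  have scl: "(r *\<^sub>R x, %t. r * f t) \<in> S" if "r \<in> \<rat>" for r using S xf that by (fastforce simp: rational_graph_def)
  have fp: "f t \<le> p t x" using b xf by (auto simp: below_def)
  consider "q = 0" | "q > 0" | "q < 0" by linarith
  then show "f t + q * ?c \<le> p t (x + q *\<^sub>R a)"
  proof cases
    case 1 then show ?thesis using fp by simp
  next
    case 2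
    have "?c \<le> p t (inverse q *\<^sub>R x + a) - inverse q * f t"
      unfolding ext_value_def
      using cINF_lower[OF ext_value_bdd[OF b] scl[of "inverse q"]] q by simp
    then have "q * ?c \<le> q * p t (inverse q *\<^sub>R x + a) - f t"
      using 2 by (simp add: field_simps)
    also have "q * p t (inverse q *\<^sub>R x + a) = p t (q *\<^sub>R (inverse q *\<^sub>R x + a))" using 2 by (simp add: hom)
    also have "q *\<^sub>R (inverse q *\<^sub>R x + a) = x + q *\<^sub>R a" using 2 by (simp add: scaleR_add_right)
    finally show ?thesis by simp
  next
    \<comment> \<open>For a negative coefficient the claim is a lower bound on \<open>c\<close>. It
      holds because every such lower bound lies below every term of the infimum that defines
      \<open>c\<close>.\<close>
    case 3
    define r where "r = - q"
    have r: "r > 0" "r \<in> \<rat>" using 3 q by (auto simp: r_def)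
    have "inverse r * f t - p t (inverse r *\<^sub>R x - a) \<le> ?c"
      unfolding ext_value_def
    proof (rule cINF_greatest)
      show "S \<noteq> {}" using xf by auto
      fix z assume z: "z \<in> S"
      have "(fst z + inverse r *\<^sub>R x, %t. snd z t + inverse r * f t) \<in> S"
        using S z scl[of "inverse r"] r unfolding rational_graph_def by (cases z) fastforce
      then have "snd z t + inverse r * f t \<le> p t (fst z + inverse r *\<^sub>R x)" using b by (auto simp: below_def)
      also have "\<dots> \<le> p t (fst z + a) + p t (inverse r *\<^sub>R x - a)"
        using sub[of t "fst z + a" "inverse r *\<^sub>R x - a"] by simp
      finally show "inverse r * f t - p t (inverse r *\<^sub>R x - a) \<le> p t (fst z + a) - snd z t" by simp
    qed
    then have "f t - r * p t (inverse r *\<^sub>R x - a) \<le> r * ?c" using r by (simp add: field_simps)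
    moreover have "r * p t (inverse r *\<^sub>R x - a) = p t (r *\<^sub>R (inverse r *\<^sub>R x - a))" using r by (simp add: hom)
    moreover have "r *\<^sub>R (inverse r *\<^sub>R x - a) = x + q *\<^sub>R a" using r by (simp add: scaleR_diff_right r_def)
    ultimately show ?thesis by (simp add: r_def)
  qed
qed

text \<open>Only countably many extension steps are made: by the prescribed pairs
  \<open>(G j, l j)\<close>, then by the dense sequence \<open>a\<close>. The domination
  \<open>base\<close> is asked for rational coefficients only, since these are countably many
  conditions and so can be arranged to hold at one common set of times.\<close>

theorem measurable_hahn_banach:
  fixes G a :: "nat => 'v" and l :: "nat => 't => real" and X :: "'v set"
  assumes l: "!!j. l j \<in> borel_measurable M"
    and base: "!!t (n::nat) q. (!!j. q j \<in> \<rat>) ==> (\<Sum>j<n. q j * l j t) \<le> p t (\<Sum>j<n. q j *\<^sub>R G j)"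
    and X: "subspace X" and dense: "!!x e. x \<in> X ==> 0 < e ==> \<exists>k. norm (x - a k) < e"
  obtains \<Lambda> where "!!x. x \<in> X ==> (%t. \<Lambda> t x) \<in> borel_measurable M"
    "!!t x y. x \<in> X ==> y \<in> X ==> \<Lambda> t (x + y) = \<Lambda> t x + \<Lambda> t y"
    "!!t x c. x \<in> X ==> \<Lambda> t (c *\<^sub>R x) = c * \<Lambda> t x"
    "!!t x. x \<in> X ==> \<Lambda> t x \<le> p t x"
    "!!t j. G j \<in> X ==> \<Lambda> t (G j) = l j t"
proof -
  \<comment> \<open>Linear dependencies among the \<open>G j\<close> may put one vector into the
    graph with several prescribed functions, so a relation is built. Domination by \<open>p\<close>,
    which is 0 at 0, applied to differences of pairs forces these values to agree.\<close>
  define B where "B = rec_nat {(0, %t::'t. 0::real)} (%n S. adjoin S (G n) (l n))"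
  have B0: "B 0 = {(0, %t. 0)}" and BS: "B (Suc n) = adjoin (B n) (G n) (l n)" for n by (simp_all add: B_def)
  have Bg: "rational_graph M (B n)" for n
  proof (induction n)
    case 0 show ?case by (simp add: B0 rational_graph_def)
  next
    case (Suc n) then show ?case unfolding BS by (intro rational_graph_adjoin l)
  qed
  have Brep: "\<exists>q. (\<forall>j. q j \<in> \<rat>) \<and> z = (\<Sum>j<n. q j *\<^sub>R G j, %t. \<Sum>j<n. q j * l j t)" if "z \<in> B n" for n z
    using that
  proof (induction n arbitrary: z)
    case 0 then show ?case by (intro exI[of _ "%_. 0"]) (simp add: B0)
  next
    case (Suc n)
    then obtain x f r where z: "(x, f) \<in> B n" "r \<in> \<rat>" "z = (x + r *\<^sub>R G n, %t. f t + r * l n t)"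
      unfolding BS by (auto elim: adjoinE)
    from Suc.IH[OF z(1)] obtain q where q: "\<forall>j. q j \<in> \<rat>" "x = (\<Sum>j<n. q j *\<^sub>R G j)" "f = (%t. \<Sum>j<n. q j * l j t)" by auto
    show ?case using q z by (intro exI[of _ "q(n := r)"]) auto
  qed
  define S0 where "S0 = (\<Union>n. B n)"
  have S0g: "rational_graph M S0" unfolding S0_def
    by (rule rational_graph_Union[OF Bg]) (simp add: BS subset_adjoin)
  have S0b: "below p S0"
    unfolding below_def
  proof clarify
    fix x f t assume "(x, f) \<in> S0"
    then obtain n where "(x, f) \<in> B n" by (auto simp: S0_def)
    from Brep[OF this] obtain q where "\<forall>j. q j \<in> \<rat>" "x = (\<Sum>j<n. q j *\<^sub>R G j)" "f = (%t. \<Sum>j<n. q j * l j t)" by auto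
    then show "f t \<le> p t x" using base[of q t n] by simp
  qed
  define U where "U = rec_nat S0 (%n S. adjoin S (a n) (ext_value S (a n)))"
  have U0: "U 0 = S0" and US: "U (Suc n) = adjoin (U n) (a n) (ext_value (U n) (a n))" for n by (simp_all add: U_def)
  have Ug: "rational_graph M (U n) \<and> below p (U n)" for n
  proof (induction n)
    case 0 show ?case using S0g S0b by (simp add: U0)
  next
    case (Suc n) then show ?case unfolding US
      using rational_graph_adjoin ext_value_measurable below_adjoin by blast
  qed
  define S where "S = (\<Union>n. U n)"
  have Sg: "rational_graph M S" unfolding S_def
    by (rule rational_graph_Union) (use Ug in blast, unfold US, rule subset_adjoin)
  have Sb: "below p S" using Ug by (fastforce simp: S_def below_def)
  have a_in: "\<exists>c. (a n, c) \<in> S" for n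
  proof -
    have "(a n, ext_value (U n) (a n)) \<in> U (Suc n)"
      unfolding US by (rule mem_adjoin) (use Ug in blast)
    then show ?thesis by (auto simp: S_def)
  qed
  have G_in: "(G n, l n) \<in> S" for n
  proof -
    have "(G n, l n) \<in> B (Suc n)" unfolding BS by (rule mem_adjoin[OF Bg])
    then have "(G n, l n) \<in> U 0" by (auto simp: U0 S0_def)
    then show ?thesis by (auto simp: S_def)
  qed
  \<comment> \<open>The largest extension of the graph that moves by at most \<open>p\<close>. It
    stays within \<open>C t\<close> times the distance from every prescribed value, so it is the
    limit of such values at each point of \<open>X\<close>, where linearity is then inherited; the
    countable infimum keeps it measurable.\<close>
  define \<Lambda> where "\<Lambda> t x = (INF z\<in>S. snd z t + p t (x - fst z))" for t x
  have lower: "g t - p t (y - x) \<le> snd z t + p t (x - fst z)" if "(y, g) \<in> S" "z \<in> S" for y g t x z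
  proof -
    have "(y + (- 1) *\<^sub>R fst z, %t. g t + (- 1) * snd z t) \<in> S"
    proof -
      have "((- 1) *\<^sub>R fst z, %t. (- 1) * snd z t) \<in> S" using Sg that unfolding rational_graph_def by (cases z) fastforce
      then show ?thesis using Sg that unfolding rational_graph_def by fastforce
    qed
    then have "g t + (- 1) * snd z t \<le> p t (y + (- 1) *\<^sub>R fst z)" using Sb by (auto simp: below_def)
    also have "\<dots> \<le> p t (y - x) + p t (x - fst z)" using sub[of t "y - x" "x - fst z"] by simp
    finally show ?thesis by simp
  qed
  have bdd: "bdd_below ((%z. snd z t + p t (x - fst z)) ` S)" for t x
    using lower[of 0 "%t. 0"] Sg by (intro bdd_belowI2[of _ "0 - p t (0 - x)"]) (auto simp: rational_graph_def)
  have upper: "\<Lambda> t x \<le> g t + p t (x - y)" if "(y, g) \<in> S" for t x y g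
    unfolding \<Lambda>_def using cINF_lower[OF bdd that] by simp
  have lower': "g t - p t (y - x) \<le> \<Lambda> t x" if "(y, g) \<in> S" for t x y g
    unfolding \<Lambda>_def using that lower by (intro cINF_greatest) auto
  have approx: "\<bar>\<Lambda> t x - g t\<bar> \<le> C t * norm (x - y)" if "(y, g) \<in> S" for t x y g
    using upper[OF that, of t x] lower'[OF that, of t x] bound[of t "x - y"] bound[of t "y - x"]
    by (simp add: norm_minus_commute abs_le_iff)
  have lim: "(%n. snd (z n) t) \<longlonglongrightarrow> \<Lambda> t x" if z: "!!n. z n \<in> S" "(%n. fst (z n)) \<longlonglongrightarrow> x" for z :: "nat => _" and t x
  proof (rule LIM_zero_cancel, rule Lim_null_comparison[OF always_eventually])
    show "\<forall>n. norm (snd (z n) t - \<Lambda> t x) \<le> C t * norm (x - fst (z n))"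
      using approx[of "fst (z _)" "snd (z _)" t x] z(1) by (simp add: abs_minus_commute)
    show "(%n. C t * norm (x - fst (z n))) \<longlonglongrightarrow> 0"
      using tendsto_mult[OF tendsto_const tendsto_norm[OF tendsto_diff[OF tendsto_const z(2)]], of "C t" x] by simp
  qed
  have near: "\<exists>z. (\<forall>n::nat. z n \<in> S) \<and> (%n. fst (z n)) \<longlonglongrightarrow> x" if x: "x \<in> X" for x
  proof -
    have "\<exists>z\<in>S. norm (fst z - x) < 1 / real (Suc n)" for n
    proof -
      obtain k where k: "norm (a k - x) < 1 / real (Suc n)" using dense[OF x, of "1 / real (Suc n)"] by (auto simp: norm_minus_commute)
      obtain c where "(a k, c) \<in> S" using a_in[of k] by blast
      then show ?thesis using k by (intro bexI[of _ "(a k, c)"]) auto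
    qed
    then obtain z where z: "!!n. z n \<in> S" "!!n. norm (fst (z n) - x) < 1 / real (Suc n)" by metis
    have "(%n. fst (z n) - x) \<longlonglongrightarrow> 0"
      by (rule Lim_null_comparison[OF always_eventually LIMSEQ_inverse_real_of_nat])
         (use z(2) in \<open>auto simp: inverse_eq_divide less_imp_le\<close>)
    then have "(%n. fst (z n)) \<longlonglongrightarrow> x" by (rule LIM_zero_cancel)
    then show ?thesis using z(1) by blast
  qed
  show ?thesis
  proof (rule that[of \<Lambda>])
    show "(%t. \<Lambda> t x) \<in> borel_measurable M" for x
      unfolding \<Lambda>_def
    proof (rule borel_measurable_cINF)
      show "countable S" using Sg by (simp add: rational_graph_def)
      show "(%t. snd z t + p t (x - fst z)) \<in> borel_measurable M" if "z \<in> S" for z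
      proof (intro borel_measurable_add meas)
        show "snd z \<in> borel_measurable M" using Sg that by (auto simp: rational_graph_def)
      qed
    qed (rule bdd)
    show "\<Lambda> t x \<le> p t x" for t x
      using upper[of 0 "%t. 0" t x] Sg by (simp add: rational_graph_def)
    show "\<Lambda> t (G j) = l j t" for t j using approx[OF G_in, of t "G j" j] by simp
    show "\<Lambda> t (x + y) = \<Lambda> t x + \<Lambda> t y" if x: "x \<in> X" and y: "y \<in> X" for t x y
    proof -
      obtain f where f: "!!n. f n \<in> S" "(%n. fst (f n)) \<longlonglongrightarrow> x" using near[OF x] by blast
      obtain g where g: "!!n. g n \<in> S" "(%n. fst (g n)) \<longlonglongrightarrow> y" using near[OF y] by blast
      have "(fst (f n) + fst (g n), %t. snd (f n) t + snd (g n) t) \<in> S" for n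
        using Sg f(1)[of n] g(1)[of n] unfolding rational_graph_def by (cases "f n"; cases "g n") fastforce
      from lim[of "%n. (fst (f n) + fst (g n), %t. snd (f n) t + snd (g n) t)" "x + y" t, OF this] have "(%n. snd (f n) t + snd (g n) t) \<longlonglongrightarrow> \<Lambda> t (x + y)"
        using tendsto_add[OF f(2) g(2)] by simp
      moreover have "(%n. snd (f n) t + snd (g n) t) \<longlonglongrightarrow> \<Lambda> t x + \<Lambda> t y" by (intro tendsto_add lim f g)
      ultimately show ?thesis by (rule LIMSEQ_unique)
    qed
    show "\<Lambda> t (c *\<^sub>R x) = c * \<Lambda> t x" if x: "x \<in> X" for t x c
    proof -
      obtain f where f: "!!n. f n \<in> S" "(%n. fst (f n)) \<longlonglongrightarrow> x" using near[OF x] by blast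
      have "\<exists>q\<in>\<rat>. \<bar>q - c\<bar> < 1 / real (Suc n)" for n
      proof -
        have "c < c + 1 / real (Suc n)" by simp
        then obtain q where "q \<in> \<rat>" "c < q" "q < c + 1 / real (Suc n)" using Rats_dense_in_real by blast
        then show ?thesis by (intro bexI[of _ q]) auto
      qed
      then obtain q where q: "!!n. q n \<in> \<rat>" "!!n. \<bar>q n - c\<bar> < 1 / real (Suc n)" by metis
      have "(%n. q n - c) \<longlonglongrightarrow> 0"
        by (rule Lim_null_comparison[OF always_eventually LIMSEQ_inverse_real_of_nat])
           (use q(2) in \<open>auto simp: inverse_eq_divide less_imp_le\<close>)
      then have qc: "q \<longlonglongrightarrow> c" by (rule LIM_zero_cancel)
      have "(q n *\<^sub>R fst (f n), %t. q n * snd (f n) t) \<in> S" for n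
        using Sg f(1)[of n] q(1)[of n] unfolding rational_graph_def by (cases "f n") fastforce
      from lim[of "%n. (q n *\<^sub>R fst (f n), %t. q n * snd (f n) t)" "c *\<^sub>R x" t, OF this] have "(%n. q n * snd (f n) t) \<longlonglongrightarrow> \<Lambda> t (c *\<^sub>R x)"
        using tendsto_scaleR[OF qc f(2)] by simp
      moreover have "(%n. q n * snd (f n) t) \<longlonglongrightarrow> c * \<Lambda> t x" by (intro tendsto_mult qc lim f)
      ultimately show ?thesis by (rule LIMSEQ_unique)
    qed
  qed
qed

end

section \<open>Riesz representation along a space-filling curve\<close>

text \<open>Integrating \<open>f\<close> against the discrete measure with masses
  \<open>L (Bernstein n k) / L 1\<close> at the points \<open>k / n\<close> gives \<open>L\<close>
  of the Bernstein polynomial of \<open>f\<close>, divided by \<open>L 1\<close>. This converges by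
  the theorem of Bernstein and Weierstrass, while Helly selection provides a weak limit of the
  measures.\<close>

lemma riesz_unit_interval:
  fixes L :: "(real => real) => real"
  assumes add: "!!f g. continuous_on {0..1} f ==> continuous_on {0..1} g ==> L (%x. f x + g x) = L f + L g"
    and scale: "!!f c. continuous_on {0..1} f ==> L (%x. c * f x) = c * L f"
    and pos: "!!f. continuous_on {0..1} f ==> (!!x. x \<in> {0..1} ==> 0 \<le> f x) ==> 0 \<le> L f"
  obtains M where "finite_measure M" "sets M = sets borel"
    "!!f B. continuous_on UNIV f ==> (!!x. \<bar>f x\<bar> \<le> B) ==> integral\<^sup>L M f = L f"
proof -
  have mono: "L f \<le> L g" if "continuous_on {0..1} f" "continuous_on {0..1} g" "!!x. x \<in> {0..1} ==> f x \<le> g x" for f g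
  proof -
    have "0 \<le> L (%x. g x + (- 1) * f x)" using that by (intro pos continuous_intros) auto
    also have "\<dots> = L g + L (%x. (- 1) * f x)" using that by (intro add continuous_intros)
    also have "L (%x. (- 1) * f x) = - L f" using scale[of f "- 1"] that by simp
    finally show ?thesis by simp
  qed
  have bound: "\<bar>L f - L g\<bar> \<le> e * L (%_. 1)"
    if fg: "continuous_on {0..1} f" "continuous_on {0..1} g" "!!x. x \<in> {0..1} ==> \<bar>f x - g x\<bar> \<le> e" for f g e
  proof -
    have c: "L (%x. g x + e * 1) = L g + e * L (%_. 1)" "L (%x. f x + e * 1) = L f + e * L (%_. 1)"
      using fg scale[of "%_. 1" e] by (subst add; auto intro!: continuous_intros)+
    have "L f \<le> L (%x. g x + e * 1)" using fg(3) by (intro mono continuous_intros fg) (auto simp: abs_le_iff algebra_simps)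
    moreover have "L g \<le> L (%x. f x + e * 1)" using fg(3) by (intro mono continuous_intros fg) (auto simp: abs_le_iff algebra_simps)
    ultimately show ?thesis using c by linarith
  qed
  define c where "c = L (%_. 1)"
  have c0: "0 \<le> c" unfolding c_def by (rule pos) auto
  have Lsum: "L (%x. \<Sum>k\<in>A. f k x) = (\<Sum>k\<in>A. L (f k))" if "finite A" "!!k. k \<in> A ==> continuous_on {0..1} (f k)" for A :: "nat set" and f
    using that
  proof (induction rule: finite_induct)
    case empty show ?case using scale[of "%_. 0" 0] by simp
  next
    case (insert k A)
    then show ?case by (simp add: add continuous_on_sum)
  qed
  have Bc: "continuous_on {0..1} (Bernstein n k)" for n k
    unfolding Bernstein_def by (intro continuous_intros)
  show ?thesis
  proof (cases "c = 0")
    \<comment> \<open>With \<open>L 1 = 0\<close> a normalisation to probability measures is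
      impossible, but positivity then forces \<open>L\<close> to vanish.\<close>
    case True
    show ?thesis
    proof (rule that[of "null_measure borel"])
      show "finite_measure (null_measure borel)" by (rule finite_measureI) simp
      fix f :: "real => real" and B assume f: "continuous_on UNIV f" "!!x. \<bar>f x\<bar> \<le> B"
      have "\<bar>L f - L (%_. 0)\<bar> \<le> B * L (%_. 1)"
        using f by (intro bound) (auto intro: continuous_on_subset)
      then have "L f = 0" using True scale[of "%_. 0" 0] by (simp add: c_def)
      then show "integral\<^sup>L (null_measure borel) f = L f" by (simp add: integral_null_measure)
    qed simp
  next
    case False
    then have c: "c > 0" using c0 by simp
    define w where "w n k = L (Bernstein n k) / c" for n k
    have w0: "0 \<le> w n k" for n k unfolding w_def using c
      by (intro divide_nonneg_pos pos Bc Bernstein_nonneg) auto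
    have w1: "(\<Sum>k\<le>n. w n k) = 1" for n
    proof -
      have "(\<Sum>k\<le>n. w n k) = L (%x. \<Sum>k\<le>n. Bernstein n k x) / c"
        using Lsum[of "{..n}" "Bernstein n"] Bc unfolding w_def by (simp add: sum_divide_distrib[symmetric])
      then show ?thesis using c by (simp add: c_def)
    qed
    define P where "P n = point_measure {..n} (%k. ennreal (w n k))" for n
    define \<mu> where "\<mu> n = distr (P n) borel (%k. real k / real n)" for n
    have Pm: "g \<in> measurable (P n) N \<longleftrightarrow> g \<in> {..n} \<rightarrow> space N" for g :: "nat => real" and n N
      by (simp add: P_def)
    have Pprob: "prob_space (P n)" for n
    proof (rule prob_spaceI)
      have "emeasure (P n) (space (P n)) = (\<Sum>k\<le>n. ennreal (w n k))"
        unfolding P_def by (simp add: space_point_measure emeasure_point_measure_finite)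
      also have "\<dots> = ennreal (\<Sum>k\<le>n. w n k)" by (rule sum_ennreal) (rule w0)
      finally show "emeasure (P n) (space (P n)) = 1" by (simp add: w1)
    qed
    have rd: "real_distribution (\<mu> n)" for n
    proof -
      interpret prob_space "P n" by (rule Pprob)
      have "prob_space (\<mu> n)" unfolding \<mu>_def by (rule prob_space_distr) (simp add: Pm)
      then show ?thesis by (simp add: real_distribution_def real_distribution_axioms_def \<mu>_def)
    qed
    have int\<mu>: "integral\<^sup>L (\<mu> n) f = (\<Sum>k\<le>n. w n k * f (real k / real n))" if "f \<in> borel_measurable borel" for f :: "real => real" and n
    proof -
      have "integral\<^sup>L (\<mu> n) f = integral\<^sup>L (P n) (%k. f (real k / real n))"
        unfolding \<mu>_def using that by (intro integral_distr) (simp add: Pm)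
      also have "\<dots> = (\<Sum>k\<le>n. w n k * f (real k / real n))"
        unfolding P_def using w0 by (subst lebesgue_integral_point_measure_finite) auto
      finally show ?thesis .
    qed
    have tight: "tight \<mu>"
      unfolding tight_def
    proof (intro conjI allI impI)
      show "real_distribution (\<mu> n)" for n by (rule rd)
      fix \<epsilon> :: real assume e: "0 < \<epsilon>"
      \<comment> \<open>All atoms \<open>k / n\<close> lie in [0,1]; the interval is open on the
        left, hence the room on that side. For \<open>n = 0\<close> the atom is 0 by the convention
        on division.\<close>
      have "measure (\<mu> n) {-1<..2} = 1" for n
      proof -
        interpret real_distribution "\<mu> n" by (rule rd)
        have "measure (\<mu> n) {-1<..2} = integral\<^sup>L (\<mu> n) (indicator {-1<..2})" by simp
        also have "\<dots> = (\<Sum>k\<le>n. w n k * indicator {-1<..2} (real k / real n))" by (rule int\<mu>) simp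
        also have "\<dots> = (\<Sum>k\<le>n. w n k)"
        proof (rule sum.cong)
          fix k assume "k \<in> {..n}"
          then have "real k / real n \<le> 1" "0 \<le> real k / real n" by (auto simp: divide_le_eq_1)
          then have "-1 < real k / real n" "real k / real n \<le> 2" by linarith+
          then show "w n k * indicator {-1<..2} (real k / real n) = w n k" by (auto simp: indicator_def)
        qed simp
        finally show ?thesis by (simp add: w1)
      qed
      then show "\<exists>a b. a < b \<and> (\<forall>n. 1 - \<epsilon> < measure (\<mu> n) {a<..b})"
        using e by (intro exI[of _ "-1"] exI[of _ 2]) auto
    qed
    obtain r N where r: "strict_mono (r :: nat => nat)" and N: "real_distribution N" and wc: "weak_conv_m (%n. \<mu> (r n)) N"
      using tight_imp_convergent_subsubsequence[OF tight, of id] by (auto simp: strict_mono_id o_def)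
    interpret N: real_distribution N by (rule N)
    have key: "integral\<^sup>L N f = L f / c" if f: "continuous_on UNIV f" "!!x. \<bar>f x\<bar> \<le> B" for f B
    proof -
      have "(%n. integral\<^sup>L (\<mu> (r n)) f) \<longlonglongrightarrow> integral\<^sup>L N f"
        using f rd N wc
        by (intro weak_conv_imp_integral_bdd_continuous_conv[where B=B]) (auto simp: continuous_on_eq_continuous_at)
      moreover have "(%n. integral\<^sup>L (\<mu> (r n)) f) \<longlonglongrightarrow> L f / c"
      proof -
        have fc: "continuous_on {0..1} f" using f(1) by (rule continuous_on_subset) auto
        have "(%n. L (%x. \<Sum>k\<le>n. f (real k / real n) * Bernstein n k x)) \<longlonglongrightarrow> L f"
        proof (rule LIMSEQ_I)
          fix e :: real assume "0 < e"
          then have "0 < e / (2 * c)" using c by simp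
          from Bernstein_Weierstrass[OF fc this] obtain n0 where
            n0: "!!n x. n0 \<le> n ==> x \<in> {0..1} ==> \<bar>f x - (\<Sum>k\<le>n. f (real k / real n) * Bernstein n k x)\<bar> < e / (2 * c)" by blast
          show "\<exists>no. \<forall>n\<ge>no. norm (L (%x. \<Sum>k\<le>n. f (real k / real n) * Bernstein n k x) - L f) < e"
          proof (intro exI allI impI)
            fix n assume n: "n0 \<le> n"
            have "\<bar>L f - L (%x. \<Sum>k\<le>n. f (real k / real n) * Bernstein n k x)\<bar> \<le> e / (2 * c) * L (%_. 1)"
              using n0[OF n] by (intro bound fc continuous_intros Bc) (auto intro: less_imp_le)
            also have "\<dots> = e / 2" using c by (simp add: c_def)
            finally show "norm (L (%x. \<Sum>k\<le>n. f (real k / real n) * Bernstein n k x) - L f) < e"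
              using \<open>0 < e\<close> by (simp add: abs_minus_commute)
          qed
        qed
        then have "(%n. L (%x. \<Sum>k\<le>n. f (real k / real n) * Bernstein n k x) / c) \<longlonglongrightarrow> L f / c"
          using c by (intro tendsto_divide tendsto_const) auto
        moreover have "L (%x. \<Sum>k\<le>n. f (real k / real n) * Bernstein n k x) / c = integral\<^sup>L (\<mu> n) f" for n
        proof -
          have "L (%x. \<Sum>k\<le>n. f (real k / real n) * Bernstein n k x) = (\<Sum>k\<le>n. f (real k / real n) * L (Bernstein n k))"
            by (subst Lsum) (auto intro!: continuous_intros Bc simp: scale[OF Bc])
          then show ?thesis using borel_measurable_continuous_onI[OF f(1)]
            by (simp add: int\<mu> w_def sum_divide_distrib mult.commute)
        qed
        ultimately have "(%n. integral\<^sup>L (\<mu> n) f) \<longlonglongrightarrow> L f / c" by simp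
        from LIMSEQ_subseq_LIMSEQ[OF this r] show ?thesis by (simp add: o_def)
      qed
      ultimately show ?thesis by (rule LIMSEQ_unique)
    qed
    show ?thesis
    proof (rule that[of "density N (%_. ennreal c)"])
      show "finite_measure (density N (%_. ennreal c))"
        using N.emeasure_space_1 by (intro finite_measureI) (simp add: emeasure_density_const)
      show "sets (density N (%_. ennreal c)) = sets borel" by simp
      show "integral\<^sup>L (density N (%_. ennreal c)) f = L f" if f: "continuous_on UNIV f" "!!x. \<bar>f x\<bar> \<le> B" for f B
        using borel_measurable_continuous_onI[OF f(1)] c key[OF f]
        by (subst integral_density) (auto simp: )
    qed
  qed
qed

text \<open>Subsets of a separable metric space are separable: for every step function with finitely
  many values from a countable dense set and every tolerance, one member of the family close to it
  is picked, if there is any. The sequence therefore consists of members of \<open>F\<close>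
  itself.\<close>

lemma separable_continuous_family:
  fixes \<Phi> :: "'x => real => 'e::euclidean_space"
  assumes ne: "F \<noteq> {}" and cont: "!!\<phi>. \<phi> \<in> F ==> continuous_on {0..1} (\<Phi> \<phi>)"
  obtains D :: "nat => 'x" where "!!n. D n \<in> F"
    "!!\<phi> e. \<phi> \<in> F ==> 0 < e ==> \<exists>n. \<forall>s\<in>{0..1}. norm (\<Phi> \<phi> s - \<Phi> (D n) s) < e"
proof -
  obtain Q :: "'e set" where Q: "countable Q" "!!X. open X ==> X \<noteq> {} ==> \<exists>d\<in>Q. d \<in> X"
    by (rule countable_dense_setE) blast
  \<comment> \<open>The code \<open>(N, l, m)\<close> stands for the step function with value
    \<open>l ! i\<close> on \<open>[i/N, (i+1)/N)\<close> and the tolerance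
    \<open>1 / (m + 1)\<close>.\<close>
  define R where "R = (%(N::nat, l, m::nat) \<phi>. \<phi> \<in> F \<and> (\<forall>s\<in>{0..1}. norm (\<Phi> \<phi> s - l ! nat \<lfloor>real N * s\<rfloor>) < 1 / real (Suc m)))"
  define C where "C = (UNIV :: nat set) \<times> lists Q \<times> (UNIV :: nat set)"
  have C: "countable C" unfolding C_def using Q(1) by (intro countable_SIGMA countable_lists) auto
  have Cne: "C \<noteq> {}" unfolding C_def by auto
  obtain \<phi>0 where \<phi>0: "\<phi>0 \<in> F" using ne by blast
  define D' where "D' c = (if \<exists>\<phi>. R c \<phi> then SOME \<phi>. R c \<phi> else \<phi>0)" for c
  have D': "R c (D' c)" if "R c \<phi>" for c \<phi> using that unfolding D'_def by (metis someI_ex)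
  have DF: "D' c \<in> F" for c
  proof (cases "\<exists>\<phi>. R c \<phi>")
    case True
    then have "R c (D' c)" using D' by blast
    then show ?thesis by (cases c) (auto simp: R_def)
  qed (simp add: D'_def \<phi>0)
  show ?thesis
  proof (rule that[of "%n. D' (from_nat_into C n)"])
    show "D' (from_nat_into C n) \<in> F" for n by (rule DF)
    fix \<phi> and e :: real assume \<phi>: "\<phi> \<in> F" and e: "0 < e"
    obtain m where m: "2 / e < real (Suc m)" using reals_Archimedean2[of "2 / e"] by (metis less_Suc_eq of_nat_less_iff less_trans)
    define \<eta> where "\<eta> = 1 / real (Suc m)"
    have \<eta>: "\<eta> > 0" "2 * \<eta> < e" using m e by (auto simp: \<eta>_def field_simps)
    have "uniformly_continuous_on {0..1} (\<Phi> \<phi>)"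
      by (rule compact_uniformly_continuous[OF cont[OF \<phi>]]) simp
    then obtain \<delta> where \<delta>: "\<delta> > 0" "!!s s'. s \<in> {0..1} ==> s' \<in> {0..1} ==> dist s' s < \<delta> ==> dist (\<Phi> \<phi> s') (\<Phi> \<phi> s) < \<eta> / 2"
      unfolding uniformly_continuous_on_def using \<eta>(1) by (metis half_gt_zero)
    obtain N where N: "1 / \<delta> < real N" using reals_Archimedean2 by blast
    have N0: "real N > 0" using N \<delta>(1) by (smt (verit) divide_pos_pos)
    have "\<exists>d\<in>Q. d \<in> ball (\<Phi> \<phi> (real i / real N)) (\<eta> / 2)" for i
      using \<eta>(1) by (intro Q(2)) auto
    then obtain d where d: "!!i. d i \<in> Q" "!!i. dist (\<Phi> \<phi> (real i / real N)) (d i) < \<eta> / 2"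
      by (metis mem_ball)
    define l where "l = map d [0..<Suc N]"
    have R: "R (N, l, m) \<phi>"
      unfolding R_def prod.case
    proof (intro conjI ballI \<phi>)
      fix s :: real assume s: "s \<in> {0..1}"
      define i where "i = nat \<lfloor>real N * s\<rfloor>"
      have i: "real i \<le> real N * s" "real N * s < real i + 1" using s by (auto simp: i_def)
      have iN: "i \<le> N"
      proof -
        have "real i \<le> real N * 1" using i(1) s mult_left_mono[of s 1 "real N"] by auto
        then show ?thesis by simp
      qed
      have l: "l ! i = d i" using iN by (simp add: l_def del: upt_Suc)
      have "dist (real i / real N) s < \<delta>"
      proof -
        have "\<bar>real i / real N - s\<bar> = \<bar>real i - real N * s\<bar> / real N" using N0 by (simp add: field_simps)
        also have "\<dots> < 1 / real N" using i N0 by (intro divide_strict_right_mono) (auto simp: abs_less_iff)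
        also have "\<dots> < \<delta>" using N \<delta>(1) N0 by (simp add: field_simps)
        finally show ?thesis by (simp add: dist_real_def)
      qed
      then have "dist (\<Phi> \<phi> (real i / real N)) (\<Phi> \<phi> s) < \<eta> / 2"
        using iN s N0 by (intro \<delta>(2)) auto
      then have "dist (\<Phi> \<phi> s) (d i) < \<eta>"
        using d(2)[of i] dist_triangle_half_r[of "\<Phi> \<phi> (real i / real N)" "\<Phi> \<phi> s" \<eta> "d i"] by simp
      then show "norm (\<Phi> \<phi> s - l ! nat \<lfloor>real N * s\<rfloor>) < 1 / real (Suc m)"
        using l by (simp add: dist_norm \<eta>_def i_def)
    qed
    have "(N, l, m) \<in> C" using d(1) by (auto simp: C_def l_def)
    then obtain n where n: "from_nat_into C n = (N, l, m)" using from_nat_into_surj[OF C] by blast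
    have R': "R (N, l, m) (D' (N, l, m))" by (rule D'[OF R])
    show "\<exists>n. \<forall>s\<in>{0..1}. norm (\<Phi> \<phi> s - \<Phi> (D' (from_nat_into C n)) s) < e"
    proof (intro exI ballI)
      fix s :: real assume s: "s \<in> {0..1}"
      have "norm (\<Phi> \<phi> s - l ! nat \<lfloor>real N * s\<rfloor>) < \<eta>" "norm (\<Phi> (D' (N, l, m)) s - l ! nat \<lfloor>real N * s\<rfloor>) < \<eta>"
        using R R' s by (auto simp: R_def \<eta>_def)
      then have "norm (\<Phi> \<phi> s - \<Phi> (D' (N, l, m)) s) < 2 * \<eta>"
        using norm_triangle_ineq4[of "\<Phi> \<phi> s - l ! nat \<lfloor>real N * s\<rfloor>" "\<Phi> (D' (N, l, m)) s - l ! nat \<lfloor>real N * s\<rfloor>"] by simp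
      then show "norm (\<Phi> \<phi> s - \<Phi> (D' (from_nat_into C n)) s) < e" using \<eta> n by simp
    qed
  qed
qed

text \<open>Schoenberg's space-filling curve: the zigzag reads off the ternary digits of a point of the Cantor set.\<close>

definition zigzag :: "real => real" where
  "zigzag x = max 0 (min 1 (1/2 - cos (pi * x)))"

lemma zigzag_bounds: "0 \<le> zigzag x" "zigzag x \<le> 1" by (auto simp: zigzag_def)

lemma continuous_zigzag: "continuous_on A zigzag"
  unfolding zigzag_def by (intro continuous_intros)

lemma zigzag_periodic: "zigzag (x + 2 * of_int n) = zigzag x"
proof -
  have "cos (pi * (x + 2 * of_int n)) = cos (pi * x + 2 * pi * of_int n)" by (simp add: algebra_simps)
  also have "\<dots> = cos (pi * x)" unfolding cos_add cos_int_2pin sin_int_2pin by simp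
  finally show ?thesis by (simp add: zigzag_def)
qed

lemma zigzag_low: "0 \<le> x ==> x \<le> 1/3 ==> zigzag x = 0"
proof -
  assume x: "0 \<le> x" "x \<le> 1/3"
  then have "pi * x \<le> pi / 3" by (simp add: field_simps)
  then have "cos (pi / 3) \<le> cos (pi * x)" using x by (intro cos_monotone_0_pi_le) auto
  then show ?thesis by (simp add: zigzag_def cos_60)
qed

lemma zigzag_high: "2/3 \<le> x ==> x \<le> 1 ==> zigzag x = 1"
proof -
  assume x: "2/3 \<le> x" "x \<le> 1"
  then have "pi - pi / 3 \<le> pi * x" by (simp add: field_simps)
  then have "cos (pi * x) \<le> cos (pi - pi / 3)" using x by (intro cos_monotone_0_pi_le) auto
  also have "cos (pi - pi / 3) = - (1/2)" unfolding cos_pi_minus cos_60 by simp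
  finally have "cos (pi * x) \<le> - (1/2)" .
  then show ?thesis by (simp add: zigzag_def)
qed

text \<open>With ternary digits 0 and 2 only, \<open>3 ^ m * t\<close> is an even integer plus a
  tail in \<open>[0,1/3]\<close> or \<open>[2/3,1]\<close>, according to the digit
  \<open>a m\<close>. The period 2 of the zigzag removes the even integer, and it is constant on the
  two intervals.\<close>

lemma zigzag_ternary:
  fixes a :: "nat => int"
  assumes a: "!!m. a m = 0 \<or> a m = 1"
  defines "t \<equiv> (\<Sum>l. 2 * of_int (a l) / 3 ^ Suc l :: real)"
  shows "t \<in> {0..1}" "zigzag (3 ^ m * t) = of_int (a m)"
proof -
  define tail where "tail m = (\<Sum>l. 2 * of_int (a (m + l)) / 3 ^ Suc l :: real)" for m
  have g: "(%l. 2 / 3 ^ Suc l :: real) sums 1"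
  proof -
    have "(%l. (2/3) * (1/3) ^ l :: real) sums ((2/3) * (1 / (1 - 1/3)))"
      by (intro sums_mult geometric_sums) auto
    then show ?thesis by (simp add: power_divide field_simps)
  qed
  have le: "0 \<le> 2 * of_int (a l) / (3 ^ Suc k :: real)" "2 * of_int (a l) / (3 ^ Suc k :: real) \<le> 2 / 3 ^ Suc k" for l k
    using a[of l] by auto
  have sm: "summable (%l. 2 * of_int (a (m + l)) / 3 ^ Suc l :: real)" for m
  proof (rule summable_comparison_test'[OF sums_summable[OF g], of 0])
    fix n
    show "norm (2 * of_int (a (m + n)) / 3 ^ Suc n :: real) \<le> 2 / 3 ^ Suc n"
      using le(1)[of "m + n" n] le(2)[of "m + n" n] by (simp only: real_norm_def abs_of_nonneg)
  qed
  have tb: "0 \<le> tail m" "tail m \<le> 1" for m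
  proof -
    show "0 \<le> tail m" unfolding tail_def by (intro suminf_nonneg sm le)
    have "tail m \<le> (\<Sum>l. 2 / 3 ^ Suc l :: real)" unfolding tail_def
      by (intro suminf_le sm le sums_summable[OF g])
    then show "tail m \<le> 1" using sums_unique[OF g] by simp
  qed
  have step: "3 * tail m = 2 * of_int (a m) + tail (Suc m)" for m
  proof -
    have "tail m = 2 * of_int (a m) / 3 + (\<Sum>l. 2 * of_int (a (m + Suc l)) / 3 ^ Suc (Suc l))"
      unfolding tail_def using suminf_split_head[OF sm[of m]] by (simp add: algebra_simps)
    also have "(\<Sum>l. 2 * of_int (a (m + Suc l)) / 3 ^ Suc (Suc l) :: real) = (\<Sum>l. (1/3) * (2 * of_int (a (Suc m + l)) / 3 ^ Suc l))"
      by simp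
    also have "\<dots> = (1/3) * tail (Suc m)" unfolding tail_def by (rule suminf_mult[OF sm])
    finally show ?thesis by simp
  qed
  have t0: "t = tail 0" by (simp add: t_def tail_def)
  then show "t \<in> {0..1}" using tb[of 0] by simp
  have "\<exists>N::int. 3 ^ m * t = tail m + 2 * of_int N"
  proof (induction m)
    case 0 show ?case using t0 by (intro exI[of _ 0]) simp
  next
    case (Suc m)
    then obtain N :: int where "3 ^ m * t = tail m + 2 * of_int N" by blast
    then have "3 ^ Suc m * t = 3 * tail m + 6 * of_int N" by simp
    also have "\<dots> = tail (Suc m) + 2 * of_int (a m + 3 * N)" using step[of m] by simp
    finally show ?case by blast
  qed
  then have z: "zigzag (3 ^ m * t) = zigzag (tail m)" using zigzag_periodic by metis
  show "zigzag (3 ^ m * t) = of_int (a m)"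
    using a[of m]
  proof
    assume "a m = 0"
    then show ?thesis unfolding z using step[of m] tb[of m] tb[of "Suc m"] by (simp add: zigzag_low)
  next
    assume "a m = 1"
    then show ?thesis unfolding z using step[of m] tb[of m] tb[of "Suc m"] by (simp add: zigzag_high)
  qed
qed

lemma binary_digits:
  fixes y :: real
  assumes y: "0 \<le> y" "y < 1"
  obtains b :: "nat => int" where "!!k. b k = 0 \<or> b k = 1" "(%k. of_int (b k) / 2 ^ Suc k) sums y"
proof -
  define b where "b k = \<lfloor>2 ^ Suc k * y\<rfloor> - 2 * \<lfloor>2 ^ k * y\<rfloor>" for k :: nat
  show ?thesis
  proof (rule that[of b])
    show "b k = 0 \<or> b k = 1" for k unfolding b_def by (simp add: mult.assoc) linarith
    have partial: "(\<Sum>k<n. of_int (b k) / 2 ^ Suc k) = of_int \<lfloor>2 ^ n * y\<rfloor> / (2 ^ n :: real)" for n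
    proof (induction n)
      case 0
      have "\<lfloor>y\<rfloor> = 0" using y by linarith
      then show ?case by simp
    next
      case (Suc n) then show ?case by (simp add: b_def field_simps)
    qed
    have lim: "(%n. of_int \<lfloor>2 ^ n * y\<rfloor> / (2 ^ n :: real)) \<longlonglongrightarrow> y"
    proof (rule tendsto_sandwich)
      show "\<forall>\<^sub>F n in sequentially. y - (1/2) ^ n \<le> of_int \<lfloor>2 ^ n * y\<rfloor> / (2 ^ n :: real)"
      proof (rule always_eventually, rule allI)
        fix n :: nat
        have "2 ^ n * y - 1 \<le> of_int \<lfloor>2 ^ n * y\<rfloor>" by linarith
        then have "(2 ^ n * y - 1) / 2 ^ n \<le> of_int \<lfloor>2 ^ n * y\<rfloor> / (2 ^ n :: real)" by (rule divide_right_mono) simp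
        then show "y - (1/2) ^ n \<le> of_int \<lfloor>2 ^ n * y\<rfloor> / (2 ^ n :: real)"
          by (simp add: diff_divide_distrib power_divide)
      qed
      show "\<forall>\<^sub>F n in sequentially. of_int \<lfloor>2 ^ n * y\<rfloor> / (2 ^ n :: real) \<le> y"
      proof (rule always_eventually, rule allI)
        fix n :: nat
        have "of_int \<lfloor>2 ^ n * y\<rfloor> \<le> 2 ^ n * y" by linarith
        then show "of_int \<lfloor>2 ^ n * y\<rfloor> / (2 ^ n :: real) \<le> y" by (simp add: field_simps)
      qed
      have "(%n. y - (1/2) ^ n) \<longlonglongrightarrow> y - 0"
        by (intro tendsto_diff tendsto_const LIMSEQ_realpow_zero) auto
      then show "(%n. y - (1/2) ^ n) \<longlonglongrightarrow> y" by simp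
    qed simp
    show "(%k. of_int (b k) / 2 ^ Suc k) sums y"
      unfolding sums_def partial by (rule lim)
  qed
qed

text \<open>Coordinate \<open>j\<close> takes the ternary digits at the positions congruent to
  \<open>j\<close> modulo 3 as binary digits. Three coordinates interleave, hence the factor 3 in
  the exponent.\<close>

definition schoenberg :: "nat => real => real" where
  "schoenberg j s = (\<Sum>k. zigzag (3 ^ (3 * k + j) * s) / 2 ^ Suc k)"

lemma continuous_schoenberg: "continuous_on UNIV (schoenberg j)"
proof -
  have "uniform_limit UNIV (%n s. \<Sum>k<n. zigzag (3 ^ (3 * k + j) * s) / 2 ^ Suc k) (schoenberg j) sequentially"
    unfolding schoenberg_def[abs_def]
  proof (rule Weierstrass_m_test[where M="%k. 1 / 2 ^ Suc k"])
    show "norm (zigzag (3 ^ (3 * k + j) * s) / 2 ^ Suc k) \<le> 1 / 2 ^ Suc k" for k s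
      using zigzag_bounds[of "3 ^ (3 * k + j) * s"] by (simp add: divide_right_mono)
    have "summable (%k. (1/2) * (1/2) ^ k :: real)" by (intro summable_mult summable_geometric) auto
    then show "summable (%k. 1 / 2 ^ Suc k :: real)" by (simp add: power_divide)
  qed
  moreover have "continuous_on UNIV (%s. \<Sum>k<n. zigzag (3 ^ (3 * k + j) * s) / 2 ^ Suc k)" for n
    by (intro continuous_intros continuous_on_compose2[OF continuous_zigzag[of UNIV]]) auto
  ultimately show ?thesis by (intro uniform_limit_theorem[OF _ _ trivial_limit_sequentially]) auto
qed

definition coord_num :: "3 => nat" where
  "coord_num i = (if i = 1 then 0 else if i = 2 then 1 else 2)"

lemma coord_num_lt: "coord_num i < 3" by (simp add: coord_num_def)

lemma coord_num_inj: "coord_num i = coord_num j ==> i = j"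
  using exhaust_3[of i] exhaust_3[of j] by (auto simp: coord_num_def split: if_splits)

definition unit_curve :: "real => vec3" where
  "unit_curve s = (\<chi> i. schoenberg (coord_num i) s)"

lemma continuous_unit_curve: "continuous_on UNIV unit_curve"
  unfolding unit_curve_def by (intro continuous_on_vec_lambda continuous_schoenberg)

text \<open>The binary digits of the three coordinates are interleaved into one sequence, which is
  used as the ternary expansion of a point of the Cantor set.\<close>

lemma unit_curve_surj:
  assumes y: "!!i. 0 \<le> y $ i" "!!i. y $ i < 1"
  shows "\<exists>s\<in>{0..1}. unit_curve s = y"
proof -
  have "\<exists>b :: nat => int. (\<forall>k. b k = 0 \<or> b k = 1) \<and> (%k. of_int (b k) / 2 ^ Suc k) sums (y $ i)" for i
    using binary_digits[OF y] by metis
  then obtain b :: "3 => nat => int" where b: "!!i k. b i k = 0 \<or> b i k = 1"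
    "!!i. (%k. of_int (b i k) / 2 ^ Suc k) sums (y $ i)" by metis
  define a where "a m = b (SOME i. coord_num i = m mod 3) (m div 3)" for m
  have a: "a (3 * k + coord_num i) = b i k" for k i
  proof -
    have "(SOME i'. coord_num i' = (3 * k + coord_num i) mod 3) = i"
      using coord_num_lt[of i] by (intro some_equality) (auto intro: coord_num_inj)
    then show ?thesis using coord_num_lt[of i] by (simp add: a_def)
  qed
  define t where "t = (\<Sum>l. 2 * of_int (a l) / 3 ^ Suc l :: real)"
  have a01: "a m = 0 \<or> a m = 1" for m unfolding a_def by (rule b)
  note z = zigzag_ternary[of a, OF a01, folded t_def]
  have "schoenberg (coord_num i) t = y $ i" for i
    unfolding schoenberg_def z(2) a using sums_unique[OF b(2)] by simp
  then show ?thesis using z(1) by (intro bexI[of _ t]) (auto simp: unit_curve_def vec_eq_iff)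
qed

section \<open>From the cube to the whole space by logistic coordinates\<close>

definition logit :: "vec3 => vec3" where
  "logit y = (\<chi> i. ln (y $ i / (1 - y $ i)))"

definition expit :: "vec3 => vec3" where
  "expit x = (\<chi> i. 1 / (1 + exp (- x $ i)))"

definition unit_box :: "vec3 set" where
  "unit_box = {y. \<forall>i. 0 < y $ i \<and> y $ i < 1}"

lemma expit_in: "expit x \<in> unit_box"
proof -
  have "0 < 1 / (1 + e) \<and> 1 / (1 + e) < 1" if "0 < e" for e :: real using that by (auto simp: field_simps)
  from this[OF exp_gt_zero] show ?thesis by (simp add: expit_def unit_box_def)
qed

lemma logit_expit: "logit (expit x) = x"
proof -
  have "1 / (1 + exp (- u)) / (1 - 1 / (1 + exp (- u))) = exp u" for u :: real
  proof -
    have "1 + exp (- u) > 0" by (intro add_pos_pos) auto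
    then show ?thesis by (simp add: field_simps exp_minus)
  qed
  then show ?thesis by (simp add: logit_def expit_def vec_eq_iff)
qed

lemma expit_logit: "y \<in> unit_box ==> expit (logit y) = y"
proof -
  assume y: "y \<in> unit_box"
  have "1 / (1 + exp (- ln (u / (1 - u)))) = u" if "0 < u" "u < 1" for u :: real
    using that by (simp add: exp_minus field_simps)
  then show ?thesis using y by (simp add: logit_def expit_def vec_eq_iff unit_box_def)
qed

lemma continuous_expit: "continuous_on A expit"
  unfolding expit_def
  by (intro continuous_on_vec_lambda continuous_intros) (smt (verit) exp_gt_zero)

lemma continuous_logit: "continuous_on unit_box logit"
  unfolding logit_def unit_box_def
  by (intro continuous_on_vec_lambda continuous_on_ln continuous_intros ballI) (simp; metis less_irrefl)+

lemma open_unit_box: "open unit_box"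
proof -
  have "unit_box = (\<Inter>i. {y. 0 < y $ i} \<inter> {y. y $ i < 1})" by (auto simp: unit_box_def)
  moreover have "open (\<Inter>i. {y :: vec3. 0 < y $ i} \<inter> {y. y $ i < 1})"
    by (intro open_INT open_Int open_Collect_less continuous_intros ballI) auto
  ultimately show ?thesis by simp
qed

text \<open>The curve runs through the closed cube, but only the open cube is mapped
  homeomorphically onto the space. The excluded parameters correspond to infinity.\<close>

definition curve_dom :: "real set" where "curve_dom = unit_curve -` unit_box"
definition curve :: "real => vec3" where "curve s = logit (unit_curve s)"

lemma curve_surj: "\<exists>s\<in>{0..1} \<inter> curve_dom. curve s = x"
proof -
  have "0 \<le> expit x $ i" "expit x $ i < 1" for i using expit_in[of x] by (auto simp: unit_box_def less_imp_le)
  then obtain s where "s \<in> {0..1}" "unit_curve s = expit x" using unit_curve_surj by blast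
  then show ?thesis using expit_in[of x]
    by (intro bexI[of _ s]) (auto simp: curve_dom_def curve_def logit_expit)
qed

lemma open_curve_dom: "open curve_dom"
  unfolding curve_dom_def using continuous_unit_curve open_unit_box
  by (auto intro: open_vimage)

lemma borel_measurable_curve: "curve \<in> borel_measurable borel"
proof -
  have [measurable]: "(%s. unit_curve s $ i) \<in> borel_measurable borel" for i
    unfolding unit_curve_def using continuous_schoenberg by (simp add: borel_measurable_continuous_onI)
  have "(%s. curve s $ i) \<in> borel_measurable borel" for i
    unfolding curve_def logit_def by simp
  then show ?thesis
    by (subst borel_measurable_euclidean_space) (auto simp: Basis_vec_def inner_axis)
qed

lemma compact_support_zero: "x \<notin> closure {x. f x \<noteq> 0} ==> f x = 0"
  using closure_subset[of "{x. f x \<noteq> 0}"] by auto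

definition pull :: "(vec3 => 'b::zero) => real => 'b" where
  "pull f s = (if s \<in> curve_dom then f (curve s) else 0)"

text \<open>Surjectivity of the curve: bounds along the parameter interval are bounds in space. Thus
  uniform distances on [0,1] control uniform distances of the original fields.\<close>

lemma pull_le:
  fixes f :: "vec3 => 'b::zero" and n :: "'b => real"
  assumes "!!s. s \<in> {0..1} ==> n (pull f s) \<le> q"
  shows "n (f x) \<le> q"
proof -
  obtain s where "s \<in> {0..1} \<inter> curve_dom" "curve s = x" using curve_surj[of x] by blast
  then show ?thesis using assms[of s] by (auto simp: pull_def)
qed

text \<open>The image of the compact support is compact inside the open cube, so the extension by 0
  to the rest of the cube is continuous.\<close>

lemma continuous_pull:
  fixes f :: "vec3 => 'b::real_normed_vector"
  assumes f: "continuous_on UNIV f" and K: "compact (closure {x. f x \<noteq> 0})"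
  shows "continuous_on A (pull f)"
proof -
  let ?K = "expit ` closure {x. f x \<noteq> 0}"
  let ?F = "%y. if y \<in> unit_box then f (logit y) else 0"
  have K': "closed ?K" using K by (intro compact_imp_closed compact_continuous_image continuous_expit)
  have z: "?F y = 0" if "y \<notin> ?K" for y
  proof (cases "y \<in> unit_box")
    case True
    have "logit y \<notin> closure {x. f x \<noteq> 0}"
    proof
      assume "logit y \<in> closure {x. f x \<noteq> 0}"
      then have "expit (logit y) \<in> ?K" by (rule imageI)
      then show False using that expit_logit[OF True] by simp
    qed
    then have "f (logit y) = 0" by (rule compact_support_zero)
    then show ?thesis by simp
  qed simp
  have "continuous_on (unit_box \<union> - ?K) ?F"
  proof (rule continuous_on_open_Un[OF open_unit_box])
    show "open (- ?K)" using K' by auto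
    have "continuous_on unit_box (%y. f (logit y))"
      by (rule continuous_on_compose2[OF f continuous_logit]) auto
    then show "continuous_on unit_box ?F" by (rule continuous_on_eq) simp
    show "continuous_on (- ?K) ?F" by (rule continuous_on_eq[of _ "%_. 0"]) (use z in auto)
  qed
  moreover have "unit_box \<union> - ?K = UNIV" using expit_in by auto
  ultimately have "continuous_on UNIV ?F" by simp
  from continuous_on_compose2[OF this continuous_unit_curve] have "continuous_on UNIV (%s. ?F (unit_curve s))" by auto
  then have "continuous_on UNIV (pull f)" by (simp add: pull_def[abs_def] curve_dom_def curve_def cong: if_cong)
  then show ?thesis by (rule continuous_on_subset) simp
qed

section \<open>Test functions and square integrable functions\<close>

lemma test_fun_add:
  assumes "\<phi> \<in> test_fun U" "\<psi> \<in> test_fun U"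
  shows "(%x. \<phi> x + \<psi> x) \<in> test_fun U"
proof -
  let ?C = "closure {x. \<phi> x \<noteq> 0} \<union> closure {x. \<psi> x \<noteq> 0}"
  have C: "compact ?C" "?C \<subseteq> U" using assms by (auto simp: test_fun_def)
  have "{x. \<phi> x + \<psi> x \<noteq> 0} \<subseteq> {x. \<phi> x \<noteq> 0} \<union> {x. \<psi> x \<noteq> 0}" by auto
  from closure_mono[OF this] have sub: "closure {x. \<phi> x + \<psi> x \<noteq> 0} \<subseteq> ?C" by (simp only: closure_Un)
  have "compact (closure {x. \<phi> x + \<psi> x \<noteq> 0})" by (rule closed_subset_compact_aux[OF C(1) closed_closure sub])
  then show ?thesis using assms Ck_add[of _ \<phi> \<psi>] sub C(2) unfolding test_fun_def by blast
qed

lemma test_fun_linear: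
  assumes L: "bounded_linear L" and \<phi>: "\<phi> \<in> test_fun U"
  shows "(%x. L (\<phi> x)) \<in> test_fun U"
proof -
  interpret bounded_linear L by fact
  have "{x. L (\<phi> x) \<noteq> 0} \<subseteq> {x. \<phi> x \<noteq> 0}" by (auto simp: zero)
  then have sub: "closure {x. L (\<phi> x) \<noteq> 0} \<subseteq> closure {x. \<phi> x \<noteq> 0}" by (rule closure_mono)
  then have "compact (closure {x. L (\<phi> x) \<noteq> 0})"
    using \<phi> closed_subset_compact_aux[OF _ closed_closure sub] by (auto simp: test_fun_def)
  then show ?thesis using \<phi> Ck_linear_comp[OF L] sub by (auto simp: test_fun_def)
qed

lemma test_fun_mult:
  fixes \<phi> \<psi> :: "'a::euclidean_space => real"
  assumes \<phi>: "\<phi> \<in> test_fun U" and \<psi>: "\<psi> \<in> test_fun V"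
  shows "(%x. \<phi> x * \<psi> x) \<in> test_fun U"
proof -
  have "{x. \<phi> x * \<psi> x \<noteq> 0} \<subseteq> {x. \<phi> x \<noteq> 0}" by auto
  then have sub: "closure {x. \<phi> x * \<psi> x \<noteq> 0} \<subseteq> closure {x. \<phi> x \<noteq> 0}" by (rule closure_mono)
  then have "compact (closure {x. \<phi> x * \<psi> x \<noteq> 0})"
    using \<phi> closed_subset_compact_aux[OF _ closed_closure sub] by (auto simp: test_fun_def)
  then show ?thesis using \<phi> \<psi> Ck_mult[of _ \<phi> \<psi>] sub unfolding test_fun_def by blast
qed

lemma test_fun_scaleR: "\<phi> \<in> test_fun U ==> (%x. c *\<^sub>R \<phi> x) \<in> test_fun U"
  by (rule test_fun_linear[OF bounded_linear_scaleR_right])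

lemma test_fun_zero:
  fixes U :: "'a::euclidean_space set"
  shows "(%x. 0 :: 'b::real_normed_vector) \<in> test_fun U"
proof -
  have "Ck n (%x::'a. 0::'b)" for n
  proof (induction n)
    case (Suc n)
    have "frechet_derivative (%x::'a. 0::'b) (at x) = (%h. 0)" for x
      by (rule frechet_derivative_unique_at) simp
    then show ?case using Suc by simp
  qed simp
  then show ?thesis by (simp add: test_fun_def)
qed

lemma test_fun_mono: "U \<subseteq> V ==> test_fun U \<subseteq> test_fun V" by (auto simp: test_fun_def)

lemma test_fun_continuous: "\<phi> \<in> test_fun U ==> continuous_on UNIV \<phi>"
  by (auto simp: test_fun_def dest: spec[of _ 0])

lemma test_fun_borel: "\<phi> \<in> test_fun U ==> \<phi> \<in> borel_measurable borel"
  by (intro borel_measurable_continuous_onI test_fun_continuous)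

lemma borel_lebesgue_on: "f \<in> borel_measurable borel ==> f \<in> borel_measurable (lebesgue_on S)"
  by (intro measurable_restrict_space1 measurable_completion) simp

lemma continuous_compact_support_bounded:
  fixes f :: "'a::euclidean_space => 'b::real_normed_vector"
  assumes "continuous_on UNIV f" "compact (closure {x. f x \<noteq> 0})"
  obtains B where "0 < B" "!!x. norm (f x) \<le> B"
proof -
  let ?K = "closure {x. f x \<noteq> 0}"
  have "bounded (f ` ?K)"
    using assms by (intro compact_imp_bounded compact_continuous_image) (auto intro: continuous_on_subset)
  then obtain B where B: "!!x. x \<in> ?K ==> norm (f x) \<le> B" by (auto simp: bounded_iff)
  show ?thesis
  proof (rule that[of "\<bar>B\<bar> + 1"])
    show "norm (f x) \<le> \<bar>B\<bar> + 1" for x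
    proof (cases "x \<in> ?K")
      case True then show ?thesis using B[OF True] by linarith
    next
      case False
      then have "f x = 0" by (rule compact_support_zero)
      then show ?thesis by simp
    qed
  qed simp
qed

lemma test_fun_bounded:
  fixes \<phi> :: "'a::euclidean_space => 'b::real_normed_vector"
  assumes "\<phi> \<in> test_fun U"
  obtains B where "0 < B" "!!x. norm (\<phi> x) \<le> B"
  using continuous_compact_support_bounded[of \<phi>] test_fun_continuous[OF assms] assms
  by (auto simp: test_fun_def)

section \<open>Square integrable functions and the density of test functions\<close>

definition square_int :: "vec3 set => (vec3 => real) set" where
  "square_int Q = {u. u \<in> borel_measurable (lebesgue_on Q) \<and> integrable (lebesgue_on Q) (%x. (u x)\<^sup>2)}"

lemma integrable_mult_square:
  fixes u v :: "'a => real"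
  assumes "u \<in> borel_measurable M" "integrable M (%x. (u x)\<^sup>2)" "v \<in> borel_measurable M" "integrable M (%x. (v x)\<^sup>2)"
  shows "integrable M (%x. u x * v x)"
proof (rule Bochner_Integration.integrable_bound)
  show "integrable M (%x. (u x)\<^sup>2 + (v x)\<^sup>2)" using assms by auto
  show "AE x in M. norm (u x * v x) \<le> norm ((u x)\<^sup>2 + (v x)\<^sup>2)"
  proof (rule AE_I2)
    fix x
    have "2 * (\<bar>u x\<bar> * \<bar>v x\<bar>) \<le> (u x)\<^sup>2 + (v x)\<^sup>2"
      using sum_squares_bound[of "\<bar>u x\<bar>" "\<bar>v x\<bar>"] by simp
    moreover have "0 \<le> \<bar>u x\<bar> * \<bar>v x\<bar>" by simp
    ultimately have "\<bar>u x * v x\<bar> \<le> (u x)\<^sup>2 + (v x)\<^sup>2" unfolding abs_mult by linarith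
    then show "norm (u x * v x) \<le> norm ((u x)\<^sup>2 + (v x)\<^sup>2)" by simp
  qed
qed (use assms in measurable)

lemma square_int_mult: "u \<in> square_int Q ==> v \<in> square_int Q ==> integrable (lebesgue_on Q) (%x. u x * v x)"
  by (auto simp: square_int_def intro: integrable_mult_square)

lemma square_int_scale: "u \<in> square_int Q ==> (%x. c * u x) \<in> square_int Q"
  by (auto simp: square_int_def power_mult_distrib)

lemma square_int_add: "u \<in> square_int Q ==> v \<in> square_int Q ==> (%x. u x + v x) \<in> square_int Q"
  using square_int_mult[of u Q v]
  by (auto simp: square_int_def power2_sum mult.assoc)

lemma square_int_diff: "u \<in> square_int Q ==> v \<in> square_int Q ==> (%x. u x - v x) \<in> square_int Q"
  using square_int_add[of u Q "%x. (- 1) * v x"] square_int_scale[of v Q "- 1"] by simp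

lemma square_int_bounded:
  assumes Q: "Q \<in> lmeasurable" and f: "f \<in> borel_measurable (lebesgue_on Q)" "!!x. \<bar>f x\<bar> \<le> B"
  shows "f \<in> square_int Q"
proof -
  interpret finite_measure "lebesgue_on Q" using Q by (rule finite_measure_lebesgue_on)
  have "integrable (lebesgue_on Q) (%x. (f x)\<^sup>2)"
  proof (rule integrable_const_bound)
    show "AE x in lebesgue_on Q. norm ((f x)\<^sup>2) \<le> B\<^sup>2"
      using f(2) by (auto simp: abs_le_square_iff[symmetric] intro!: AE_I2) (metis abs_ge_zero abs_of_nonneg order_trans power2_abs power_mono)
  qed (use f in measurable)
  then show ?thesis using f by (simp add: square_int_def)
qed

lemma square_int_test_fun: "Q \<in> lmeasurable ==> \<phi> \<in> test_fun U ==> \<phi> \<in> square_int Q"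
  using test_fun_bounded[of \<phi> U] borel_lebesgue_on[OF test_fun_borel] square_int_bounded by (metis real_norm_def)

definition L2_approx :: "vec3 set => (vec3 => real) => bool" where
  "L2_approx Q u \<longleftrightarrow> u \<in> square_int Q \<and>
     (\<forall>e>0. \<exists>\<phi>\<in>test_fun Q. (LINT x|lebesgue_on Q. (u x - \<phi> x)\<^sup>2) < e)"

context
  fixes Q :: "vec3 set"
  assumes Q: "Q \<in> lmeasurable"
begin

lemma square_int_triangle:
  assumes "u \<in> square_int Q" "v \<in> square_int Q" "w \<in> square_int Q"
  shows "(LINT x|lebesgue_on Q. (u x - w x)\<^sup>2) \<le> 2 * (LINT x|lebesgue_on Q. (u x - v x)\<^sup>2) + 2 * (LINT x|lebesgue_on Q. (v x - w x)\<^sup>2)"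
proof -
  have i: "integrable (lebesgue_on Q) (%x. (u x - v x)\<^sup>2)" "integrable (lebesgue_on Q) (%x. (v x - w x)\<^sup>2)"
    "integrable (lebesgue_on Q) (%x. (u x - w x)\<^sup>2)"
    using square_int_diff[OF assms(1,2)] square_int_diff[OF assms(2,3)] square_int_diff[OF assms(1,3)] by (auto simp: square_int_def)
  have "(LINT x|lebesgue_on Q. (u x - w x)\<^sup>2) \<le> (LINT x|lebesgue_on Q. 2 * (u x - v x)\<^sup>2 + 2 * (v x - w x)\<^sup>2)"
  proof (rule integral_mono)
    fix x
    have "(u x - w x)\<^sup>2 + ((u x - v x) - (v x - w x))\<^sup>2 = 2 * (u x - v x)\<^sup>2 + 2 * (v x - w x)\<^sup>2"
      by (simp add: power2_eq_square algebra_simps)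
    then show "(u x - w x)\<^sup>2 \<le> 2 * (u x - v x)\<^sup>2 + 2 * (v x - w x)\<^sup>2"
      using zero_le_power2[of "(u x - v x) - (v x - w x)"] by linarith
  qed (use i in auto)
  also have "\<dots> = 2 * (LINT x|lebesgue_on Q. (u x - v x)\<^sup>2) + 2 * (LINT x|lebesgue_on Q. (v x - w x)\<^sup>2)"
    using i by simp
  finally show ?thesis .
qed

lemma L2_approx_near:
  assumes "u \<in> square_int Q" and near: "!!e. 0 < e ==> \<exists>v. L2_approx Q v \<and> (LINT x|lebesgue_on Q. (u x - v x)\<^sup>2) < e"
  shows "L2_approx Q u"
  unfolding L2_approx_def
proof (intro conjI allI impI assms(1))
  fix e :: real assume e: "0 < e"
  obtain v where v: "L2_approx Q v" "(LINT x|lebesgue_on Q. (u x - v x)\<^sup>2) < e / 4" using near[of "e / 4"] e by auto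
  obtain \<phi> where \<phi>: "\<phi> \<in> test_fun Q" "(LINT x|lebesgue_on Q. (v x - \<phi> x)\<^sup>2) < e / 4"
    using v(1) e unfolding L2_approx_def by (meson zero_less_divide_iff zero_less_numeral)
  have "(LINT x|lebesgue_on Q. (u x - \<phi> x)\<^sup>2) < e"
    using square_int_triangle[OF assms(1) _ square_int_test_fun[OF Q \<phi>(1)], of v] v \<phi> by (simp add: L2_approx_def)
  then show "\<exists>\<phi>\<in>test_fun Q. (LINT x|lebesgue_on Q. (u x - \<phi> x)\<^sup>2) < e" using \<phi> by blast
qed

lemma L2_approx_lim:
  assumes u: "u \<in> square_int Q" and v: "!!n. L2_approx Q (v n)" and g: "g \<in> square_int Q"
    and lim: "!!x. x \<in> Q ==> (%n. v n x) \<longlonglongrightarrow> u x" and bnd: "!!n x. x \<in> Q ==> \<bar>v n x\<bar> \<le> \<bar>g x\<bar>"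
  shows "L2_approx Q u"
proof (rule L2_approx_near[OF u])
  fix e :: real assume e: "0 < e"
  have "(%n. LINT x|lebesgue_on Q. (u x - v n x)\<^sup>2) \<longlonglongrightarrow> (LINT x|lebesgue_on Q. 0)"
  proof (rule integral_dominated_convergence[where w="%x. 2 * (u x)\<^sup>2 + 2 * (g x)\<^sup>2"])
    show "integrable (lebesgue_on Q) (%x. 2 * (u x)\<^sup>2 + 2 * (g x)\<^sup>2)" using u g by (auto simp: square_int_def)
    show "(%x. (u x - v n x)\<^sup>2) \<in> borel_measurable (lebesgue_on Q)" for n
    proof -
      have [measurable]: "u \<in> borel_measurable (lebesgue_on Q)" "v n \<in> borel_measurable (lebesgue_on Q)"
        using u v[of n] by (auto simp: square_int_def L2_approx_def)
      show ?thesis by measurable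
    qed
    show "AE x in lebesgue_on Q. (%n. (u x - v n x)\<^sup>2) \<longlonglongrightarrow> 0"
    proof (rule AE_I2)
      fix x assume "x \<in> space (lebesgue_on Q)"
      then have "(%n. (u x - v n x)\<^sup>2) \<longlonglongrightarrow> (u x - u x)\<^sup>2" by (intro tendsto_intros lim) simp
      then show "(%n. (u x - v n x)\<^sup>2) \<longlonglongrightarrow> 0" by simp
    qed
    show "AE x in lebesgue_on Q. norm ((u x - v n x)\<^sup>2) \<le> 2 * (u x)\<^sup>2 + 2 * (g x)\<^sup>2" for n
    proof (rule AE_I2)
      fix x assume "x \<in> space (lebesgue_on Q)"
      then have "(v n x)\<^sup>2 \<le> (g x)\<^sup>2" using bnd by (simp add: abs_le_square_iff)
      moreover have "(u x - v n x)\<^sup>2 + (u x + v n x)\<^sup>2 = 2 * (u x)\<^sup>2 + 2 * (v n x)\<^sup>2" by (simp add: power2_eq_square algebra_simps)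
      ultimately have "(u x - v n x)\<^sup>2 \<le> 2 * (u x)\<^sup>2 + 2 * (g x)\<^sup>2"
        using zero_le_power2[of "u x + v n x"] by linarith
      then show "norm ((u x - v n x)\<^sup>2) \<le> 2 * (u x)\<^sup>2 + 2 * (g x)\<^sup>2" by simp
    qed
  qed simp
  then have "(%n. LINT x|lebesgue_on Q. (u x - v n x)\<^sup>2) \<longlonglongrightarrow> 0" by simp
  then have "eventually (%n. (LINT x|lebesgue_on Q. (u x - v n x)\<^sup>2) < e) sequentially"
    using e by (rule order_tendstoD)
  then obtain n where "(LINT x|lebesgue_on Q. (u x - v n x)\<^sup>2) < e" by (auto simp: eventually_sequentially)
  then show "\<exists>v. L2_approx Q v \<and> (LINT x|lebesgue_on Q. (u x - v x)\<^sup>2) < e" using v by blast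
qed

lemma L2_approx_test_fun: "\<phi> \<in> test_fun Q ==> L2_approx Q \<phi>"
  unfolding L2_approx_def using square_int_test_fun[OF Q] by (auto intro!: bexI[of _ \<phi>])

lemma L2_approx_add:
  assumes u: "L2_approx Q u" and v: "L2_approx Q v"
  shows "L2_approx Q (%x. u x + v x)"
  unfolding L2_approx_def
proof (intro conjI allI impI)
  have s: "u \<in> square_int Q" "v \<in> square_int Q" using u v by (auto simp: L2_approx_def)
  then show sq: "(%x. u x + v x) \<in> square_int Q" by (rule square_int_add)
  fix e :: real assume e: "0 < e"
  obtain \<phi> where \<phi>: "\<phi> \<in> test_fun Q" "(LINT x|lebesgue_on Q. (u x - \<phi> x)\<^sup>2) < e / 4"
    using u e unfolding L2_approx_def by (meson zero_less_divide_iff zero_less_numeral)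
  obtain \<psi> where \<psi>: "\<psi> \<in> test_fun Q" "(LINT x|lebesgue_on Q. (v x - \<psi> x)\<^sup>2) < e / 4"
    using v e unfolding L2_approx_def by (meson zero_less_divide_iff zero_less_numeral)
  note t = square_int_test_fun[OF Q \<phi>(1)] square_int_test_fun[OF Q \<psi>(1)]
  have "(LINT x|lebesgue_on Q. ((u x + v x) - (\<phi> x + \<psi> x))\<^sup>2) \<le>
     2 * (LINT x|lebesgue_on Q. ((u x + v x) - (\<phi> x + v x))\<^sup>2) + 2 * (LINT x|lebesgue_on Q. ((\<phi> x + v x) - (\<phi> x + \<psi> x))\<^sup>2)"
    by (intro square_int_triangle square_int_add s t)
  then have "(LINT x|lebesgue_on Q. ((u x + v x) - (\<phi> x + \<psi> x))\<^sup>2) < e" using \<phi> \<psi> by simp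
  then show "\<exists>\<phi>\<in>test_fun Q. (LINT x|lebesgue_on Q. (u x + v x - \<phi> x)\<^sup>2) < e"
    using test_fun_add[OF \<phi>(1) \<psi>(1)] by (intro bexI[of _ "%x. \<phi> x + \<psi> x"])
qed

lemma L2_approx_scale:
  assumes u: "L2_approx Q u"
  shows "L2_approx Q (%x. c * u x)"
  unfolding L2_approx_def
proof (intro conjI allI impI)
  show "(%x. c * u x) \<in> square_int Q" using u by (intro square_int_scale) (simp add: L2_approx_def)
  fix e :: real assume e: "0 < e"
  have c: "0 < c\<^sup>2 + 1" by (simp add: add_nonneg_pos)
  obtain \<phi> where \<phi>: "\<phi> \<in> test_fun Q" "(LINT x|lebesgue_on Q. (u x - \<phi> x)\<^sup>2) < e / (c\<^sup>2 + 1)"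
    using u e c unfolding L2_approx_def by (meson divide_pos_pos)
  have "(LINT x|lebesgue_on Q. (c * u x - c * \<phi> x)\<^sup>2) = c\<^sup>2 * (LINT x|lebesgue_on Q. (u x - \<phi> x)\<^sup>2)"
    by (simp add: right_diff_distrib[symmetric] power_mult_distrib)
  also have "\<dots> \<le> (c\<^sup>2 + 1) * (LINT x|lebesgue_on Q. (u x - \<phi> x)\<^sup>2)" by (intro mult_right_mono) auto
  also have "\<dots> < e" using \<phi>(2) c by (simp add: field_simps)
  finally show "\<exists>\<phi>\<in>test_fun Q. (LINT x|lebesgue_on Q. (c * u x - \<phi> x)\<^sup>2) < e"
    using test_fun_scaleR[OF \<phi>(1), of c] by (intro bexI[of _ "%x. c * \<phi> x"]) auto
qed

lemma L2_approx_indicator_open: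
  assumes V: "open V" "V \<subseteq> Q"
  shows "L2_approx Q (indicator V)"
proof -
  obtain f :: "nat => vec3 => real" where f: "!!k. f k \<in> test_fun V" "!!k x. \<bar>f k x\<bar> \<le> 1" "!!x. (%k. f k x) \<longlonglongrightarrow> indicator V x"
    using open_bump_approx[OF V(1)] by blast
  show ?thesis
  proof (rule L2_approx_lim[where v=f and g="%_. 1"])
    have "V \<in> sets lebesgue" using V(1) by auto
    then show "indicator V \<in> square_int Q"
      by (intro square_int_bounded[OF Q, of _ 1] measurable_restrict_space1) auto
    show "(%_. 1) \<in> square_int Q" by (intro square_int_bounded[OF Q, of _ 1]) auto
    show "L2_approx Q (f k)" for k using f(1) test_fun_mono[OF V(2)] by (intro L2_approx_test_fun) blast
    show "(%k. f k x) \<longlonglongrightarrow> indicator V x" for x by (rule f)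
  qed (simp add: f)
qed

lemma L2_approx_indicator:
  assumes op: "open Q" and A: "A \<in> sets lebesgue" "A \<subseteq> Q"
  shows "L2_approx Q (indicator A)"
proof (rule L2_approx_near)
  show "indicator A \<in> square_int Q"
    using A by (intro square_int_bounded[OF Q, of _ 1] measurable_restrict_space1) auto
  fix e :: real assume e: "0 < e"
  obtain V where V: "open V" "A \<subseteq> V" "V - A \<in> lmeasurable" "emeasure lebesgue (V - A) < ennreal e"
    by (rule sets_lebesgue_outer_open[OF A(1) e])
  let ?V = "V \<inter> Q"
  have m: "?V - A \<in> sets lebesgue" using V A op by auto
  have "(%x. (indicator A x - indicator ?V x)\<^sup>2 :: real) = indicator (?V - A)"
    using V(2) A(2) by (auto simp: fun_eq_iff indicator_def)
  then have "(LINT x|lebesgue_on Q. (indicator A x - indicator ?V x)\<^sup>2) = measure (lebesgue_on Q) ((?V - A) \<inter> space (lebesgue_on Q))"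
    using m by simp
  also have "\<dots> = measure lebesgue (?V - A)"
    using op m by (subst measure_restrict_space) (auto intro: arg_cong[where f="measure lebesgue"])
  also have "\<dots> < e"
  proof -
    have "emeasure lebesgue (?V - A) \<le> emeasure lebesgue (V - A)" using V m by (intro emeasure_mono) auto
    also have "\<dots> < ennreal e" by (rule V(4))
    finally show ?thesis using e
      by (cases "emeasure lebesgue (?V - A)") (auto simp: measure_def ennreal_less_iff)
  qed
  finally show "\<exists>v. L2_approx Q v \<and> (LINT x|lebesgue_on Q. (indicator A x - v x)\<^sup>2) < e"
    using L2_approx_indicator_open[of ?V] V(1) op by blast
qed

lemma L2_approx_cong:
  assumes "L2_approx Q u" "!!x. x \<in> Q ==> u x = v x"
  shows "L2_approx Q v"
proof -
  have m: "v \<in> borel_measurable (lebesgue_on Q) \<longleftrightarrow> u \<in> borel_measurable (lebesgue_on Q)"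
    using assms(2) by (intro measurable_cong) auto
  have i: "integrable (lebesgue_on Q) (%x. (v x)\<^sup>2) \<longleftrightarrow> integrable (lebesgue_on Q) (%x. (u x)\<^sup>2)"
    using assms(2) by (intro Bochner_Integration.integrable_cong) auto
  have l: "(LINT x|lebesgue_on Q. (v x - \<phi> x)\<^sup>2) = (LINT x|lebesgue_on Q. (u x - \<phi> x)\<^sup>2)" for \<phi>
    using assms(2) by (intro Bochner_Integration.integral_cong) auto
  show ?thesis using assms(1) by (simp add: L2_approx_def square_int_def m i l)
qed

text \<open>Indicators of open sets are limits of bump functions, those of measurable sets are
  reached by outer regularity, and simple functions by linearity; dominated convergence covers the
  general case.\<close>

lemma L2_approx_all:
  assumes op: "open Q" and u: "u \<in> square_int Q"
  shows "L2_approx Q u"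
proof -
  have um: "u \<in> borel_measurable (lebesgue_on Q)" using u by (simp add: square_int_def)
  obtain F where F': "!!n. simple_function (lebesgue_on Q) (F n)" "!!x. x \<in> space (lebesgue_on Q) ==> (%n. F n x) \<longlonglongrightarrow> u x"
    "!!n x. x \<in> space (lebesgue_on Q) ==> dist (F n x) 0 \<le> 2 * dist (u x) 0"
    using borel_measurable_implies_sequence_metric[OF um, of 0] by blast
  have F: "!!n. simple_function (lebesgue_on Q) (F n)" "!!x. x \<in> Q ==> (%n. F n x) \<longlonglongrightarrow> u x"
    "!!n x. x \<in> Q ==> dist (F n x) 0 \<le> 2 * dist (u x) 0"
    using F' by simp_all
  have simple: "L2_approx Q f" if f: "simple_function (lebesgue_on Q) f" for f :: "vec3 => real"
  proof -
    let ?S = "%y. f -` {y} \<inter> Q"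
    have fin: "finite (f ` Q)" using simple_functionD(1)[OF f] by simp
    have S: "?S y \<in> sets lebesgue" for y
      using simple_functionD(2)[OF f, of "{y}"] op by (auto simp: sets_restrict_space_iff)
    define h where "h y x = y * (indicator (?S y) x :: real)" for y x
    have h: "L2_approx Q (h y)" for y
      unfolding h_def by (intro L2_approx_scale L2_approx_indicator[OF op S]) auto
    have "indicator {} = (%x :: vec3. 0 :: real)" by (simp add: indicator_def fun_eq_iff)
    then have zero: "L2_approx Q (%x. 0)" using L2_approx_indicator_open[of "{}"] by simp
    have "L2_approx Q (%x. \<Sum>y\<in>Y. h y x)" if "finite Y" for Y
      using that by (induction rule: finite_induct) (auto intro!: zero h L2_approx_add)
    from this[OF fin] show ?thesis
    proof (rule L2_approx_cong)
      fix x assume x: "x \<in> Q"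
      have "(\<Sum>y\<in>f ` Q. h y x) = (\<Sum>y\<in>f ` Q. if y = f x then y else 0)"
        using x by (intro sum.cong) (auto simp: indicator_def h_def)
      then show "(\<Sum>y\<in>f ` Q. h y x) = f x" using fin x by (simp add: sum.delta)
    qed
  qed
  show ?thesis
    by (rule L2_approx_lim[OF u simple[OF F(1)] square_int_scale[OF u, of 2] F(2)]) (use F(3) in \<open>auto simp: abs_mult\<close>)
qed

end

lemma lebesgue_on_complete: "open S ==> complete_measure (lebesgue_on S)"
  by (rule complete_lebesgue_on) auto

lemma integral_lebesgue_on:
  fixes f :: "'a::euclidean_space => 'b::{banach, second_countable_topology}"
  assumes "S \<in> sets lebesgue"
  shows "(LINT x|lebesgue_on S. f x) = (LINT x|lebesgue. indicator S x *\<^sub>R f x)"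
    "integrable (lebesgue_on S) f \<longleftrightarrow> integrable lebesgue (%x. indicator S x *\<^sub>R f x)"
  using assms by (auto simp: integral_restrict_space integrable_restrict_space)

lemma AE_lebesgue_on_iff: "S \<in> sets lebesgue ==> (AE x in lebesgue_on S. P x) \<longleftrightarrow> (AE x in lebesgue. x \<in> S \<longrightarrow> P x)"
  by (simp add: AE_restrict_space_iff)

text \<open>Pulled back along the curve, the test functions form a family of continuous functions on
  [0,1] and so have a uniformly dense sequence. On a set of finite measure uniform closeness implies
  closeness in \<open>L^2\<close>.\<close>

lemma L2_dense_sequence:
  assumes Q: "Q \<in> lmeasurable" "open Q"
  obtains \<phi> :: "nat => vec3 => real" where "!!k. \<phi> k \<in> test_fun Q"
    "!!u e. u \<in> square_int Q ==> 0 < e ==> \<exists>k. (LINT x|lebesgue_on Q. (u x - \<phi> k x)\<^sup>2) < e"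
proof -
  let ?L = "lebesgue_on Q"
  interpret finite_measure ?L by (rule finite_measure_lebesgue_on[OF Q(1)])
  have ne: "(test_fun Q :: (vec3 => real) set) \<noteq> {}" using test_fun_zero by blast
  have "continuous_on {0..1} (pull \<phi>)" if "\<phi> \<in> test_fun Q" for \<phi> :: "vec3 => real"
    using that by (intro continuous_pull test_fun_continuous) (auto simp: test_fun_def)
  then obtain \<phi> :: "nat => vec3 => real" where \<phi>: "!!k. \<phi> k \<in> test_fun Q"
    "!!\<psi> e. \<psi> \<in> test_fun Q ==> 0 < e ==> \<exists>k. \<forall>s\<in>{0..1}. norm (pull \<psi> s - pull (\<phi> k) s) < e"
    using separable_continuous_family[where \<Phi>=pull, OF ne] by metis
  have "\<exists>k. (LINT x|?L. (u x - \<phi> k x)\<^sup>2) < e" if u: "u \<in> square_int Q" "0 < e" for u e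
  proof -
    obtain \<psi> where \<psi>: "\<psi> \<in> test_fun Q" "(LINT x|?L. (u x - \<psi> x)\<^sup>2) < e / 4"
      using L2_approx_all[OF Q u(1)] u(2) unfolding L2_approx_def by (meson zero_less_divide_iff zero_less_numeral)
    define m where "m = measure ?L Q"
    \<comment> \<open>The bound by 1 serves to replace \<open>\<delta>\<close> squared by
      \<open>\<delta>\<close>; the summand 1 in the denominator covers a domain of measure
      0.\<close>
    define \<delta> where "\<delta> = min 1 (e / (4 * (m + 1)))"
    have m: "0 \<le> m" by (simp add: m_def)
    have \<delta>: "0 < \<delta>" "\<delta> \<le> 1" using u(2) m by (auto simp: \<delta>_def)
    obtain k where k: "\<forall>s\<in>{0..1}. norm (pull \<psi> s - pull (\<phi> k) s) < \<delta>" using \<phi>(2)[OF \<psi>(1) \<delta>(1)] by blast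
    have b: "\<bar>\<psi> x - \<phi> k x\<bar> \<le> \<delta>" for x
      by (rule pull_le[where n=abs and f="%x. \<psi> x - \<phi> k x"]) (use k in \<open>auto simp: pull_def less_imp_le split: if_splits\<close>)
    note s = square_int_test_fun[OF Q(1) \<psi>(1)] square_int_test_fun[OF Q(1) \<phi>(1)[of k]]
    have "(LINT x|?L. (\<psi> x - \<phi> k x)\<^sup>2) \<le> (LINT x|?L. \<delta>\<^sup>2)"
      using square_int_diff[OF s] b by (intro integral_mono) (auto simp: square_int_def abs_le_square_iff[symmetric] abs_of_pos[OF \<delta>(1)])
    also have "\<dots> \<le> \<delta> * m" using mult_right_mono[OF mult_left_mono[OF \<delta>(2) less_imp_le[OF \<delta>(1)]] m] by (simp add: m_def power2_eq_square mult.commute)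
    also have "\<dots> \<le> e / (4 * (m + 1)) * m" using m by (intro mult_right_mono) (auto simp: \<delta>_def)
    also have "\<dots> \<le> e / 4" using m u(2) by (simp add: field_simps)
    finally show ?thesis using square_int_triangle[OF Q(1) u(1) s] \<psi>(2) by (intro exI[of _ k]) linarith
  qed
  with \<phi>(1) show ?thesis by (rule that)
qed

text \<open>Pettis' theorem for \<open>L\<^sup>2\<close>: the first element of a dense sequence within distance \<open>2\<^sup>-\<^sup>n\<close> of \<open>g t\<close>
  depends measurably on \<open>t\<close>, and along these approximations one has convergence almost everywhere.\<close>

lemma joint_representative:
  fixes g :: "'t => vec3 => real"
  assumes Q: "Q \<in> lmeasurable" "open Q" and M: "complete_measure M"
    and sq: "AE t in M. g t \<in> square_int Q"
    and weak: "!!\<phi>. \<phi> \<in> test_fun Q ==> (%t. LINT x|lebesgue_on Q. g t x * \<phi> x) \<in> borel_measurable M"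
  obtains G where "G \<in> borel_measurable (M \<Otimes>\<^sub>M lebesgue_on Q)"
    "AE t in M. AE x in lebesgue_on Q. G (t, x) = g t x"
proof -
  let ?L = "lebesgue_on Q"
  interpret M: complete_measure M by fact
  obtain \<phi> :: "nat => vec3 => real" where \<phi>: "!!k. \<phi> k \<in> test_fun Q"
    "!!u e. u \<in> square_int Q ==> 0 < e ==> \<exists>k. (LINT x|?L. (u x - \<phi> k x)\<^sup>2) < e"
    using L2_dense_sequence[OF Q] by blast
  have \<phi>s: "\<phi> k \<in> square_int Q" for k by (rule square_int_test_fun[OF Q(1) \<phi>(1)])
  define g0 where "g0 t = (if g t \<in> square_int Q then g t else (%x. 0))" for t
  have zero_sq: "(%x. 0) \<in> square_int Q" by (simp add: square_int_def)
  have g0: "g0 t \<in> square_int Q" for t using zero_sq by (simp add: g0_def)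
  have g0eq: "AE t in M. g t = g0 t" using sq by eventually_elim (simp add: g0_def)
  have ip: "(%t. LINT x|?L. g0 t x * \<phi> k x) \<in> borel_measurable M" for k
  proof (rule M.borel_measurable_AE_cong[OF weak[OF \<phi>(1)[of k]]])
    show "AE t in M. (LINT x|?L. g t x * \<phi> k x) = (LINT x|?L. g0 t x * \<phi> k x)"
      using g0eq by eventually_elim simp
  qed
  define c where "c k = (LINT x|?L. (\<phi> k x)\<^sup>2)" for k
  define N2 where "N2 t = (LINT x|?L. (g0 t x)\<^sup>2)" for t
  define d where "d k t = (LINT x|?L. (g0 t x - \<phi> k x)\<^sup>2)" for k t
  have d: "d k t = N2 t - (2 * (LINT x|?L. g0 t x * \<phi> k x) - c k)" for k t
  proof -
    have "d k t = (LINT x|?L. (g0 t x)\<^sup>2 - 2 * (g0 t x * \<phi> k x) + (\<phi> k x)\<^sup>2)"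
      unfolding d_def by (simp add: power2_diff algebra_simps)
    also have "\<dots> = N2 t - 2 * (LINT x|?L. g0 t x * \<phi> k x) + c k"
      using square_int_mult[OF g0[of t] \<phi>s[of k]] g0[of t] \<phi>s[of k] by (simp add: N2_def c_def square_int_def)
    finally show ?thesis by simp
  qed
  have d0: "0 \<le> d k t" for k t unfolding d_def by simp
  have small: "\<exists>k. d k t < e" if "0 < e" for e t unfolding d_def by (rule \<phi>(2)[OF g0 that])
  \<comment> \<open>Measurability of the norm is not given. Since the squared distances to the dense
    sequence have infimum 0, the squared norm is a countable supremum of expressions in the
    measurable inner products.\<close>
  have N2m: "N2 \<in> borel_measurable M"
  proof -
    have bd: "bdd_above (range (%k. 2 * (LINT x|?L. g0 t x * \<phi> k x) - c k))" for t
      using d0 d by (intro bdd_aboveI2[of _ _ "N2 t"]) (simp add: algebra_simps)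
    have "N2 t = (SUP k. 2 * (LINT x|?L. g0 t x * \<phi> k x) - c k)" for t
    proof (rule antisym)
      show "(SUP k. 2 * (LINT x|?L. g0 t x * \<phi> k x) - c k) \<le> N2 t"
        using d0 d by (intro cSUP_least) (auto simp: algebra_simps)
      show "N2 t \<le> (SUP k. 2 * (LINT x|?L. g0 t x * \<phi> k x) - c k)"
      proof (rule field_le_epsilon)
        fix e :: real assume "0 < e"
        then obtain k where "d k t < e" using small by blast
        then have "N2 t \<le> (2 * (LINT x|?L. g0 t x * \<phi> k x) - c k) + e" using d[of k t] by simp
        also have "2 * (LINT x|?L. g0 t x * \<phi> k x) - c k \<le> (SUP k. 2 * (LINT x|?L. g0 t x * \<phi> k x) - c k)"
          by (intro cSUP_upper bd) auto
        finally show "N2 t \<le> (SUP k. 2 * (LINT x|?L. g0 t x * \<phi> k x) - c k) + e" by simp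
      qed
    qed
    moreover have "(%t. SUP k. 2 * (LINT x|?L. g0 t x * \<phi> k x) - c k) \<in> borel_measurable M"
      using ip bd by (intro borel_measurable_cSUP) auto
    ultimately show ?thesis by presburger
  qed
  have dm[measurable]: "d k \<in> borel_measurable M" for k
  proof -
    have "d k = (%t. N2 t - (2 * (LINT x|?L. g0 t x * \<phi> k x) - c k))" using d by auto
    moreover have "(%t. N2 t - (2 * (LINT x|?L. g0 t x * \<phi> k x) - c k)) \<in> borel_measurable M"
      by (intro borel_measurable_diff borel_measurable_times borel_measurable_const N2m ip)
    ultimately show ?thesis by simp
  qed
  define K where "K n t = (LEAST k. d k t < (1/4) ^ n)" for n t
  have Kd: "d (K n t) t < (1/4) ^ n" for n t
    unfolding K_def by (rule LeastI_ex[where P="%k. d k t < (1/4) ^ n", OF small]) simp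
  have Km: "K n \<in> measurable M (count_space UNIV)" for n
    unfolding K_def by measurable
  define u where "u n p = \<phi> (K n (fst p)) (snd p)" for n p
  have um: "u n \<in> borel_measurable (M \<Otimes>\<^sub>M ?L)" for n
    unfolding u_def
  proof (rule measurable_compose_countable)
    show "(%p. \<phi> i (snd p)) \<in> borel_measurable (M \<Otimes>\<^sub>M ?L)" for i
      using borel_lebesgue_on[OF test_fun_borel[OF \<phi>(1)[of i]], of Q] by measurable
    show "(%p. K n (fst p)) \<in> measurable (M \<Otimes>\<^sub>M ?L) (count_space UNIV)"
      using Km by measurable
  qed
  have conv: "AE x in ?L. (%n. u n (t, x)) \<longlonglongrightarrow> g0 t x" for t
  proof -
    let ?h = "%n x. (g0 t x - u n (t, x))\<^sup>2"
    have hi: "integrable ?L (?h n)" for n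
      using square_int_diff[OF g0[of t] \<phi>s[of "K n t"]] by (simp add: u_def square_int_def)
    have "(\<integral>\<^sup>+x. (\<Sum>n. ennreal (?h n x)) \<partial>?L) = (\<Sum>n. \<integral>\<^sup>+x. ennreal (?h n x) \<partial>?L)"
      using hi by (intro nn_integral_suminf) auto
    also have "\<dots> = (\<Sum>n. ennreal (d (K n t) t))"
      using hi by (subst nn_integral_eq_integral) (auto simp: d_def u_def)
    also have "\<dots> \<le> (\<Sum>n. ennreal ((1/4) ^ n))"
      using Kd by (intro suminf_le ennreal_leI less_imp_le) auto
    also have "\<dots> = ennreal (\<Sum>n. (1/4) ^ n)" by (intro suminf_ennreal2 summable_geometric) auto
    also have "\<dots> < \<infinity>" by simp
    finally have "(\<integral>\<^sup>+x. (\<Sum>n. ennreal (?h n x)) \<partial>?L) < \<infinity>" .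
    then have "AE x in ?L. (\<Sum>n. ennreal (?h n x)) \<noteq> \<infinity>"
      using hi by (intro nn_integral_PInf_AE) auto
    then show ?thesis
    proof eventually_elim
      case (elim x)
      have "summable (%n. ?h n x)"
        using elim by (intro summable_suminf_not_top) auto
      then have "(%n. ?h n x) \<longlonglongrightarrow> 0" by (rule summable_LIMSEQ_zero)
      then have "(%n. sqrt (?h n x)) \<longlonglongrightarrow> sqrt 0" by (rule tendsto_real_sqrt)
      then have "(%n. \<bar>g0 t x - u n (t, x)\<bar>) \<longlonglongrightarrow> 0" by simp
      then have "(%n. g0 t x - u n (t, x)) \<longlonglongrightarrow> 0" by (simp add: tendsto_rabs_zero_iff)
      from tendsto_diff[OF tendsto_const[of "g0 t x"] this] show ?case by simp
    qed
  qed
  show ?thesis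
  proof (rule that[of "%p. lim (%n. u n p)"])
    show "(%p. lim (%n. u n p)) \<in> borel_measurable (M \<Otimes>\<^sub>M ?L)"
      using um by (intro borel_measurable_lim_metric)
    show "AE t in M. AE x in ?L. lim (%n. u n (t, x)) = g t x"
      using g0eq
    proof eventually_elim
      case (elim t)
      show ?case using conv[of t] by eventually_elim (simp add: limI elim)
    qed
  qed
qed

section \<open>The fundamental lemma and weak gradients\<close>

lemma loc_int_component: "loc_int Q (G :: vec3 => mat3) ==> loc_int Q (%x. G x $ i $ j)"
proof -
  have L: "bounded_linear (%A :: mat3. A $ i $ j)"
    using bounded_linear_compose[OF bounded_linear_vec_nth[of j] bounded_linear_vec_nth[of i]] by simp
  assume "loc_int Q G"
  then show ?thesis unfolding loc_int_def using integrable_bounded_linear[OF L] by blast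
qed

lemma loc_int_test_fun: "loc_int Q g ==> open Q ==> \<phi> \<in> test_fun Q ==> integrable (lebesgue_on Q) (%x. g x * \<phi> x)"
  for g \<phi> :: "vec3 => real"
proof -
  assume g: "loc_int Q g" and Q: "open Q" and \<phi>: "\<phi> \<in> test_fun Q"
  let ?K = "closure {x. \<phi> x \<noteq> 0}"
  have K: "compact ?K" "?K \<subseteq> Q" using \<phi> by (auto simp: test_fun_def)
  have Kl: "?K \<in> sets lebesgue" using K(1) by (simp add: lmeasurable_compact fmeasurableD)
  have "integrable (lebesgue_on ?K) g" using g K by (simp add: loc_int_def)
  then have i: "integrable lebesgue (%x. indicator ?K x *\<^sub>R g x)" using integral_lebesgue_on(2)[OF Kl] by blast
  obtain B where B: "0 < B" "!!x. norm (\<phi> x) \<le> B" using test_fun_bounded[OF \<phi>] by blast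
  have "integrable lebesgue (%x. (indicator ?K x *\<^sub>R g x) * \<phi> x)"
  proof (rule Bochner_Integration.integrable_bound[OF integrable_mult_right[OF i, of B]])
    show "(%x. (indicator ?K x *\<^sub>R g x) * \<phi> x) \<in> borel_measurable lebesgue"
      using borel_lebesgue_on[OF test_fun_borel[OF \<phi>], of UNIV]
      by (intro borel_measurable_times[OF borel_measurable_integrable[OF i]]) (simp add: lebesgue_on_UNIV_eq)
    show "AE x in lebesgue. norm ((indicator ?K x *\<^sub>R g x) * \<phi> x) \<le> norm (B * (indicator ?K x *\<^sub>R g x))"
      using B by (intro AE_I2) (auto simp: abs_mult mult.commute intro!: mult_right_mono)
  qed
  moreover have "(%x. (indicator ?K x *\<^sub>R g x) * \<phi> x) = (%x. indicator Q x *\<^sub>R (g x * \<phi> x))"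
  proof
    fix x
    show "(indicator ?K x *\<^sub>R g x) * \<phi> x = indicator Q x *\<^sub>R (g x * \<phi> x)"
    proof (cases "x \<in> ?K")
      case True
      then show ?thesis using K(2) by auto
    next
      case False
      then have "\<phi> x = 0" by (rule compact_support_zero)
      then show ?thesis by simp
    qed
  qed
  ultimately show ?thesis using Q by (subst integral_lebesgue_on(2)) auto
qed

text \<open>Multiplying \<open>g\<close> by a bump function makes it integrable on the whole space.
  The indicator of a box is a limit of test functions, and their products with the bump function are
  test functions on \<open>Q\<close>, so all box integrals vanish.\<close>

lemma fundamental_lemma:
  fixes g :: "vec3 => real"
  assumes Q: "open Q" and g: "loc_int Q g"
    and zero: "!!\<phi>. \<phi> \<in> test_fun Q ==> (LINT x|lebesgue_on Q. g x * \<phi> x) = 0"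
  shows "AE x in lebesgue_on Q. g x = 0"
proof -
  have l: "Q \<in> sets lebesgue" using Q by auto
  obtain b :: "nat => vec3 => real" where b: "!!k. b k \<in> test_fun Q" "!!x. (%k. b k x) \<longlonglongrightarrow> indicator Q x"
    using open_bump_approx[OF Q] by metis
  have "AE x in lebesgue. indicator Q x * (g x * b k x) = 0" for k
  proof (rule AE_zero_if_box_integrals_zero)
    let ?h = "%x. indicator Q x * (g x * b k x)"
    show h: "integrable lebesgue ?h" using loc_int_test_fun[OF g Q b(1)] l by (simp add: integral_lebesgue_on)
    fix a c :: vec3
    obtain f :: "nat => vec3 => real" where f: "!!n. f n \<in> test_fun (box a c)" "!!n x. \<bar>f n x\<bar> \<le> 1" "!!x. (%n. f n x) \<longlonglongrightarrow> indicator (box a c) x"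
      using open_bump_approx[OF open_box] by blast
    have "(%n. LINT x|lebesgue. f n x * ?h x) \<longlonglongrightarrow> (LINT x|lebesgue. indicator (box a c) x * ?h x)"
    proof (rule integral_dominated_convergence[where w="%x. \<bar>?h x\<bar>"])
      show "(%x. indicator (box a c) x * ?h x) \<in> borel_measurable lebesgue"
        by (intro borel_measurable_times borel_measurable_indicator borel_measurable_integrable[OF h]) auto
      show "(%x. f n x * ?h x) \<in> borel_measurable lebesgue" for n
        using borel_lebesgue_on[OF test_fun_borel[OF f(1)[of n]], of UNIV]
        by (intro borel_measurable_times[OF _ borel_measurable_integrable[OF h]]) (simp add: lebesgue_on_UNIV_eq)
      show "AE x in lebesgue. (%n. f n x * ?h x) \<longlonglongrightarrow> indicator (box a c) x * ?h x"
        using f(3) by (intro AE_I2 tendsto_mult tendsto_const)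
      show "AE x in lebesgue. norm (f n x * ?h x) \<le> \<bar>?h x\<bar>" for n
        using f(2) by (intro AE_I2) (simp only: real_norm_def abs_mult[of "f n _"] mult_left_le_one_le abs_ge_zero)
      show "integrable lebesgue (%x. \<bar>?h x\<bar>)" by (rule integrable_abs[OF h])
    qed
    moreover have "(LINT x|lebesgue. f n x * ?h x) = 0" for n
    proof -
      have "(LINT x|lebesgue. f n x * ?h x) = (LINT x|lebesgue_on Q. g x * (b k x * f n x))"
        using l by (simp add: integral_lebesgue_on mult_ac)
      then show ?thesis using zero[OF test_fun_mult[OF b(1) f(1)]] by simp
    qed
    ultimately show "(LINT x|lebesgue. indicator (box a c) x * ?h x) = 0" by (simp add: LIMSEQ_const_iff)
  qed
  then have "AE x in lebesgue. \<forall>k. indicator Q x * (g x * b k x) = 0" unfolding AE_all_countable by blast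
  moreover have "g x = 0" if z: "\<forall>k. indicator Q x * (g x * b k x) = 0" and x: "x \<in> Q" for x
  proof (rule ccontr)
    assume "g x \<noteq> 0"
    then have "b k x = 0" for k using z x by simp
    then show False using b(2)[of x] x by (simp add: LIMSEQ_const_iff)
  qed
  ultimately have "AE x in lebesgue. x \<in> Q \<longrightarrow> g x = 0" by (elim eventually_mono) blast
  then show ?thesis using l by (subst AE_lebesgue_on_iff) auto
qed

lemma weak_grad_unique:
  assumes Q: "open Q" and G: "has_weak_grad Q u G" and H: "has_weak_grad Q u H"
  shows "AE x in lebesgue_on Q. G x = H x"
proof -
  have "AE x in lebesgue_on Q. G x $ i $ j - H x $ i $ j = 0" for i j
  proof (rule fundamental_lemma[OF Q])
    have lG: "loc_int Q (%x. G x $ i $ j)" and lH: "loc_int Q (%x. H x $ i $ j)"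
      using G H by (auto simp: has_weak_grad_def intro: loc_int_component)
    then show "loc_int Q (%x. G x $ i $ j - H x $ i $ j)" by (auto simp: loc_int_def)
    fix \<phi> :: "vec3 => real" assume \<phi>: "\<phi> \<in> test_fun Q"
    have "(LINT x|lebesgue_on Q. (G x $ i $ j - H x $ i $ j) * \<phi> x)
      = (LINT x|lebesgue_on Q. G x $ i $ j * \<phi> x) - (LINT x|lebesgue_on Q. H x $ i $ j * \<phi> x)"
      unfolding left_diff_distrib by (intro Bochner_Integration.integral_diff loc_int_test_fun lG lH Q \<phi>)
    also have "\<dots> = 0" using G H \<phi> unfolding has_weak_grad_def by (metis (no_types, lifting) add.inverse_inverse diff_self)
    finally show "(LINT x|lebesgue_on Q. (G x $ i $ j - H x $ i $ j) * \<phi> x) = 0" .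
  qed
  then have "AE x in lebesgue_on Q. \<forall>i j. G x $ i $ j - H x $ i $ j = 0"
    by (simp add: AE_all_countable)
  then show ?thesis by eventually_elim (simp add: vec_eq_iff)
qed

lemma wgrad_AE: "open Q ==> has_weak_grad Q u G ==> AE x in lebesgue_on Q. wgrad Q u x = G x"
  unfolding wgrad_def by (rule weak_grad_unique[OF _ someI[of "has_weak_grad Q u"]])

lemma wgrad_has_weak_grad: "has_weak_grad Q u G ==> has_weak_grad Q u (wgrad Q u)"
  unfolding wgrad_def by (rule someI[of "has_weak_grad Q u"])

lemma Lp_AE_cong:
  assumes Q: "open Q" and u: "u \<in> Lp Q p" and eq: "AE x in lebesgue_on Q. u x = w x"
  shows "w \<in> Lp Q p"
proof -
  interpret complete_measure "lebesgue_on Q" by (rule lebesgue_on_complete[OF Q])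
  have m: "w \<in> borel_measurable (lebesgue_on Q)" by (rule borel_measurable_AE_cong[OF _ eq]) (use u in \<open>simp add: Lp_def\<close>)
  have "integrable (lebesgue_on Q) (%x. norm (w x) powr p)"
  proof (rule integrable_AE_cong)
    show "integrable (lebesgue_on Q) (%x. norm (u x) powr p)" using u by (simp add: Lp_def)
    show "AE x in lebesgue_on Q. norm (u x) powr p = norm (w x) powr p" using eq by eventually_elim simp
  qed
  then show ?thesis using m by (simp add: Lp_def)
qed

lemma wgrad_H1: "open Q ==> u \<in> H1 Q ==> has_weak_grad Q u (wgrad Q u) \<and> wgrad Q u \<in> Lp Q 2"
proof -
  assume Q: "open Q" and "u \<in> H1 Q"
  then obtain G where G: "G \<in> Lp Q 2" "has_weak_grad Q u G" by (auto simp: H1_def)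
  have "AE x in lebesgue_on Q. G x = wgrad Q u x" using wgrad_AE[OF Q G(2)] by eventually_elim simp
  then show ?thesis using wgrad_has_weak_grad[OF G(2)] Lp_AE_cong[OF Q G(1)] by blast
qed

section \<open>Integration by parts and classical gradients\<close>

lemma has_derivative_zero_outside_support:
  fixes f :: "'a::real_normed_vector => 'b::real_normed_vector"
  assumes x: "x \<notin> closure {x. f x \<noteq> 0}"
  shows "(f has_derivative (%h. 0)) (at x)"
proof (rule has_derivative_transform_within_open[where f="%_. 0" and s="- closure {x. f x \<noteq> 0}"])
  fix y assume "y \<in> - closure {x. f x \<noteq> 0}"
  then show "0 = f y" using compact_support_zero[of y f] by simp
qed (use x in auto)

text \<open>By translation invariance of Lebesgue measure all difference quotients have integral zero.\<close>

lemma integral_derivative_zero: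
  fixes f :: "'a::euclidean_space => real"
  assumes D: "!!x. (f has_derivative f' x) (at x)" and c: "continuous_on UNIV (%x. f' x b)"
    and K: "compact (closure {x. f x \<noteq> 0})"
  shows "(LINT x|lborel. f' x b) = 0"
proof -
  let ?K = "closure {x. f x \<noteq> 0}"
  have fc: "continuous_on UNIV f" using D by (auto simp: continuous_on_eq_continuous_at intro!: has_derivative_continuous)
  have zero: "f' x b = 0" if "x \<notin> ?K" for x
    using has_derivative_unique[OF D[of x] has_derivative_zero_outside_support[OF that]] by simp
  have supp: "closure {x. f' x b \<noteq> 0} \<subseteq> ?K" using zero by (intro closure_minimal) auto
  then have "compact (closure {x. f' x b \<noteq> 0})" using closed_subset_compact_aux[OF K closed_closure] by blast
  then obtain B where B: "0 < B" "!!x. norm (f' x b) \<le> B" using continuous_compact_support_bounded[OF c] by blast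
  obtain R where R: "!!x. x \<in> ?K ==> norm x \<le> R" using K compact_imp_bounded bounded_iff by metis
  \<comment> \<open>The difference quotients shift by at most \<open>norm b\<close>, so this ball
    contains all points where any of them is nonzero and carries the integrable majorant.\<close>
  let ?C = "cball 0 (R + norm b) :: 'a set"
  define q where "q n x = real (Suc n) * (f (x + (1 / real (Suc n)) *\<^sub>R b) - f x)" for n x
  have Cint: "integrable lborel (%x. indicator ?C x *\<^sub>R B)" by (rule borel_integrable_compact) auto
  have fi: "integrable lborel f"
  proof -
    have "integrable lborel (%x. indicator ?K x *\<^sub>R f x)"
      by (rule borel_integrable_compact[OF K]) (rule continuous_on_subset[OF fc], auto)
    moreover have "(%x. indicator ?K x *\<^sub>R f x) = f"
    proof
      fix x show "indicator ?K x *\<^sub>R f x = f x" using compact_support_zero[of x f] by (cases "x \<in> ?K") auto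
    qed
    ultimately show ?thesis by simp
  qed
  have fb: "f \<in> borel_measurable borel" using fc by (rule borel_measurable_continuous_onI)
  have tr: "integrable lborel (%x. f (x + h)) \<and> (LINT x|lborel. f (x + h)) = (LINT x|lborel. f x)" for h
  proof -
    have "integrable (distr lborel borel ((+) h)) f" using fi by (simp add: lborel_distr_plus)
    then have "integrable lborel (%x. f (h + x))" by (subst (asm) integrable_distr_eq) (use fb in auto)
    moreover have "(LINT x|lborel. f x) = (LINT x|distr lborel borel ((+) h). f x)" by (simp add: lborel_distr_plus)
    moreover have "\<dots> = (LINT x|lborel. f (h + x))" by (rule integral_distr) (use fb in auto)
    ultimately show ?thesis by (simp add: add.commute)
  qed
  have q0: "(LINT x|lborel. q n x) = 0" for n
    unfolding q_def using tr[of "(1 / real (Suc n)) *\<^sub>R b"] fi by simp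
  have line: "((%s. f (x + s *\<^sub>R b)) has_real_derivative f' (x + s *\<^sub>R b) b) (at s)" for x s
  proof -
    have "((%s. x + s *\<^sub>R b) has_derivative (%k. k *\<^sub>R b)) (at s)" by (auto intro!: derivative_eq_intros)
    from diff_chain_at[OF this D] have "((%s. f (x + s *\<^sub>R b)) has_derivative (%k. f' (x + s *\<^sub>R b) (k *\<^sub>R b))) (at s)"
      by (simp add: o_def)
    moreover have "(%k. f' (x + s *\<^sub>R b) (k *\<^sub>R b)) = (*) (f' (x + s *\<^sub>R b) b)"
      using linear_scale[OF has_derivative_linear[OF D[of "x + s *\<^sub>R b"]]] by (auto simp: fun_eq_iff)
    ultimately show ?thesis by (simp add: has_field_derivative_def)
  qed
  have mvt: "\<bar>f (x + h *\<^sub>R b) - f x\<bar> \<le> B * h" if h: "0 < h" for x h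
  proof -
    from MVT2[OF h line[of x]] obtain z where "f (x + h *\<^sub>R b) - f (x + 0 *\<^sub>R b) = (h - 0) * f' (x + z *\<^sub>R b) b" by auto
    then have "\<bar>f (x + h *\<^sub>R b) - f x\<bar> = h * \<bar>f' (x + z *\<^sub>R b) b\<bar>" using h by (simp add: abs_mult)
    also have "\<dots> \<le> h * B" using B(2)[of "x + z *\<^sub>R b"] h by (intro mult_left_mono) auto
    finally show ?thesis by (simp add: mult.commute)
  qed
  have "(%n. LINT x|lborel. q n x) \<longlonglongrightarrow> (LINT x|lborel. f' x b)"
  proof (rule integral_dominated_convergence[OF _ _ Cint])
    show "(%x. f' x b) \<in> borel_measurable lborel" using c by (simp add: borel_measurable_continuous_onI)
    show "q n \<in> borel_measurable lborel" for n
      unfolding q_def using fb by simp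
    show "AE x in lborel. (%n. q n x) \<longlonglongrightarrow> f' x b"
    proof (rule AE_I2)
      fix x
      have "((%s. (f (x + s *\<^sub>R b) - f x) / s) \<longlongrightarrow> f' x b) (at 0)" using line[of x 0] by (simp add: has_field_derivative_iff)
      moreover have "filterlim (%n. 1 / real (Suc n)) (at 0) sequentially"
        unfolding filterlim_at using LIMSEQ_inverse_real_of_nat by (auto simp: inverse_eq_divide)
      ultimately have "(%n. (f (x + (1 / real (Suc n)) *\<^sub>R b) - f x) / (1 / real (Suc n))) \<longlonglongrightarrow> f' x b"
        by (rule filterlim_compose)
      then show "(%n. q n x) \<longlonglongrightarrow> f' x b" by (simp add: q_def mult.commute)
    qed
    show "AE x in lborel. norm (q n x) \<le> indicator ?C x *\<^sub>R B" for n
    proof (rule AE_I2)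
      fix x :: 'a
      let ?h = "1 / real (Suc n)"
      show "norm (q n x) \<le> indicator ?C x *\<^sub>R B"
      proof (cases "x \<in> ?C")
        case True
        have "\<bar>q n x\<bar> = real (Suc n) * \<bar>f (x + ?h *\<^sub>R b) - f x\<bar>" by (simp add: q_def abs_mult)
        also have "\<dots> \<le> real (Suc n) * (B * ?h)" by (intro mult_left_mono mvt) auto
        also have "\<dots> = B" by simp
        finally show ?thesis using True by simp
      next
        case False
        have "norm (?h *\<^sub>R b) = ?h * norm b" by simp
        also have "\<dots> \<le> 1 * norm b" by (intro mult_right_mono) auto
        finally have "norm (?h *\<^sub>R b) \<le> norm b" by simp
        then have "norm (x + ?h *\<^sub>R b) > R"
          using False norm_diff_ineq[of x "?h *\<^sub>R b"] by (simp add: dist_norm)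
        moreover have "norm x > R"
        proof -
          have "\<not> norm x \<le> R + norm b" using False by simp
          then show ?thesis using norm_ge_zero[of b] by linarith
        qed
        ultimately have "x \<notin> ?K" "x + ?h *\<^sub>R b \<notin> ?K" using R[of x] R[of "x + ?h *\<^sub>R b"] by auto
        then have "f x = 0" "f (x + ?h *\<^sub>R b) = 0" by (auto intro: compact_support_zero)
        then show ?thesis using False by (simp add: q_def)
      qed
    qed
  qed
  then have "(%n::nat. 0) \<longlonglongrightarrow> (LINT x|lborel. f' x b)" by (simp add: q0)
  then show ?thesis using LIMSEQ_unique tendsto_const by blast
qed

definition C1_fun :: "(vec3 => 'b::real_normed_vector) => bool" where
  "C1_fun f \<longleftrightarrow> (\<forall>x. f differentiable (at x)) \<and> (\<forall>b\<in>Basis. continuous_on UNIV (%x. frechet_derivative f (at x) b))"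

lemma C1_test_fun: "\<phi> \<in> test_fun U ==> C1_fun \<phi>"
  by (auto simp: test_fun_def C1_fun_def dest: spec[of _ "Suc 0"])

lemma C1_differentiable: "C1_fun f ==> (f has_derivative frechet_derivative f (at x)) (at x)"
  by (auto simp: C1_fun_def frechet_derivative_works)

lemma C1_continuous: "C1_fun f ==> continuous_on UNIV f"
  by (auto simp: continuous_on_eq_continuous_at intro!: has_derivative_continuous C1_differentiable)

lemma integration_by_parts:
  fixes f g :: "vec3 => real"
  assumes f: "C1_fun f" and g: "g \<in> test_fun Q" and Q: "open Q" and b: "b \<in> Basis"
  shows "(LINT x|lebesgue_on Q. f x * frechet_derivative g (at x) b) = - (LINT x|lebesgue_on Q. frechet_derivative f (at x) b * g x)"
    "integrable (lebesgue_on Q) (%x. f x * frechet_derivative g (at x) b)"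
    "integrable (lebesgue_on Q) (%x. frechet_derivative f (at x) b * g x)"
proof -
  let ?f' = "%x. frechet_derivative f (at x)" and ?g' = "%x. frechet_derivative g (at x)"
  let ?K = "closure {x. g x \<noteq> 0}"
  have K: "compact ?K" "?K \<subseteq> Q" using g by (auto simp: test_fun_def)
  have gC: "C1_fun g" by (rule C1_test_fun[OF g])
  have fc: "continuous_on UNIV f" "continuous_on UNIV g" by (rule C1_continuous f gC)+
  have dc: "continuous_on UNIV (%x. ?f' x b)" "continuous_on UNIV (%x. ?g' x b)" using f gC b by (auto simp: C1_fun_def)
  have zero: "g x = 0" "?g' x b = 0" if x: "x \<notin> ?K" for x
  proof -
    show "g x = 0" using x by (rule compact_support_zero)
    show "?g' x b = 0" using frechet_derivative_unique_at[OF has_derivative_zero_outside_support[OF x]] by simp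
  qed
  have int: "integrable lborel u \<and> integrable (lebesgue_on Q) u \<and> (LINT x|lebesgue_on Q. u x) = (LINT x|lborel. u x)"
    if u: "continuous_on UNIV u" "!!x. x \<notin> ?K ==> u x = 0" for u :: "vec3 => real"
  proof -
    have e: "(%x. indicator ?K x *\<^sub>R u x) = u" "(%x. indicator Q x *\<^sub>R u x) = u"
      using u(2) K(2) by (auto simp: indicator_def fun_eq_iff)
    have "integrable lborel (%x. indicator ?K x *\<^sub>R u x)"
      by (rule borel_integrable_compact[OF K(1)]) (rule continuous_on_subset[OF u(1)], auto)
    then have i: "integrable lborel u" by (simp only: e)
    have m: "u \<in> borel_measurable lborel" using u(1) by (simp add: borel_measurable_continuous_onI)
    have "Q \<in> sets lebesgue" using Q by auto
    then show ?thesis using i m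
      by (simp only: integral_lebesgue_on e integrable_completion integral_completion simp_thms)
  qed
  have 1: "continuous_on UNIV (%x. f x * ?g' x b)" "continuous_on UNIV (%x. ?f' x b * g x)"
    by (intro continuous_intros fc dc)+
  have I1: "integrable lborel (%x. f x * ?g' x b) \<and> integrable (lebesgue_on Q) (%x. f x * ?g' x b) \<and>
    (LINT x|lebesgue_on Q. f x * ?g' x b) = (LINT x|lborel. f x * ?g' x b)"
  proof (rule int[OF 1(1)])
    fix x assume x: "x \<notin> ?K"
    show "f x * ?g' x b = 0" unfolding zero(2)[OF x] by simp
  qed
  have I2: "integrable lborel (%x. ?f' x b * g x) \<and> integrable (lebesgue_on Q) (%x. ?f' x b * g x) \<and>
    (LINT x|lebesgue_on Q. ?f' x b * g x) = (LINT x|lborel. ?f' x b * g x)"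
  proof (rule int[OF 1(2)])
    fix x assume x: "x \<notin> ?K"
    show "?f' x b * g x = 0" unfolding zero(1)[OF x] by simp
  qed
  show "integrable (lebesgue_on Q) (%x. f x * ?g' x b)" "integrable (lebesgue_on Q) (%x. ?f' x b * g x)"
    using I1 I2 by blast+
  have "(LINT x|lborel. f x * ?g' x b + ?f' x b * g x) = 0"
  proof (rule integral_derivative_zero[of "%x. f x * g x" "%x h. f x * ?g' x h + ?f' x h * g x"])
    show "((%x. f x * g x) has_derivative (%h. f x * ?g' x h + ?f' x h * g x)) (at x)" for x
      by (intro has_derivative_mult C1_differentiable f gC)
    show "continuous_on UNIV (%x. f x * ?g' x b + ?f' x b * g x)" by (intro continuous_intros fc dc)
    have "{x. f x * g x \<noteq> 0} \<subseteq> {x. g x \<noteq> 0}" by auto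
    then show "compact (closure {x. f x * g x \<noteq> 0})"
      by (intro closed_subset_compact_aux[OF K(1) closed_closure] closure_mono)
  qed
  then have "(LINT x|lborel. f x * ?g' x b) + (LINT x|lborel. ?f' x b * g x) = 0" using I1 I2 by simp
  then show "(LINT x|lebesgue_on Q. f x * ?g' x b) = - (LINT x|lebesgue_on Q. ?f' x b * g x)"
    using I1 I2 by linarith
qed

lemma jacobian_nth: "jacobian \<phi> (at x) $ i $ j = frechet_derivative \<phi> (at x) (axis j 1) $ i"
  by (simp add: jacobian_def matrix_def)

lemma C1_component:
  fixes \<phi> :: "vec3 => vec3"
  assumes "C1_fun \<phi>"
  shows "C1_fun (%x. \<phi> x $ i)" "frechet_derivative (%x. \<phi> x $ i) (at x) b = frechet_derivative \<phi> (at x) b $ i"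
proof -
  have D: "((%x. \<phi> x $ i) has_derivative (%h. frechet_derivative \<phi> (at x) h $ i)) (at x)" for x
    by (intro bounded_linear.has_derivative[OF bounded_linear_vec_nth] C1_differentiable assms)
  have eq: "frechet_derivative (%x. \<phi> x $ i) (at x) = (%h. frechet_derivative \<phi> (at x) h $ i)" for x
    by (rule frechet_derivative_unique_at[OF D])
  then show "frechet_derivative (%x. \<phi> x $ i) (at x) b = frechet_derivative \<phi> (at x) b $ i" by simp
  show "C1_fun (%x. \<phi> x $ i)"
    using D assms unfolding C1_fun_def eq differentiable_def by (auto intro!: continuous_intros)
qed

lemma continuous_jacobian: "C1_fun (\<phi> :: vec3 => vec3) ==> continuous_on UNIV (%x. jacobian \<phi> (at x))"
  unfolding jacobian_def matrix_def
  by (intro continuous_on_vec_lambda continuous_intros) (auto simp: C1_fun_def axis_in_Basis_iff)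

lemma test_fun_component: "(\<phi> :: vec3 => vec3) \<in> test_fun U ==> (%x. \<phi> x $ i) \<in> test_fun U"
  by (rule test_fun_linear[OF bounded_linear_vec_nth])

lemma loc_int_continuous:
  fixes f :: "vec3 => 'b::euclidean_space"
  assumes "continuous_on UNIV f"
  shows "loc_int Q f"
  unfolding loc_int_def
proof (intro allI impI, elim conjE)
  fix C :: "vec3 set" assume C: "compact C"
  have "integrable lborel (%x. indicator C x *\<^sub>R f x)"
    by (rule borel_integrable_compact[OF C]) (rule continuous_on_subset[OF assms], auto)
  then have "integrable lebesgue (%x. indicator C x *\<^sub>R f x)"
    by (subst integrable_completion) auto
  then show "integrable (lebesgue_on C) f"
    using C by (subst integral_lebesgue_on(2)) (auto simp: lmeasurable_compact fmeasurableD)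
qed

lemma C1_has_weak_grad:
  assumes Q: "open Q" and \<phi>: "C1_fun \<phi>"
  shows "has_weak_grad Q \<phi> (%x. jacobian \<phi> (at x))"
  unfolding has_weak_grad_def
proof (intro conjI ballI allI)
  show "loc_int Q \<phi>" by (intro loc_int_continuous C1_continuous \<phi>)
  show "loc_int Q (%x. jacobian \<phi> (at x))" by (intro loc_int_continuous continuous_jacobian \<phi>)
  fix \<psi> :: "vec3 => real" and i j assume \<psi>: "\<psi> \<in> test_fun Q"
  show "(LINT x|lebesgue_on Q. \<phi> x $ i * frechet_derivative \<psi> (at x) (axis j 1))
      = - (LINT x|lebesgue_on Q. jacobian \<phi> (at x) $ i $ j * \<psi> x)"
    using integration_by_parts(1)[OF C1_component(1)[OF \<phi>, of i] \<psi> Q, of "axis j 1"]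
    by (simp add: C1_component(2)[OF \<phi>] jacobian_nth axis_in_Basis_iff)
qed

lemma test_fun_wgrad:
  "open Q ==> \<phi> \<in> test_fun U ==> AE x in lebesgue_on Q. wgrad Q \<phi> x = jacobian \<phi> (at x)"
  by (intro wgrad_AE C1_has_weak_grad C1_test_fun)

lemma test_fun_deriv_support:
  fixes \<phi> :: "vec3 => vec3"
  assumes \<phi>: "\<phi> \<in> test_fun U"
  shows "compact (closure {x. jacobian \<phi> (at x) \<noteq> 0})" "closure {x. jacobian \<phi> (at x) \<noteq> 0} \<subseteq> U"
proof -
  let ?K = "closure {x. \<phi> x \<noteq> 0}"
  have K: "compact ?K" "?K \<subseteq> U" using \<phi> by (auto simp: test_fun_def)
  have "jacobian \<phi> (at x) = 0" if x: "x \<notin> ?K" for x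
  proof -
    show ?thesis using frechet_derivative_unique_at[OF has_derivative_zero_outside_support[OF x]]
      by (simp add: jacobian_def matrix_def vec_eq_iff)
  qed
  then have "closure {x. jacobian \<phi> (at x) \<noteq> 0} \<subseteq> ?K" by (intro closure_minimal) auto
  then show "compact (closure {x. jacobian \<phi> (at x) \<noteq> 0})" "closure {x. jacobian \<phi> (at x) \<noteq> 0} \<subseteq> U"
    using K closed_subset_compact_aux[OF K(1) closed_closure] by auto
qed

lemma test_fun_jacobian_bounded:
  fixes \<phi> :: "vec3 => vec3"
  assumes \<phi>: "\<phi> \<in> test_fun U"
  obtains B where "0 < B" "!!x. norm (jacobian \<phi> (at x)) \<le> B"
  using continuous_compact_support_bounded[OF continuous_jacobian[OF C1_test_fun[OF \<phi>]] test_fun_deriv_support(1)[OF \<phi>]] by blast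

lemma jacobian_linear:
  fixes \<phi> \<psi> :: "vec3 => vec3"
  assumes "C1_fun \<phi>" "C1_fun \<psi>"
  shows "jacobian (%x. \<phi> x + \<psi> x) (at x) = jacobian \<phi> (at x) + jacobian \<psi> (at x)"
    "jacobian (%x. c *\<^sub>R \<phi> x) (at x) = c *\<^sub>R jacobian \<phi> (at x)"
proof -
  have "((%x. \<phi> x + \<psi> x) has_derivative (%h. frechet_derivative \<phi> (at x) h + frechet_derivative \<psi> (at x) h)) (at x)"
    by (intro has_derivative_add C1_differentiable assms)
  from frechet_derivative_unique_at[OF this]
  show "jacobian (%x. \<phi> x + \<psi> x) (at x) = jacobian \<phi> (at x) + jacobian \<psi> (at x)"
    by (simp add: vec_eq_iff jacobian_nth)
  have "((%x. c *\<^sub>R \<phi> x) has_derivative (%h. c *\<^sub>R frechet_derivative \<phi> (at x) h)) (at x)"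
    by (intro has_derivative_scaleR_right C1_differentiable assms)
  from frechet_derivative_unique_at[OF this]
  show "jacobian (%x. c *\<^sub>R \<phi> x) (at x) = c *\<^sub>R jacobian \<phi> (at x)"
    by (simp add: vec_eq_iff jacobian_nth)
qed

section \<open>Test fields as elements of the function spaces\<close>

lemma Lp2_iff: "u \<in> Lp Q 2 \<longleftrightarrow> u \<in> borel_measurable (lebesgue_on Q) \<and> integrable (lebesgue_on Q) (%x. (norm (u x))\<^sup>2)"
  by (simp add: Lp_def powr_numeral)

lemma Lp2_norm: "(Lp_norm Q 2 u)\<^sup>2 = (LINT x|lebesgue_on Q. (norm (u x))\<^sup>2)"
proof -
  have "0 \<le> (LINT x|lebesgue_on Q. (norm (u x))\<^sup>2)" by simp
  then show ?thesis
    by (simp add: Lp_norm_def powr_numeral powr_half_sqrt)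
qed

lemma Lp_norm_nonneg: "0 \<le> Lp_norm Q p u" by (simp add: Lp_norm_def)

lemma borel_measurable_nth_comp:
  fixes u :: "'a => 'b::euclidean_space ^ 'n"
  assumes "u \<in> borel_measurable M"
  shows "(%x. u x $ i) \<in> borel_measurable M"
  by (rule measurable_compose[OF assms borel_measurable_continuous_onI]) (intro continuous_intros)

lemma Lp2_vec_component: "(u :: vec3 => vec3) \<in> Lp Q 2 ==> (%x. u x $ i) \<in> square_int Q"
proof -
  assume u: "u \<in> Lp Q 2"
  have m: "(%x. u x $ i) \<in> borel_measurable (lebesgue_on Q)"
    using u by (intro borel_measurable_nth_comp) (simp add: Lp2_iff)
  have "integrable (lebesgue_on Q) (%x. (u x $ i)\<^sup>2)"
    by (rule Bochner_Integration.integrable_bound[of _ "%x. (norm (u x))\<^sup>2"])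
       (use u m in \<open>auto simp: Lp2_iff abs_le_square_iff[symmetric] component_le_norm_cart\<close>)
  then show ?thesis using m by (simp add: square_int_def)
qed

lemma Lp2_mat_component: "(G :: vec3 => mat3) \<in> Lp Q 2 ==> (%x. G x $ i $ j) \<in> square_int Q"
proof -
  assume u: "G \<in> Lp Q 2"
  have m: "(%x. G x $ i $ j) \<in> borel_measurable (lebesgue_on Q)"
    using u by (intro borel_measurable_nth_comp) (simp add: Lp2_iff)
  have "\<bar>A $ i $ j\<bar> \<le> norm A" for A :: mat3
    using component_le_norm_cart[of "A $ i" j] Finite_Cartesian_Product.norm_nth_le[of A i] by linarith
  then have "norm ((G x $ i $ j)\<^sup>2) \<le> norm ((norm (G x))\<^sup>2)" for x
    using abs_le_square_iff[of "G x $ i $ j" "norm (G x)"] by simp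
  then have "integrable (lebesgue_on Q) (%x. (G x $ i $ j)\<^sup>2)"
    using u m unfolding Lp2_iff
    by (intro Bochner_Integration.integrable_bound[of _ "%x. (norm (G x))\<^sup>2" "%x. (G x $ i $ j)\<^sup>2"]) auto
  then show ?thesis using m by (simp add: square_int_def)
qed

lemma bounded_Lp2:
  fixes f :: "vec3 => 'b::euclidean_space"
  assumes Q: "Q \<in> lmeasurable" and f: "f \<in> borel_measurable (lebesgue_on Q)" and B: "!!x. norm (f x) \<le> B"
  shows "f \<in> Lp Q 2"
proof -
  have "(%x. norm (f x)) \<in> square_int Q" using f B by (intro square_int_bounded[OF Q]) auto
  then show ?thesis using f by (simp add: Lp2_iff square_int_def)
qed

lemma test_fun_Lp2:
  fixes \<phi> :: "vec3 => 'b::euclidean_space"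
  assumes "Q \<in> lmeasurable" "\<phi> \<in> test_fun U"
  shows "\<phi> \<in> Lp Q 2"
proof -
  obtain B where "0 < B" "!!x. norm (\<phi> x) \<le> B" using test_fun_bounded[OF assms(2)] by blast
  then show ?thesis using assms by (intro bounded_Lp2 borel_lebesgue_on test_fun_borel)
qed

lemma test_fun_jacobian_Lp2:
  fixes \<phi> :: "vec3 => vec3"
  assumes "Q \<in> lmeasurable" "\<phi> \<in> test_fun U"
  shows "(%x. jacobian \<phi> (at x)) \<in> Lp Q 2"
proof -
  obtain B where "0 < B" "!!x. norm (jacobian \<phi> (at x)) \<le> B" using test_fun_jacobian_bounded[OF assms(2)] by blast
  then show ?thesis using assms
    by (intro bounded_Lp2 borel_lebesgue_on borel_measurable_continuous_onI continuous_jacobian C1_test_fun)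
qed

lemma test_fun_H1: "open Q ==> Q \<in> lmeasurable ==> \<phi> \<in> test_fun U ==> \<phi> \<in> H1 Q"
  unfolding H1_def
  by (intro CollectI conjI test_fun_Lp2 bexI[of _ "%x. jacobian \<phi> (at x)"] test_fun_jacobian_Lp2 C1_has_weak_grad C1_test_fun)

lemma Lp_norm_zero_fun: "Lp_norm Q 2 (%x. 0) = 0"
  by (simp add: Lp_norm_def)

lemma Lp_norm_AE_zero: "open Q ==> AE x in lebesgue_on Q. u x = 0 ==> Lp_norm Q 2 u = 0"
proof -
  assume Q: "open Q" and u: "AE x in lebesgue_on Q. u x = 0"
  interpret complete_measure "lebesgue_on Q" by (rule lebesgue_on_complete[OF Q])
  have "(LINT x|lebesgue_on Q. norm (u x) powr 2) = (LINT x|lebesgue_on Q. 0)"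
    by (rule integral_AE_cong) (use u in eventually_elim, simp)
  then show ?thesis by (simp add: Lp_norm_def)
qed

lemma wgrad_zero: "open Q ==> AE x in lebesgue_on Q. wgrad Q (%x. 0) x = 0"
proof -
  assume Q: "open Q"
  have "jacobian (%x. 0 :: vec3) (at x) = 0" for x :: vec3
    by (simp add: jacobian_def frechet_derivative_unique_at[OF has_derivative_const] matrix_def vec_eq_iff)
  then show ?thesis using test_fun_wgrad[OF Q test_fun_zero[of UNIV]] by simp
qed

lemma H1_norm_zero: "open Q ==> H1_norm Q (%x. 0) = 0"
  using Lp_norm_AE_zero[OF _ wgrad_zero, of Q] by (simp add: H1_norm_def Lp_norm_zero_fun)

lemma test_fun_sol_test_fun: "\<phi> \<in> test_fun_sol Q ==> \<phi> \<in> test_fun Q"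
  by (simp add: test_fun_sol_def)

lemma test_fun_sol_linear:
  "\<phi> \<in> test_fun_sol Q ==> \<psi> \<in> test_fun_sol Q ==> (%x. \<phi> x + \<psi> x) \<in> test_fun_sol Q"
  "\<phi> \<in> test_fun_sol Q ==> (%x. c *\<^sub>R \<phi> x) \<in> test_fun_sol Q"
proof -
  have tr: "trace (A + B) = trace A + trace B" "trace (c *\<^sub>R A) = c * trace A" for A B :: mat3
    by (auto simp: trace_def sum.distrib sum_distrib_left)
  show "\<phi> \<in> test_fun_sol Q ==> \<psi> \<in> test_fun_sol Q ==> (%x. \<phi> x + \<psi> x) \<in> test_fun_sol Q"
    using test_fun_add[of \<phi> Q \<psi>] C1_test_fun[of \<phi> Q] C1_test_fun[of \<psi> Q]
    by (auto simp: test_fun_sol_def jacobian_linear tr)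
  show "\<phi> \<in> test_fun_sol Q ==> (%x. c *\<^sub>R \<phi> x) \<in> test_fun_sol Q"
    using test_fun_scaleR[of \<phi> Q] C1_test_fun[of \<phi> Q]
    by (auto simp: test_fun_sol_def jacobian_linear(2)[where \<psi>=\<phi>] tr)
qed

lemma test_fun_sol_zero: "(%x. 0) \<in> test_fun_sol Q"
proof -
  have "jacobian (%x. 0 :: vec3) (at x) = 0" for x :: vec3
    by (simp add: jacobian_def frechet_derivative_unique_at[OF has_derivative_const] matrix_def vec_eq_iff)
  then show ?thesis by (auto simp: test_fun_sol_def trace_def intro: test_fun_zero)
qed

lemma test_fun_sol_spaces:
  assumes "open Q" "Q \<in> lmeasurable" "\<phi> \<in> test_fun_sol Q"
  shows "\<phi> \<in> L2_sol Q" "\<phi> \<in> H10_sol Q"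
  using assms test_fun_sol_test_fun[OF assms(3)]
  by (auto simp: L2_sol_def H10_sol_def Lp_norm_zero_fun H1_norm_zero intro!: bexI[of _ \<phi>] test_fun_Lp2 test_fun_H1)

text \<open>The energy-variational inequality is used with test fields constant in time only. What
  it says about fields depending on time is recovered later from these.\<close>

lemma ev_test_constant:
  assumes Q: "open Q" "Q \<in> lmeasurable" and T: "0 < T" and \<phi>: "\<phi> \<in> test_fun_sol Q"
  shows "ev_test Q T (%t. \<phi>) (%t u. 0)"
proof -
  note S = test_fun_sol_spaces[OF Q \<phi>]
  have z: "dual_norm (H10_sol Q) (H1_norm Q) (%u. 0) = 0"
  proof -
    have "(%x. 0) \<in> {u \<in> H10_sol Q. H1_norm Q u \<le> 1}"
      using test_fun_sol_spaces(2)[OF Q test_fun_sol_zero] H1_norm_zero[OF Q(1)] by simp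
    then have "{u \<in> H10_sol Q. H1_norm Q u \<le> 1} \<noteq> {}" by blast
    then show ?thesis by (simp add: dual_norm_def)
  qed
  interpret finite_measure "lebesgue_on {0<..<T}" by (rule finite_measure_lebesgue_on) simp
  have "(%t. \<phi>) \<in> bochner_L2 T Q (H10_sol Q) (H1_norm Q)"
    using S by (simp add: bochner_L2_def)
  moreover have "(%u. 0) \<in> dual (H10_sol Q) (H1_norm Q)"
    by (auto simp: dual_def intro!: exI[of _ 0])
  ultimately show ?thesis using S z by (simp add: ev_test_def)
qed

lemma test_fun_deriv:
  fixes \<phi> :: "'a::euclidean_space => 'b::real_normed_vector"
  assumes \<phi>: "\<phi> \<in> test_fun U" and b: "b \<in> Basis"
  shows "(%x. frechet_derivative \<phi> (at x) b) \<in> test_fun U"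
proof -
  let ?K = "closure {x. \<phi> x \<noteq> 0}" and ?D = "%x. frechet_derivative \<phi> (at x) b"
  have K: "compact ?K" "?K \<subseteq> U" and Ck: "!!n. Ck (Suc n) \<phi>" using \<phi> by (auto simp: test_fun_def)
  have "?D x = 0" if "x \<notin> ?K" for x
    using frechet_derivative_unique_at[OF has_derivative_zero_outside_support[OF that]] by simp
  then have sub: "closure {x. ?D x \<noteq> 0} \<subseteq> ?K" by (intro closure_minimal) auto
  have "compact (closure {x. ?D x \<noteq> 0})" by (rule closed_subset_compact_aux[OF K(1) closed_closure sub])
  moreover have "Ck n ?D" for n using Ck[of n] b by simp
  ultimately show ?thesis using sub K by (auto simp: test_fun_def)
qed

lemma bochner_weak_component:
  assumes f: "f \<in> bochner_L2 T Q X N" and \<phi>: "\<phi> \<in> test_fun Q"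
  shows "(%t. LINT x|lebesgue_on Q. f t x $ i * \<phi> x) \<in> borel_measurable (lebesgue_on {0<..<T})"
proof -
  have "(%x. \<phi> x *\<^sub>R (axis i 1 :: vec3)) \<in> test_fun Q"
    by (rule test_fun_linear[OF bounded_linear_scaleR_left \<phi>])
  then have "(%t. LINT x|lebesgue_on Q. f t x \<bullet> (\<phi> x *\<^sub>R axis i 1)) \<in> borel_measurable (lebesgue_on {0<..<T})"
    using f by (auto simp: bochner_L2_def)
  then show ?thesis by (simp add: inner_axis mult.commute)
qed

section \<open>Joint measurability in time and space\<close>

lemma borel_measurable_vec:
  fixes f :: "'a => real ^ 'n"
  assumes "!!i. (%x. f x $ i) \<in> borel_measurable M"
  shows "f \<in> borel_measurable M"
  using assms by (subst borel_measurable_euclidean_space) (auto simp: Basis_vec_def inner_axis)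

lemma borel_measurable_mat:
  fixes f :: "'a => real ^ 'n ^ 'm"
  assumes "!!i j. (%x. f x $ i $ j) \<in> borel_measurable M"
  shows "f \<in> borel_measurable M"
  using assms by (subst borel_measurable_euclidean_space) (auto simp: Basis_vec_def inner_axis)

lemma joint_vec:
  fixes g :: "'t => vec3 => vec3"
  assumes Q: "Q \<in> lmeasurable" "open Q" and M: "complete_measure M"
    and sq: "AE t in M. g t \<in> Lp Q 2"
    and weak: "!!\<phi> i. \<phi> \<in> test_fun Q ==> (%t. LINT x|lebesgue_on Q. g t x $ i * \<phi> x) \<in> borel_measurable M"
  shows "\<exists>G. G \<in> borel_measurable (M \<Otimes>\<^sub>M lebesgue_on Q) \<and> (AE t in M. AE x in lebesgue_on Q. G (t, x) = g t x)"
proof -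
  have "\<exists>H. H \<in> borel_measurable (M \<Otimes>\<^sub>M lebesgue_on Q) \<and> (AE t in M. AE x in lebesgue_on Q. H (t, x) = g t x $ i)" for i
  proof -
    have "AE t in M. (%x. g t x $ i) \<in> square_int Q" using sq by eventually_elim (rule Lp2_vec_component)
    then show ?thesis by (rule joint_representative[OF Q M _ weak]) blast+
  qed
  then have "\<exists>H. \<forall>i. H i \<in> borel_measurable (M \<Otimes>\<^sub>M lebesgue_on Q) \<and> (AE t in M. AE x in lebesgue_on Q. H i (t, x) = g t x $ i)"
    by (intro choice) blast
  then obtain H where H: "!!i. H i \<in> borel_measurable (M \<Otimes>\<^sub>M lebesgue_on Q)"
    "!!i. AE t in M. AE x in lebesgue_on Q. H i (t, x) = g t x $ i" by blast
  have "(%p. \<chi> i. H i p) \<in> borel_measurable (M \<Otimes>\<^sub>M lebesgue_on Q)" using H(1) by (intro borel_measurable_vec) simp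
  moreover have "AE t in M. AE x in lebesgue_on Q. \<forall>i. H i (t, x) = g t x $ i"
  proof -
    have "AE t in M. \<forall>i. AE x in lebesgue_on Q. H i (t, x) = g t x $ i" using H(2) by (simp add: AE_all_countable)
    then show ?thesis by eventually_elim (simp add: AE_all_countable)
  qed
  then have "AE t in M. AE x in lebesgue_on Q. (\<chi> i. H i (t, x)) = g t x"
    by (simp add: vec_eq_iff)
  ultimately show ?thesis by (intro exI[of _ "%p. \<chi> i. H i p"]) auto
qed

text \<open>Moving the derivative onto the test function reduces the measurability in time of the
  weak gradient to that of the field itself.\<close>

lemma joint_grad:
  fixes g :: "'t => vec3 => vec3"
  assumes Q: "Q \<in> lmeasurable" "open Q" and M: "complete_measure M"
    and sq: "AE t in M. g t \<in> H1 Q"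
    and weak: "!!\<phi> i. \<phi> \<in> test_fun Q ==> (%t. LINT x|lebesgue_on Q. g t x $ i * \<phi> x) \<in> borel_measurable M"
  shows "\<exists>G. G \<in> borel_measurable (M \<Otimes>\<^sub>M lebesgue_on Q) \<and> (AE t in M. AE x in lebesgue_on Q. G (t, x) = wgrad Q (g t) x)"
proof -
  have "\<exists>H. H \<in> borel_measurable (M \<Otimes>\<^sub>M lebesgue_on Q) \<and> (AE t in M. AE x in lebesgue_on Q. H (t, x) = wgrad Q (g t) x $ i $ j)" for i j
  proof -
    have a1: "AE t in M. (%x. wgrad Q (g t) x $ i $ j) \<in> square_int Q"
      using sq by eventually_elim (use wgrad_H1[OF Q(2)] Lp2_mat_component in blast)
    have a2: "(%t. LINT x|lebesgue_on Q. wgrad Q (g t) x $ i $ j * \<phi> x) \<in> borel_measurable M" if \<phi>: "\<phi> \<in> test_fun Q" for \<phi>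
    proof (rule complete_measure.borel_measurable_AE_cong[OF M])
      have "(%x. frechet_derivative \<phi> (at x) (axis j 1)) \<in> test_fun Q"
        by (rule test_fun_deriv[OF \<phi>]) (simp add: axis_in_Basis_iff)
      from weak[OF this, of i]
      show "(%t. - (LINT x|lebesgue_on Q. g t x $ i * frechet_derivative \<phi> (at x) (axis j 1))) \<in> borel_measurable M"
        by simp
      show "AE t in M. - (LINT x|lebesgue_on Q. g t x $ i * frechet_derivative \<phi> (at x) (axis j 1))
        = (LINT x|lebesgue_on Q. wgrad Q (g t) x $ i $ j * \<phi> x)"
        using sq
      proof eventually_elim
        case (elim t)
        then show ?case using wgrad_H1[OF Q(2) elim] \<phi> unfolding has_weak_grad_def by simp
      qed
    qed
    show ?thesis by (rule joint_representative[OF Q M a1 a2]) blast+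
  qed
  then have "\<exists>H. \<forall>i j. H i j \<in> borel_measurable (M \<Otimes>\<^sub>M lebesgue_on Q) \<and> (AE t in M. AE x in lebesgue_on Q. H i j (t, x) = wgrad Q (g t) x $ i $ j)"
    by (intro choice allI) blast
  then obtain H where H: "!!i j. H i j \<in> borel_measurable (M \<Otimes>\<^sub>M lebesgue_on Q)"
    "!!i j. AE t in M. AE x in lebesgue_on Q. H i j (t, x) = wgrad Q (g t) x $ i $ j" by blast
  have "(%p. \<chi> i j. H i j p) \<in> borel_measurable (M \<Otimes>\<^sub>M lebesgue_on Q)" using H(1) by (intro borel_measurable_mat) simp
  moreover have "AE t in M. AE x in lebesgue_on Q. \<forall>i j. H i j (t, x) = wgrad Q (g t) x $ i $ j"
  proof -
    have "AE t in M. \<forall>i j. AE x in lebesgue_on Q. H i j (t, x) = wgrad Q (g t) x $ i $ j" using H(2) by (simp add: AE_all_countable)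
    then show ?thesis by eventually_elim (simp add: AE_all_countable)
  qed
  then have "AE t in M. AE x in lebesgue_on Q. (\<chi> i j. H i j (t, x)) = wgrad Q (g t) x"
    by (simp add: vec_eq_iff)
  ultimately show ?thesis by (intro exI[of _ "%p. \<chi> i j. H i j p"]) auto
qed

section \<open>Functions of bounded variation in time\<close>

lemma BV_decomposition:
  assumes E: "E \<in> BV T"
  obtains V where "!!x y. 0 \<le> x ==> x \<le> y ==> y \<le> T ==> V x \<le> V y"
    "!!x y. 0 \<le> x ==> x \<le> y ==> y \<le> T ==> V x - E x \<le> V y - E y"
proof -
  obtain C where C: "!!n (p::nat => real). mono p ==> range p \<subseteq> {0..T} ==> (\<Sum>i<n. \<bar>E (p (Suc i)) - E (p i)\<bar>) \<le> C"
    using E unfolding BV_def by blast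
  define S where "S x = {(n::nat, p::nat => real). mono p \<and> range p \<subseteq> {0..x}}" for x
  define F where "F = (%(n::nat, p::nat => real). \<Sum>i<n. \<bar>E (p (Suc i)) - E (p i)\<bar>)"
  define V where "V x = (SUP z\<in>S x. F z)" for x
  have bdd: "bdd_above (F ` S x)" if "x \<le> T" for x
  proof (rule bdd_aboveI2[where M=C])
    fix z assume "z \<in> S x"
    then show "F z \<le> C" using that by (cases z) (auto simp: S_def F_def intro!: C)
  qed
  have ne: "S x \<noteq> {}" if "0 \<le> x" for x
  proof -
    have "(0, %_. 0) \<in> S x" using that by (auto simp: S_def mono_def)
    then show ?thesis by blast
  qed
  \<comment> \<open>\<open>V\<close> is the variation up to a given time. That it grows at least by
    the increment of \<open>E\<close> in absolute value makes both \<open>V\<close> and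
    \<open>V - E\<close> nondecreasing.\<close>
  have key: "V x + \<bar>E y - E x\<bar> \<le> V y" if xy: "0 \<le> x" "x \<le> y" "y \<le> T" for x y
  proof -
    have "V x \<le> V y - \<bar>E y - E x\<bar>"
      unfolding V_def[of x]
    proof (rule cSUP_least[OF ne[OF xy(1)]])
      fix z assume z: "z \<in> S x"
      obtain n p where np: "z = (n, p)" by (cases z)
      have p: "mono p" "range p \<subseteq> {0..x}" using z by (auto simp: S_def np)
      \<comment> \<open>The partition of \<open>[0,x]\<close> is prolonged by the points
        \<open>x\<close> and \<open>y\<close>. As partitions are infinite monotone sequences of
        which only an initial part is summed, it stays at \<open>y\<close> from then on.\<close>
      define p' where "p' i = (if i \<le> n then p i else if i = Suc n then x else y)" for i
      have pb: "0 \<le> p i" "p i \<le> x" for i using p(2) by (auto simp: image_subset_iff)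
      have py: "p i \<le> y" for i using pb(2)[of i] xy by linarith
      have "mono p'"
        unfolding mono_def p'_def using p(1)[unfolded mono_def] pb py xy by auto
      moreover have "range p' \<subseteq> {0..y}"
        using pb py xy by (auto simp: p'_def)
      ultimately have "(n + 2, p') \<in> S y" by (auto simp: S_def)
      then have "F (n + 2, p') \<le> V y" unfolding V_def using xy by (intro cSUP_upper bdd)
      moreover have "F (n + 2, p') = (\<Sum>i<n. \<bar>E (p' (Suc i)) - E (p' i)\<bar>) + \<bar>E x - E (p n)\<bar> + \<bar>E y - E x\<bar>"
        by (simp add: F_def p'_def)
      moreover have "(\<Sum>i<n. \<bar>E (p' (Suc i)) - E (p' i)\<bar>) = F z"
        unfolding F_def np by (auto simp: p'_def intro!: sum.cong)
      ultimately show "F z \<le> V y - \<bar>E y - E x\<bar>" by linarith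
    qed
    then show ?thesis by linarith
  qed
  show ?thesis
  proof (rule that[of V])
    fix x y assume "0 \<le> x" "x \<le> y" "y \<le> T"
    from key[OF this] show "V x \<le> V y" "V x - E x \<le> V y - E y" by linarith+
  qed
qed

lemma mono_left_limit:
  fixes f :: "real => real"
  assumes mono: "!!x y. 0 \<le> x ==> x \<le> y ==> y \<le> T ==> f x \<le> f y" and s: "0 < s" "s \<le> T"
  shows "(f \<longlongrightarrow> (SUP x\<in>{0..<s}. f x)) (at_left s)"
proof -
  let ?L = "SUP x\<in>{0..<s}. f x"
  have bdd: "bdd_above (f ` {0..<s})" using mono s by (intro bdd_aboveI2[where M="f s"]) auto
  show ?thesis
  proof (rule order_tendstoI)
    fix a assume "a < ?L"
    then obtain x where x: "x \<in> {0..<s}" "a < f x" using s bdd by (subst (asm) less_cSUP_iff) auto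
    have "eventually (%y. x < y \<and> y < s) (at_left s)"
      using x by (auto simp: eventually_at_left_field intro!: exI[of _ x])
    then show "eventually (%y. a < f y) (at_left s)"
    proof eventually_elim
      case (elim y)
      then show ?case using mono[of x y] x s by auto
    qed
  next
    fix a assume a: "?L < a"
    have "eventually (%y. 0 < y \<and> y < s) (at_left s)"
      using s by (auto simp: eventually_at_left_field intro!: exI[of _ 0])
    then show "eventually (%y. f y < a) (at_left s)"
    proof eventually_elim
      case (elim y)
      have "f y \<le> ?L" using elim by (intro cSUP_upper bdd) auto
      then show ?case using a by simp
    qed
  qed
qed

text \<open>\<open>left_val\<close> is defined through \<open>Lim\<close>, whose value is only
  meaningful once the limit is known to exist.\<close>

lemma BV_left_limit:
  assumes E: "E \<in> BV T" and s: "0 < s" "s \<le> T"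
  obtains l where "(E \<longlongrightarrow> l) (at_left s)"
proof -
  obtain V where V: "!!x y. 0 \<le> x ==> x \<le> y ==> y \<le> T ==> V x \<le> V y"
    "!!x y. 0 \<le> x ==> x \<le> y ==> y \<le> T ==> V x - E x \<le> V y - E y" using BV_decomposition[OF E] by blast
  have "(V \<longlongrightarrow> (SUP x\<in>{0..<s}. V x)) (at_left s)" by (rule mono_left_limit[of T]) (use V s in auto)
  moreover have "((%x. V x - E x) \<longlongrightarrow> (SUP x\<in>{0..<s}. V x - E x)) (at_left s)"
    by (rule mono_left_limit[of T]) (use V s in auto)
  ultimately have "((%x. V x - (V x - E x)) \<longlongrightarrow> (SUP x\<in>{0..<s}. V x) - (SUP x\<in>{0..<s}. V x - E x)) (at_left s)"
    by (rule tendsto_diff)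
  then show ?thesis by (intro that) simp
qed

lemma BV_measurable:
  assumes E: "E \<in> BV T" and T: "0 < T"
  shows "E \<in> borel_measurable (lebesgue_on {0<..<T})"
proof -
  obtain V where V: "!!x y. 0 \<le> x ==> x \<le> y ==> y \<le> T ==> V x \<le> V y"
    "!!x y. 0 \<le> x ==> x \<le> y ==> y \<le> T ==> V x - E x \<le> V y - E y" using BV_decomposition[OF E] by blast
  define cl where "cl x = max 0 (min T x)" for x
  have m: "(%x. f (cl x)) \<in> borel_measurable borel" if "!!x y. 0 \<le> x ==> x \<le> y ==> y \<le> T ==> f x \<le> f y" for f :: "real => real"
    using T by (intro borel_measurable_mono monoI that) (auto simp: cl_def)
  have "(%x. V (cl x) - (V (cl x) - E (cl x))) \<in> borel_measurable borel"
    by (intro borel_measurable_diff m V m[of "%x. V x - E x"])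
  then have "(%x. E (cl x)) \<in> borel_measurable (lebesgue_on {0<..<T})" by (intro borel_lebesgue_on) simp
  moreover have "E (cl x) = E x" if "x \<in> space (lebesgue_on {0<..<T})" for x using that by (simp add: cl_def)
  ultimately show ?thesis by (subst measurable_cong[of _ _ "%x. E (cl x)"]) auto
qed

lemma BV_bounded:
  assumes E: "E \<in> BV T" and T: "0 < T"
  obtains C where "!!t. t \<in> {0..T} ==> \<bar>E t\<bar> \<le> C"
proof -
  obtain C where C: "!!n (p::nat => real). mono p ==> range p \<subseteq> {0..T} ==> (\<Sum>i<n. \<bar>E (p (Suc i)) - E (p i)\<bar>) \<le> C"
    using E unfolding BV_def by blast
  have "\<bar>E t\<bar> \<le> \<bar>E 0\<bar> + C" if t: "t \<in> {0..T}" for t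
  proof -
    let ?p = "%i::nat. if i = 0 then 0 else t"
    have "mono ?p" "range ?p \<subseteq> {0..T}" using t by (auto simp: mono_def)
    from C[OF this, of 1] show ?thesis by simp
  qed
  then show ?thesis by (rule that)
qed

section \<open>Growth of the stresses\<close>

lemma norm_cross3_le: "norm (cross3 x y) \<le> norm x * norm y"
proof -
  have "(norm (cross3 x y))\<^sup>2 \<le> (norm x * norm y)\<^sup>2"
    using norm_cross_dot[of x y] by (smt (verit) zero_le_power2)
  then show ?thesis by (simp add: power2_le_iff_abs_le)
qed

lemma norm_mskw_le: "norm (mskw A) \<le> norm A"
  using norm_triangle_ineq4[of A "transpose A"] by (simp add: mskw_def norm_transpose)

lemma norm_stress_D_le:
  assumes "norm d = 1"
  shows "norm (stress_D lam \<mu>1 \<mu>4 \<mu>5 \<mu>6 d A) \<le> (\<bar>\<mu>1 + lam\<^sup>2\<bar> + \<bar>\<mu>4\<bar> + \<bar>\<mu>5 + \<mu>6 - lam\<^sup>2\<bar>) * norm A"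
proof -
  have m: "norm (msym A *v d) \<le> norm A"
    using norm_matrix_vector_le[of "msym A" d] norm_msym_le[of A] assms by simp
  then have i: "\<bar>d \<bullet> (msym A *v d)\<bar> \<le> norm A"
    using Cauchy_Schwarz_ineq2[of d "msym A *v d"] assms by simp
  have 1: "norm (((\<mu>1 + lam\<^sup>2) * (d \<bullet> (msym A *v d))) *\<^sub>R tensor d d) \<le> \<bar>\<mu>1 + lam\<^sup>2\<bar> * norm A"
    using i assms by (simp add: norm_tensor abs_mult mult_left_mono)
  have 2: "norm (\<mu>4 *\<^sub>R msym A) \<le> \<bar>\<mu>4\<bar> * norm A" using norm_msym_le[of A] by (simp add: mult_left_mono)
  have "norm (msym (tensor d (msym A *v d))) \<le> norm A"
    using norm_msym_le[of "tensor d (msym A *v d)"] m assms by (simp add: norm_tensor)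
  then have 3: "norm ((\<mu>5 + \<mu>6 - lam\<^sup>2) *\<^sub>R msym (tensor d (msym A *v d))) \<le> \<bar>\<mu>5 + \<mu>6 - lam\<^sup>2\<bar> * norm A"
    by (simp add: mult_left_mono)
  show ?thesis unfolding stress_D_def
    using norm_add_leD 1 2 3 norm_triangle_ineq[of "((\<mu>1 + lam\<^sup>2) * (d \<bullet> (msym A *v d))) *\<^sub>R tensor d d + \<mu>4 *\<^sub>R msym A" "(\<mu>5 + \<mu>6 - lam\<^sup>2) *\<^sub>R msym (tensor d (msym A *v d))"]
      norm_triangle_ineq[of "((\<mu>1 + lam\<^sup>2) * (d \<bullet> (msym A *v d))) *\<^sub>R tensor d d" "\<mu>4 *\<^sub>R msym A"]
    by (simp add: distrib_right)
qed

lemma norm_stress_el_le: "norm (stress_el lam d p) \<le> (\<bar>lam\<bar> + 1) * (norm d * norm p)"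
proof -
  have "norm (lam *\<^sub>R msym (tensor d p)) \<le> \<bar>lam\<bar> * (norm d * norm p)"
    using norm_msym_le[of "tensor d p"] by (simp add: norm_tensor mult_left_mono)
  moreover have "norm (mskw (tensor d p)) \<le> norm d * norm p"
    using norm_mskw_le[of "tensor d p"] by (simp add: norm_tensor)
  ultimately show ?thesis unfolding stress_el_def
    using norm_triangle_ineq[of "lam *\<^sub>R msym (tensor d p)" "mskw (tensor d p)"] by (simp add: distrib_right)
qed

lemma norm_matrix_mult_le: "norm (A ** B) \<le> norm (A :: real^'n^'m) * norm (B :: real^'p^'n)"
proof -
  have "(norm (A ** B))\<^sup>2 = (\<Sum>i\<in>UNIV. \<Sum>j\<in>UNIV. (A $ i \<bullet> column j B)\<^sup>2)"
    unfolding power2_norm_eq_inner mat_inner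
    by (simp add: matrix_matrix_mult_def power2_eq_square inner_vec_def column_def)
  also have "\<dots> \<le> (\<Sum>i\<in>UNIV. \<Sum>j\<in>UNIV. (norm (A $ i))\<^sup>2 * (norm (column j B))\<^sup>2)"
    unfolding power2_norm_eq_inner by (intro sum_mono Cauchy_Schwarz_ineq)
  also have "\<dots> = (\<Sum>i\<in>UNIV. (norm (A $ i))\<^sup>2) * (\<Sum>j\<in>UNIV. (norm (column j B))\<^sup>2)"
    by (simp add: sum_product)
  also have "(\<Sum>i\<in>UNIV. (norm (A $ i))\<^sup>2) = (norm A)\<^sup>2"
    unfolding power2_norm_eq_inner inner_vec_def[of A] by simp
  also have "(\<Sum>j\<in>UNIV. (norm (column j B))\<^sup>2) = (norm B)\<^sup>2"
    unfolding power2_norm_eq_inner mat_inner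
    by (simp add: inner_vec_def column_def) (rule sum.swap)
  finally show ?thesis by (simp add: power_mult_distrib[symmetric] power2_le_iff_abs_le)
qed

lemma stress_D_sym: "transpose (stress_D lam \<mu>1 \<mu>4 \<mu>5 \<mu>6 d A) = stress_D lam \<mu>1 \<mu>4 \<mu>5 \<mu>6 d A"
proof -
  have "transpose (tensor d d) = tensor d d" by (simp add: transpose_def tensor_def vec_eq_iff)
  then show ?thesis by (simp add: stress_D_def transpose_add transpose_scaleR transpose_msym)
qed

lemma inner_msym_right: "transpose A = A ==> A \<bullet> msym B = A \<bullet> B"
  using inner_transpose[of A B] by (simp add: msym_def inner_add_right)

section \<open>Energy-variational solutions\<close>

lemma BV_mem_energy: "energy \<Omega> v d = 1/2 * (LINT x|lebesgue_on \<Omega>. (norm (v x))\<^sup>2) + 1/2 * (LINT x|lebesgue_on \<Omega>. (norm (wgrad \<Omega> d x))\<^sup>2)"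
  by (simp add: energy_def Lp2_norm)

text \<open>The five arguments are the values of \<open>v\<close>, \<open>d\<close>, the gradients
  of \<open>v\<close> and \<open>d\<close>, and the cross product of \<open>d\<close> with its
  Laplacian. This growth is what energy and dissipation control; the bound is asked for unit
  directors only.\<close>

definition quadratic_growth :: "real => (vec3 \<times> vec3 \<times> mat3 \<times> mat3 \<times> vec3 => 'b::real_normed_vector) => bool" where
  "quadratic_growth C \<Phi> \<longleftrightarrow> (\<forall>a b A B q. norm b = 1 \<longrightarrow>
     norm (\<Phi> (a, b, A, B, q)) \<le> C * (1 + (norm a)\<^sup>2 + (norm A)\<^sup>2 + (norm B)\<^sup>2 + (norm q)\<^sup>2))"

locale ev_setting =
  fixes \<Omega> :: "vec3 set" and T lam \<mu>1 \<mu>4 \<mu>5 \<mu>6 :: real and v0 d0 d\<Gamma> :: field3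
    and v d :: "real => field3" and E :: "real => real"
  assumes op: "open \<Omega>" and T: "0 < T"
    and ev: "ev_solution \<Omega> T lam \<mu>1 \<mu>4 \<mu>5 \<mu>6 v0 d0 d\<Gamma> (weight_K \<Omega>) (ericksen_TE \<Omega>) v d E"
begin

abbreviation "L \<equiv> lebesgue_on \<Omega>"
abbreviation "I \<equiv> lebesgue_on {0<..<T}"

lemma cL: "complete_measure L" by (rule lebesgue_on_complete[OF op])
lemma cI: "complete_measure I" by (rule lebesgue_on_complete) simp
sublocale L: complete_measure L by (rule cL)
sublocale I: complete_measure I by (rule cI)

lemma v_weak: "v \<in> weak_cont T (L2_sol \<Omega>) (Lp_norm \<Omega> 2) (L2_sol \<Omega>)"
  and v_bochner: "v \<in> bochner_L2 T \<Omega> (H10_sol \<Omega>) (H1_norm \<Omega>)"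
  and E_BV: "E \<in> BV T"
  and d_weak: "d \<in> weak_cont T (H1 \<Omega>) (H1_norm \<Omega>) (H1_sphere \<Omega>)"
  and d_bochner: "d \<in> bochner_L2 T \<Omega> (Lp \<Omega> (3/2)) (Lp_norm \<Omega> (3/2))"
  and q_bochner: "(%t. cross_lap \<Omega> (d t)) \<in> bochner_L2 T \<Omega> (Lp \<Omega> 2) (Lp_norm \<Omega> 2)"
  and energy_le: "!!t. t \<in> {0..T} ==> energy \<Omega> (v t) (d t) \<le> E t"
  and v_init: "AE x in L. v 0 x = v0 x" and d_init: "AE x in L. d 0 x = d0 x"
  and dir_eq: "director_eq \<Omega> T lam v d"
  using ev unfolding ev_solution_def by auto

text \<open>A field of modulus 1 is square integrable only over a set of finite measure, and the
  director at time 0 is such a field.\<close>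

lemma finite_Omega: "\<Omega> \<in> lmeasurable"
proof -
  have "d 0 \<in> H1_sphere \<Omega>" using d_weak T by (auto simp: weak_cont_def)
  then have 1: "integrable L (%x. (norm (d 0 x))\<^sup>2)" and 2: "AE x in L. norm (d 0 x) = 1"
    by (auto simp: H1_sphere_def H1_def Lp2_iff)
  have "integrable L (%x. 1 :: real)" by (rule L.integrable_AE_cong[OF 1]) (use 2 in eventually_elim, simp)
  then have "(\<integral>\<^sup>+x. 1 \<partial>L) < \<infinity>" by (simp add: integrable_iff_bounded)
  then have "emeasure L \<Omega> < \<infinity>" by simp
  then have "emeasure lebesgue \<Omega> < \<infinity>" using op by (simp add: emeasure_restrict_space)
  then show ?thesis using op by (intro fmeasurableI) auto
qed

sublocale Lf: finite_measure L by (rule finite_measure_lebesgue_on[OF finite_Omega])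
sublocale If: finite_measure I by (rule finite_measure_lebesgue_on) simp
sublocale P: pair_sigma_finite I L ..

lemma AE_H: "AE t in I. v t \<in> H10_sol \<Omega> \<and> cross_lap \<Omega> (d t) \<in> Lp \<Omega> 2"
  using v_bochner q_bochner by (auto simp: bochner_L2_def)

lemma d_H1: "t \<in> {0..T} ==> d t \<in> H1 \<Omega> \<and> (AE x in L. norm (d t x) = 1)"
  using d_weak by (auto simp: weak_cont_def H1_sphere_def)

lemma v_L2: "t \<in> {0..T} ==> v t \<in> Lp \<Omega> 2"
  using v_weak by (auto simp: weak_cont_def L2_sol_def)

lemma AE_I_times: "AE t in I. t \<in> {0..T}"
  by (rule AE_I2) simp

lemma AE_good: "AE t in I. t \<in> {0..T} \<and> v t \<in> H10_sol \<Omega> \<and> v t \<in> H1 \<Omega> \<and> v t \<in> Lp \<Omega> 2 \<and> d t \<in> H1 \<Omega> \<and> (AE x in L. norm (d t x) = 1)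
    \<and> cross_lap \<Omega> (d t) \<in> Lp \<Omega> 2 \<and> wgrad \<Omega> (v t) \<in> Lp \<Omega> 2 \<and> wgrad \<Omega> (d t) \<in> Lp \<Omega> 2"
  using AE_H AE_I_times
proof eventually_elim
  case (elim t)
  then have "v t \<in> H1 \<Omega>" by (simp add: H10_sol_def)
  then show ?case using elim d_H1[of t] v_L2[of t] wgrad_H1[OF op] by auto
qed

abbreviation fields :: "real => vec3 => vec3 \<times> vec3 \<times> mat3 \<times> mat3 \<times> vec3" where
  "fields t x \<equiv> (v t x, d t x, wgrad \<Omega> (v t) x, wgrad \<Omega> (d t) x, cross_lap \<Omega> (d t) x)"

text \<open>The solution is given slice by slice, with \<open>wgrad\<close> and
  \<open>cross_lap\<close> chosen anew at each time. Fubini's theorem needs one jointly measurable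
  function that agrees with almost all slices almost everywhere.\<close>

lemma fields_representative:
  "\<exists>Z. Z \<in> borel_measurable (I \<Otimes>\<^sub>M L) \<and> (AE t in I. AE x in L. Z (t, x) = fields t x)"
proof -
  note O = finite_Omega op
  have vw: "(%t. LINT x|L. v t x $ i * \<phi> x) \<in> borel_measurable I" if "\<phi> \<in> test_fun \<Omega>" for \<phi> i
    by (rule bochner_weak_component[OF v_bochner that])
  have dw: "(%t. LINT x|L. d t x $ i * \<phi> x) \<in> borel_measurable I" if "\<phi> \<in> test_fun \<Omega>" for \<phi> i
    by (rule bochner_weak_component[OF d_bochner that])
  have qw: "(%t. LINT x|L. cross_lap \<Omega> (d t) x $ i * \<phi> x) \<in> borel_measurable I" if "\<phi> \<in> test_fun \<Omega>" for \<phi> i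
    by (rule bochner_weak_component[OF q_bochner that])
  have v2: "AE t in I. v t \<in> Lp \<Omega> 2" and q2: "AE t in I. cross_lap \<Omega> (d t) \<in> Lp \<Omega> 2"
    and v1: "AE t in I. v t \<in> H1 \<Omega>" and d1: "AE t in I. d t \<in> H1 \<Omega>"
    using AE_good by auto
  have d2: "AE t in I. d t \<in> Lp \<Omega> 2" using d1 by eventually_elim (simp add: H1_def)
  obtain V where V: "V \<in> borel_measurable (I \<Otimes>\<^sub>M L)" "AE t in I. AE x in L. V (t, x) = v t x"
    using joint_vec[OF O cI v2 vw] by blast
  obtain D where D: "D \<in> borel_measurable (I \<Otimes>\<^sub>M L)" "AE t in I. AE x in L. D (t, x) = d t x"
    using joint_vec[OF O cI d2 dw] by blast
  obtain Q where Q: "Q \<in> borel_measurable (I \<Otimes>\<^sub>M L)" "AE t in I. AE x in L. Q (t, x) = cross_lap \<Omega> (d t) x"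
    using joint_vec[OF O cI q2 qw] by blast
  obtain A where A: "A \<in> borel_measurable (I \<Otimes>\<^sub>M L)" "AE t in I. AE x in L. A (t, x) = wgrad \<Omega> (v t) x"
    using joint_grad[OF O cI v1 vw] by blast
  obtain B where B: "B \<in> borel_measurable (I \<Otimes>\<^sub>M L)" "AE t in I. AE x in L. B (t, x) = wgrad \<Omega> (d t) x"
    using joint_grad[OF O cI d1 dw] by blast
  have "AE t in I. AE x in L. (V (t, x), D (t, x), A (t, x), B (t, x), Q (t, x)) = fields t x"
    using V(2) D(2) A(2) B(2) Q(2)
  proof eventually_elim
    case (elim t)
    then show ?case by eventually_elim simp
  qed
  moreover have "(%p. (V p, D p, A p, B p, Q p)) \<in> borel_measurable (I \<Otimes>\<^sub>M L)"
    by (intro borel_measurable_Pair V D A B Q)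
  ultimately show ?thesis by (intro exI[of _ "%p. (V p, D p, A p, B p, Q p)"]) auto
qed

definition "rep = (SOME Z. Z \<in> borel_measurable (I \<Otimes>\<^sub>M L) \<and> (AE t in I. AE x in L. Z (t, x) = fields t x))"

lemma rep: "rep \<in> borel_measurable (I \<Otimes>\<^sub>M L)" "AE t in I. AE x in L. rep (t, x) = fields t x"
  using someI_ex[OF fields_representative] unfolding rep_def by auto

lemma E_bounded: "\<exists>C. \<forall>t\<in>{0..T}. \<bar>E t\<bar> \<le> C"
  using BV_bounded[OF E_BV T] by metis

lemma energy_nonneg: "0 \<le> energy \<Omega> u w"
  unfolding BV_mem_energy by (intro add_nonneg_nonneg mult_nonneg_nonneg) auto

definition weight :: "real => vec3 => real" where
  "weight t x = 1 + (norm (v t x))\<^sup>2 + (norm (wgrad \<Omega> (v t) x))\<^sup>2 + (norm (wgrad \<Omega> (d t) x))\<^sup>2 + (norm (cross_lap \<Omega> (d t) x))\<^sup>2"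

text \<open>A bound for the space integral of \<open>weight\<close> made of quantities whose
  integrability in time comes from the definition of a solution; the energy is replaced by
  \<open>E\<close>, which is bounded.\<close>

definition total_weight :: "real => real" where
  "total_weight t = measure lebesgue \<Omega> + 2 * E t + (H1_norm \<Omega> (v t))\<^sup>2 + (Lp_norm \<Omega> 2 (cross_lap \<Omega> (d t)))\<^sup>2"

lemma total_weight_integrable: "integrable I total_weight"
proof -
  obtain C where C: "!!t. t \<in> {0..T} ==> \<bar>E t\<bar> \<le> C" using E_bounded by blast
  have "integrable I E"
    using C by (intro If.integrable_const_bound[where B=C] BV_measurable[OF E_BV T]) auto
  then show ?thesis using v_bochner q_bochner unfolding total_weight_def[abs_def] bochner_L2_def by auto
qed

lemma weight_bound:
  "AE t in I. integrable L (weight t) \<and> (LINT x|L. weight t x) \<le> total_weight t"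
  using AE_good
proof eventually_elim
  case (elim t)
  have i: "integrable L (%x. (norm (v t x))\<^sup>2)" "integrable L (%x. (norm (wgrad \<Omega> (v t) x))\<^sup>2)"
    "integrable L (%x. (norm (wgrad \<Omega> (d t) x))\<^sup>2)" "integrable L (%x. (norm (cross_lap \<Omega> (d t) x))\<^sup>2)"
    using elim by (auto simp: Lp2_iff)
  then have 1: "integrable L (weight t)" unfolding weight_def[abs_def] by auto
  have m: "measure L \<Omega> = measure lebesgue \<Omega>" using op by (subst measure_restrict_space) auto
  have "(LINT x|L. weight t x) = measure lebesgue \<Omega> + (LINT x|L. (norm (v t x))\<^sup>2) + (LINT x|L. (norm (wgrad \<Omega> (v t) x))\<^sup>2)
     + (LINT x|L. (norm (wgrad \<Omega> (d t) x))\<^sup>2) + (LINT x|L. (norm (cross_lap \<Omega> (d t) x))\<^sup>2)"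
    unfolding weight_def[abs_def] using i by (simp add: m)
  moreover have "(LINT x|L. (norm (v t x))\<^sup>2) + (LINT x|L. (norm (wgrad \<Omega> (d t) x))\<^sup>2) \<le> 2 * E t"
    using energy_le[of t] elim by (simp add: BV_mem_energy)
  moreover have "(LINT x|L. (norm (wgrad \<Omega> (v t) x))\<^sup>2) \<le> (H1_norm \<Omega> (v t))\<^sup>2"
    by (simp add: H1_norm_def Lp2_norm)
  moreover have "(LINT x|L. (norm (cross_lap \<Omega> (d t) x))\<^sup>2) = (Lp_norm \<Omega> 2 (cross_lap \<Omega> (d t)))\<^sup>2" by (simp add: Lp2_norm)
  ultimately show ?case using 1 by (simp add: total_weight_def)
qed

text \<open>Quadratic growth is dominated by \<open>weight\<close>, whose space integral is at most
  \<open>total_weight\<close> and so integrable in time. Continuity transfers measurability from the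
  representative to the expression.\<close>

lemma integrable_expression:
  fixes \<Phi> :: "vec3 \<times> vec3 \<times> mat3 \<times> mat3 \<times> vec3 => 'b::euclidean_space"
  assumes cont: "continuous_on UNIV \<Phi>"
    and bound: "quadratic_growth C \<Phi>"
  shows "integrable (I \<Otimes>\<^sub>M L) (%p. \<Phi> (rep p))" "AE t in I. AE x in L. \<Phi> (rep (t, x)) = \<Phi> (fields t x)"
    "AE t in I. integrable L (%x. \<Phi> (fields t x))"
proof -
  let ?C = "\<bar>C\<bar>"
  have m: "(%p. \<Phi> (rep p)) \<in> borel_measurable (I \<Otimes>\<^sub>M L)"
    by (rule measurable_compose[OF rep(1)]) (rule borel_measurable_continuous_onI[OF cont])
  show ae: "AE t in I. AE x in L. \<Phi> (rep (t, x)) = \<Phi> (fields t x)"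
    using rep(2) by eventually_elim (auto elim: eventually_mono)
  have mt: "(%x. \<Phi> (rep (t, x))) \<in> borel_measurable L" if "t \<in> space I" for t
    using measurable_compose[OF measurable_Pair1'[OF that, of L] m] by (simp add: o_def)
  have b: "AE t in I. AE x in L. norm (\<Phi> (rep (t, x))) \<le> ?C * weight t x"
    using ae AE_good
  proof eventually_elim
    case (elim t)
    then have "AE x in L. \<Phi> (rep (t, x)) = \<Phi> (fields t x)" "AE x in L. norm (d t x) = 1" by auto
    then show ?case
    proof eventually_elim
      case (elim x)
      have "norm (\<Phi> (fields t x)) \<le> C * weight t x" unfolding weight_def by (rule bound[unfolded quadratic_growth_def, rule_format, OF elim(2)])
      also have "\<dots> \<le> ?C * weight t x" by (intro mult_right_mono) (auto simp: weight_def intro!: add_nonneg_nonneg)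
      finally show ?case using elim by simp
    qed
  qed
  have it: "AE t in I. integrable L (%x. \<Phi> (rep (t, x))) \<and> (\<integral>\<^sup>+x. norm (\<Phi> (rep (t, x))) \<partial>L) \<le> ennreal (?C * total_weight t)"
    using b weight_bound AE_space
  proof eventually_elim
    case (elim t)
    have w: "integrable L (%x. ?C * weight t x)" using elim by auto
    have w0: "0 \<le> weight t x" for x by (auto simp: weight_def intro!: add_nonneg_nonneg)
    have 1: "integrable L (%x. \<Phi> (rep (t, x)))"
    proof (rule Bochner_Integration.integrable_bound[OF w mt[OF elim(3)]])
      show "AE x in L. norm (\<Phi> (rep (t, x))) \<le> norm (?C * weight t x)"
        using elim(1) by eventually_elim (simp add: w0 abs_mult)
    qed
    have "(\<integral>\<^sup>+x. norm (\<Phi> (rep (t, x))) \<partial>L) \<le> (\<integral>\<^sup>+x. ennreal (?C * weight t x) \<partial>L)"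
      using elim(1) by (intro nn_integral_mono_AE) (auto elim!: eventually_mono intro: ennreal_leI)
    also have "\<dots> = ennreal (LINT x|L. ?C * weight t x)"
      by (rule nn_integral_eq_integral[OF w]) (simp add: w0)
    also have "\<dots> \<le> ennreal (?C * total_weight t)"
      using elim(2) by (intro ennreal_leI) (simp add: mult_left_mono)
    finally show ?case using 1 by blast
  qed
  show "AE t in I. integrable L (%x. \<Phi> (fields t x))"
    using it ae by eventually_elim (auto intro: L.integrable_AE_cong)
  have tw: "(\<integral>\<^sup>+t. ennreal (?C * total_weight t) \<partial>I) < \<infinity>"
  proof -
    have "integrable I (%t. ?C * total_weight t)" using total_weight_integrable by auto
    then have "(\<integral>\<^sup>+t. ennreal (norm (?C * total_weight t)) \<partial>I) < \<infinity>"
      using integrable_iff_bounded[of I "%t. ?C * total_weight t"] by blast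
    moreover have "(\<integral>\<^sup>+t. ennreal (?C * total_weight t) \<partial>I) \<le> (\<integral>\<^sup>+t. ennreal (norm (?C * total_weight t)) \<partial>I)"
      by (intro nn_integral_mono ennreal_leI) simp
    ultimately show ?thesis by (rule le_less_trans[rotated])
  qed
  show "integrable (I \<Otimes>\<^sub>M L) (%p. \<Phi> (rep p))"
  proof (rule integrableI_bounded[OF m])
    have "(\<integral>\<^sup>+p. norm (\<Phi> (rep p)) \<partial>(I \<Otimes>\<^sub>M L)) = (\<integral>\<^sup>+t. \<integral>\<^sup>+x. norm (\<Phi> (rep (t, x))) \<partial>L \<partial>I)"
      using m by (intro Lf.nn_integral_fst[symmetric]) auto
    also have "\<dots> \<le> (\<integral>\<^sup>+t. ennreal (?C * total_weight t) \<partial>I)"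
      using it by (intro nn_integral_mono_AE) auto
    also have "\<dots> < \<infinity>" by (rule tw)
    finally show "(\<integral>\<^sup>+p. norm (\<Phi> (rep p)) \<partial>(I \<Otimes>\<^sub>M L)) < \<infinity>" .
  qed
qed

lemma integral_expression:
  fixes \<Phi> :: "vec3 \<times> vec3 \<times> mat3 \<times> mat3 \<times> vec3 => real"
  assumes cont: "continuous_on UNIV \<Phi>"
    and bound: "quadratic_growth C \<Phi>"
  shows "integrable I (%t. LINT x|L. \<Phi> (fields t x))"
proof (rule I.integrable_AE_cong)
  show "integrable I (%t. LINT x|L. \<Phi> (rep (t, x)))"
    using P.integrable_fst'[OF integrable_expression(1)[OF cont bound]] by simp
  show "AE t in I. (LINT x|L. \<Phi> (rep (t, x))) = (LINT x|L. \<Phi> (fields t x))"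
    using integrable_expression(2)[OF cont bound] by eventually_elim (rule L.integral_AE_cong)
qed

lemma integral_pairing:
  fixes \<Phi> :: "vec3 \<times> vec3 \<times> mat3 \<times> mat3 \<times> vec3 => mat3"
  assumes cont: "continuous_on UNIV \<Phi>"
    and bound: "quadratic_growth C \<Phi>"
    and G: "continuous_on UNIV G" "!!x. norm (G x) \<le> K"
  shows "AE t in I. integrable L (%x. \<Phi> (fields t x) \<bullet> G x)" "integrable I (%t. LINT x|L. \<Phi> (fields t x) \<bullet> G x)"
proof -
  have Gm: "G \<in> borel_measurable L" by (intro borel_lebesgue_on borel_measurable_continuous_onI G)
  have ib: "norm (A \<bullet> G x) \<le> norm (K *\<^sub>R A)" for A x
  proof -
    have "0 \<le> K" using G(2)[of x] norm_ge_zero[of "G x"] by linarith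
    then show ?thesis
      using Cauchy_Schwarz_ineq2[of A "G x"] mult_left_mono[OF G(2)[of x], of "norm A"] by (simp add: mult.commute)
  qed
  have pi: "integrable (I \<Otimes>\<^sub>M L) (%p. \<Phi> (rep p) \<bullet> G (snd p))"
  proof (rule Bochner_Integration.integrable_bound[OF integrable_scaleR_right[OF integrable_expression(1)[OF cont bound], of K]])
    have "(%p. \<Phi> (rep p)) \<in> borel_measurable (I \<Otimes>\<^sub>M L)"
      by (rule borel_measurable_integrable[OF integrable_expression(1)[OF cont bound]])
    moreover have "(%p. G (snd p)) \<in> borel_measurable (I \<Otimes>\<^sub>M L)" using Gm by measurable
    ultimately show "(%p. \<Phi> (rep p) \<bullet> G (snd p)) \<in> borel_measurable (I \<Otimes>\<^sub>M L)" by (rule borel_measurable_inner)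
  qed (use ib in auto)
  show 1: "AE t in I. integrable L (%x. \<Phi> (fields t x) \<bullet> G x)"
    using integrable_expression(3)[OF cont bound]
  proof eventually_elim
    case (elim t)
    show ?case
    proof (rule Bochner_Integration.integrable_bound[OF integrable_scaleR_right[OF elim, of K]])
      show "(%x. \<Phi> (fields t x) \<bullet> G x) \<in> borel_measurable L"
        by (rule borel_measurable_inner[OF borel_measurable_integrable[OF elim] Gm])
    qed (use ib in auto)
  qed
  show "integrable I (%t. LINT x|L. \<Phi> (fields t x) \<bullet> G x)"
  proof (rule I.integrable_AE_cong)
    show "integrable I (%t. LINT x|L. \<Phi> (rep (t, x)) \<bullet> G x)"
      using P.integrable_fst'[OF pi] by simp
    show "AE t in I. (LINT x|L. \<Phi> (rep (t, x)) \<bullet> G x) = (LINT x|L. \<Phi> (fields t x) \<bullet> G x)"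
      using integrable_expression(2)[OF cont bound]
    proof eventually_elim
      case (elim t)
      show ?case by (rule L.integral_AE_cong) (use elim in eventually_elim, simp)
    qed
  qed
qed

end

section \<open>Stresses, gap and moments as functions of time\<close>

lemma continuous_transpose: "continuous_on A f ==> continuous_on A (%x. transpose (f x :: real ^ 'n ^ 'm))"
  by (rule bounded_linear.continuous_on[OF linear_conv_bounded_linear[THEN iffD1, OF linear_transpose]])

lemma continuous_msym: "continuous_on A f ==> continuous_on A (%x. msym (f x))"
  by (rule bounded_linear.continuous_on[OF bounded_linear_msym])

lemma continuous_mskw: "continuous_on A f ==> continuous_on A (%x. mskw (f x))"
  unfolding mskw_def by (intro continuous_intros continuous_transpose)

lemma continuous_tensor: "continuous_on A f ==> continuous_on A g ==> continuous_on A (%x. tensor (f x) (g x))"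
  unfolding tensor_def by (intro continuous_on_vec_lambda continuous_intros)

lemma continuous_matvec:
  "continuous_on A f ==> continuous_on A g ==> continuous_on A (%x. (f x :: real ^ 'n ^ 'm) *v g x)"
  unfolding matrix_vector_mult_def by (intro continuous_on_vec_lambda continuous_intros)

lemma continuous_matmul:
  "continuous_on A f ==> continuous_on A g ==> continuous_on A (%x. (f x :: real ^ 'n ^ 'm) ** (g x :: real ^ 'p ^ 'n))"
  unfolding matrix_matrix_mult_def by (intro continuous_on_vec_lambda continuous_intros)

lemmas matrix_continuous_intros = continuous_transpose continuous_msym continuous_mskw continuous_tensor
  continuous_matvec continuous_matmul continuous_on_cross

lemma continuous_stress_D:
  "continuous_on A f ==> continuous_on A g ==> continuous_on A (%x. stress_D lam \<mu>1 \<mu>4 \<mu>5 \<mu>6 (f x) (g x))"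
  unfolding stress_D_def by (intro continuous_intros matrix_continuous_intros)

lemma continuous_stress_el:
  "continuous_on A f ==> continuous_on A g ==> continuous_on A (%x. stress_el lam (f x) (g x))"
  unfolding stress_el_def by (intro continuous_intros matrix_continuous_intros)

definition conv_stress :: "vec3 \<times> vec3 \<times> mat3 \<times> mat3 \<times> vec3 => mat3" where
  "conv_stress = (%(a, b, A, B, q). tensor a a)"
definition erick_stress :: "vec3 \<times> vec3 \<times> mat3 \<times> mat3 \<times> vec3 => mat3" where
  "erick_stress = (%(a, b, A, B, q). transpose B ** B)"

context ev_setting
begin

definition diss_stress :: "vec3 \<times> vec3 \<times> mat3 \<times> mat3 \<times> vec3 => mat3" where
  "diss_stress = (%(a, b, A, B, q). stress_D lam \<mu>1 \<mu>4 \<mu>5 \<mu>6 b A)"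
definition elastic_stress :: "vec3 \<times> vec3 \<times> mat3 \<times> mat3 \<times> vec3 => mat3" where
  "elastic_stress = (%(a, b, A, B, q). stress_el lam b (- cross3 b q))"
definition dissipation :: "vec3 \<times> vec3 \<times> mat3 \<times> mat3 \<times> vec3 => real" where
  "dissipation = (%(a, b, A, B, q). stress_D lam \<mu>1 \<mu>4 \<mu>5 \<mu>6 b A \<bullet> A + (norm q)\<^sup>2)"
text \<open>Minus the total stress of the momentum balance, that is \<open>stress_L\<close> less the
  convective and the Ericksen part.\<close>

definition flux :: "vec3 \<times> vec3 \<times> mat3 \<times> mat3 \<times> vec3 => mat3" where
  "flux z = conv_stress z + erick_stress z - diss_stress z - elastic_stress z"

definition "DC = \<bar>\<mu>1 + lam\<^sup>2\<bar> + \<bar>\<mu>4\<bar> + \<bar>\<mu>5 + \<mu>6 - lam\<^sup>2\<bar>"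
definition "BC = DC + \<bar>lam\<bar> + 2"

lemma DC: "0 \<le> DC" "DC \<le> BC" "1 \<le> BC" "\<bar>lam\<bar> + 1 \<le> BC" by (auto simp: DC_def BC_def)

lemma continuous_stresses: "continuous_on UNIV conv_stress" "continuous_on UNIV erick_stress"
  "continuous_on UNIV diss_stress" "continuous_on UNIV elastic_stress" "continuous_on UNIV dissipation" "continuous_on UNIV flux"
proof -
  show 1: "continuous_on UNIV conv_stress" "continuous_on UNIV erick_stress"
    "continuous_on UNIV diss_stress" "continuous_on UNIV elastic_stress"
    unfolding conv_stress_def erick_stress_def diss_stress_def elastic_stress_def split_beta
    by (intro continuous_intros matrix_continuous_intros continuous_stress_D continuous_stress_el)+
  show "continuous_on UNIV dissipation"
    unfolding dissipation_def split_beta by (intro continuous_intros continuous_stress_D)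
  show "continuous_on UNIV flux"
    unfolding flux_def[abs_def] by (intro continuous_intros 1)
qed

lemma le_sq: "x \<le> 1 + x\<^sup>2" for x :: real
  using zero_le_power2[of "x - 1/2"] by (simp add: power2_eq_square algebra_simps)

lemma stress_bounds:
  fixes a b q :: vec3 and A B :: mat3
  assumes b: "norm b = 1"
  defines "W \<equiv> 1 + (norm a)\<^sup>2 + (norm A)\<^sup>2 + (norm B)\<^sup>2 + (norm q)\<^sup>2"
  shows "norm (conv_stress (a, b, A, B, q)) \<le> BC * W" "norm (erick_stress (a, b, A, B, q)) \<le> BC * W"
    "norm (diss_stress (a, b, A, B, q)) \<le> BC * W" "norm (elastic_stress (a, b, A, B, q)) \<le> BC * W"
    "norm (dissipation (a, b, A, B, q)) \<le> BC * W" "norm (flux (a, b, A, B, q)) \<le> (4 * BC) * W"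
proof -
  have W: "0 \<le> W" by (auto simp: W_def intro!: add_nonneg_nonneg)
  have WB: "W \<le> BC * W" using mult_right_mono[OF DC(3) W] by simp
  have "norm (tensor a a) = (norm a)\<^sup>2" by (simp add: norm_tensor power2_eq_square)
  also have "\<dots> \<le> W" by (simp add: W_def)
  finally show 1: "norm (conv_stress (a, b, A, B, q)) \<le> BC * W" using WB by (simp add: conv_stress_def)
  have "norm (transpose B ** B) \<le> (norm B)\<^sup>2"
    using norm_matrix_mult_le[of "transpose B" B] by (simp add: norm_transpose power2_eq_square)
  also have "\<dots> \<le> W" by (simp add: W_def)
  finally show 2: "norm (erick_stress (a, b, A, B, q)) \<le> BC * W" using WB by (simp add: erick_stress_def)
  have D: "norm (stress_D lam \<mu>1 \<mu>4 \<mu>5 \<mu>6 b A) \<le> DC * norm A" unfolding DC_def by (rule norm_stress_D_le[OF b])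
  also have "\<dots> \<le> BC * W"
  proof (rule mult_mono)
    have "norm A \<le> 1 + (norm A)\<^sup>2" by (rule le_sq)
    also have "\<dots> \<le> W" by (simp add: W_def)
    finally show "norm A \<le> W" .
  qed (use DC in auto)
  finally show 3: "norm (diss_stress (a, b, A, B, q)) \<le> BC * W" by (simp add: diss_stress_def)
  have "norm (stress_el lam b (- cross3 b q)) \<le> (\<bar>lam\<bar> + 1) * norm q"
  proof -
    have "norm (stress_el lam b (- cross3 b q)) \<le> (\<bar>lam\<bar> + 1) * norm (cross3 b q)"
      using norm_stress_el_le[of lam b "- cross3 b q"] b by simp
    also have "\<dots> \<le> (\<bar>lam\<bar> + 1) * norm q"
      using norm_cross3_le[of b q] b by (intro mult_left_mono) auto
    finally show ?thesis .
  qed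
  also have "\<dots> \<le> BC * W"
  proof (rule mult_mono)
    have "norm q \<le> 1 + (norm q)\<^sup>2" by (rule le_sq)
    also have "\<dots> \<le> W" by (simp add: W_def)
    finally show "norm q \<le> W" .
  qed (use DC in auto)
  finally show 4: "norm (elastic_stress (a, b, A, B, q)) \<le> BC * W" by (simp add: elastic_stress_def)
  have "\<bar>stress_D lam \<mu>1 \<mu>4 \<mu>5 \<mu>6 b A \<bullet> A\<bar> \<le> DC * norm A * norm A"
    using Cauchy_Schwarz_ineq2[of "stress_D lam \<mu>1 \<mu>4 \<mu>5 \<mu>6 b A" A] mult_right_mono[OF D norm_ge_zero[of A]] by linarith
  then have "\<bar>stress_D lam \<mu>1 \<mu>4 \<mu>5 \<mu>6 b A \<bullet> A\<bar> \<le> DC * (norm A)\<^sup>2" by (simp add: power2_eq_square mult.assoc)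
  moreover have "\<bar>(norm q)\<^sup>2\<bar> = (norm q)\<^sup>2" by simp
  ultimately have "\<bar>stress_D lam \<mu>1 \<mu>4 \<mu>5 \<mu>6 b A \<bullet> A + (norm q)\<^sup>2\<bar> \<le> DC * (norm A)\<^sup>2 + 1 * (norm q)\<^sup>2"
    using abs_triangle_ineq[of "stress_D lam \<mu>1 \<mu>4 \<mu>5 \<mu>6 b A \<bullet> A" "(norm q)\<^sup>2"] by linarith
  also have "\<dots> \<le> BC * (norm A)\<^sup>2 + BC * (norm q)\<^sup>2"
    using DC by (intro add_mono mult_right_mono) auto
  also have "\<dots> \<le> BC * W" unfolding distrib_left[symmetric] using DC by (intro mult_left_mono) (auto simp: W_def)
  finally show "norm (dissipation (a, b, A, B, q)) \<le> BC * W" by (simp add: dissipation_def)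
  have "norm (flux (a, b, A, B, q)) \<le> norm (conv_stress (a, b, A, B, q)) + norm (erick_stress (a, b, A, B, q))
     + norm (diss_stress (a, b, A, B, q)) + norm (elastic_stress (a, b, A, B, q))"
    unfolding flux_def
    using norm_triangle_ineq4[of "conv_stress (a, b, A, B, q) + erick_stress (a, b, A, B, q) - diss_stress (a, b, A, B, q)" "elastic_stress (a, b, A, B, q)"]
      norm_triangle_ineq4[of "conv_stress (a, b, A, B, q) + erick_stress (a, b, A, B, q)" "diss_stress (a, b, A, B, q)"]
      norm_triangle_ineq[of "conv_stress (a, b, A, B, q)" "erick_stress (a, b, A, B, q)"] by linarith
  then show "norm (flux (a, b, A, B, q)) \<le> (4 * BC) * W"
    unfolding mult.assoc using 1 2 3 4 by linarith
qed

lemma bounds_all: "quadratic_growth BC conv_stress" "quadratic_growth BC erick_stress" "quadratic_growth BC diss_stress"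
  "quadratic_growth BC elastic_stress" "quadratic_growth BC dissipation" "quadratic_growth (4 * BC) flux"
  unfolding quadratic_growth_def by (intro allI impI stress_bounds; assumption)+

lemma proj_lap_eq: "proj_lap \<Omega> (d t) x = - cross3 (d t x) (cross_lap \<Omega> (d t) x)"
  by (simp add: proj_lap_def)

lemma energy_measurable: "integrable I (%t. energy \<Omega> (v t) (d t))"
proof -
  have 1: "integrable I (%t. LINT x|L. (%(a, b, A, B, q). (norm a)\<^sup>2) (fields t x))"
    by (rule integral_expression[where C=1]) (auto simp: quadratic_growth_def split_beta intro!: continuous_intros)
  have 2: "integrable I (%t. LINT x|L. (%(a, b, A, B, q). (norm B)\<^sup>2) (fields t x))"
    by (rule integral_expression[where C=1]) (auto simp: quadratic_growth_def split_beta intro!: continuous_intros)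
  show ?thesis unfolding BV_mem_energy using 1 2 by simp
qed

definition gap :: "real => real" where "gap t = E t - energy \<Omega> (v t) (d t)"

lemma gap_nonneg: "t \<in> {0..T} ==> 0 \<le> gap t" using energy_le by (simp add: gap_def)

lemma gap_integrable: "integrable I gap"
proof -
  obtain C where C: "!!t. t \<in> {0..T} ==> \<bar>E t\<bar> \<le> C" using E_bounded by blast
  have "integrable I E"
    using C by (intro If.integrable_const_bound[where B=C] BV_measurable[OF E_BV T]) auto
  then show ?thesis unfolding gap_def[abs_def] using energy_measurable by auto
qed

lemma gap_bounded: "\<exists>C\<ge>0. \<forall>t\<in>{0..T}. gap t \<le> C"
proof -
  obtain C where C: "!!t. t \<in> {0..T} ==> \<bar>E t\<bar> \<le> C" using E_bounded by blast
  have "gap t \<le> \<bar>C\<bar>" if "t \<in> {0..T}" for t using C[OF that] energy_nonneg[of "v t" "d t"] by (simp add: gap_def)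
  then show ?thesis by (intro exI[of _ "\<bar>C\<bar>"]) auto
qed

definition moment :: "field3 => real => real" where "moment \<phi> t = (LINT x|L. v t x \<bullet> \<phi> x)"
definition force :: "field3 => real => real" where "force \<phi> t = (LINT x|L. flux (fields t x) \<bullet> jacobian \<phi> (at x))"

lemma Lp2_inner_integrable:
  fixes u w :: "vec3 => 'b::euclidean_space"
  assumes "u \<in> Lp \<Omega> 2" "w \<in> Lp \<Omega> 2"
  shows "integrable L (%x. u x \<bullet> w x)" "\<bar>LINT x|L. u x \<bullet> w x\<bar> \<le> Lp_norm \<Omega> 2 u * Lp_norm \<Omega> 2 w"
proof -
  have m: "u \<in> borel_measurable L" "w \<in> borel_measurable L" "integrable L (%x. (norm (u x))\<^sup>2)" "integrable L (%x. (norm (w x))\<^sup>2)"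
    using assms by (auto simp: Lp2_iff)
  have nn: "integrable L (%x. norm (u x) * norm (w x))" by (rule integrable_mult_square) (use m in auto)
  show i: "integrable L (%x. u x \<bullet> w x)"
    by (rule Bochner_Integration.integrable_bound[OF nn]) (use m Cauchy_Schwarz_ineq2 in \<open>auto intro: borel_measurable_inner\<close>)
  define a b c where "a = (LINT x|L. (norm (u x))\<^sup>2)" and "b = (LINT x|L. u x \<bullet> w x)" and "c = (LINT x|L. (norm (w x))\<^sup>2)"
  \<comment> \<open>The squared norm of \<open>s u + w\<close> is nonnegative for every
    \<open>s\<close>, which is the discriminant form of the Cauchy-Schwarz inequality;
    \<open>a = 0\<close> is the degenerate case.\<close>
  have q: "0 \<le> s\<^sup>2 * a + 2 * s * b + c" for s
  proof -
    have "0 \<le> (LINT x|L. (norm (s *\<^sub>R u x + w x))\<^sup>2)" by simp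
    also have "\<dots> = (LINT x|L. s\<^sup>2 * (norm (u x))\<^sup>2 + 2 * s * (u x \<bullet> w x) + (norm (w x))\<^sup>2)"
    proof (rule Bochner_Integration.integral_cong[OF refl])
      show "(norm (s *\<^sub>R u x + w x))\<^sup>2 = s\<^sup>2 * (norm (u x))\<^sup>2 + 2 * s * (u x \<bullet> w x) + (norm (w x))\<^sup>2" for x
        unfolding power2_norm_eq_inner power2_eq_square[of s]
        by (simp only: inner_add_left inner_add_right inner_scaleR_left inner_scaleR_right inner_commute[of "w x" "u x"] distrib_left mult.assoc)
    qed
    also have "\<dots> = s\<^sup>2 * a + 2 * s * b + c" using m i by (simp add: a_def b_def c_def)
    finally show ?thesis .
  qed
  have a0: "0 \<le> a" "0 \<le> c" by (auto simp: a_def c_def)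
  have "b\<^sup>2 \<le> a * c"
  proof (cases "a = 0")
    case True
    have "b = 0"
    proof (rule ccontr)
      assume "b \<noteq> 0"
      then show False using q[of "- (c + 1) / (2 * b)"] True by (simp add: field_simps)
    qed
    then show ?thesis using True by simp
  next
    case False
    then have "a > 0" using a0 by simp
    have "0 \<le> a * ((- b / a)\<^sup>2 * a + 2 * (- b / a) * b + c)" using q[of "- b / a"] a0 by simp
    also have "\<dots> = a * c - b\<^sup>2" using \<open>a > 0\<close> by (simp add: field_simps power2_eq_square)
    finally show ?thesis by simp
  qed
  then have "b\<^sup>2 \<le> (Lp_norm \<Omega> 2 u * Lp_norm \<Omega> 2 w)\<^sup>2" by (simp add: power_mult_distrib Lp2_norm a_def c_def)
  then show "\<bar>LINT x|L. u x \<bullet> w x\<bar> \<le> Lp_norm \<Omega> 2 u * Lp_norm \<Omega> 2 w"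
    using Lp_norm_nonneg[of \<Omega> 2 u] Lp_norm_nonneg[of \<Omega> 2 w] by (simp add: power2_le_iff_abs_le b_def)
qed

lemma moment_continuous:
  assumes "\<phi> \<in> Lp \<Omega> 2"
  shows "continuous_on {0..T} (moment \<phi>)"
proof -
  have L2: "u \<in> Lp \<Omega> 2" if "u \<in> L2_sol \<Omega>" for u using that by (simp add: L2_sol_def)
  have "(%u. LINT x|L. u x \<bullet> \<phi> x) \<in> dual (L2_sol \<Omega>) (Lp_norm \<Omega> 2)"
    unfolding dual_def
  proof (intro CollectI conjI ballI allI)
    fix u w assume "u \<in> L2_sol \<Omega>" "w \<in> L2_sol \<Omega>"
    then show "(LINT x|L. (u x + w x) \<bullet> \<phi> x) = (LINT x|L. u x \<bullet> \<phi> x) + (LINT x|L. w x \<bullet> \<phi> x)"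
      using Lp2_inner_integrable(1)[OF L2 assms] by (simp add: inner_add_left)
  next
    fix u c assume "u \<in> L2_sol \<Omega>"
    show "(LINT x|L. (c *\<^sub>R u x) \<bullet> \<phi> x) = c * (LINT x|L. u x \<bullet> \<phi> x)" by simp
  next
    show "\<exists>C. \<forall>u\<in>L2_sol \<Omega>. \<bar>LINT x|L. u x \<bullet> \<phi> x\<bar> \<le> C * Lp_norm \<Omega> 2 u"
      using Lp2_inner_integrable(2)[OF L2 assms] by (intro exI[of _ "Lp_norm \<Omega> 2 \<phi>"]) (auto simp: mult.commute)
  qed
  moreover have "\<forall>F\<in>dual (L2_sol \<Omega>) (Lp_norm \<Omega> 2). continuous_on {0..T} (%t. F (v t))"
    using v_weak by (simp add: weak_cont_def)
  ultimately have "continuous_on {0..T} (%t. (%u. LINT x|L. u x \<bullet> \<phi> x) (v t))" by (rule bspec[rotated])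
  then show ?thesis by (simp add: moment_def[abs_def])
qed

lemma v_norm_bounded: "\<exists>C\<ge>0. \<forall>t\<in>{0..T}. Lp_norm \<Omega> 2 (v t) \<le> C"
proof -
  obtain C where C: "!!t. t \<in> {0..T} ==> \<bar>E t\<bar> \<le> C" using E_bounded by blast
  have "Lp_norm \<Omega> 2 (v t) \<le> 1 + 2 * \<bar>C\<bar>" if t: "t \<in> {0..T}" for t
  proof -
    have "(Lp_norm \<Omega> 2 (v t))\<^sup>2 \<le> 2 * energy \<Omega> (v t) (d t)" by (simp add: energy_def)
    also have "\<dots> \<le> 2 * \<bar>C\<bar>" using energy_le[OF t] C[OF t] by simp
    finally show ?thesis using le_sq[of "Lp_norm \<Omega> 2 (v t)"] by linarith
  qed
  then show ?thesis by (intro exI[of _ "1 + 2 * \<bar>C\<bar>"]) auto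
qed

end

section \<open>The weight and the convective term of a test field\<close>

lemma continuous_AE_eq_open:
  fixes f g :: "'a::euclidean_space => 'b::euclidean_space"
  assumes "open S" "continuous_on S f" "continuous_on S g" "AE x in lebesgue_on S. f x = g x" "x \<in> S"
  shows "f x = g x"
proof (rule ccontr)
  assume ne: "f x \<noteq> g x"
  let ?D = "{x \<in> S. f x - g x \<in> - {0}}"
  have eq: "?D = S \<inter> (%x. f x - g x) -` (- {0})" by auto
  have "open ?D" unfolding eq using assms(1-3) by (intro continuous_open_preimage continuous_intros) auto
  moreover have "AE x in lebesgue. x \<in> S \<longrightarrow> f x = g x" using assms(1,4) by (subst (asm) AE_lebesgue_on_iff) auto
  then have "AE x in lebesgue. x \<notin> ?D" by eventually_elim auto
  then have "?D \<in> null_sets lebesgue"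
    using \<open>open ?D\<close> by (subst AE_iff_null_sets) auto
  then have "negligible ?D" by (simp add: negligible_iff_null_sets)
  ultimately show False using open_not_negligible[of ?D] ne assms(5) by auto
qed

text \<open>\<open>C_norm\<close> evaluates an arbitrarily chosen continuous representative on the
  closure. It agrees almost everywhere with the negative part of the classical Jacobian, by
  continuity everywhere in \<open>\<Omega>\<close>, and the pointwise bound extends to the
  closure.\<close>

lemma weight_K_bound:
  assumes \<Omega>: "open \<Omega>" and w: "w \<in> test_fun \<Omega>" and q: "!!x. psd_dist (jacobian w (at x)) \<le> q"
  shows "weight_K \<Omega> w \<le> ennreal (2 * q)"
proof -
  have q0: "0 \<le> q" using q[of 0] psd_dist_nonneg[of "jacobian w (at 0)"] by linarith
  let ?h0 = "%x. neg_part (jacobian w (at x))"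
  have c0: "continuous_on UNIV ?h0"
    by (rule continuous_on_compose2[OF continuous_neg_part continuous_jacobian[OF C1_test_fun[OF w]]]) auto
  have n0: "norm (?h0 x) \<le> q" for x using q[of x] by (simp add: psd_dist_def)
  have ex: "cont_rep \<Omega> (%x. neg_part (wgrad \<Omega> w x)) ?h0"
    unfolding cont_rep_def
  proof (intro conjI)
    show "continuous_on (closure \<Omega>) ?h0" using c0 by (rule continuous_on_subset) auto
    show "bounded (?h0 ` closure \<Omega>)" using n0 by (auto simp: bounded_iff)
    show "AE x in lebesgue_on \<Omega>. neg_part (wgrad \<Omega> w x) = neg_part (jacobian w (at x))"
      using test_fun_wgrad[OF \<Omega> w] by eventually_elim simp
  qed
  define h where "h = (SOME h. cont_rep \<Omega> (%x. neg_part (wgrad \<Omega> w x)) h)"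
  have h: "cont_rep \<Omega> (%x. neg_part (wgrad \<Omega> w x)) h" unfolding h_def by (rule someI[of "cont_rep \<Omega> (%x. neg_part (wgrad \<Omega> w x))", OF ex])
  have eq: "h x = ?h0 x" if "x \<in> \<Omega>" for x
  proof (rule continuous_AE_eq_open[OF \<Omega> _ _ _ that])
    show "continuous_on \<Omega> h" using h closure_subset unfolding cont_rep_def by (blast intro: continuous_on_subset)
    show "continuous_on \<Omega> ?h0" using c0 by (rule continuous_on_subset) auto
    have 1: "AE x in lebesgue_on \<Omega>. neg_part (wgrad \<Omega> w x) = h x" using h by (simp add: cont_rep_def)
    have 2: "AE x in lebesgue_on \<Omega>. neg_part (wgrad \<Omega> w x) = ?h0 x" using ex by (simp add: cont_rep_def)
    show "AE x in lebesgue_on \<Omega>. h x = ?h0 x" using 1 2 by eventually_elim simp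
  qed
  have hn: "norm (h x) \<le> q" if "x \<in> closure \<Omega>" for x
    by (rule continuous_on_closure_norm_le[OF _ _ that]) (use h eq n0 in \<open>auto simp: cont_rep_def\<close>)
  have "C_norm \<Omega> (%x. neg_part (wgrad \<Omega> w x)) = (SUP x\<in>closure \<Omega>. ennreal (spectral_norm (h x)))"
    unfolding C_norm_def h_def using ex by auto
  also have "\<dots> \<le> ennreal q"
    by (intro SUP_least ennreal_leI order_trans[OF spectral_norm_le] hn)
  finally have "weight_K \<Omega> w \<le> 2 * ennreal q" unfolding weight_K_def by (intro mult_left_mono) auto
  then show ?thesis using q0 by (simp add: ennreal_mult)
qed

context ev_setting
begin

lemma Lp2_norm_fun: "u \<in> Lp \<Omega> 2 ==> (%x. norm (u x)) \<in> Lp \<Omega> 2 \<and> Lp_norm \<Omega> 2 (%x. norm (u x)) = Lp_norm \<Omega> 2 u"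
  by (auto simp: Lp2_iff Lp_norm_def)

lemma Lp2_diff:
  fixes u w :: "vec3 => 'b::euclidean_space"
  assumes u: "u \<in> Lp \<Omega> 2" and w: "w \<in> Lp \<Omega> 2"
  shows "(%x. u x - w x) \<in> Lp \<Omega> 2"
proof -
  have m: "u \<in> borel_measurable L" "w \<in> borel_measurable L" "integrable L (%x. (norm (u x))\<^sup>2)" "integrable L (%x. (norm (w x))\<^sup>2)"
    using assms by (auto simp: Lp2_iff)
  have sq: "(norm (a - b))\<^sup>2 \<le> 2 * (norm a)\<^sup>2 + 2 * (norm b)\<^sup>2" for a b :: 'b
  proof -
    have "(norm (a - b))\<^sup>2 + (norm (a + b))\<^sup>2 = 2 * (norm a)\<^sup>2 + 2 * (norm b)\<^sup>2"
      unfolding power2_norm_eq_inner by (simp add: inner_add_left inner_add_right inner_diff_left inner_diff_right inner_commute)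
    then show ?thesis using zero_le_power2[of "norm (a + b)"] by linarith
  qed
  have dm: "(%x. u x - w x) \<in> borel_measurable L" using m by simp
  have "integrable L (%x. (norm (u x - w x))\<^sup>2)"
  proof (rule Bochner_Integration.integrable_bound)
    show "integrable L (%x. 2 * (norm (u x))\<^sup>2 + 2 * (norm (w x))\<^sup>2)" using m by auto
    show "AE x in L. norm ((norm (u x - w x))\<^sup>2) \<le> norm (2 * (norm (u x))\<^sup>2 + 2 * (norm (w x))\<^sup>2)"
      using sq by (intro AE_I2) simp
  qed (use dm in measurable)
  then show ?thesis using dm by (simp add: Lp2_iff)
qed

lemma bounded_product:
  fixes a b :: "vec3 => 'b::euclidean_space" and a' b' :: "vec3 => 'c::euclidean_space"
  assumes u: "u \<in> Lp \<Omega> 2" and w: "w \<in> Lp \<Omega> 2" and f: "f \<in> borel_measurable L"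
    and b: "!!x. \<bar>f x\<bar> \<le> B * (norm (u x) * norm (w x))" and B: "0 \<le> B"
  shows "integrable L f" "\<bar>LINT x|L. f x\<bar> \<le> B * (Lp_norm \<Omega> 2 u * Lp_norm \<Omega> 2 w)"
proof -
  note n = Lp2_norm_fun[OF u] Lp2_norm_fun[OF w]
  have i: "integrable L (%x. norm (u x) * norm (w x))" "(LINT x|L. norm (u x) * norm (w x)) \<le> Lp_norm \<Omega> 2 u * Lp_norm \<Omega> 2 w"
    using Lp2_inner_integrable[of "%x. norm (u x)" "%x. norm (w x)"] n by (auto simp: abs_le_iff)
  show fi: "integrable L f"
    by (rule Bochner_Integration.integrable_bound[OF integrable_mult_right[OF i(1), of B] f]) (use b B in \<open>auto simp: abs_mult\<close>)
  have "\<bar>LINT x|L. f x\<bar> \<le> (LINT x|L. \<bar>f x\<bar>)" by (rule integral_abs_bound)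
  also have "\<dots> \<le> (LINT x|L. B * (norm (u x) * norm (w x)))"
    using fi i b by (intro integral_mono) auto
  also have "\<dots> = B * (LINT x|L. norm (u x) * norm (w x))" by simp
  also have "\<dots> \<le> B * (Lp_norm \<Omega> 2 u * Lp_norm \<Omega> 2 w)" using i B by (intro mult_left_mono)
  finally show "\<bar>LINT x|L. f x\<bar> \<le> B * (Lp_norm \<Omega> 2 u * Lp_norm \<Omega> 2 w)" .
qed

text \<open>The weak gradient of \<open>u\<close> is tested with the products of components of
  \<open>\<psi>\<close> and \<open>\<phi>\<close>. By the product rule one term contains the
  divergence of \<open>\<psi>\<close>, which vanishes.\<close>

lemma convection_test:
  assumes u: "u \<in> H1 \<Omega>" and \<psi>: "\<psi> \<in> test_fun_sol \<Omega>" and \<phi>: "\<phi> \<in> test_fun \<Omega>"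
  shows "(LINT x|L. (wgrad \<Omega> u x *v \<psi> x) \<bullet> \<phi> x) = - (LINT x|L. tensor (u x) (\<psi> x) \<bullet> jacobian \<phi> (at x))"
proof -
  let ?G = "wgrad \<Omega> u" and ?J = "%\<phi> x. jacobian \<phi> (at x)"
  note \<psi>t = test_fun_sol_test_fun[OF \<psi>]
  have G: "has_weak_grad \<Omega> u ?G" using wgrad_H1[OF op u] by blast
  have l: "loc_int \<Omega> (%x. u x $ i)" "loc_int \<Omega> (%x. ?G x $ i $ j)" for i j
    using G integrable_bounded_linear[OF bounded_linear_vec_nth[of i]]
    by (auto simp: has_weak_grad_def loc_int_component) (auto simp: loc_int_def)
  have \<theta>: "(%x. \<psi> x $ j * \<phi> x $ i) \<in> test_fun \<Omega>" for i j by (rule test_fun_mult[OF test_fun_component[OF \<psi>t] test_fun_component[OF \<phi>]])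
  have d: "frechet_derivative (%x. \<psi> x $ j * \<phi> x $ i) (at x) (axis j 1) = \<psi> x $ j * ?J \<phi> x $ i $ j + ?J \<psi> x $ j $ j * \<phi> x $ i" for i j x
  proof -
    note C = C1_component[OF C1_test_fun[OF \<psi>t], of j] C1_component[OF C1_test_fun[OF \<phi>], of i]
    show ?thesis
      using frechet_derivative_unique_at[OF has_derivative_mult[OF C1_differentiable[OF C(1)] C1_differentiable[OF C(3)]], of x]
      by (simp add: C(2,4) jacobian_nth)
  qed
  have i1: "integrable L (%x. u x $ i * (\<psi> x $ j * ?J \<phi> x $ i $ j + ?J \<psi> x $ j $ j * \<phi> x $ i))" for i j
    using loc_int_test_fun[OF l(1)[of i] op test_fun_deriv[OF \<theta>[of j i], of "axis j 1"]] by (simp add: d axis_in_Basis_iff)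
  have i2: "integrable L (%x. ?G x $ i $ j * (\<psi> x $ j * \<phi> x $ i))" for i j by (rule loc_int_test_fun[OF l(2) op \<theta>])
  have "(LINT x|L. u x $ i * (\<psi> x $ j * ?J \<phi> x $ i $ j + ?J \<psi> x $ j $ j * \<phi> x $ i)) = - (LINT x|L. ?G x $ i $ j * (\<psi> x $ j * \<phi> x $ i))" for i j
    using G \<theta>[of j i] unfolding has_weak_grad_def d[symmetric] by blast
  then have "(LINT x|L. (\<Sum>i\<in>UNIV. \<Sum>j\<in>UNIV. u x $ i * (\<psi> x $ j * ?J \<phi> x $ i $ j + ?J \<psi> x $ j $ j * \<phi> x $ i)))
     = - (LINT x|L. (\<Sum>i\<in>UNIV. \<Sum>j\<in>UNIV. ?G x $ i $ j * (\<psi> x $ j * \<phi> x $ i)))"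
    using i1 i2 by (simp add: sum_negf)
  moreover have "(\<Sum>i\<in>UNIV. \<Sum>j\<in>UNIV. u x $ i * (\<psi> x $ j * ?J \<phi> x $ i $ j + ?J \<psi> x $ j $ j * \<phi> x $ i)) = tensor (u x) (\<psi> x) \<bullet> ?J \<phi> x" for x
  proof -
    have "(\<Sum>j\<in>UNIV. ?J \<psi> x $ j $ j) = 0" using \<psi> by (simp add: test_fun_sol_def trace_def)
    then have "(\<Sum>i\<in>UNIV. \<Sum>j\<in>UNIV. u x $ i * (?J \<psi> x $ j $ j * \<phi> x $ i)) = 0"
      by (simp add: sum_distrib_left[symmetric] sum_distrib_right[symmetric])
    then show ?thesis by (simp add: mat_inner tensor_def distrib_left sum.distrib mult.assoc)
  qed
  moreover have "(\<Sum>i\<in>UNIV. \<Sum>j\<in>UNIV. ?G x $ i $ j * (\<psi> x $ j * \<phi> x $ i)) = (?G x *v \<psi> x) \<bullet> \<phi> x" for x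
    by (simp add: inner_vec_def matrix_vector_mult_def sum_distrib_right mult.assoc)
  ultimately show ?thesis by simp
qed

text \<open>Only the transporting factor is replaced by solenoidal test fields; the transported one
  stays fixed in \<open>H1 \<Omega>\<close>. Both sides are continuous in the transporting factor
  with respect to the \<open>L^2\<close> norm, as \<open>\<phi>\<close> and its Jacobian are
  bounded.\<close>

lemma convection:
  assumes u: "u \<in> H10_sol \<Omega>" and \<phi>: "\<phi> \<in> test_fun \<Omega>"
  shows "(LINT x|L. (wgrad \<Omega> u x *v u x) \<bullet> \<phi> x) = - (LINT x|L. tensor (u x) (u x) \<bullet> jacobian \<phi> (at x))"
proof -
  let ?G = "wgrad \<Omega> u" and ?J = "%x. jacobian \<phi> (at x)"
  have uH: "u \<in> H1 \<Omega>" and u2: "u \<in> Lp \<Omega> 2" using u by (auto simp: H10_sol_def H1_def)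
  have G: "?G \<in> Lp \<Omega> 2" using wgrad_H1[OF op uH] by auto
  obtain B0 where B0: "0 < B0" "!!x. norm (\<phi> x) \<le> B0" using test_fun_bounded[OF \<phi>] by blast
  obtain B1 where B1: "0 < B1" "!!x. norm (?J x) \<le> B1" using test_fun_jacobian_bounded[OF \<phi>] by blast
  define R where "R = (LINT x|L. (?G x *v u x) \<bullet> \<phi> x) + (LINT x|L. tensor (u x) (u x) \<bullet> ?J x)"
  define K where "K = B0 * Lp_norm \<Omega> 2 ?G + B1 * Lp_norm \<Omega> 2 u"
  have K: "0 \<le> K" using B0 B1 by (simp add: K_def Lp_norm_nonneg)
  have \<phi>m: "\<phi> \<in> borel_measurable L" "?J \<in> borel_measurable L"
    by (intro borel_lebesgue_on borel_measurable_continuous_onI continuous_jacobian C1_test_fun[OF \<phi>] test_fun_continuous[OF \<phi>])+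
  have m: "u \<in> borel_measurable L" "?G \<in> borel_measurable L" using u2 G by (auto simp: Lp2_iff)
  have mv: "(%x. (?G x *v w x) \<bullet> \<phi> x) \<in> borel_measurable L" "(%x. tensor (u x) (w x) \<bullet> ?J x) \<in> borel_measurable L"
    if "w \<in> Lp \<Omega> 2" for w :: "vec3 => vec3"
  proof -
    have w: "w \<in> borel_measurable L" using that by (simp add: Lp2_iff)
    have c: "continuous_on UNIV (%z :: mat3 \<times> vec3. fst z *v snd z)" "continuous_on UNIV (%z :: vec3 \<times> vec3. tensor (fst z) (snd z))"
      by (intro matrix_continuous_intros continuous_intros)+
    show "(%x. (?G x *v w x) \<bullet> \<phi> x) \<in> borel_measurable L" "(%x. tensor (u x) (w x) \<bullet> ?J x) \<in> borel_measurable L"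
      using measurable_compose[OF borel_measurable_Pair[OF m(2) w] borel_measurable_continuous_onI[OF c(1)]]
        measurable_compose[OF borel_measurable_Pair[OF m(1) w] borel_measurable_continuous_onI[OF c(2)]]
      by (auto intro!: borel_measurable_inner \<phi>m)
  qed
  have bm: "\<bar>(M *v w) \<bullet> \<phi> x\<bar> \<le> B0 * (norm M * norm w)" for M :: mat3 and w x
    using order_trans[OF Cauchy_Schwarz_ineq2 mult_mono[OF norm_matrix_vector_le B0(2)[of x]]] by (simp add: mult.commute)
  have bt: "\<bar>tensor a w \<bullet> ?J x\<bar> \<le> B1 * (norm a * norm w)" for a w x
    using order_trans[OF Cauchy_Schwarz_ineq2 mult_left_mono[OF B1(2)[of x] norm_ge_zero[of "tensor a w"]]]
    by (simp add: norm_tensor mult.commute)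
  note P = bounded_product[OF G _ mv(1) bm less_imp_le[OF B0(1)]] and Q = bounded_product[OF u2 _ mv(2) bt less_imp_le[OF B1(1)]]
  have "\<bar>R\<bar> \<le> 0"
  proof (rule field_le_epsilon)
    fix e :: real assume e: "0 < e"
    define \<delta> where "\<delta> = e / (K + 1)"
    have \<delta>: "0 < \<delta>" "K * \<delta> \<le> e" using e K by (auto simp: \<delta>_def field_simps)
    obtain \<psi> where \<psi>: "\<psi> \<in> test_fun_sol \<Omega>" "H1_norm \<Omega> (%x. u x - \<psi> x) < \<delta>" using u \<delta> by (auto simp: H10_sol_def)
    have \<psi>2: "\<psi> \<in> Lp \<Omega> 2" by (rule test_fun_Lp2[OF finite_Omega test_fun_sol_test_fun[OF \<psi>(1)]])
    note D = Lp2_diff[OF u2 \<psi>2]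
    have d: "Lp_norm \<Omega> 2 (%x. u x - \<psi> x) \<le> \<delta>"
      using real_sqrt_sum_squares_ge1[of "Lp_norm \<Omega> 2 (%x. u x - \<psi> x)"] \<psi>(2) unfolding H1_norm_def by (rule order_trans[OF _ less_imp_le])
    have "R = ((LINT x|L. (?G x *v u x) \<bullet> \<phi> x) - (LINT x|L. (?G x *v \<psi> x) \<bullet> \<phi> x))
        + ((LINT x|L. tensor (u x) (u x) \<bullet> ?J x) - (LINT x|L. tensor (u x) (\<psi> x) \<bullet> ?J x))"
      using convection_test[OF uH \<psi>(1) \<phi>] unfolding R_def by linarith
    also have "\<dots> = (LINT x|L. (?G x *v (u x - \<psi> x)) \<bullet> \<phi> x) + (LINT x|L. tensor (u x) (u x - \<psi> x) \<bullet> ?J x)"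
    proof -
      have "tensor a (b - c) = tensor a b - tensor a c" for a b c by (simp add: tensor_def vec_eq_iff algebra_simps)
      then show ?thesis
        using P(1)[OF u2 u2] P(1)[OF \<psi>2 \<psi>2] Q(1)[OF u2 u2] Q(1)[OF \<psi>2 \<psi>2]
        by (simp add: matrix_vector_mult_diff_distrib inner_diff_left)
    qed
    finally have "\<bar>R\<bar> \<le> K * Lp_norm \<Omega> 2 (%x. u x - \<psi> x)"
      using P(2)[OF D D] Q(2)[OF D D] by (simp add: K_def distrib_right)
    also have "\<dots> \<le> K * \<delta>" by (rule mult_left_mono[OF d K])
    finally show "\<bar>R\<bar> \<le> 0 + e" using \<delta> by simp
  qed
  then show ?thesis by (simp add: R_def)
qed

end

section \<open>The momentum residual\<close>

lemma AE_lebesgue_ne: "AE x in lebesgue. x \<noteq> (c :: real)"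
  by (rule AE_I'[of "{c}"]) (auto simp: negligible_iff_null_sets[symmetric])

lemma complete_lebesgue: "complete_measure (lebesgue :: 'a::euclidean_space measure)"
  by (rule completion.complete_measure_axioms)

context ev_setting
begin

lemma AE_closed_interval:
  assumes "AE r in I. P r" "0 \<le> s" "t \<le> T"
  shows "AE r in lebesgue_on {s..t}. P r"
proof -
  have "AE r in lebesgue. r \<in> {0<..<T} \<longrightarrow> P r" using assms(1) by (subst (asm) AE_lebesgue_on_iff) auto
  then have "AE r in lebesgue. r \<in> {s..t} \<longrightarrow> P r"
    using AE_lebesgue_ne[of 0] AE_lebesgue_ne[of T] by eventually_elim (use assms in auto)
  then show ?thesis by (subst AE_lebesgue_on_iff) auto
qed

lemma integrable_closed_interval:
  fixes f :: "real => real"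
  assumes f: "integrable I f" and st: "0 \<le> s" "t \<le> T"
  shows "integrable (lebesgue_on {s..t}) f"
proof -
  have 1: "integrable lebesgue (%x. indicator {0<..<T} x *\<^sub>R f x)"
    using f by (subst (asm) integral_lebesgue_on) auto
  have "integrable lebesgue (%x. indicator ({s..t} \<inter> {0<..<T}) x *\<^sub>R f x)"
  proof (rule Bochner_Integration.integrable_bound[OF 1])
    have "(%x. indicator {s..t} x *\<^sub>R (indicator {0<..<T} x *\<^sub>R f x)) \<in> borel_measurable lebesgue"
      by (intro borel_measurable_scaleR borel_measurable_indicator borel_measurable_integrable[OF 1]) auto
    then show "(%x. indicator ({s..t} \<inter> {0<..<T}) x *\<^sub>R f x) \<in> borel_measurable lebesgue"
      by (simp add: indicator_inter_arith mult.assoc)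
  qed (auto simp: indicator_def)
  then have "integrable lebesgue (%x. indicator {s..t} x *\<^sub>R f x)"
  proof (rule complete_measure.integrable_AE_cong[OF complete_lebesgue])
    show "AE x in lebesgue. indicator ({s..t} \<inter> {0<..<T}) x *\<^sub>R f x = indicator {s..t} x *\<^sub>R f x"
      using AE_lebesgue_ne[of 0] AE_lebesgue_ne[of T] by eventually_elim (use st in \<open>auto simp: indicator_def\<close>)
  qed
  then show ?thesis by (subst integral_lebesgue_on) auto
qed

text \<open>Moments are continuous in time by weak continuity of \<open>v\<close>, so only
  \<open>E\<close> can jump at \<open>s\<close>.\<close>

lemma left_val_moment:
  assumes \<phi>: "\<phi> \<in> Lp \<Omega> 2" and s: "0 \<le> s" "s \<le> T"
  shows "left_val (%r. E r - \<alpha> * moment \<phi> r) s = left_val E s - \<alpha> * moment \<phi> s"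
proof (cases "s = 0")
  case False
  then have s0: "0 < s" using s by simp
  obtain l where l: "(E \<longlongrightarrow> l) (at_left s)" using BV_left_limit[OF E_BV s0 s(2)] .
  have "(moment \<phi> \<longlongrightarrow> moment \<phi> s) (at s within {0..T})"
    using moment_continuous[OF \<phi>] s by (auto simp: continuous_on_def)
  then have "(moment \<phi> \<longlongrightarrow> moment \<phi> s) (at s within {0..<s})" by (rule tendsto_within_subset) (use s in auto)
  moreover have "at s within {0..<s} = at_left s"
    by (rule at_within_nhd[of _ "{0<..}"]) (use s0 in auto)
  ultimately have m: "(moment \<phi> \<longlongrightarrow> moment \<phi> s) (at_left s)" by simp
  have "((%r. E r - \<alpha> * moment \<phi> r) \<longlongrightarrow> l - \<alpha> * moment \<phi> s) (at_left s)" by (intro tendsto_intros l m)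
  then show ?thesis using l False by (simp add: left_val_def tendsto_Lim)
qed (simp add: left_val_def)

text \<open>For \<open>\<alpha> > 0\<close> every pairing with the test field
  \<open>\<alpha> \<phi>\<close> and the bound on its weight scale by \<open>\<alpha>\<close>, the
  distance to the cone being positively homogeneous, while \<open>E\<close> and the dissipation do
  not scale. Separating the two parts is what makes large \<open>\<alpha>\<close>
  informative.\<close>

lemma ev_scaled:
  assumes \<phi>: "\<phi> \<in> test_fun_sol \<Omega>" and q: "!!x. psd_dist (jacobian \<phi> (at x)) \<le> q" and \<alpha>: "0 < \<alpha>"
    and st: "0 \<le> s" "s < t" "t < T"
  defines "R \<equiv> lebesgue_on {s..t}"
  shows "E t - left_val E s + (LINT r|R. LINT x|L. dissipation (fields r x))
     + \<alpha> * (- (moment \<phi> t - moment \<phi> s) + (LINT r|R. force \<phi> r) - 2 * q * (LINT r|R. gap r)) \<le> 0"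
proof -
  note \<phi>t = test_fun_sol_test_fun[OF \<phi>]
  let ?J = "%x. jacobian \<phi> (at x)"
  define w where "w = (%x. \<alpha> *\<^sub>R \<phi> x)"
  have w: "w \<in> test_fun_sol \<Omega>" unfolding w_def by (rule test_fun_sol_linear(2)[OF \<phi>])
  have \<phi>2: "\<phi> \<in> Lp \<Omega> 2" by (rule test_fun_Lp2[OF finite_Omega \<phi>t])
  have Jw: "jacobian w (at x) = \<alpha> *\<^sub>R ?J x" for x unfolding w_def by (rule jacobian_linear(2)[OF C1_test_fun[OF \<phi>t] C1_test_fun[OF \<phi>t]])
  have gw: "AE x in L. wgrad \<Omega> w x = \<alpha> *\<^sub>R ?J x"
    using test_fun_wgrad[OF op test_fun_sol_test_fun[OF w]] by (simp add: Jw)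
  have K: "weight_K \<Omega> w \<le> ennreal (2 * (\<alpha> * q))"
    by (rule weight_K_bound[OF op test_fun_sol_test_fun[OF w]]) (use q \<alpha> in \<open>simp add: Jw psd_dist_scaleR\<close>)
  have q0: "0 \<le> q" using q[of 0] psd_dist_nonneg[of "jacobian \<phi> (at 0)"] by linarith
  have Kr: "enn2real (weight_K \<Omega> w) \<le> 2 * (\<alpha> * q)"
    using K q0 \<alpha> by (intro enn2real_leI) auto
  have Kfin: "(\<integral>\<^sup>+t. weight_K \<Omega> w \<partial>I) < \<infinity>"
  proof -
    have "(\<integral>\<^sup>+t. weight_K \<Omega> w \<partial>I) \<le> (\<integral>\<^sup>+t. ennreal (2 * (\<alpha> * q)) \<partial>I)" by (intro nn_integral_mono K)
    also have "\<dots> < \<infinity>" using If.emeasure_finite[of "space I"] by (simp add: less_top[symmetric] ennreal_mult_eq_top_iff)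
    finally show ?thesis .
  qed
  obtain B where B: "0 < B" "!!x. norm (?J x) \<le> B" using test_fun_jacobian_bounded[OF \<phi>t] by blast
  have cJ: "continuous_on UNIV ?J" by (rule continuous_jacobian[OF C1_test_fun[OF \<phi>t]])
  note pc = integral_pairing[OF continuous_stresses(1) bounds_all(1) cJ B(2)]
    and pe = integral_pairing[OF continuous_stresses(2) bounds_all(2) cJ B(2)]
    and pd = integral_pairing[OF continuous_stresses(3) bounds_all(3) cJ B(2)]
    and pl = integral_pairing[OF continuous_stresses(4) bounds_all(4) cJ B(2)]
  note ps = integrable_expression(3)[OF continuous_stresses(5) bounds_all(5)]
    integral_expression[OF continuous_stresses(5) bounds_all(5)]
  define c where "c r = (LINT x|L. conv_stress (fields r x) \<bullet> ?J x)" for r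
  define e where "e r = (LINT x|L. erick_stress (fields r x) \<bullet> ?J x)" for r
  define D where "D r = (LINT x|L. diss_stress (fields r x) \<bullet> ?J x)" for r
  define l where "l r = (LINT x|L. elastic_stress (fields r x) \<bullet> ?J x)" for r
  define S where "S r = (LINT x|L. dissipation (fields r x))" for r
  have iR: "integrable R c" "integrable R e" "integrable R D" "integrable R l" "integrable R S" "integrable R gap"
    unfolding R_def c_def[abs_def] e_def[abs_def] D_def[abs_def] l_def[abs_def] S_def[abs_def]
    by (intro integrable_closed_interval pc(2) pe(2) pd(2) pl(2) ps(2) gap_integrable; use st in simp)+
  have Rc: "complete_measure R" unfolding R_def by (rule complete_lebesgue_on) auto
  have "AE r in I. force \<phi> r = c r + e r - D r - l r"
    using pc(1) pe(1) pd(1) pl(1)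
    by eventually_elim (simp add: force_def flux_def c_def e_def D_def l_def inner_add_left inner_diff_left)
  then have "(LINT r|R. force \<phi> r) = (LINT r|R. c r + e r - D r - l r)"
    unfolding R_def by (intro complete_measure.integral_AE_cong[OF Rc[unfolded R_def]] AE_closed_interval st(1) less_imp_le[OF st(3)])
  then have F: "(LINT r|R. force \<phi> r) = (LINT r|R. c r) + (LINT r|R. e r) - (LINT r|R. D r) - (LINT r|R. l r)"
    using iR by simp
  have mw: "(LINT x|L. v r x \<bullet> w x) = \<alpha> * moment \<phi> r" for r by (simp add: w_def moment_def)
  have "AE r in R. (LINT x|L. (wgrad \<Omega> (v r) x *v v r x) \<bullet> w x) = - \<alpha> * c r"
    unfolding R_def
  proof (rule AE_closed_interval[OF _ st(1) less_imp_le[OF st(3)]], use AE_good in eventually_elim)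
    case (elim r)
    then have "(LINT x|L. (wgrad \<Omega> (v r) x *v v r x) \<bullet> w x) = - (LINT x|L. tensor (v r x) (v r x) \<bullet> jacobian w (at x))"
      by (intro convection[OF _ test_fun_sol_test_fun[OF w]]) auto
    then show ?case by (simp add: Jw c_def conv_stress_def)
  qed
  then have "(LINT r|R. 0 - (LINT x|L. (wgrad \<Omega> (v r) x *v v r x) \<bullet> w x)) = (LINT r|R. \<alpha> * c r)"
    by (intro complete_measure.integral_AE_cong[OF Rc]) (auto elim: eventually_mono)
  then have T1: "(LINT r|R. 0 - (LINT x|L. (wgrad \<Omega> (v r) x *v v r x) \<bullet> w x)) = \<alpha> * (LINT r|R. c r)" by simp
  have te: "ericksen_TE \<Omega> (d r) w = - (\<alpha> * e r)" for r
  proof -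
    have "(LINT x|L. (transpose (wgrad \<Omega> (d r) x) ** wgrad \<Omega> (d r) x) \<bullet> wgrad \<Omega> w x)
      = (LINT x|L. \<alpha> * (erick_stress (fields r x) \<bullet> ?J x))"
      by (rule L.integral_AE_cong) (use gw in eventually_elim, simp add: erick_stress_def)
    then show ?thesis by (simp add: ericksen_TE_def e_def)
  qed
  have T2: "(LINT r|R. ericksen_TE \<Omega> (d r) w) = - (\<alpha> * (LINT r|R. e r))" by (simp add: te)
  have "AE r in R. (LINT x|L. stress_D lam \<mu>1 \<mu>4 \<mu>5 \<mu>6 (d r x) (wgrad \<Omega> (v r) x) \<bullet> (wgrad \<Omega> (v r) x - wgrad \<Omega> w x)
       + (norm (cross_lap \<Omega> (d r) x))\<^sup>2) = S r - \<alpha> * D r"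
    unfolding R_def
  proof (rule AE_closed_interval[OF _ st(1) less_imp_le[OF st(3)]], use pd(1) ps(1) in eventually_elim)
    case (elim r)
    have "(LINT x|L. stress_D lam \<mu>1 \<mu>4 \<mu>5 \<mu>6 (d r x) (wgrad \<Omega> (v r) x) \<bullet> (wgrad \<Omega> (v r) x - wgrad \<Omega> w x)
       + (norm (cross_lap \<Omega> (d r) x))\<^sup>2) = (LINT x|L. dissipation (fields r x) - \<alpha> * (diss_stress (fields r x) \<bullet> ?J x))"
      by (rule L.integral_AE_cong) (use gw in eventually_elim, simp add: dissipation_def diss_stress_def inner_diff_right)
    also have "\<dots> = S r - \<alpha> * D r" using elim by (simp add: S_def D_def)
    finally show ?case .
  qed
  then have "(LINT r|R. LINT x|L. stress_D lam \<mu>1 \<mu>4 \<mu>5 \<mu>6 (d r x) (wgrad \<Omega> (v r) x) \<bullet> (wgrad \<Omega> (v r) x - wgrad \<Omega> w x)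
       + (norm (cross_lap \<Omega> (d r) x))\<^sup>2) = (LINT r|R. S r - \<alpha> * D r)"
    by (rule complete_measure.integral_AE_cong[OF Rc])
  then have T3: "(LINT r|R. LINT x|L. stress_D lam \<mu>1 \<mu>4 \<mu>5 \<mu>6 (d r x) (wgrad \<Omega> (v r) x) \<bullet> (wgrad \<Omega> (v r) x - wgrad \<Omega> w x)
       + (norm (cross_lap \<Omega> (d r) x))\<^sup>2) = (LINT r|R. S r) - \<alpha> * (LINT r|R. D r)"
    using iR by simp
  have el: "(LINT x|L. stress_el lam (d r x) (proj_lap \<Omega> (d r) x) \<bullet> wgrad \<Omega> w x) = \<alpha> * l r" for r
  proof -
    have "(LINT x|L. stress_el lam (d r x) (proj_lap \<Omega> (d r) x) \<bullet> wgrad \<Omega> w x) = (LINT x|L. \<alpha> * (elastic_stress (fields r x) \<bullet> ?J x))"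
      by (rule L.integral_AE_cong) (use gw in eventually_elim, simp add: elastic_stress_def proj_lap_eq)
    then show ?thesis by (simp add: l_def)
  qed
  have T4: "(LINT r|R. LINT x|L. stress_el lam (d r x) (proj_lap \<Omega> (d r) x) \<bullet> wgrad \<Omega> w x) = \<alpha> * (LINT r|R. l r)" by (simp add: el)
  have gap0: "0 \<le> (LINT r|R. gap r)"
    by (rule integral_nonneg_AE, rule AE_I2) (use st gap_nonneg in \<open>auto simp: R_def\<close>)
  have "(LINT r|R. enn2real (weight_K \<Omega> w) * (energy \<Omega> (v r) (d r) - E r)) = (LINT r|R. (- enn2real (weight_K \<Omega> w)) * gap r)"
    by (simp add: gap_def algebra_simps)
  also have "\<dots> = - (enn2real (weight_K \<Omega> w) * (LINT r|R. gap r))" by simp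
  \<comment> \<open>The weight multiplies the nonpositive difference of energy and \<open>E\<close>;
    an upper bound for the weight therefore bounds the term from below.\<close>
  also have "\<dots> \<ge> - (2 * (\<alpha> * q) * (LINT r|R. gap r))" using mult_right_mono[OF Kr gap0] by simp
  finally have T5: "- (2 * (\<alpha> * q) * (LINT r|R. gap r)) \<le> (LINT r|R. enn2real (weight_K \<Omega> w) * (energy \<Omega> (v r) (d r) - E r))" .
  \<comment> \<open>Picks from the definition of a solution the conjunct with the inequality for all
    test pairs.\<close>
  note i = ev[unfolded ev_solution_def, THEN conjunct2, THEN conjunct2, THEN conjunct2, THEN conjunct2, THEN conjunct2, THEN conjunct2, THEN conjunct2, THEN conjunct2, THEN conjunct2, THEN conjunct2, THEN conjunct2, THEN conjunct2, THEN conjunct2, THEN conjunct1]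
  from i[rule_format, of "%t. w" "%t u. 0" s t]
  have "(E t - \<alpha> * moment \<phi> t) - left_val (%r. E r - \<alpha> * moment \<phi> r) s + \<alpha> * (LINT r|R. c r) - - (\<alpha> * (LINT r|R. e r))
      + ((LINT r|R. S r) - \<alpha> * (LINT r|R. D r)) - \<alpha> * (LINT r|R. l r)
      + (LINT r|R. enn2real (weight_K \<Omega> w) * (energy \<Omega> (v r) (d r) - E r)) \<le> 0"
    unfolding Let_def mw R_def[symmetric] T1 T2 T3 T4
    using ev_test_constant[OF op finite_Omega T w] Kfin st by auto
  then have "(E t - \<alpha> * moment \<phi> t) - (left_val E s - \<alpha> * moment \<phi> s) + \<alpha> * (LINT r|R. c r) - - (\<alpha> * (LINT r|R. e r))
      + ((LINT r|R. S r) - \<alpha> * (LINT r|R. D r)) - \<alpha> * (LINT r|R. l r) - 2 * (\<alpha> * q) * (LINT r|R. gap r) \<le> 0"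
    using T5 left_val_moment[OF \<phi>2, of s \<alpha>] st by simp
  then show ?thesis unfolding F S_def by (simp add: algebra_simps)
qed

lemma momentum_inequality:
  assumes \<phi>: "\<phi> \<in> test_fun_sol \<Omega>" and q: "!!x. psd_dist (jacobian \<phi> (at x)) \<le> q"
    and st: "0 \<le> s" "s < t" "t < T"
  shows "- (moment \<phi> t - moment \<phi> s) + (LINT r|lebesgue_on {s..t}. force \<phi> r) \<le> 2 * q * (LINT r|lebesgue_on {s..t}. gap r)"
proof (rule ccontr)
  let ?B = "- (moment \<phi> t - moment \<phi> s) + (LINT r|lebesgue_on {s..t}. force \<phi> r) - 2 * q * (LINT r|lebesgue_on {s..t}. gap r)"
  let ?A = "E t - left_val E s + (LINT r|lebesgue_on {s..t}. LINT x|L. dissipation (fields r x))"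
  assume "\<not> ?thesis"
  then have B: "0 < ?B" by simp
  \<comment> \<open>Chosen so that \<open>\<alpha>\<close> times the supposedly positive quantity
    exceeds the absolute value of the remaining part by 1.\<close>
  define \<alpha> where "\<alpha> = (\<bar>?A\<bar> + 1) / ?B"
  have "0 < \<alpha>" using B by (auto simp: \<alpha>_def intro!: divide_pos_pos)
  from ev_scaled[OF \<phi> q this st] have "?A + \<alpha> * ?B \<le> 0" .
  moreover have "\<alpha> * ?B = \<bar>?A\<bar> + 1" using B by (simp add: \<alpha>_def)
  ultimately show False by linarith
qed

text \<open>For the zero field the part linear in \<open>\<alpha>\<close> vanishes. At
  \<open>s = 0\<close> the left value is \<open>E 0\<close> by convention, so no initial jump of
  \<open>E\<close> goes uncounted.\<close>

lemma energy_dissipation: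
  assumes "0 < t" "t < T"
  shows "E t - E 0 + (LINT r|lebesgue_on {0..t}. LINT x|L. dissipation (fields r x)) \<le> 0"
proof -
  have J: "jacobian (%x. 0) (at x) = (0 :: mat3)" for x :: vec3
    using jacobian_linear(2)[OF C1_test_fun[OF test_fun_sol_test_fun[OF test_fun_sol_zero]] C1_test_fun[OF test_fun_sol_test_fun[OF test_fun_sol_zero]], of 0 x] by simp
  have "psd_dist 0 \<le> 0" using psd_dist_psd[OF psd_0] by simp
  from ev_scaled[OF test_fun_sol_zero, of 0 1 0 t] this assms
  show ?thesis by (simp add: J moment_def force_def left_val_def)
qed

end

section \<open>Differentiating the residual in time\<close>

context ev_setting
begin

definition upto :: "(real => real) => real => real" where
  "upto f t = (LINT r|lebesgue_on {0..t}. f r)"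

lemma upto:
  assumes f: "integrable I f"
  shows "!!a b. 0 \<le> a ==> a \<le> b ==> b \<le> T ==> (LINT r|lebesgue_on {a..b}. f r) = upto f b - upto f a"
    "!!a b. 0 \<le> a ==> a \<le> b ==> b \<le> T ==> (LINT x|lebesgue. indicator {a..b} x * f x) = upto f b - upto f a"
    "continuous_on {0..T} (upto f)"
    "integrable lebesgue (%x. indicator {0..T} x * f x)"
proof -
  have io: "f integrable_on {a..b}" if "0 \<le> a" "b \<le> T" for a b
    by (intro integrable_on_lebesgue_on integrable_closed_interval f that) simp
  have ie: "(LINT r|lebesgue_on {a..b}. f r) = integral {a..b} f" if "0 \<le> a" "b \<le> T" for a b
    by (intro lebesgue_integral_eq_integral integrable_closed_interval f that) simp
  show 1: "(LINT r|lebesgue_on {a..b}. f r) = upto f b - upto f a" if "0 \<le> a" "a \<le> b" "b \<le> T" for a b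
    using Henstock_Kurzweil_Integration.integral_combine[OF that(1,2) io[of 0 b]] that by (simp add: upto_def ie)
  show "(LINT x|lebesgue. indicator {a..b} x * f x) = upto f b - upto f a" if "0 \<le> a" "a \<le> b" "b \<le> T" for a b
    using 1[OF that] by (subst (asm) integral_lebesgue_on) auto
  have "continuous_on {0..T} (%t. integral {0..t} f)" by (rule indefinite_integral_continuous_1[OF io]) auto
  then show "continuous_on {0..T} (upto f)"
    by (rule continuous_on_eq) (simp add: upto_def ie)
  show "integrable lebesgue (%x. indicator {0..T} x * f x)"
  proof -
    have "integrable (lebesgue_on {0..T}) f" by (rule integrable_closed_interval[OF f]) simp_all
    then show ?thesis by (subst (asm) integral_lebesgue_on) auto
  qed
qed

lemma upto_AE_cong:
  assumes "AE r in I. f r = g r" "t \<le> T"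
  shows "upto f t = upto g t"
  unfolding upto_def
  by (rule complete_measure.integral_AE_cong[OF complete_lebesgue_on]) (use AE_closed_interval[OF assms(1) _ assms(2)] in auto)

lemma upto_linear:
  assumes "integrable I f" "integrable I g" "t \<le> T"
  shows "upto (%r. f r + g r) t = upto f t + upto g t" "upto (%r. c * f r) t = c * upto f t"
  unfolding upto_def using integrable_closed_interval[OF assms(1), of 0 t] integrable_closed_interval[OF assms(2), of 0 t] assms(3)
  by auto

lemma upto_gap:
  assumes C: "\<forall>t\<in>{0..T}. gap t \<le> C" and ab: "0 \<le> a" "a \<le> b" "b \<le> T"
  shows "0 \<le> upto gap b - upto gap a" "upto gap b - upto gap a \<le> C * (b - a)"
proof -
  note i = integrable_closed_interval[OF gap_integrable ab(1,3)]
  have "0 \<le> (LINT r|lebesgue_on {a..b}. gap r)"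
    by (rule integral_nonneg_AE, rule AE_I2) (use ab gap_nonneg in auto)
  then show "0 \<le> upto gap b - upto gap a" by (simp add: upto(1)[OF gap_integrable ab])
  interpret finite_measure "lebesgue_on {a..b}" by (rule finite_measure_lebesgue_on) simp
  have "(LINT r|lebesgue_on {a..b}. gap r) \<le> (LINT r|lebesgue_on {a..b}. C)"
    by (rule integral_mono[OF i]) (use C ab in auto)
  also have "\<dots> = C * (b - a)" using ab by (simp add: measure_restrict_space)
  finally show "upto gap b - upto gap a \<le> C * (b - a)" by (simp add: upto(1)[OF gap_integrable ab])
qed

lemma force_integrable:
  assumes \<phi>: "\<phi> \<in> test_fun_sol \<Omega>"
  shows "AE t in I. integrable L (%x. flux (fields t x) \<bullet> jacobian \<phi> (at x))" "integrable I (force \<phi>)"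
proof -
  note \<phi>t = test_fun_sol_test_fun[OF \<phi>]
  obtain B where B: "0 < B" "!!x. norm (jacobian \<phi> (at x)) \<le> B" using test_fun_jacobian_bounded[OF \<phi>t] by blast
  have cJ: "continuous_on UNIV (%x. jacobian \<phi> (at x))" by (rule continuous_jacobian[OF C1_test_fun[OF \<phi>t]])
  note p = integral_pairing[OF continuous_stresses(6) bounds_all(6) cJ B(2)]
  show "AE t in I. integrable L (%x. flux (fields t x) \<bullet> jacobian \<phi> (at x))" by (rule p(1))
  show "integrable I (force \<phi>)" unfolding force_def[abs_def] by (rule p(2))
qed

lemma force_linear:
  assumes "\<phi> \<in> test_fun_sol \<Omega>" "\<psi> \<in> test_fun_sol \<Omega>"
  shows "AE t in I. force (%x. \<phi> x + \<psi> x) t = force \<phi> t + force \<psi> t" "force (%x. c *\<^sub>R \<phi> x) t = c * force \<phi> t"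
proof -
  note C = C1_test_fun[OF test_fun_sol_test_fun[OF assms(1)]] C1_test_fun[OF test_fun_sol_test_fun[OF assms(2)]]
  show "AE t in I. force (%x. \<phi> x + \<psi> x) t = force \<phi> t + force \<psi> t"
    using force_integrable(1)[OF assms(1)] force_integrable(1)[OF assms(2)]
    by eventually_elim (simp add: force_def jacobian_linear(1)[OF C] inner_add_right)
  show "force (%x. c *\<^sub>R \<phi> x) t = c * force \<phi> t"
    by (simp add: force_def jacobian_linear(2)[OF C(1,1)])
qed

lemma moment_linear:
  assumes "\<phi> \<in> Lp \<Omega> 2" "\<psi> \<in> Lp \<Omega> 2" "t \<in> {0..T}"
  shows "moment (%x. \<phi> x + \<psi> x) t = moment \<phi> t + moment \<psi> t" "moment (%x. c *\<^sub>R \<phi> x) t = c * moment \<phi> t"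
  using Lp2_inner_integrable(1)[OF v_L2[OF assms(3)] assms(1)] Lp2_inner_integrable(1)[OF v_L2[OF assms(3)] assms(2)]
  by (auto simp: moment_def inner_add_right)

text \<open>A primitive: its increments are the momentum residuals integrated over time intervals.
  In this form it can be shown to be Lipschitz and then be differentiated.\<close>

definition resid :: "field3 => real => real" where
  "resid \<phi> t = - moment \<phi> t + upto (force \<phi>) t"

lemma sol_Lp2: "\<phi> \<in> test_fun_sol \<Omega> ==> \<phi> \<in> Lp \<Omega> 2"
  by (rule test_fun_Lp2[OF finite_Omega test_fun_sol_test_fun])

lemma resid_linear:
  assumes "\<phi> \<in> test_fun_sol \<Omega>" "\<psi> \<in> test_fun_sol \<Omega>" "t \<in> {0..T}"
  shows "resid (%x. \<phi> x + \<psi> x) t = resid \<phi> t + resid \<psi> t" "resid (%x. c *\<^sub>R \<phi> x) t = c * resid \<phi> t"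
proof -
  have t: "t \<le> T" using assms(3) by simp
  note m = moment_linear[OF sol_Lp2[OF assms(1)] sol_Lp2[OF assms(2)] assms(3)]
  note i = force_integrable(2)[OF assms(1)] force_integrable(2)[OF assms(2)]
  have "upto (force (%x. \<phi> x + \<psi> x)) t = upto (%r. force \<phi> r + force \<psi> r) t"
    by (rule upto_AE_cong[OF force_linear(1)[OF assms(1,2)] t])
  then show "resid (%x. \<phi> x + \<psi> x) t = resid \<phi> t + resid \<psi> t"
    by (simp add: resid_def m(1) upto_linear(1)[OF i t])
  have "upto (force (%x. c *\<^sub>R \<phi> x)) t = upto (%r. c * force \<phi> r) t"
    by (simp add: upto_def force_linear(2)[OF assms(1,2)])
  then show "resid (%x. c *\<^sub>R \<phi> x) t = c * resid \<phi> t"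
    by (simp add: resid_def m(2) upto_linear(2)[OF i(1) i(1) t] algebra_simps)
qed

lemma resid_continuous: "\<phi> \<in> test_fun_sol \<Omega> ==> continuous_on {0..T} (resid \<phi>)"
  unfolding resid_def[abs_def]
  by (intro continuous_intros moment_continuous sol_Lp2 upto(3) force_integrable(2))

lemma resid_le:
  assumes \<phi>: "\<phi> \<in> test_fun_sol \<Omega>" and q: "!!x. psd_dist (jacobian \<phi> (at x)) \<le> q"
    and ab: "0 \<le> a" "a \<le> b" "b \<le> T"
  shows "resid \<phi> b - resid \<phi> a \<le> 2 * q * (upto gap b - upto gap a)"
proof (cases "a = b")
  case False
  have *: "resid \<phi> t - 2 * q * upto gap t \<le> resid \<phi> a - 2 * q * upto gap a" if "t \<in> {a..<T}" for t
  proof (cases "a = t")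
    case False
    then have t: "0 \<le> a" "a < t" "t < T" "a \<le> t" "t \<le> T" using that ab by auto
    show ?thesis using momentum_inequality[OF \<phi> q t(1-3)]
      unfolding upto(1)[OF force_integrable(2)[OF \<phi>] t(1,4,5)] upto(1)[OF gap_integrable t(1,4,5)] resid_def
      by (simp add: algebra_simps)
  qed simp
  \<comment> \<open>The inequality is available before the final time only. Both sides are
    continuous in \<open>t\<close>, which includes \<open>b = T\<close>.\<close>
  have cl: "closure {a..<T} = {a..T}" using ab False by simp
  have c: "continuous_on {a..T} (%t. resid \<phi> t - 2 * q * upto gap t)"
    by (intro continuous_intros continuous_on_subset[OF resid_continuous[OF \<phi>]] continuous_on_subset[OF upto(3)[OF gap_integrable]]) (use ab in auto)
  have "resid \<phi> b - 2 * q * upto gap b \<le> resid \<phi> a - 2 * q * upto gap a"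
    by (rule continuous_le_on_closure[of "{a..<T}" "%t. resid \<phi> t - 2 * q * upto gap t", unfolded cl, OF c _ *]) (use ab in auto)
  then show ?thesis by (simp add: algebra_simps)
qed simp

definition gap_bound :: real where "gap_bound = (SOME C. 0 \<le> C \<and> (\<forall>t\<in>{0..T}. gap t \<le> C))"

lemma gap_bound: "0 \<le> gap_bound" "\<forall>t\<in>{0..T}. gap t \<le> gap_bound"
proof -
  have "\<exists>C. 0 \<le> C \<and> (\<forall>t\<in>{0..T}. gap t \<le> C)" using gap_bounded by blast
  from someI_ex[OF this] show "0 \<le> gap_bound" "\<forall>t\<in>{0..T}. gap t \<le> gap_bound" unfolding gap_bound_def by auto
qed

text \<open>The one-sided estimate applied to \<open>\<phi>\<close> and to \<open>- \<phi>\<close>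
  bounds the increment by the integral of the gap from both sides, and the gap is bounded since
  \<open>E\<close> is.\<close>

lemma resid_lipschitz:
  assumes \<phi>: "\<phi> \<in> test_fun_sol \<Omega>" and B: "!!x. norm (jacobian \<phi> (at x)) \<le> B"
    and ab: "0 \<le> a" "a \<le> b" "b \<le> T"
  shows "\<bar>resid \<phi> b - resid \<phi> a\<bar> \<le> (2 * B * gap_bound) * (b - a)"
proof -
  have B0: "0 \<le> B" using B[of 0] norm_ge_zero[of "jacobian \<phi> (at 0)"] by linarith
  have le: "resid \<psi> b - resid \<psi> a \<le> (2 * B * gap_bound) * (b - a)"
    if \<psi>: "\<psi> \<in> test_fun_sol \<Omega>" "!!x. norm (jacobian \<psi> (at x)) \<le> B" for \<psi>
  proof -
    have "resid \<psi> b - resid \<psi> a \<le> 2 * B * (upto gap b - upto gap a)"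
      by (rule resid_le[OF \<psi>(1) order_trans[OF psd_dist_le_norm \<psi>(2)] ab])
    also have "\<dots> \<le> 2 * B * (gap_bound * (b - a))"
      by (intro mult_left_mono upto_gap(2)[OF gap_bound(2) ab]) (use B0 in simp)
    finally show ?thesis by (simp add: mult.assoc)
  qed
  have n: "(%x. (-1) *\<^sub>R \<phi> x) \<in> test_fun_sol \<Omega>" by (rule test_fun_sol_linear(2)[OF \<phi>])
  have "norm (jacobian (%x. (-1) *\<^sub>R \<phi> x) (at x)) \<le> B" for x
    using B[of x] by (simp add: jacobian_linear(2)[OF C1_test_fun[OF test_fun_sol_test_fun[OF \<phi>]] C1_test_fun[OF test_fun_sol_test_fun[OF \<phi>]], of "-1" x, simplified])
  from le[OF n this] le[OF \<phi> B] show ?thesis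
    using resid_linear(2)[OF \<phi> \<phi>, of a "-1"] resid_linear(2)[OF \<phi> \<phi>, of b "-1"] ab by auto
qed

lemma resid_density:
  assumes \<phi>: "\<phi> \<in> test_fun_sol \<Omega>"
  shows "\<exists>f. f \<in> borel_measurable borel \<and> integrable lebesgue (%x. indicator {0..T} x * f x) \<and>
    (\<forall>a b. 0 \<le> a \<longrightarrow> a \<le> b \<longrightarrow> b \<le> T \<longrightarrow> (LINT x|lebesgue. indicator {a..b} x * f x) = resid \<phi> b - resid \<phi> a)"
proof -
  obtain B where B: "0 < B" "!!x. norm (jacobian \<phi> (at x)) \<le> B" using test_fun_jacobian_bounded[OF test_fun_sol_test_fun[OF \<phi>]] by blast
  obtain f where f: "f \<in> borel_measurable borel" "integrable lborel (%x. indicator {0..T} x * f x)"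
    "!!a b. 0 \<le> a ==> a \<le> b ==> b \<le> T ==> (LINT x|lborel. indicator {a..b} x * f x) = resid \<phi> b - resid \<phi> a"
    using lipschitz_density[OF T resid_lipschitz[OF \<phi> B(2)]] by blast
  have m: "(%x. indicator {a..b} x * f x) \<in> borel_measurable lborel" for a b using f(1) by simp
  show ?thesis
    using f(1,3) integrable_completion[OF m, of 0 T] f(2) integral_completion[OF m]
    by (intro exI[of _ f]) auto
qed

definition dens :: "field3 => real => real" where
  "dens \<phi> = (SOME f. f \<in> borel_measurable borel \<and> integrable lebesgue (%x. indicator {0..T} x * f x) \<and>
    (\<forall>a b. 0 \<le> a \<longrightarrow> a \<le> b \<longrightarrow> b \<le> T \<longrightarrow> (LINT x|lebesgue. indicator {a..b} x * f x) = resid \<phi> b - resid \<phi> a))"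

lemma dens:
  assumes "\<phi> \<in> test_fun_sol \<Omega>"
  shows "dens \<phi> \<in> borel_measurable borel" "integrable lebesgue (%x. indicator {0..T} x * dens \<phi> x)"
    "!!a b. 0 \<le> a ==> a \<le> b ==> b \<le> T ==> (LINT x|lebesgue. indicator {a..b} x * dens \<phi> x) = resid \<phi> b - resid \<phi> a"
  using someI_ex[OF resid_density[OF assms]] unfolding dens_def by auto

lemma integrable_subinterval:
  fixes f :: "real => real"
  assumes f: "integrable lebesgue (%x. indicator {0..T} x * f x)" and ab: "0 \<le> a" "b \<le> T"
  shows "integrable lebesgue (%x. indicator {a..b} x * f x)"
proof -
  have e: "indicator {a..b} x * f x = indicator {a..b} x * (indicator {0..T} x * f x)" for x
    using ab by (auto simp: indicator_def)
  show ?thesis unfolding e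
  proof (rule Bochner_Integration.integrable_bound[OF f])
    show "(%x. indicator {a..b} x * (indicator {0..T} x * f x)) \<in> borel_measurable lebesgue"
      by (intro borel_measurable_times borel_measurable_indicator borel_measurable_integrable[OF f]) auto
  qed (auto simp: indicator_def)
qed

lemma combination_sol:
  assumes "!!j::nat. \<phi> j \<in> test_fun_sol \<Omega>"
  shows "(%x. \<Sum>j<n. q j *\<^sub>R \<phi> j x) \<in> test_fun_sol \<Omega>"
    "jacobian (%x. \<Sum>j<n. q j *\<^sub>R \<phi> j x) (at x) = (\<Sum>j<n. q j *\<^sub>R jacobian (\<phi> j) (at x))"
    "t \<in> {0..T} ==> resid (%x. \<Sum>j<n. q j *\<^sub>R \<phi> j x) t = (\<Sum>j<n. q j * resid (\<phi> j) t)"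
proof (induction n)
  case 0
  show 1: "(%x. \<Sum>j<0. q j *\<^sub>R \<phi> j x) \<in> test_fun_sol \<Omega>" using test_fun_sol_zero by simp
  note C = C1_test_fun[OF test_fun_sol_test_fun[OF 1]]
  show "jacobian (%x. \<Sum>j<0. q j *\<^sub>R \<phi> j x) (at x) = (\<Sum>j<0. q j *\<^sub>R jacobian (\<phi> j) (at x))"
    using jacobian_linear(2)[OF C C, of 0 x] by simp
  show "resid (%x. \<Sum>j<0. q j *\<^sub>R \<phi> j x) t = (\<Sum>j<0. q j * resid (\<phi> j) t)" if "t \<in> {0..T}"
    using resid_linear(2)[OF 1 1 that, of 0] by simp
next
  case (Suc n)
  note s = test_fun_sol_linear(2)[OF assms[of n], of "q n"]
  note C = C1_test_fun[OF test_fun_sol_test_fun[OF Suc(1)]] C1_test_fun[OF test_fun_sol_test_fun[OF s]] C1_test_fun[OF test_fun_sol_test_fun[OF assms[of n]]]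
  show "(%x. \<Sum>j<Suc n. q j *\<^sub>R \<phi> j x) \<in> test_fun_sol \<Omega>" using test_fun_sol_linear(1)[OF Suc(1) s] by simp
  show "jacobian (%x. \<Sum>j<Suc n. q j *\<^sub>R \<phi> j x) (at x) = (\<Sum>j<Suc n. q j *\<^sub>R jacobian (\<phi> j) (at x))"
    using jacobian_linear(1)[OF C(1,2), of x] jacobian_linear(2)[OF C(3,3), of "q n" x] Suc(2) by simp
  show "resid (%x. \<Sum>j<Suc n. q j *\<^sub>R \<phi> j x) t = (\<Sum>j<Suc n. q j * resid (\<phi> j) t)" if "t \<in> {0..T}"
    using resid_linear(1)[OF Suc(1) s that] resid_linear(2)[OF assms[of n] assms[of n] that, of "q n"] Suc(3)[OF that] by simp
qed

text \<open>The difference of the two sides is the density of \<open>2 Q upto gap - resid\<close>, a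
  function that is nondecreasing by \<open>resid_le\<close>. The exceptional null set depends on the
  combination, so only countably many combinations can be treated at once.\<close>

lemma dens_le:
  assumes \<phi>: "!!j::nat. \<phi> j \<in> test_fun_sol \<Omega>" and Q: "!!x. psd_dist (\<Sum>j<n. q j *\<^sub>R jacobian (\<phi> j) (at x)) \<le> Q"
  shows "AE t in lebesgue. t \<in> {0..T} \<longrightarrow> (\<Sum>j<n. q j * dens (\<phi> j) t) \<le> 2 * Q * gap t"
proof -
  let ?\<psi> = "%x. \<Sum>j<n. q j *\<^sub>R \<phi> j x" and ?f = "%t. 2 * Q * gap t - (\<Sum>j<n. q j * dens (\<phi> j) t)"
  let ?F = "%t. 2 * Q * upto gap t - resid ?\<psi> t"
  note \<psi> = combination_sol(1)[where \<phi>=\<phi> and n=n and q=q, OF \<phi>] and J = combination_sol(2)[where \<phi>=\<phi> and n=n and q=q, OF \<phi>]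
    and r = combination_sol(3)[where \<phi>=\<phi> and n=n and q=q, OF \<phi>]
  obtain B where B: "0 < B" "!!x. norm (jacobian ?\<psi> (at x)) \<le> B" using test_fun_jacobian_bounded[OF test_fun_sol_test_fun[OF \<psi>]] by blast
  have Q0: "0 \<le> Q" using Q[of 0] psd_dist_nonneg[of "\<Sum>j<n. q j *\<^sub>R jacobian (\<phi> j) (at 0)"] by linarith
  have e: "indicator S t * ?f t = 2 * Q * (indicator S t * gap t) - (\<Sum>j<n. q j * (indicator S t * dens (\<phi> j) t))" for t S
    by (simp add: right_diff_distrib sum_distrib_left mult_ac)
  have i: "integrable lebesgue (%t. indicator {a..b} t * gap t)" "integrable lebesgue (%t. indicator {a..b} t * dens (\<phi> j) t)"
    if "0 \<le> a" "b \<le> T" for a b j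
    using integrable_subinterval[OF upto(4)[OF gap_integrable] that] integrable_subinterval[OF dens(2)[OF \<phi>] that] by auto
  have "AE t in lebesgue. t \<in> {0..T} \<longrightarrow> 0 \<le> ?f t"
  proof (rule AE_nonneg_if_integral_mono[OF T, where F="?F" and \<kappa>="2 * Q * gap_bound + 2 * B * gap_bound"])
    show "integrable lebesgue (%x. indicator {0..T} x * ?f x)" unfolding e using i[of 0 T] by auto
    fix a b assume ab: "0 \<le> a" "a \<le> b" "b \<le> T"
    show "?F a \<le> ?F b" using resid_le[OF \<psi> _ ab, unfolded J, OF Q] by (simp add: algebra_simps)
    have "2 * Q * (upto gap b - upto gap a) \<le> 2 * Q * (gap_bound * (b - a))"
      by (intro mult_left_mono upto_gap(2)[OF gap_bound(2) ab]) (use Q0 in simp)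
    then show "?F b - ?F a \<le> (2 * Q * gap_bound + 2 * B * gap_bound) * (b - a)"
      using resid_lipschitz[OF \<psi> B(2) ab] by (simp add: algebra_simps)
    have "(LINT x|lebesgue. indicator {a..b} x * ?f x) = 2 * Q * (upto gap b - upto gap a) - (\<Sum>j<n. q j * (resid (\<phi> j) b - resid (\<phi> j) a))"
      unfolding e using i[OF ab(1,3)] dens(3)[OF \<phi> ab] upto(2)[OF gap_integrable ab] by simp
    also have "\<dots> = ?F b - ?F a" using r[of a] r[of b] ab by (simp add: sum_subtractf right_diff_distrib)
    finally show "(LINT x|lebesgue. indicator {a..b} x * ?f x) = ?F b - ?F a" .
  qed
  then show ?thesis by eventually_elim auto
qed

end

section \<open>The defect measure\<close>

definition clip :: "real => real" where "clip s = max 0 (min 1 s)"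

lemma clip: "clip s \<in> {0..1}" "s \<in> {0..1} ==> clip s = s" by (auto simp: clip_def)

lemma continuous_clip: "continuous_on UNIV clip" unfolding clip_def by (intro continuous_intros)

text \<open>Extends by constants beyond [0,1]. In this way the continuous functions on [0,1] become
  part of a normed space given as a type, as the Hahn-Banach theorem above requires.\<close>

definition emb :: "(real => mat3) => (real \<Rightarrow>\<^sub>C mat3)" where "emb g = Bcontfun (%s. g (clip s))"

lemma emb_apply: "continuous_on {0..1} g ==> apply_bcontfun (emb g) s = g (clip s)"
proof -
  assume g: "continuous_on {0..1} g"
  have "continuous_on UNIV (%s. g (clip s))"
    by (rule continuous_on_compose2[OF g continuous_clip]) (use clip(1) in auto)
  moreover have "bounded (g ` {0..1})" by (intro compact_imp_bounded compact_continuous_image g) auto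
  then have "bounded (range (%s. g (clip s)))" by (rule bounded_subset) (use clip(1) in auto)
  ultimately have "(%s. g (clip s)) \<in> bcontfun" by (simp add: bcontfun_def)
  then show ?thesis by (simp add: emb_def Bcontfun_inverse)
qed

lemma emb_linear:
  "continuous_on {0..1} f ==> continuous_on {0..1} g ==> emb (%s. f s + g s) = emb f + emb g"
  "continuous_on {0..1} f ==> emb (%s. c *\<^sub>R f s) = c *\<^sub>R emb f"
  by (rule bcontfun_eqI; simp add: emb_apply plus_bcontfun.rep_eq scaleR_bcontfun.rep_eq continuous_intros)+

lemma apply_bcontfun_sum: "apply_bcontfun (\<Sum>j<(n::nat). q j *\<^sub>R G j) s = (\<Sum>j<n. q j *\<^sub>R apply_bcontfun (G j) s)"
  by (induction n) (simp_all add: plus_bcontfun.rep_eq scaleR_bcontfun.rep_eq zero_bcontfun.rep_eq)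

definition psd_sup :: "(real \<Rightarrow>\<^sub>C mat3) => real" where "psd_sup B = (SUP s. psd_dist (apply_bcontfun B s))"

lemma psd_sup_upper: "psd_dist (apply_bcontfun B s) \<le> psd_sup B"
  unfolding psd_sup_def
  by (rule cSUP_upper) (auto intro!: bdd_aboveI2[where M="norm B"] order_trans[OF psd_dist_le_norm] norm_bounded)

lemma psd_sup_least: "(!!s. psd_dist (apply_bcontfun B s) \<le> q) ==> psd_sup B \<le> q"
  unfolding psd_sup_def by (rule cSUP_least) auto

lemma psd_sup_nonneg: "0 \<le> psd_sup B"
  using psd_sup_upper[of B 0] psd_dist_nonneg[of "apply_bcontfun B 0"] by linarith

lemma psd_sup_add: "psd_sup (A + B) \<le> psd_sup A + psd_sup B"
proof (rule psd_sup_least)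
  show "psd_dist (apply_bcontfun (A + B) s) \<le> psd_sup A + psd_sup B" for s
    using psd_dist_add[of "apply_bcontfun A s" "apply_bcontfun B s"] psd_sup_upper[of A s] psd_sup_upper[of B s]
    by (simp add: plus_bcontfun.rep_eq)
qed

lemma psd_sup_scaleR: "0 \<le> c ==> psd_sup (c *\<^sub>R B) = c * psd_sup B"
proof -
  have le: "psd_sup (c *\<^sub>R B) \<le> c * psd_sup B" if "0 \<le> c" for c B
    by (rule psd_sup_least) (use that psd_sup_upper in \<open>simp add: scaleR_bcontfun.rep_eq psd_dist_scaleR mult_left_mono\<close>)
  assume c: "0 \<le> c"
  show ?thesis
  proof (cases "c = 0")
    case True
    then show ?thesis using le[of 0 B] psd_sup_nonneg[of "0 *\<^sub>R B"] by simp
  next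
    case False
    then have "0 < c" using c by simp
    then have "psd_sup B \<le> (1 / c) * psd_sup (c *\<^sub>R B)" using le[of "1 / c" "c *\<^sub>R B"] by simp
    then have "c * psd_sup B \<le> psd_sup (c *\<^sub>R B)" using \<open>0 < c\<close> by (simp add: field_simps)
    then show ?thesis using le[OF c, of B] by simp
  qed
qed

lemma psd_sup_le_norm: "psd_sup B \<le> norm B"
  by (rule psd_sup_least) (rule order_trans[OF psd_dist_le_norm norm_bounded])

lemma sublinear_family_psd:
  assumes "!!t. 0 \<le> c t" "c \<in> borel_measurable M"
  shows "sublinear_family M (%t B. 2 * c t * psd_sup B) (%t. 2 * c t)"
proof
  show "2 * c t * psd_sup (x + y) \<le> 2 * c t * psd_sup x + 2 * c t * psd_sup y" for t x y
    using mult_left_mono[OF psd_sup_add[of x y], of "2 * c t"] assms(1)[of t] by (simp add: distrib_left)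
  show "2 * c t * psd_sup x \<le> 2 * c t * norm x" for t x
    by (intro mult_left_mono psd_sup_le_norm) (use assms(1) in simp)
qed (use assms in \<open>auto simp: psd_sup_scaleR\<close>)

text \<open>The assumption \<open>le\<close> carries all the structure: \<open>psd_dist\<close> is 0
  on skew matrices and on the cone, so the functional vanishes on skew fields and is nonpositive on
  semi-definite ones; with \<open>q\<close> a bound on the norm it also gives continuity.\<close>

locale psd_functional =
  fixes M :: "real measure" and \<Lambda> :: "real => (real => mat3) => real" and c :: "real => real"
  assumes add: "!!t f g. continuous_on {0..1} f ==> continuous_on {0..1} g ==> \<Lambda> t (%s. f s + g s) = \<Lambda> t f + \<Lambda> t g"
    and scale: "!!t f a. continuous_on {0..1} f ==> \<Lambda> t (%s. a *\<^sub>R f s) = a * \<Lambda> t f"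
    and le: "!!t f q. continuous_on {0..1} f ==> (!!s. s \<in> {0..1} ==> psd_dist (f s) \<le> q) ==> \<Lambda> t f \<le> 2 * c t * q"
    and c_nonneg: "!!t. 0 \<le> c t"
    and measurable: "!!f. continuous_on {0..1} f ==> (%t. \<Lambda> t f) \<in> borel_measurable M"
begin

lemma diff: "continuous_on {0..1} f ==> continuous_on {0..1} g ==> \<Lambda> t (%s. f s - g s) = \<Lambda> t f - \<Lambda> t g"
  using add[of f "%s. (-1) *\<^sub>R g s" t] scale[of g t "-1"] by (simp add: continuous_on_minus)

lemma abs_le:
  assumes f: "continuous_on {0..1} f" and q: "!!s. s \<in> {0..1} ==> norm (f s) \<le> q"
  shows "\<bar>\<Lambda> t f\<bar> \<le> 2 * c t * q"
proof -
  have "\<Lambda> t f \<le> 2 * c t * q" using q by (intro le f order_trans[OF psd_dist_le_norm]) auto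
  moreover have "\<Lambda> t (%s. (-1) *\<^sub>R f s) \<le> 2 * c t * q"
    using q by (intro le continuous_intros f order_trans[OF psd_dist_le_norm]) auto
  ultimately show ?thesis using scale[OF f, of t "-1"] by simp
qed

end

lemma pull_jacobian_continuous:
  assumes "\<phi> \<in> test_fun U"
  shows "continuous_on A (pull (%x. jacobian \<phi> (at x) :: mat3))"
  by (rule continuous_pull[OF continuous_jacobian[OF C1_test_fun[OF assms]] test_fun_deriv_support(1)[OF assms]])

context ev_setting
begin

abbreviation "Jac \<phi> \<equiv> pull (%x. jacobian \<phi> (at x))"

lemma functional_exists:
  "\<exists>\<Lambda> c. psd_functional I \<Lambda> c \<and> (\<forall>t. c t \<le> gap_bound) \<and> (\<forall>t\<in>{0..T}. c t \<le> gap t) \<and> c 0 = 0 \<and> integrable I c \<and>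
     (\<forall>f. continuous_on {0..1} f \<longrightarrow> integrable I (%t. \<Lambda> t f)) \<and>
     (\<forall>\<phi>\<in>test_fun_sol \<Omega>. \<forall>b\<in>{0..T}. upto (%t. \<Lambda> t (Jac \<phi>)) b = resid \<phi> b - resid \<phi> 0)"
proof -
  have ne: "test_fun_sol \<Omega> \<noteq> {}" using test_fun_sol_zero by blast
  have cJ: "continuous_on {0..1} (Jac \<phi>)" if "\<phi> \<in> test_fun_sol \<Omega>" for \<phi>
    by (rule pull_jacobian_continuous[OF test_fun_sol_test_fun[OF that]])
  obtain \<phi> where \<phi>: "!!n::nat. \<phi> n \<in> test_fun_sol \<Omega>"
    and \<phi>d: "!!\<psi> e. \<psi> \<in> test_fun_sol \<Omega> ==> 0 < e ==> \<exists>n. \<forall>s\<in>{0..1}. norm (Jac \<psi> s - Jac (\<phi> n) s) < e"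
    using separable_continuous_family[where \<Phi>=Jac, OF ne cJ] by metis
  define G where "G j = emb (Jac (\<phi> j))" for j
  \<comment> \<open>The times at which the inequality holds for all rational coefficient lists at
    once. There are countably many lists, so almost every time belongs to \<open>N\<close>.\<close>
  define N where "N = {t\<in>{0<..<T}. \<forall>qs\<in>lists \<rat>. (\<Sum>j<length qs. qs ! j * dens (\<phi> j) t) \<le> 2 * psd_sup (\<Sum>j<length qs. qs ! j *\<^sub>R G j) * gap t}"
  have one: "AE t in lebesgue. t \<in> {0..T} \<longrightarrow> (\<Sum>j<n. q j * dens (\<phi> j) t) \<le> 2 * psd_sup (\<Sum>j<n. q j *\<^sub>R G j) * gap t" for n q
  proof (rule dens_le[OF \<phi>])
    fix x :: vec3
    obtain s where s: "s \<in> {0..1} \<inter> curve_dom" "curve s = x" using curve_surj[of x] by blast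
    have "(\<Sum>j<n. q j *\<^sub>R jacobian (\<phi> j) (at x)) = apply_bcontfun (\<Sum>j<n. q j *\<^sub>R G j) s"
      using s by (auto simp: apply_bcontfun_sum G_def emb_apply[OF cJ[OF \<phi>]] clip(2) pull_def)
    then show "psd_dist (\<Sum>j<n. q j *\<^sub>R jacobian (\<phi> j) (at x)) \<le> psd_sup (\<Sum>j<n. q j *\<^sub>R G j)"
      using psd_sup_upper by simp
  qed
  have "countable (lists \<rat> :: real list set)" by (intro countable_lists countable_rat)
  then have "AE t in lebesgue. \<forall>qs\<in>lists \<rat>. t \<in> {0..T} \<longrightarrow> (\<Sum>j<length qs. qs ! j * dens (\<phi> j) t) \<le> 2 * psd_sup (\<Sum>j<length qs. qs ! j *\<^sub>R G j) * gap t"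
    by (simp only: AE_ball_countable) (intro ballI one)
  then have "AE t in lebesgue. t \<in> {0<..<T} \<longrightarrow> t \<in> N" by eventually_elim (auto simp: N_def)
  then have NAE: "AE t in I. t \<in> N" by (subst AE_lebesgue_on_iff) auto
  \<comment> \<open>Outside \<open>N\<close> both the bound \<open>c\<close> and the prescribed
    values \<open>l\<close> are set to 0, so that the domination holds at every time and not only
    almost everywhere.\<close>
  define c where "c t = (if t \<in> N then gap t else 0)" for t
  define l where "l j t = (if t \<in> N then dens (\<phi> j) t else 0)" for j t
  have c0: "0 \<le> c t" for t using gap_nonneg by (auto simp: c_def N_def)
  have cg: "AE t in I. gap t = c t" and lg: "AE t in I. dens (\<phi> j) t = l j t" for j
    using NAE by (eventually_elim, simp add: c_def l_def)+
  have cm: "c \<in> borel_measurable I"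
    by (rule I.borel_measurable_AE_cong[OF borel_measurable_integrable[OF gap_integrable] cg])
  have lm: "l j \<in> borel_measurable I" for j
    by (rule I.borel_measurable_AE_cong[OF borel_lebesgue_on[OF dens(1)[OF \<phi>]] lg])
  have cb: "c t \<le> gap_bound" for t using gap_bound by (auto simp: c_def N_def)
  have ci: "integrable I c" using c0 cb by (intro If.integrable_const_bound[where B=gap_bound] cm) auto
  interpret S: sublinear_family I "%t B. 2 * c t * psd_sup B" "%t. 2 * c t"
    by (rule sublinear_family_psd[OF c0 cm])
  \<comment> \<open>The functions determined by their values on [0,1]. This subspace contains the
    range of \<open>emb\<close> and, unlike the space of all bounded continuous functions on the
    line, is separable.\<close>
  define X where "X = {f :: real \<Rightarrow>\<^sub>C mat3. \<forall>s. apply_bcontfun f s = apply_bcontfun f (clip s)}"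
  have X: "subspace X" by (auto simp: subspace_def X_def plus_bcontfun.rep_eq scaleR_bcontfun.rep_eq zero_bcontfun.rep_eq)
  have embX: "emb g \<in> X" if "continuous_on {0..1} g" for g
    using that clip by (simp add: X_def emb_apply)
  have "X \<noteq> {}" using subspace_0[OF X] by blast
  moreover have "continuous_on {0..1} (apply_bcontfun f)" for f :: "real \<Rightarrow>\<^sub>C mat3"
    by (rule continuous_on_apply_bcontfun)
  ultimately obtain a :: "nat => real \<Rightarrow>\<^sub>C mat3" where aX: "!!n. a n \<in> X" and a: "!!f e. f \<in> X ==> 0 < e ==> \<exists>n. \<forall>s\<in>{0..1}. norm (apply_bcontfun f s - apply_bcontfun (a n) s) < e"
    using separable_continuous_family[where \<Phi>=apply_bcontfun and F=X] by metis
  have dense: "\<exists>k. norm (x - a k) < e" if xe: "x \<in> X" "0 < e" for x e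
  proof -
    obtain n where n: "\<forall>s\<in>{0..1}. norm (apply_bcontfun x s - apply_bcontfun (a n) s) < e / 2" using a[OF xe(1), of "e / 2"] xe(2) by auto
    have "norm (apply_bcontfun (x - a n) s) \<le> e / 2" for s
    proof -
      have "apply_bcontfun (x - a n) s = apply_bcontfun x (clip s) - apply_bcontfun (a n) (clip s)"
        using xe(1) aX[of n] by (auto simp: X_def minus_bcontfun.rep_eq)
      then show ?thesis using n clip(1)[of s] by (auto intro: less_imp_le)
    qed
    then have "norm (x - a n) \<le> e / 2" by (rule norm_bound)
    then show ?thesis using xe(2) by (intro exI[of _ n]) linarith
  qed
  have base: "(\<Sum>j<n. q j * l j t) \<le> 2 * c t * psd_sup (\<Sum>j<n. q j *\<^sub>R G j)" if q: "!!j. q j \<in> \<rat>" for t n q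
  proof (cases "t \<in> N")
    case True
    let ?qs = "map q [0..<n]"
    have "?qs \<in> lists \<rat>" using q by auto
    then have "(\<Sum>j<length ?qs. ?qs ! j * dens (\<phi> j) t) \<le> 2 * psd_sup (\<Sum>j<length ?qs. ?qs ! j *\<^sub>R G j) * gap t"
      using True unfolding N_def by blast
    then show ?thesis using True by (simp add: l_def c_def mult_ac)
  qed (simp add: l_def c_def)
  obtain \<Lambda>0 where \<Lambda>0: "!!x. x \<in> X ==> (%t. \<Lambda>0 t x) \<in> borel_measurable I"
    "!!t x y. x \<in> X ==> y \<in> X ==> \<Lambda>0 t (x + y) = \<Lambda>0 t x + \<Lambda>0 t y"
    "!!t x a. x \<in> X ==> \<Lambda>0 t (a *\<^sub>R x) = a * \<Lambda>0 t x"
    "!!t x. x \<in> X ==> \<Lambda>0 t x \<le> 2 * c t * psd_sup x"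
    "!!t j. G j \<in> X ==> \<Lambda>0 t (G j) = l j t"
    using S.measurable_hahn_banach[where l=l and G=G and X=X and a=a, OF lm base X dense] by blast
  define \<Lambda> where "\<Lambda> t g = \<Lambda>0 t (emb g)" for t g
  interpret F: psd_functional I \<Lambda> c
  proof
    show "\<Lambda> t (%s. f s + g s) = \<Lambda> t f + \<Lambda> t g" if "continuous_on {0..1} f" "continuous_on {0..1} g" for t f g
      using that by (simp add: \<Lambda>_def emb_linear \<Lambda>0(2) embX)
    show "\<Lambda> t (%s. a *\<^sub>R f s) = a * \<Lambda> t f" if "continuous_on {0..1} f" for t f a
      using that by (simp add: \<Lambda>_def emb_linear \<Lambda>0(3) embX)
    show "\<Lambda> t f \<le> 2 * c t * q" if f: "continuous_on {0..1} f" and q: "!!s. s \<in> {0..1} ==> psd_dist (f s) \<le> q" for t f q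
    proof -
      have "\<Lambda> t f \<le> 2 * c t * psd_sup (emb f)" by (simp add: \<Lambda>_def \<Lambda>0(4) embX f)
      also have "\<dots> \<le> 2 * c t * q"
        by (intro mult_left_mono psd_sup_least) (use c0 q clip(1) in \<open>simp_all add: emb_apply[OF f]\<close>)
      finally show ?thesis .
    qed
    show "(%t. \<Lambda> t f) \<in> borel_measurable I" if "continuous_on {0..1} f" for f
      using \<Lambda>0(1)[OF embX[OF that]] by (simp add: \<Lambda>_def[abs_def])
  qed (rule c0)
  have \<Lambda>j: "\<Lambda> t (Jac (\<phi> j)) = l j t" for t j
    using \<Lambda>0(5)[of j t] embX[OF cJ[OF \<phi>]] by (simp add: \<Lambda>_def G_def)
  have uj: "upto (%t. \<Lambda> t (Jac (\<phi> j))) b = resid (\<phi> j) b - resid (\<phi> j) 0" if b: "b \<in> {0..T}" for j b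
  proof -
    have "upto (%t. \<Lambda> t (Jac (\<phi> j))) b = upto (l j) b" by (simp add: \<Lambda>j)
    also have "\<dots> = upto (dens (\<phi> j)) b" 
    proof (rule upto_AE_cong)
      show "AE r in I. l j r = dens (\<phi> j) r" using lg[of j] by eventually_elim simp
    qed (use b in simp)
    also have "\<dots> = (LINT x|lebesgue. indicator {0..b} x * dens (\<phi> j) x)" by (simp add: upto_def integral_lebesgue_on)
    also have "\<dots> = resid (\<phi> j) b - resid (\<phi> j) 0" by (rule dens(3)[OF \<phi>]) (use b in auto)
    finally show ?thesis .
  qed
  have \<Lambda>i: "integrable I (%t. \<Lambda> t f)" if f: "continuous_on {0..1} f" for f
  proof -
    have "bounded (f ` {0..1})" by (intro compact_imp_bounded compact_continuous_image f) auto
    then obtain q where q: "!!s. s \<in> {0..1} ==> norm (f s) \<le> q" unfolding bounded_iff by blast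
    have q0: "0 \<le> q" using order_trans[OF norm_ge_zero q[of 0]] by simp
    have "\<bar>\<Lambda> t f\<bar> \<le> 2 * gap_bound * q" for t
    proof -
      have "\<bar>\<Lambda> t f\<bar> \<le> 2 * c t * q" by (rule F.abs_le[OF f q])
      also have "\<dots> \<le> 2 * gap_bound * q"
        using cb[of t] q0 by (intro mult_right_mono) auto
      finally show ?thesis .
    qed
    then show ?thesis by (intro If.integrable_const_bound[where B="2 * gap_bound * q"] F.measurable f) auto
  qed
  \<comment> \<open>The identity is known along the dense sequence of fields. Both sides are
    Lipschitz in the uniform norm of the Jacobian with constant \<open>2 gap_bound b\<close>, which
    gives the factor 4 in the estimate.\<close>
  have u: "upto (%t. \<Lambda> t (Jac \<psi>)) b = resid \<psi> b - resid \<psi> 0" if \<psi>: "\<psi> \<in> test_fun_sol \<Omega>" and b: "b \<in> {0..T}" for \<psi> b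
  proof -
    define R where "R = \<bar>upto (%t. \<Lambda> t (Jac \<psi>)) b - (resid \<psi> b - resid \<psi> 0)\<bar>"
    have est: "R \<le> (4 * gap_bound * b) * e" if e: "0 < e" for e
    proof -
      obtain n where n: "\<forall>s\<in>{0..1}. norm (Jac \<psi> s - Jac (\<phi> n) s) < e" using \<phi>d[OF \<psi> e] by blast
      define \<zeta> where "\<zeta> = (%x. \<psi> x + (-1) *\<^sub>R \<phi> n x)"
      have m: "(%x. (-1) *\<^sub>R \<phi> n x) \<in> test_fun_sol \<Omega>" by (rule test_fun_sol_linear(2)[OF \<phi>])
      have \<zeta>: "\<zeta> \<in> test_fun_sol \<Omega>" unfolding \<zeta>_def by (rule test_fun_sol_linear(1)[OF \<psi> m])
      note C = C1_test_fun[OF test_fun_sol_test_fun[OF \<psi>]] C1_test_fun[OF test_fun_sol_test_fun[OF m]] C1_test_fun[OF test_fun_sol_test_fun[OF \<phi>[of n]]]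
      have J\<zeta>: "jacobian \<zeta> (at x) = jacobian \<psi> (at x) - jacobian (\<phi> n) (at x)" for x
        using jacobian_linear(1)[OF C(1,2), of x] jacobian_linear(2)[OF C(3,3), of "-1" x] by (simp add: \<zeta>_def)
      have P\<zeta>: "Jac \<zeta> = (%s. Jac \<psi> s - Jac (\<phi> n) s)" by (rule ext) (simp add: pull_def J\<zeta>)
      have JB: "norm (jacobian \<zeta> (at x)) \<le> e" for x
        by (rule pull_le[where n=norm and f="%x. jacobian \<zeta> (at x)"]) (use n in \<open>auto simp: P\<zeta> intro: less_imp_le\<close>)
      have r: "resid \<zeta> t = resid \<psi> t - resid (\<phi> n) t" if "t \<in> {0..T}" for t
        using resid_linear(1)[OF \<psi> m that] resid_linear(2)[OF \<phi>[of n] \<phi>[of n] that, of "-1"] by (simp add: \<zeta>_def)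
      have r1: "\<bar>(resid \<psi> b - resid \<psi> 0) - (resid (\<phi> n) b - resid (\<phi> n) 0)\<bar> \<le> (2 * e * gap_bound) * b"
        using resid_lipschitz[OF \<zeta> JB, of 0 b] r[OF b] r[of 0] b T by (simp add: algebra_simps)
      have ub: "\<bar>\<Lambda> t (Jac \<zeta>)\<bar> \<le> 2 * e * gap_bound" for t
      proof -
        have "\<bar>\<Lambda> t (Jac \<zeta>)\<bar> \<le> 2 * c t * e"
          by (rule F.abs_le[OF cJ[OF \<zeta>]]) (use n in \<open>auto simp: P\<zeta> intro: less_imp_le\<close>)
        also have "\<dots> \<le> 2 * gap_bound * e" using cb[of t] e by (intro mult_right_mono) auto
        finally show ?thesis by (simp add: mult_ac)
      qed
      have "upto (%t. \<Lambda> t (Jac \<zeta>)) b = upto (%t. \<Lambda> t (Jac \<psi>) + (-1) * \<Lambda> t (Jac (\<phi> n))) b"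
        unfolding P\<zeta> F.diff[OF cJ[OF \<psi>] cJ[OF \<phi>]] by simp
      also have "\<dots> = upto (%t. \<Lambda> t (Jac \<psi>)) b + (-1) * upto (%t. \<Lambda> t (Jac (\<phi> n))) b"
        using b upto_linear(1)[OF \<Lambda>i[OF cJ[OF \<psi>]] integrable_mult_right[OF \<Lambda>i[OF cJ[OF \<phi>[of n]]], of "-1"], of b]
          upto_linear(2)[OF \<Lambda>i[OF cJ[OF \<phi>[of n]]] \<Lambda>i[OF cJ[OF \<phi>[of n]]], of b "-1"] by simp
      finally have e1: "upto (%t. \<Lambda> t (Jac \<zeta>)) b = upto (%t. \<Lambda> t (Jac \<psi>)) b - upto (%t. \<Lambda> t (Jac (\<phi> n))) b" by simp
      interpret fm: finite_measure "lebesgue_on {0..b}" by (rule finite_measure_lebesgue_on) simp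
      have ib: "integrable (lebesgue_on {0..b}) (%t. \<Lambda> t (Jac \<zeta>))"
        by (rule integrable_closed_interval[OF \<Lambda>i[OF cJ[OF \<zeta>]]]) (use b in auto)
      have "\<bar>upto (%t. \<Lambda> t (Jac \<zeta>)) b\<bar> \<le> (LINT t|lebesgue_on {0..b}. \<bar>\<Lambda> t (Jac \<zeta>)\<bar>)"
        unfolding upto_def by (rule integral_abs_bound)
      also have "\<dots> \<le> (LINT t|lebesgue_on {0..b}. 2 * e * gap_bound)"
        by (rule integral_mono) (use ib ub in auto)
      also have "\<dots> = (2 * e * gap_bound) * b" using b by (simp add: measure_restrict_space)
      finally have "\<bar>upto (%t. \<Lambda> t (Jac \<psi>)) b - upto (%t. \<Lambda> t (Jac (\<phi> n))) b\<bar> \<le> (2 * e * gap_bound) * b" by (simp add: e1)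
      then have "R \<le> (2 * e * gap_bound) * b + (2 * e * gap_bound) * b"
        using r1 uj[OF b, of n] unfolding R_def by linarith
      then show ?thesis by (simp add: algebra_simps)
    qed
    have "R \<le> 0"
    proof (rule field_le_epsilon)
      fix e :: real assume e: "0 < e"
      let ?K = "4 * gap_bound * b"
      have K: "0 \<le> ?K" using gap_bound(1) b by simp
      have "0 < e / (?K + 1)" by (rule divide_pos_pos[OF e]) (use K in linarith)
      then have "R \<le> ?K * (e / (?K + 1))" by (rule est)
      also have "\<dots> \<le> e" using e K by (simp add: field_simps)
      finally show "R \<le> 0 + e" by simp
    qed
    then show ?thesis by (simp add: R_def)
  qed
  show ?thesis
  proof (intro exI conjI)
    show "psd_functional I \<Lambda> c" by unfold_locales
    show "\<forall>t. c t \<le> gap_bound" using cb by blast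
    show "\<forall>t\<in>{0..T}. c t \<le> gap t" using gap_nonneg by (auto simp: c_def)
    show "c 0 = 0" by (simp add: c_def N_def)
    show "\<forall>\<phi>\<in>test_fun_sol \<Omega>. \<forall>b\<in>{0..T}. upto (%t. \<Lambda> t (Jac \<phi>)) b = resid \<phi> b - resid \<phi> 0" using u by blast
    show "\<forall>f. continuous_on {0..1} f \<longrightarrow> integrable I (%t. \<Lambda> t f)" using \<Lambda>i by blast
  qed (rule ci)
qed

end

section \<open>Riesz measures belonging to single matrices\<close>

context psd_functional
begin

lemma zero: "\<Lambda> t (%s. 0) = 0" using scale[of "%s. 0" t 0] by simp

lemma sum:
  assumes "finite K" "!!k. k \<in> K ==> continuous_on {0..1} (g k)"
  shows "\<Lambda> t (%s. \<Sum>k\<in>K. g k s) = (\<Sum>k\<in>K. \<Lambda> t (g k))"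
  using assms
proof (induction K)
  case (insert k K)
  then show ?case using add[of "g k" "%s. \<Sum>k\<in>K. g k s" t] by (simp add: continuous_on_sum)
qed (simp add: zero)

text \<open>\<open>psd_dist\<close> depends on the symmetric part only, so it is 0 on the skew
  differences \<open>A - msym A\<close> and on their negatives; \<open>le\<close> with bound 0 then
  yields both inequalities.\<close>

lemma skew:
  assumes f: "continuous_on {0..1} f"
  shows "\<Lambda> t (%s. msym (f s)) = \<Lambda> t f"
proof -
  have c: "continuous_on {0..1} (%s. msym (f s))" by (rule continuous_msym[OF f])
  have m: "msym (msym A - A) = 0" "msym (A - msym A) = 0" for A
    using linear_diff[OF linear_msym] msym_sym[OF transpose_msym[of A]] by auto
  have z: "psd_dist (msym A - A) = 0" "psd_dist (A - msym A) = 0" for A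
    using psd_dist_msym[of "msym A - A"] psd_dist_msym[of "A - msym A"] psd_dist_psd[OF psd_0] by (auto simp: m)
  have "\<Lambda> t (%s. msym (f s) - f s) \<le> 2 * c t * 0" by (intro le continuous_intros c f) (simp add: z)
  moreover have "\<Lambda> t (%s. f s - msym (f s)) \<le> 2 * c t * 0" by (intro le continuous_intros c f) (simp add: z)
  ultimately show ?thesis using diff[OF c f] diff[OF f c] by simp
qed

text \<open>If \<open>f\<close> is nonnegative, the field \<open>f P\<close> is semi-definite and
  the functional is nonpositive on it: hence the sign. The factor 1/2 anticipates that the momentum
  balance contains twice the measure.\<close>

lemma riesz:
  assumes P: "psd P"
  shows "\<exists>N. finite_measure N \<and> sets N = sets borel \<and>
    (\<forall>f B. continuous_on UNIV f \<longrightarrow> (\<forall>x. \<bar>f x\<bar> \<le> B) \<longrightarrow> integral\<^sup>L N f = - (1/2) * \<Lambda> t (%s. f s *\<^sub>R P))"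
proof -
  have a: "- (1/2) * \<Lambda> t (%s. (f s + g s) *\<^sub>R P) = - (1/2) * \<Lambda> t (%s. f s *\<^sub>R P) + - (1/2) * \<Lambda> t (%s. g s *\<^sub>R P)"
    if "continuous_on {0..1} f" "continuous_on {0..1} g" for f g :: "real => real"
    using add[of "%s. f s *\<^sub>R P" "%s. g s *\<^sub>R P" t] that by (simp add: continuous_intros scaleR_add_left add_divide_distrib)
  have s: "- (1/2) * \<Lambda> t (%s. (k * f s) *\<^sub>R P) = k * (- (1/2) * \<Lambda> t (%s. f s *\<^sub>R P))"
    if "continuous_on {0..1} f" for f :: "real => real" and k
    using scale[of "%s. f s *\<^sub>R P" t k] that by (simp add: continuous_intros)
  have p: "0 \<le> - (1/2) * \<Lambda> t (%s. f s *\<^sub>R P)" if "continuous_on {0..1} f" "!!x. x \<in> {0..1} ==> 0 \<le> f x" for f :: "real => real"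
  proof -
    have "\<Lambda> t (%s. f s *\<^sub>R P) \<le> 2 * c t * 0"
      by (rule le) (use that psd_dist_psd[OF psd_scaleR[OF _ P]] in \<open>auto intro!: continuous_intros\<close>)
    then show ?thesis by simp
  qed
  show ?thesis
  proof (rule riesz_unit_interval[where L="%f. - (1/2) * \<Lambda> t (%s. f s *\<^sub>R P)"])
    fix N :: "real measure"
    assume "finite_measure N" "sets N = sets borel"
      "!!f B. continuous_on UNIV f ==> (!!x. \<bar>f x\<bar> \<le> B) ==> integral\<^sup>L N f = - (1/2) * \<Lambda> t (%s. f s *\<^sub>R P)"
    then show ?thesis by blast
  qed (rule a, assumption+ | rule s, assumption+ | rule p, assumption+)+
qed

definition line_measure :: "real => mat3 => real measure" where
  "line_measure t P = (SOME N. finite_measure N \<and> sets N = sets borel \<and>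
    (\<forall>f B. continuous_on UNIV f \<longrightarrow> (\<forall>x. \<bar>f x\<bar> \<le> B) \<longrightarrow> integral\<^sup>L N f = - (1/2) * \<Lambda> t (%s. f s *\<^sub>R P)))"

lemma line_measure:
  assumes "psd P"
  shows "finite_measure (line_measure t P)" "sets (line_measure t P) = sets borel" "space (line_measure t P) = UNIV"
    "!!f B. continuous_on UNIV f ==> (!!x. \<bar>f x\<bar> \<le> B) ==> integral\<^sup>L (line_measure t P) f = - (1/2) * \<Lambda> t (%s. f s *\<^sub>R P)"
proof -
  note s = someI_ex[OF riesz[OF assms, of t], folded line_measure_def]
  show "finite_measure (line_measure t P)" "sets (line_measure t P) = sets borel" using s by auto
  then show "space (line_measure t P) = UNIV" using sets_eq_imp_space_eq[of "line_measure t P" borel] by simp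
  show "integral\<^sup>L (line_measure t P) f = - (1/2) * \<Lambda> t (%s. f s *\<^sub>R P)" if "continuous_on UNIV f" "!!x. \<bar>f x\<bar> \<le> B" for f B
    using s that by blast
qed

text \<open>The measures are chosen for each matrix separately. Linear relations between matrices
  nevertheless carry over, because a finite Borel measure is determined by the integrals of bounded
  continuous functions.\<close>

lemma line_measure_zero:
  fixes P :: "'k => mat3" and w :: "'k => real"
  assumes K: "finite K" and P: "!!k. psd (P k)" and z: "(\<Sum>k\<in>K. w k *\<^sub>R P k) = 0" and A: "A \<in> sets borel"
  shows "(\<Sum>k\<in>K. w k * measure (line_measure t (P k)) A) = 0"
proof (rule signed_measure_zero_continuous[OF K line_measure(1)[OF P] line_measure(2)[OF P] _ A])
  fix f :: "real => real" assume f: "continuous_on UNIV f" "!!x. \<bar>f x\<bar> \<le> 1"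
  have cf: "continuous_on {0..1} f" using f(1) by (rule continuous_on_subset) simp
  have "(\<Sum>k\<in>K. w k * integral\<^sup>L (line_measure t (P k)) f) = - (1/2) * (\<Sum>k\<in>K. w k * \<Lambda> t (%s. f s *\<^sub>R P k))"
    by (simp add: line_measure(4)[OF P f] sum_distrib_left mult_ac)
  also have "(\<Sum>k\<in>K. w k * \<Lambda> t (%s. f s *\<^sub>R P k)) = (\<Sum>k\<in>K. \<Lambda> t (%s. w k *\<^sub>R (f s *\<^sub>R P k)))"
    by (intro sum.cong refl scale[symmetric] continuous_intros cf)
  also have "\<dots> = \<Lambda> t (%s. \<Sum>k\<in>K. w k *\<^sub>R (f s *\<^sub>R P k))"
    by (rule sum[symmetric, OF K]) (intro continuous_intros cf)
  also have "(%s. \<Sum>k\<in>K. w k *\<^sub>R (f s *\<^sub>R P k)) = (%s. f s *\<^sub>R (\<Sum>k\<in>K. w k *\<^sub>R P k))"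
    by (simp add: scaleR_sum_right mult.commute)
  also have "\<dots> = (%s. 0)" by (simp add: z)
  finally show "(\<Sum>k\<in>K. w k * integral\<^sup>L (line_measure t (P k)) f) = 0" by (simp add: zero)
qed

end

text \<open>The symmetrised tensor of two unit vectors is the difference of the squares of half
  their sum and half their difference. This writes every symmetric matrix as a combination of
  semi-definite ones, to which \<open>line_measure\<close> applies.\<close>

definition pol_plus :: "3 => 3 => mat3" where
  "pol_plus i j = tensor ((1/2) *\<^sub>R (axis i 1 + axis j 1)) ((1/2) *\<^sub>R (axis i 1 + axis j 1))"
definition pol_minus :: "3 => 3 => mat3" where
  "pol_minus i j = tensor ((1/2) *\<^sub>R (axis i 1 - axis j 1)) ((1/2) *\<^sub>R (axis i 1 - axis j 1))"

lemma polarisation: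
  "psd (pol_plus i j)" "psd (pol_minus i j)" "pol_plus i j = pol_plus j i" "pol_minus i j = pol_minus j i"
  "msym Q = (\<Sum>i\<in>UNIV. \<Sum>j\<in>UNIV. Q $ i $ j *\<^sub>R (pol_plus i j - pol_minus i j))"
proof -
  show "psd (pol_plus i j)" "psd (pol_minus i j)" by (auto simp: pol_plus_def pol_minus_def psd_tensor)
  show "pol_plus i j = pol_plus j i" by (simp add: pol_plus_def add.commute)
  show "pol_minus i j = pol_minus j i" by (simp add: pol_minus_def tensor_def vec_eq_iff algebra_simps)
  have d: "(pol_plus i j - pol_minus i j) $ a $ b = ((if i = a \<and> j = b then 1 else 0) + (if j = a \<and> i = b then 1 else 0)) / 2" for i j a b
    by (cases "i = a"; cases "j = a"; cases "i = b"; cases "j = b"; simp add: pol_plus_def pol_minus_def tensor_def axis_def)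
  have "msym Q $ a $ b = (\<Sum>i\<in>UNIV. \<Sum>j\<in>UNIV. Q $ i $ j *\<^sub>R (pol_plus i j - pol_minus i j)) $ a $ b" for a b
  proof -
    have "(\<Sum>i\<in>UNIV. \<Sum>j\<in>UNIV. Q $ i $ j *\<^sub>R (pol_plus i j - pol_minus i j)) $ a $ b
      = (\<Sum>i\<in>UNIV. \<Sum>j\<in>UNIV. Q $ i $ j * (((if i = a \<and> j = b then 1 else 0) + (if j = a \<and> i = b then 1 else 0)) / 2))"
      unfolding sum_component vector_scaleR_component d real_scaleR_def ..
    also have "\<dots> = (Q $ a $ b + Q $ b $ a) / 2"
      using exhaust_3[of a] exhaust_3[of b] by (auto simp: sum_3)
    finally show ?thesis by (simp add: msym_def transpose_def)
  qed
  then show "msym Q = (\<Sum>i\<in>UNIV. \<Sum>j\<in>UNIV. Q $ i $ j *\<^sub>R (pol_plus i j - pol_minus i j))"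
    by (simp only: vec_eq_iff) blast
qed

lemma mat_entry_le: "\<bar>A $ i $ j\<bar> \<le> norm (A :: mat3)"
  using component_le_norm_cart[of "A $ i" j] Finite_Cartesian_Product.norm_nth_le[of A i] by linarith

section \<open>The matrix measure on the closure of the domain\<close>

locale psd_functional_on = psd_functional +
  fixes \<Omega> :: "vec3 set"
  assumes \<Omega>_ne: "\<Omega> \<noteq> {}"
begin

text \<open>The parameters that are kept: those where the curve does not stand for infinity and lies
  over the closure of \<open>\<Omega>\<close>.\<close>

definition "param_dom = curve_dom \<inter> curve -` closure \<Omega>"

lemma curve_vimage: "B \<in> sets borel ==> curve -` B \<in> sets borel"
  using measurable_sets[OF borel_measurable_curve, of B] by simp

lemma param_dom_borel: "param_dom \<in> sets borel"
  unfolding param_dom_def by (intro sets.Int curve_vimage borel_open open_curve_dom borel_closed closed_closure)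

definition space_measure :: "real => mat3 => vec3 measure" where
  "space_measure t P = distr (restrict_space (line_measure t P) param_dom) (restrict_space borel (closure \<Omega>)) curve"

lemma cl_borel_iff: "B \<in> cl_borel \<Omega> \<longleftrightarrow> B \<in> sets borel \<and> B \<subseteq> closure \<Omega>"
  by (subst sets_restrict_space_iff) auto

lemma space_measure:
  assumes P: "psd P"
  shows "finite_measure (space_measure t P)" "sets (space_measure t P) = cl_borel \<Omega>" "space (space_measure t P) = closure \<Omega>"
    "B \<in> cl_borel \<Omega> ==> measure (space_measure t P) B = measure (line_measure t P) (param_dom \<inter> curve -` B)"
    "!!f :: vec3 => real. f \<in> borel_measurable borel ==> integral\<^sup>L (space_measure t P) f = (LINT s|line_measure t P. indicator param_dom s * f (curve s))"
proof -
  note lm = line_measure(1-3)[OF P, of t]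
  interpret N: finite_measure "line_measure t P" by (rule lm)
  have dS: "param_dom \<in> sets (line_measure t P)" using param_dom_borel lm by simp
  have cN: "curve \<in> borel_measurable (line_measure t P)"
    using borel_measurable_curve measurable_cong_sets[OF lm(2) refl] by blast
  have cm: "curve \<in> measurable (restrict_space (line_measure t P) param_dom) (restrict_space borel (closure \<Omega>))"
  proof (rule measurable_restrict_space2)
    show "curve \<in> space (restrict_space (line_measure t P) param_dom) \<rightarrow> closure \<Omega>" by (auto simp: space_restrict_space param_dom_def)
  qed (rule measurable_restrict_space1[OF cN])
  interpret R: finite_measure "restrict_space (line_measure t P) param_dom"
    by (rule finite_measure_restrict_space[OF lm(1) dS])
  show "finite_measure (space_measure t P)" unfolding space_measure_def by (rule R.finite_measure_distr[OF cm])
  show "sets (space_measure t P) = cl_borel \<Omega>" "space (space_measure t P) = closure \<Omega>"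
    by (auto simp: space_measure_def space_restrict_space)
  show "measure (space_measure t P) B = measure (line_measure t P) (param_dom \<inter> curve -` B)" if B: "B \<in> cl_borel \<Omega>"
  proof -
    have e: "curve -` B \<inter> space (restrict_space (line_measure t P) param_dom) = param_dom \<inter> curve -` B"
      using lm by (auto simp: space_restrict_space)
    have "measure (space_measure t P) B = measure (restrict_space (line_measure t P) param_dom) (param_dom \<inter> curve -` B)"
      unfolding space_measure_def by (subst measure_distr[OF cm B]) (simp add: e)
    also have "\<dots> = measure (line_measure t P) (param_dom \<inter> curve -` B)"
      by (rule measure_restrict_space) (use dS lm in auto)
    finally show ?thesis .
  qed
  show "integral\<^sup>L (space_measure t P) f = (LINT s|line_measure t P. indicator param_dom s * f (curve s))" if f: "f \<in> borel_measurable borel" for f :: "vec3 => real"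
  proof -
    have "integral\<^sup>L (space_measure t P) f = (LINT s|restrict_space (line_measure t P) param_dom. f (curve s))"
      unfolding space_measure_def by (rule integral_distr[OF cm]) (rule measurable_restrict_space1[OF f])
    also have "\<dots> = (LINT s|line_measure t P. indicator param_dom s *\<^sub>R f (curve s))"
      by (rule integral_restrict_space) (use dS lm in auto)
    finally show ?thesis by simp
  qed
qed

definition mat_measure :: "real => vec3 set => mat3" where
  "mat_measure t B = (\<chi> i j. measure (space_measure t (pol_plus i j)) B - measure (space_measure t (pol_minus i j)) B)"

text \<open>A semi-definite \<open>Q\<close> equals its own polarised expansion, and this linear
  relation between semi-definite matrices passes to the measures. Positivity of the matrix measure
  is the case of rank one matrices, its trace the case of the identity.\<close>

lemma mat_measure_inner:
  assumes Q: "psd Q" and B: "B \<in> cl_borel \<Omega>"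
  shows "Q \<bullet> mat_measure t B = measure (space_measure t Q) B"
proof -
  \<comment> \<open>\<open>None\<close> stands for \<open>Q\<close> itself and
    \<open>Some (i, j, b)\<close> for the terms of its polarised expansion, weighted with the
    opposite sign so that the total is 0.\<close>
  define P where "P = case_option Q (%(i, j, b). if b then pol_plus i j else pol_minus i j)"
  define w where "w = case_option (1 :: real) (%(i, j, b). if b then - Q $ i $ j else Q $ i $ j)"
  have s: "(\<Sum>k\<in>UNIV. g k) = g None + (\<Sum>i\<in>UNIV. \<Sum>j\<in>UNIV. g (Some (i, j, True)) + g (Some (i, j, False)))"
    for g :: "(3 \<times> 3 \<times> bool) option => 'z::comm_monoid_add"
  proof -
    have "(\<Sum>k\<in>UNIV. g k) = g None + (\<Sum>k\<in>UNIV. g (Some k))"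
      by (simp add: UNIV_option_conv sum.reindex)
    also have "(\<Sum>k\<in>UNIV. g (Some k)) = (\<Sum>i\<in>UNIV. \<Sum>j\<in>UNIV. \<Sum>b\<in>UNIV. g (Some (i, j, b)))"
      by (simp add: sum.cartesian_product UNIV_Times_UNIV split_beta)
    finally show ?thesis by (simp add: UNIV_bool add.commute)
  qed
  have Pp: "psd (P k)" for k using Q polarisation(1,2) by (cases k) (auto simp: P_def)
  have "(\<Sum>k\<in>UNIV. w k *\<^sub>R P k) = Q - (\<Sum>i\<in>UNIV. \<Sum>j\<in>UNIV. Q $ i $ j *\<^sub>R (pol_plus i j - pol_minus i j))"
    unfolding s by (simp add: w_def P_def sum_negf[symmetric] scaleR_diff_right)
  also have "\<dots> = 0" using polarisation(5)[of Q] msym_sym[of Q] Q by (simp add: psd_def)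
  finally have z: "(\<Sum>k\<in>UNIV. w k *\<^sub>R P k) = 0" .
  have "param_dom \<inter> curve -` B \<in> sets borel" using B param_dom_borel curve_vimage by (auto simp: cl_borel_iff)
  from line_measure_zero[OF finite_class.finite_UNIV Pp z this, of t]
  have "(\<Sum>k\<in>UNIV. w k * measure (space_measure t (P k)) B) = 0" by (simp add: space_measure(4)[OF Pp B])
  then have "measure (space_measure t Q) B + (\<Sum>i\<in>UNIV. \<Sum>j\<in>UNIV. - (Q $ i $ j * mat_measure t B $ i $ j)) = 0"
    unfolding s by (simp add: w_def P_def mat_measure_def algebra_simps)
  then show ?thesis by (simp add: mat_inner sum_negf)
qed

lemma mat_measure_psd: "mat_measure t \<in> psd_measures \<Omega>"
  unfolding psd_measures_def
proof (intro CollectI conjI allI impI ballI)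
  fix A :: "nat => vec3 set" assume A: "range A \<subseteq> cl_borel \<Omega> \<and> disjoint_family A"
  have s: "(%n. measure (space_measure t P) (A n)) sums measure (space_measure t P) (\<Union>n. A n)" if "psd P" for P
    by (rule finite_measure.finite_measure_UNION[OF space_measure(1)[OF that]]) (use A space_measure(2)[OF that] in auto)
  show "(%n. mat_measure t (A n)) sums mat_measure t (\<Union>n. A n)"
    unfolding sums_def
  proof (intro vec_tendstoI)
    fix i j
    have "(%n. measure (space_measure t (pol_plus i j)) (A n) - measure (space_measure t (pol_minus i j)) (A n)) sums
      (mat_measure t (\<Union>n. A n) $ i $ j)"
      using sums_diff[OF s[OF polarisation(1)[of i j]] s[OF polarisation(2)[of i j]]] by (simp add: mat_measure_def)
    then show "(%n. (\<Sum>k<n. mat_measure t (A k)) $ i $ j) \<longlonglongrightarrow> mat_measure t (\<Union>n. A n) $ i $ j"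
      by (simp add: sums_def mat_measure_def sum_component)
  qed
next
  fix B show "transpose (mat_measure t B) = mat_measure t B"
    by (simp add: mat_measure_def transpose_def vec_eq_iff polarisation(3,4)[of _ _])
next
  fix B \<xi> assume "B \<in> cl_borel \<Omega>"
  then show "0 \<le> tensor \<xi> \<xi> \<bullet> mat_measure t B" by (simp add: mat_measure_inner psd_tensor)
qed

lemma mat_int_eq:
  assumes A: "!!i j. (%x. A x $ i $ j) \<in> borel_measurable borel" "!!x. norm (A x) \<le> K"
  shows "mat_int \<Omega> (mat_measure t) A = (\<Sum>i\<in>UNIV. \<Sum>j\<in>UNIV.
     integral\<^sup>L (space_measure t (pol_plus i j)) (%x. A x $ i $ j) - integral\<^sup>L (space_measure t (pol_minus i j)) (%x. A x $ i $ j))"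
  unfolding mat_int_def
proof (intro sum.cong refl signed_int_diff[where K=K] space_measure polarisation A)
  fix i j x
  show "\<bar>A x $ i $ j\<bar> \<le> K" using mat_entry_le A(2) by (rule order_trans)
qed (simp add: mat_measure_def)

lemma psd_mat_1: "psd (mat 1)" by (simp add: psd_def inner_ge_zero)

lemma mat_int_trace:
  "mat_int \<Omega> (mat_measure t) (%_. mat 1) = measure (space_measure t (mat 1)) (closure \<Omega>)"
  "signed_int \<Omega> (%B. trace (mat_measure t B)) (%_. 1) = measure (space_measure t (mat 1)) (closure \<Omega>)"
proof -
  have cl: "closure \<Omega> \<in> cl_borel \<Omega>" by (simp add: cl_borel_iff)
  have k: "integral\<^sup>L (space_measure t P) (%_. a) = measure (space_measure t P) (closure \<Omega>) * a" if "psd P" for P and a :: real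
    using space_measure(3)[OF that, of t] by simp
  have "mat_int \<Omega> (mat_measure t) (%_. mat 1) = (\<Sum>i\<in>UNIV. \<Sum>j\<in>UNIV. mat 1 $ i $ j * mat_measure t (closure \<Omega>) $ i $ j)"
    by (subst mat_int_eq[where K="norm (mat 1 :: mat3)"]) (simp_all add: k polarisation mat_measure_def algebra_simps space_measure(3))
  also have "\<dots> = mat 1 \<bullet> mat_measure t (closure \<Omega>)" by (simp add: mat_inner)
  also have "\<dots> = measure (space_measure t (mat 1)) (closure \<Omega>)" by (rule mat_measure_inner[OF psd_mat_1 cl])
  finally show "mat_int \<Omega> (mat_measure t) (%_. mat 1) = measure (space_measure t (mat 1)) (closure \<Omega>)" .
  have tr: "trace A = mat 1 \<bullet> A" for A :: mat3 by (simp add: mat_inner trace_def mat_def if_distrib[of "%x. x * _"] sum.delta cong: if_cong)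
  \<comment> \<open>The measure belonging to the zero matrix is the zero measure. It serves as the
    subtracted part when the nonnegative trace is integrated as a signed measure.\<close>
  have 0: "measure (space_measure t 0) B = 0" if "B \<in> cl_borel \<Omega>" for B using mat_measure_inner[OF psd_0 that, of t] by simp
  have "signed_int \<Omega> (%B. trace (mat_measure t B)) (%_. 1)
     = integral\<^sup>L (space_measure t (mat 1)) (%_. 1) - integral\<^sup>L (space_measure t 0) (%_. 1)"
    by (rule signed_int_diff[where K=1]) (simp_all add: space_measure(1-3) psd_mat_1 psd_0 tr mat_measure_inner 0)
  then show "signed_int \<Omega> (%B. trace (mat_measure t B)) (%_. 1) = measure (space_measure t (mat 1)) (closure \<Omega>)"
    by (simp add: k psd_mat_1 psd_0 0[OF cl] space_measure(3))
qed

lemma mat_int_trace_le: "1/2 * mat_int \<Omega> (mat_measure t) (%_. mat 1) \<le> c t"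
proof -
  note lm = line_measure[OF psd_mat_1, where t=t]
  interpret N: finite_measure "line_measure t (mat 1)" by (rule lm)
  have cl: "closure \<Omega> \<in> cl_borel \<Omega>" by (simp add: cl_borel_iff)
  have "mat_int \<Omega> (mat_measure t) (%_. mat 1) = measure (line_measure t (mat 1)) (param_dom \<inter> curve -` closure \<Omega>)"
    unfolding mat_int_trace(1) by (rule space_measure(4)[OF psd_mat_1 cl])
  also have "\<dots> \<le> measure (line_measure t (mat 1)) (space (line_measure t (mat 1)))" by (rule N.bounded_measure)
  also have "\<dots> = integral\<^sup>L (line_measure t (mat 1)) (%_. 1)" by simp
  also have "\<dots> = - (1/2) * \<Lambda> t (%s. 1 *\<^sub>R mat 1)" by (rule lm(4)[where B=1]) auto
  also have "\<dots> \<le> c t * norm (mat 1 :: mat3)" using abs_le[of "%s. mat 1" "norm (mat 1 :: mat3)" t] by simp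
  also have "norm (mat 1 :: mat3) = sqrt 3" unfolding norm_eq_sqrt_inner mat_inner by (simp add: sum_3 mat_def)
  also have "c t * sqrt 3 \<le> c t * 2" using c_nonneg[of t] by (intro mult_left_mono) (auto intro: real_le_lsqrt)
  finally show ?thesis by simp
qed

lemma cut_support:
  assumes A: "continuous_on UNIV A" "compact (closure {x. A x \<noteq> 0})"
  shows "continuous_on UNIV (%x. cutoff (closure \<Omega>) n x *\<^sub>R (A x :: mat3))" "compact (closure {x. cutoff (closure \<Omega>) n x *\<^sub>R A x \<noteq> 0})"
proof -
  show "continuous_on UNIV (%x. cutoff (closure \<Omega>) n x *\<^sub>R A x)" by (intro continuous_intros cutoff A)
  show "compact (closure {x. cutoff (closure \<Omega>) n x *\<^sub>R A x \<noteq> 0})"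
    by (rule closed_subset_compact_aux[OF A(2)]) (auto intro!: closure_mono)
qed

text \<open>Under the functional the polarised terms recombine to the symmetric part of the field,
  which has the same value as the field itself. The cut-off is carried along for the passage to the
  closure.\<close>

lemma cut_integral:
  assumes A: "continuous_on UNIV A" "compact (closure {x. A x \<noteq> 0})"
  shows "- (1/2) * \<Lambda> t (pull (%x. cutoff (closure \<Omega>) n x *\<^sub>R (A x :: mat3))) = (\<Sum>i\<in>UNIV. \<Sum>j\<in>UNIV.
     (LINT s|line_measure t (pol_plus i j). pull (%x. cutoff (closure \<Omega>) n x * A x $ i $ j) s)
     - (LINT s|line_measure t (pol_minus i j). pull (%x. cutoff (closure \<Omega>) n x * A x $ i $ j) s))"
proof -
  note cs = cut_support[OF A, of n]
  let ?g = "pull (%x. cutoff (closure \<Omega>) n x *\<^sub>R A x)"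
  let ?h = "%i j. pull (%x. cutoff (closure \<Omega>) n x * A x $ i $ j)"
  have h: "?h i j s = ?g s $ i $ j" for i j s by (simp add: pull_def)
  have g: "continuous_on U ?g" for U by (rule continuous_pull[OF cs])
  have ch: "continuous_on U (?h i j)" for i j U unfolding h by (intro continuous_intros g)
  obtain K where K: "!!x. norm (A x) \<le> K" using continuous_compact_support_bounded[OF A] by blast
  have hb: "\<bar>?h i j s\<bar> \<le> K" for i j s
  proof -
    have "\<bar>A x $ i $ j\<bar> \<le> K" for x using mat_entry_le K by (rule order_trans)
    then have "\<bar>cutoff (closure \<Omega>) n x * A x $ i $ j\<bar> \<le> 1 * K" for x
      unfolding abs_mult by (intro mult_mono) (auto simp: cutoff)
    moreover have "0 \<le> K" using K[of 0] norm_ge_zero order_trans by blast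
    ultimately show ?thesis by (simp add: pull_def)
  qed
  have ci: "continuous_on {0..1} (%s. ?h i j s *\<^sub>R P)" for i j and P :: mat3 by (intro continuous_intros ch)
  have "(\<Sum>i\<in>UNIV. \<Sum>j\<in>UNIV. (LINT s|line_measure t (pol_plus i j). ?h i j s) - (LINT s|line_measure t (pol_minus i j). ?h i j s))
    = (\<Sum>i\<in>UNIV. \<Sum>j\<in>UNIV. - (1/2) * (\<Lambda> t (%s. ?h i j s *\<^sub>R pol_plus i j) - \<Lambda> t (%s. ?h i j s *\<^sub>R pol_minus i j)))"
    by (intro sum.cong refl) (simp add: line_measure(4)[OF polarisation(1) ch hb] line_measure(4)[OF polarisation(2) ch hb] diff_divide_distrib)
  also have "\<dots> = - (1/2) * (\<Sum>i\<in>UNIV. \<Sum>j\<in>UNIV. \<Lambda> t (%s. ?h i j s *\<^sub>R (pol_plus i j - pol_minus i j)))"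
    by (simp add: sum_distrib_left diff[OF ci ci, symmetric] scaleR_diff_right)
  also have "(\<Sum>i\<in>UNIV. \<Sum>j\<in>UNIV. \<Lambda> t (%s. ?h i j s *\<^sub>R (pol_plus i j - pol_minus i j)))
     = \<Lambda> t (%s. \<Sum>i\<in>UNIV. \<Sum>j\<in>UNIV. ?h i j s *\<^sub>R (pol_plus i j - pol_minus i j))"
    by (subst sum) (auto intro!: continuous_intros ch sum.cong sum[symmetric])
  also have "(%s. \<Sum>i\<in>UNIV. \<Sum>j\<in>UNIV. ?h i j s *\<^sub>R (pol_plus i j - pol_minus i j)) = (%s. msym (?g s))"
    unfolding h polarisation(5) ..
  also have "\<Lambda> t (%s. msym (?g s)) = \<Lambda> t ?g" by (rule skew[OF g])
  finally show ?thesis by simp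
qed

text \<open>Restricting the measures to the closure of \<open>\<Omega>\<close> is the limit of
  multiplying by continuous cut-offs. So integrals against the matrix measure are limits of values
  of the functional, from which they inherit measurability in time and the norm bound.\<close>

lemma mat_int_limit:
  assumes A: "continuous_on UNIV A" "compact (closure {x. A x \<noteq> 0})"
  shows "(%n. - (1/2) * \<Lambda> t (pull (%x. cutoff (closure \<Omega>) n x *\<^sub>R A x))) \<longlonglongrightarrow> mat_int \<Omega> (mat_measure t) A"
proof -
  obtain K where K: "!!x. norm (A x) \<le> K" using continuous_compact_support_bounded[OF A] by blast
  have K0: "0 \<le> K" using K[of 0] norm_ge_zero order_trans by blast
  have Ab: "\<bar>A x $ i $ j\<bar> \<le> K" for x i j using mat_entry_le K by (rule order_trans)
  have Am: "(%x. A x $ i $ j) \<in> borel_measurable borel" for i j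
    by (intro borel_measurable_continuous_onI continuous_intros A)
  let ?h = "%n i j. pull (%x. cutoff (closure \<Omega>) n x * A x $ i $ j)"
  have lim: "(%n. LINT s|line_measure t P. ?h n i j s) \<longlonglongrightarrow> integral\<^sup>L (space_measure t P) (%x. A x $ i $ j)" if P: "psd P" for P i j
    unfolding space_measure(5)[OF P Am]
  proof (rule integral_dominated_convergence[where w="%s. K"])
    note lm = line_measure(1-3)[OF P, of t]
    interpret N: finite_measure "line_measure t P" by (rule lm)
    have cN: "curve \<in> borel_measurable (line_measure t P)"
      using borel_measurable_curve measurable_cong_sets[OF lm(2) refl] by blast
    show "(%s. indicator param_dom s * A (curve s) $ i $ j) \<in> borel_measurable (line_measure t P)"
      by (intro borel_measurable_times borel_measurable_indicator measurable_compose[OF cN Am]) (use param_dom_borel lm in simp)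
    show "?h n i j \<in> borel_measurable (line_measure t P)" for n
    proof -
      have "?h n i j = (%s. pull (%x. cutoff (closure \<Omega>) n x *\<^sub>R A x) s $ i $ j)" by (auto simp: pull_def)
      also have "\<dots> \<in> borel_measurable borel"
        by (intro borel_measurable_continuous_onI continuous_intros continuous_pull cut_support A)
      finally show ?thesis using measurable_cong_sets[OF lm(2) refl] by blast
    qed
    show "integrable (line_measure t P) (%s. K)" by simp
    show "AE s in line_measure t P. (%n. ?h n i j s) \<longlonglongrightarrow> indicator param_dom s * A (curve s) $ i $ j"
    proof (rule AE_I2)
      fix s
      show "(%n. ?h n i j s) \<longlonglongrightarrow> indicator param_dom s * A (curve s) $ i $ j"
      proof (cases "s \<in> curve_dom")
        case True
        have "(%n. cutoff (closure \<Omega>) n (curve s) * A (curve s) $ i $ j) \<longlonglongrightarrow> indicator (closure \<Omega>) (curve s) * A (curve s) $ i $ j"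
          by (intro tendsto_intros cutoff_tendsto) (simp_all add: \<Omega>_ne)
        then show ?thesis using True by (simp add: pull_def param_dom_def indicator_def)
      qed (simp add: pull_def param_dom_def)
    qed
    show "AE s in line_measure t P. norm (?h n i j s) \<le> K" for n
    proof (rule AE_I2)
      have "\<bar>cutoff (closure \<Omega>) n x * A x $ i $ j\<bar> \<le> 1 * K" for x
        unfolding abs_mult using Ab K0 by (intro mult_mono) (auto simp: cutoff)
      then show "norm (?h n i j s) \<le> K" for s using K0 by (simp add: pull_def)
    qed
  qed
  show ?thesis unfolding cut_integral[OF A] mat_int_eq[OF Am K]
    by (intro tendsto_intros lim polarisation)
qed

lemma mat_int_measurable:
  assumes A: "continuous_on UNIV A" "compact (closure {x. A x \<noteq> 0})"
  shows "(%t. mat_int \<Omega> (mat_measure t) A) \<in> borel_measurable M"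
proof (rule borel_measurable_LIMSEQ_real[OF mat_int_limit[OF A]])
  show "(%t. - (1/2) * \<Lambda> t (pull (%x. cutoff (closure \<Omega>) n x *\<^sub>R A x))) \<in> borel_measurable M" for n
    by (intro borel_measurable_times borel_measurable_const measurable continuous_pull cut_support A)
qed

lemma mat_int_bounded:
  assumes A: "continuous_on UNIV A" "compact (closure {x. A x \<noteq> 0})" "!!x. norm (A x) \<le> 1"
  shows "\<bar>mat_int \<Omega> (mat_measure t) A\<bar> \<le> c t"
proof (rule LIMSEQ_le_const2[OF tendsto_rabs[OF mat_int_limit[OF A(1,2)]]], intro exI[of _ 0] allI impI)
  fix n
  have b: "norm (pull (%x. cutoff (closure \<Omega>) n x *\<^sub>R A x) s) \<le> 1" for s
    using mult_mono[OF cutoff(3)[of "closure \<Omega>" n "curve s"] A(3)[of "curve s"]] by (simp add: pull_def cutoff(2))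
  have "\<bar>\<Lambda> t (pull (%x. cutoff (closure \<Omega>) n x *\<^sub>R A x))\<bar> \<le> 2 * c t * 1"
    by (rule abs_le[OF continuous_pull[OF cut_support[OF A(1,2)]] b])
  then show "\<bar>- (1/2) * \<Lambda> t (pull (%x. cutoff (closure \<Omega>) n x *\<^sub>R A x))\<bar> \<le> c t" by (simp add: abs_mult)
qed

lemma mat_int_supported:
  assumes A: "continuous_on UNIV A" "compact (closure {x. A x \<noteq> 0})" "!!x. x \<notin> \<Omega> ==> A x = 0"
  shows "mat_int \<Omega> (mat_measure t) A = - (1/2) * \<Lambda> t (pull A)"
proof -
  have e: "(%x. cutoff (closure \<Omega>) n x *\<^sub>R A x) = A" for n
  proof
    show "cutoff (closure \<Omega>) n x *\<^sub>R A x = A x" for x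
      using A(3)[of x] cutoff(4)[of x "closure \<Omega>" n] closure_subset[of \<Omega>] by (cases "x \<in> \<Omega>") auto
  qed
  show ?thesis by (rule LIMSEQ_unique[OF mat_int_limit[OF A(1,2), of t, unfolded e] tendsto_const])
qed

end

section \<open>Time-dependent test fields\<close>

lemma (in complete_measure) borel_measurable_AE_limit:
  fixes f :: "nat => 'a => real"
  assumes "!!n. f n \<in> borel_measurable M" "AE x in M. (%n. f n x) \<longlonglongrightarrow> g x"
  shows "g \<in> borel_measurable M"
proof (rule borel_measurable_AE_cong)
  show "(%x. lim (%n. f n x)) \<in> borel_measurable M" by (rule borel_measurable_lim_metric[OF assms(1)])
  show "AE x in M. lim (%n. f n x) = g x" using assms(2) by eventually_elim (rule limI)
qed

lemma test_fun_has_derivative: "f \<in> test_fun U ==> (f has_derivative frechet_derivative f (at p)) (at p)"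
proof -
  assume "f \<in> test_fun U"
  then have "Ck (Suc 0) f" unfolding test_fun_def by blast
  then show ?thesis by (simp add: frechet_derivative_works)
qed

lemma test_fun_slice:
  fixes f :: "real \<times> vec3 => 'b::real_normed_vector"
  assumes f: "f \<in> test_fun (A \<times> \<Omega>)"
  shows "(%x. f (t, x)) \<in> test_fun \<Omega>" "t \<notin> A ==> f (t, x) = 0"
proof -
  let ?K = "closure {p. f p \<noteq> 0}"
  have K: "compact ?K" "?K \<subseteq> A \<times> \<Omega>" "!!n. Ck n f" using f by (auto simp: test_fun_def)
  have cs: "compact (snd ` ?K)" by (intro compact_continuous_image continuous_intros K)
  have "{x. f (t, x) \<noteq> 0} \<subseteq> snd ` ?K" using closure_subset[of "{p. f p \<noteq> 0}"] by force
  then have s: "closure {x. f (t, x) \<noteq> 0} \<subseteq> snd ` ?K" by (rule closure_minimal[OF _ compact_imp_closed[OF cs]])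
  show "(%x. f (t, x)) \<in> test_fun \<Omega>"
    unfolding test_fun_def
  proof (intro CollectI conjI allI)
    show "Ck n (%x. f (t, x))" for n by (rule Ck_slice[OF K(3)])
    show "compact (closure {x. f (t, x) \<noteq> 0})" by (rule closed_subset_compact_aux[OF cs _ s]) simp
    show "closure {x. f (t, x) \<noteq> 0} \<subseteq> \<Omega>" using s K(2) by force
  qed
  show "t \<notin> A ==> f (t, x) = 0"
    using K(2) closure_subset[of "{p. f p \<noteq> 0}"] by blast
qed

lemma slice_derivatives:
  fixes f :: "real \<times> vec3 => 'b::real_normed_vector"
  assumes f: "f \<in> test_fun U"
  shows "((%r. f (r, x)) has_derivative (%h. h *\<^sub>R frechet_derivative f (at (t, x)) (1, 0))) (at t within S)"
    "frechet_derivative (%x. f (t, x)) (at x) h = frechet_derivative f (at (t, x)) (0, h)"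
proof -
  note D = test_fun_has_derivative[OF f, of "(t, x)"]
  interpret l: bounded_linear "frechet_derivative f (at (t, x))" by (rule has_derivative_bounded_linear[OF D])
  have "((%r. f (r, x)) has_derivative (%h. frechet_derivative f (at (t, x)) (h, 0))) (at t)"
  proof -
    have "((%r. (r, x)) has_derivative (%h. (h, 0))) (at t)" by (auto intro!: derivative_eq_intros)
    from diff_chain_at[OF this D] show ?thesis unfolding o_def .
  qed
  moreover have "(%h. frechet_derivative f (at (t, x)) (h, 0)) = (%h. h *\<^sub>R frechet_derivative f (at (t, x)) (1, 0))"
    by (rule ext) (simp add: l.scaleR[symmetric])
  ultimately have "((%r. f (r, x)) has_derivative (%h. h *\<^sub>R frechet_derivative f (at (t, x)) (1, 0))) (at t)"
    by (simp only:)
  then show "((%r. f (r, x)) has_derivative (%h. h *\<^sub>R frechet_derivative f (at (t, x)) (1, 0))) (at t within S)"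
    by (rule has_derivative_at_withinI)
  have "((%x. f (t, x)) has_derivative (%h. frechet_derivative f (at (t, x)) (0, h))) (at x)"
  proof -
    have "((%x. (t, x)) has_derivative (%h. (0, h))) (at x)" by (auto intro!: derivative_eq_intros)
    from diff_chain_at[OF this D] show ?thesis unfolding o_def .
  qed
  then show "frechet_derivative (%x. f (t, x)) (at x) h = frechet_derivative f (at (t, x)) (0, h)"
    by (simp add: frechet_derivative_unique_at)
qed

lemma test_fun_time_lipschitz:
  fixes f :: "real \<times> vec3 => 'b::euclidean_space"
  assumes f: "f \<in> test_fun U"
  shows "\<exists>B>0. \<forall>s t x. norm (f (t, x) - f (s, x)) \<le> B * \<bar>t - s\<bar>"
proof -
  have b: "(1, 0) \<in> (Basis :: (real \<times> vec3) set)" by (simp add: Basis_prod_def)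
  obtain B where B: "0 < B" "!!p. norm (frechet_derivative f (at p) (1, 0)) \<le> B"
    using test_fun_bounded[OF test_fun_deriv[OF f b]] by blast
  have "norm (f (t, x) - f (s, x)) \<le> B * norm (t - s)" for s t x
  proof (rule differentiable_bound[where f="%r. f (r, x)" and S=UNIV and f'="%r h. h *\<^sub>R frechet_derivative f (at (r, x)) (1, 0)"])
    show "((%r. f (r, x)) has_derivative (%h. h *\<^sub>R frechet_derivative f (at (r, x)) (1, 0))) (at r within UNIV)" for r
      by (rule slice_derivatives(1)[OF f])
    show "onorm (%h. h *\<^sub>R frechet_derivative f (at (r, x)) (1, 0)) \<le> B" for r
      by (rule onorm_bound) (use B in \<open>auto simp: mult.commute[of B] intro: mult_left_mono less_imp_le\<close>)
  qed auto
  then show ?thesis using B(1) by (intro exI[of _ B] conjI allI) auto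
qed

text \<open>The mean value inequality applied to \<open>f\<close> minus its linear part at
  \<open>a\<close>; the derivative of this difference is at most a constant times
  \<open>b - a\<close>, uniformly in \<open>x\<close>.\<close>

lemma test_fun_time_taylor:
  fixes f :: "real \<times> vec3 => 'b::euclidean_space"
  assumes f: "f \<in> test_fun U"
  shows "\<exists>B>0. \<forall>a b x. a \<le> b \<longrightarrow> norm (f (b, x) - f (a, x) - (b - a) *\<^sub>R frechet_derivative f (at (a, x)) (1, 0)) \<le> B * (b - a)\<^sup>2"
proof -
  let ?D = "%p. frechet_derivative f (at p) (1, 0)"
  have b: "(1, 0) \<in> (Basis :: (real \<times> vec3) set)" by (simp add: Basis_prod_def)
  obtain B where B: "0 < B" "!!s t x. norm (?D (t, x) - ?D (s, x)) \<le> B * \<bar>t - s\<bar>"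
    using test_fun_time_lipschitz[OF test_fun_deriv[OF f b]] by blast
  have "norm (f (b, x) - f (a, x) - (b - a) *\<^sub>R ?D (a, x)) \<le> B * (b - a)\<^sup>2" if ab: "a \<le> b" for a b x
  proof -
    have "norm ((f (b, x) - b *\<^sub>R ?D (a, x)) - (f (a, x) - a *\<^sub>R ?D (a, x))) \<le> (B * (b - a)) * norm (b - a)"
    proof (rule differentiable_bound[where f="%r. f (r, x) - r *\<^sub>R ?D (a, x)" and S="{a..b}" and f'="%r h. h *\<^sub>R (?D (r, x) - ?D (a, x))"])
      show "((%r. f (r, x) - r *\<^sub>R ?D (a, x)) has_derivative (%h. h *\<^sub>R (?D (r, x) - ?D (a, x)))) (at r within {a..b})" for r
        unfolding scaleR_diff_right by (intro has_derivative_diff slice_derivatives(1)[OF f]) (auto intro!: derivative_eq_intros)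
      show "onorm (%h. h *\<^sub>R (?D (r, x) - ?D (a, x))) \<le> B * (b - a)" if r: "r \<in> {a..b}" for r
      proof (rule onorm_bound)
        fix h :: real
        have "norm (?D (r, x) - ?D (a, x)) \<le> B * (b - a)"
          using B(2)[of r x a] r B(1) by (intro order_trans[OF B(2)] mult_left_mono) auto
        then show "norm (h *\<^sub>R (?D (r, x) - ?D (a, x))) \<le> B * (b - a) * norm h"
          using mult_left_mono[of "norm (?D (r, x) - ?D (a, x))" "B * (b - a)" "\<bar>h\<bar>"] by (simp add: mult.commute)
      qed (use B ab in simp)
    qed (use ab in auto)
    then show ?thesis using ab by (simp add: algebra_simps power2_eq_square)
  qed
  then show ?thesis using B(1) by (intro exI[of _ B] conjI allI impI)
qed

lemma norm_mat_le_sum: "norm (A :: mat3) \<le> (\<Sum>i\<in>UNIV. \<Sum>j\<in>UNIV. \<bar>A $ i $ j\<bar>)"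
proof -
  have "norm A \<le> (\<Sum>i\<in>UNIV. norm (A $ i))" unfolding norm_vec_def by (rule L2_set_le_sum) simp
  also have "\<dots> \<le> (\<Sum>i\<in>UNIV. \<Sum>j\<in>UNIV. \<bar>A $ i $ j\<bar>)" by (intro sum_mono norm_le_l1_cart)
  finally show ?thesis .
qed

locale time_test =
  fixes T :: real and \<Omega> :: "vec3 set" and w :: "real => field3"
  assumes w: "(%(t, x). w t x) \<in> test_fun ({0<..<T} \<times> \<Omega>)" and sol: "!!t x. trace (jacobian (w t) (at x)) = 0"
begin

definition dw :: "real => field3" where "dw t x = frechet_derivative (%(t, x). w t x) (at (t, x)) (1, 0)"

lemma w_sol: "w t \<in> test_fun_sol \<Omega>"
  using test_fun_slice(1)[OF w, of t] sol by (simp add: test_fun_sol_def)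

lemma w_zero: "t \<notin> {0<..<T} ==> w t = (%x. 0)"
  using test_fun_slice(2)[OF w, of t] by auto

lemma dw_test: "(%(t, x). dw t x) \<in> test_fun ({0<..<T} \<times> \<Omega>)"
proof -
  have b: "(1, 0) \<in> (Basis :: (real \<times> vec3) set)" by (simp add: Basis_prod_def)
  have "(%(t, x). dw t x) = (%p. frechet_derivative (%(t, x). w t x) (at p) (1, 0))" by (auto simp: dw_def)
  then show ?thesis using test_fun_deriv[OF w b] by simp
qed

lemma dw_slice: "dw t \<in> test_fun \<Omega>"
  using test_fun_slice(1)[OF dw_test, of t] by simp

lemma dw_eq: "vector_derivative (%r. w r x) (at s) = dw s x"
  using slice_derivatives(1)[OF w, of x s UNIV] by (intro vector_derivative_at) (simp add: dw_def has_vector_derivative_def)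

lemma w_taylor: "\<exists>B>0. \<forall>a b x. a \<le> b \<longrightarrow> norm (w b x - w a x - (b - a) *\<^sub>R dw a x) \<le> B * (b - a)\<^sup>2"
  using test_fun_time_taylor[OF w] by (auto simp: dw_def)

lemma dw_lipschitz: "\<exists>B>0. \<forall>s t x. norm (dw t x - dw s x) \<le> B * \<bar>t - s\<bar>"
  using test_fun_time_lipschitz[OF dw_test] by auto

lemma jacobian_lipschitz: "\<exists>B>0. \<forall>s t x. norm (jacobian (w t) (at x) - jacobian (w s) (at x)) \<le> B * \<bar>t - s\<bar>"
proof -
  let ?D = "%j p. frechet_derivative (%(t, x). w t x) (at p) (0, axis j 1)"
  have b: "(0, axis j 1) \<in> (Basis :: (real \<times> vec3) set)" for j by (simp add: Basis_prod_def axis_in_Basis_iff)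
  have "\<exists>B>0. \<forall>s t x. norm (?D j (t, x) - ?D j (s, x)) \<le> B * \<bar>t - s\<bar>" for j
    using test_fun_time_lipschitz[OF test_fun_deriv[OF w b]] by metis
  then obtain B where B: "!!j. 0 < B j" "!!j s t x. norm (?D j (t, x) - ?D j (s, x)) \<le> B j * \<bar>t - s\<bar>" by metis
  have J: "jacobian (w t) (at x) $ i $ j = ?D j (t, x) $ i" for t x i j
    using slice_derivatives(2)[OF w, of t x "axis j 1"] by (simp add: jacobian_nth)
  have "norm (jacobian (w t) (at x) - jacobian (w s) (at x)) \<le> (\<Sum>i\<in>(UNIV :: 3 set). \<Sum>j\<in>UNIV. B j) * \<bar>t - s\<bar>" for s t x
  proof -
    have "norm (jacobian (w t) (at x) - jacobian (w s) (at x)) \<le> (\<Sum>i\<in>UNIV. \<Sum>j\<in>UNIV. \<bar>(jacobian (w t) (at x) - jacobian (w s) (at x)) $ i $ j\<bar>)"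
      by (rule norm_mat_le_sum)
    also have "\<dots> \<le> (\<Sum>i\<in>(UNIV :: 3 set). \<Sum>j\<in>UNIV. B j * \<bar>t - s\<bar>)"
    proof (intro sum_mono)
      fix i j
      have "\<bar>(jacobian (w t) (at x) - jacobian (w s) (at x)) $ i $ j\<bar> = \<bar>(?D j (t, x) - ?D j (s, x)) $ i\<bar>" by (simp add: J)
      also have "\<dots> \<le> B j * \<bar>t - s\<bar>" by (rule order_trans[OF component_le_norm_cart B(2)])
      finally show "\<bar>(jacobian (w t) (at x) - jacobian (w s) (at x)) $ i $ j\<bar> \<le> B j * \<bar>t - s\<bar>" .
    qed
    finally show ?thesis by (simp only: sum_distrib_right)
  qed
  moreover have "0 < (\<Sum>i\<in>(UNIV :: 3 set). \<Sum>j\<in>UNIV. B j)" using B(1) by (intro sum_pos) auto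
  ultimately show ?thesis by blast
qed

end

text \<open>On a partition of mesh \<open>h\<close> the errors add up to
  \<open>C h (\<zeta> T - \<zeta> 0) + \<epsilon> T\<close>. The nondecreasing
  \<open>\<zeta>\<close> will be the primitive of a merely integrable function, of which only the
  total increment is under control; the extra factor \<open>b - a\<close> makes this
  suffice.\<close>

lemma telescoping_zero:
  fixes G \<zeta> :: "real => real"
  assumes T: "0 < T" and \<zeta>: "!!a b. 0 \<le> a ==> a \<le> b ==> b \<le> T ==> \<zeta> a \<le> \<zeta> b" and C: "0 \<le> C"
    and step: "!!\<epsilon>. 0 < \<epsilon> ==> \<exists>\<delta>>0. \<forall>a b. 0 \<le> a \<longrightarrow> a \<le> b \<longrightarrow> b \<le> T \<longrightarrow> b - a < \<delta> \<longrightarrow>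
       \<bar>G b - G a\<bar> \<le> C * (b - a) * (\<zeta> b - \<zeta> a) + \<epsilon> * (b - a)"
  shows "G T = G 0"
proof -
  have "\<bar>G T - G 0\<bar> \<le> 0"
  proof (rule field_le_epsilon)
    fix e :: real assume e: "0 < e"
    define Z where "Z = \<zeta> T - \<zeta> 0"
    have Z: "0 \<le> Z" using \<zeta>[of 0 T] T by (simp add: Z_def)
    obtain \<delta> where \<delta>: "0 < \<delta>" "!!a b. 0 \<le> a ==> a \<le> b ==> b \<le> T ==> b - a < \<delta> ==>
       \<bar>G b - G a\<bar> \<le> C * (b - a) * (\<zeta> b - \<zeta> a) + e / (2 * T) * (b - a)"
      using step[of "e / (2 * T)"] e T by auto
    define \<eta> where "\<eta> = min \<delta> (e / (2 * (C * Z + 1)))"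
    have "0 < C * Z + 1" using mult_nonneg_nonneg[OF C Z] by linarith
    then have \<eta>: "0 < \<eta>" using \<delta>(1) e by (simp add: \<eta>_def)
    obtain n :: nat where n: "T / \<eta> < real n" using reals_Archimedean2 by blast
    have n0: "0 < real n" using n T \<eta> by (intro le_less_trans[OF _ n]) simp
    define h where "h = T / real n"
    have h: "0 < h" "h < \<eta>" "real n * h = T" using n n0 T \<eta> by (auto simp: h_def field_simps)
    have st: "\<bar>G (real (Suc k) * h) - G (real k * h)\<bar> \<le> C * h * (\<zeta> (real (Suc k) * h) - \<zeta> (real k * h)) + e / (2 * T) * h" if k: "k < n" for k
    proof -
      have "real (Suc k) * h \<le> real n * h" using k h by (intro mult_right_mono) auto
      moreover have "real (Suc k) * h - real k * h = h" by (simp add: algebra_simps)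
      ultimately show ?thesis using \<delta>(2)[of "real k * h" "real (Suc k) * h"] h by (auto simp: \<eta>_def)
    qed
    have "\<bar>G T - G 0\<bar> = \<bar>\<Sum>k<n. G (real (Suc k) * h) - G (real k * h)\<bar>"
      using sum_lessThan_telescope[of "%k. G (real k * h)" n] h(3) by simp
    also have "\<dots> \<le> (\<Sum>k<n. \<bar>G (real (Suc k) * h) - G (real k * h)\<bar>)" by (rule sum_abs)
    also have "\<dots> \<le> (\<Sum>k<n. C * h * (\<zeta> (real (Suc k) * h) - \<zeta> (real k * h)) + e / (2 * T) * h)"
      by (rule sum_mono) (use st in auto)
    also have "\<dots> = C * h * (\<Sum>k<n. \<zeta> (real (Suc k) * h) - \<zeta> (real k * h)) + real n * (e / (2 * T) * h)"
      by (simp add: sum.distrib sum_distrib_left)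
    also have "(\<Sum>k<n. \<zeta> (real (Suc k) * h) - \<zeta> (real k * h)) = Z"
      using sum_lessThan_telescope[of "%k. \<zeta> (real k * h)" n] h(3) by (simp add: Z_def)
    also have "real n * (e / (2 * T) * h) = e / 2" 
    proof -
      have "real n * (e / (2 * T) * h) = e / (2 * T) * (real n * h)" by simp
      then show ?thesis using T by (simp add: h(3))
    qed
    also have "C * h * Z \<le> e / 2"
    proof -
      have "C * Z * h \<le> (C * Z + 1) * (e / (2 * (C * Z + 1)))"
        using h(1,2) C Z by (intro mult_mono) (auto simp: \<eta>_def)
      also have "\<dots> = e / 2" using \<open>0 < C * Z + 1\<close> by (simp add: field_simps)
      finally show ?thesis by (simp add: mult_ac)
    qed
    finally show "\<bar>G T - G 0\<bar> \<le> 0 + e" by simp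
  qed
  then show ?thesis by simp
qed

context ev_setting
begin

lemma upto_0: "integrable I f ==> upto f 0 = 0"
  using upto(1)[of f 0 0] T by (simp add: upto_def)

lemma integral_I_upto: "integrable I f ==> (LINT t|I. f t) = upto f T"
proof -
  assume "integrable I f"
  have "(LINT t|I. f t) = (LINT t|lebesgue. indicator {0<..<T} t *\<^sub>R f t)" by (rule integral_lebesgue_on) simp
  also have "\<dots> = (LINT t|lebesgue. indicator {0..T} t *\<^sub>R f t)"
    by (rule complete_measure.integral_AE_cong[OF complete_lebesgue])
       (use AE_lebesgue_ne[of 0] AE_lebesgue_ne[of T] in \<open>eventually_elim, auto simp: indicator_def\<close>)
  also have "\<dots> = upto f T" unfolding upto_def by (rule integral_lebesgue_on[symmetric]) simp
  finally show ?thesis .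
qed

definition vbound :: real where "vbound = (SOME C. 0 \<le> C \<and> (\<forall>t\<in>{0..T}. (LINT x|L. norm (v t x)) \<le> C))"

lemma vbound: "0 \<le> vbound" "t \<in> {0..T} ==> (LINT x|L. norm (v t x)) \<le> vbound"
proof -
  obtain C where C: "0 \<le> C" "\<forall>t\<in>{0..T}. Lp_norm \<Omega> 2 (v t) \<le> C" using v_norm_bounded by blast
  have "(LINT x|L. norm (v t x)) \<le> measure L \<Omega> + C\<^sup>2" if t: "t \<in> {0..T}" for t
  proof -
    have m: "v t \<in> borel_measurable L" "integrable L (%x. (norm (v t x))\<^sup>2)" using v_L2[OF t] by (auto simp: Lp2_iff)
    have i: "integrable L (%x. 1 + (norm (v t x))\<^sup>2)" using m by auto
    have "integrable L (%x. norm (v t x))"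
      by (rule Bochner_Integration.integrable_bound[OF i]) (use m le_sq in auto)
    then have "(LINT x|L. norm (v t x)) \<le> (LINT x|L. 1 + (norm (v t x))\<^sup>2)" by (rule integral_mono[OF _ i le_sq])
    also have "\<dots> = measure L \<Omega> + (Lp_norm \<Omega> 2 (v t))\<^sup>2" using m by (simp add: Lp2_norm)
    also have "\<dots> \<le> measure L \<Omega> + C\<^sup>2" using C t by (intro add_left_mono power_mono Lp_norm_nonneg) auto
    finally show ?thesis .
  qed
  then have "\<exists>C. 0 \<le> C \<and> (\<forall>t\<in>{0..T}. (LINT x|L. norm (v t x)) \<le> C)" by (intro exI[of _ "measure L \<Omega> + C\<^sup>2"]) auto
  from someI_ex[OF this] show "0 \<le> vbound" "t \<in> {0..T} ==> (LINT x|L. norm (v t x)) \<le> vbound" unfolding vbound_def by auto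
qed

lemma v_L1: "t \<in> {0..T} ==> integrable L (%x. norm (v t x))"
proof -
  assume t: "t \<in> {0..T}"
  have m: "v t \<in> borel_measurable L" "integrable L (%x. (norm (v t x))\<^sup>2)" using v_L2[OF t] by (auto simp: Lp2_iff)
  have i: "integrable L (%x. 1 + (norm (v t x))\<^sup>2)" using m by auto
  show ?thesis by (rule Bochner_Integration.integrable_bound[OF i]) (use m le_sq in auto)
qed

lemma moment_bound:
  assumes t: "t \<in> {0..T}" and u: "u \<in> borel_measurable L" and B: "!!x. norm (u x) \<le> B"
  shows "\<bar>moment u t\<bar> \<le> vbound * B"
proof -
  have B0: "0 \<le> B" using B[of 0] norm_ge_zero order_trans by blast
  have m: "v t \<in> borel_measurable L" using v_L2[OF t] by (auto simp: Lp2_iff)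
  have le: "\<bar>v t x \<bullet> u x\<bar> \<le> norm (v t x) * B" for x
    using Cauchy_Schwarz_ineq2[of "v t x" "u x"] mult_left_mono[OF B[of x] norm_ge_zero[of "v t x"]] by linarith
  have i: "integrable L (%x. v t x \<bullet> u x)"
    by (rule Bochner_Integration.integrable_bound[OF integrable_mult_left[OF v_L1[OF t], of B] borel_measurable_inner[OF m u]])
       (use le B0 in auto)
  have "\<bar>moment u t\<bar> \<le> (LINT x|L. \<bar>v t x \<bullet> u x\<bar>)" unfolding moment_def by (rule integral_abs_bound)
  also have "\<dots> \<le> (LINT x|L. norm (v t x) * B)" using i v_L1[OF t] le by (intro integral_mono) auto
  also have "\<dots> = (LINT x|L. norm (v t x)) * B" by simp
  also have "\<dots> \<le> vbound * B" by (rule mult_right_mono[OF vbound(2)[OF t] B0])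
  finally show ?thesis .
qed

lemma moment_diff:
  assumes "\<phi> \<in> Lp \<Omega> 2" "\<psi> \<in> Lp \<Omega> 2" "t \<in> {0..T}"
  shows "moment (%x. \<phi> x - \<psi> x) t = moment \<phi> t - moment \<psi> t"
  using Lp2_inner_integrable(1)[OF v_L2[OF assms(3)] assms(1)] Lp2_inner_integrable(1)[OF v_L2[OF assms(3)] assms(2)]
  by (simp add: moment_def inner_diff_right)

text \<open>Here \<open>Y \<phi>\<close> is minus the time derivative of the moment of a fixed field
  \<open>\<phi>\<close>. The exceptional times in the Lipschitz estimate do not depend on the
  fields, so that a field moving with \<open>t\<close> may be inserted and compared with a frozen
  one.\<close>

lemma momentum_time_dependent:
  fixes Y :: "field3 => real => real"
  assumes Z: "integrable I Z" "!!t. 0 \<le> Z t"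
    and Yi: "!!\<phi>. \<phi> \<in> test_fun_sol \<Omega> ==> integrable I (Y \<phi>)"
    and Yl: "AE t in I. \<forall>\<phi>\<in>test_fun_sol \<Omega>. \<forall>\<psi>\<in>test_fun_sol \<Omega>. \<forall>B.
       (\<forall>x. norm (jacobian \<phi> (at x) - jacobian \<psi> (at x)) \<le> B) \<longrightarrow> \<bar>Y \<phi> t - Y \<psi> t\<bar> \<le> Z t * B"
    and Yu: "!!\<phi> b. \<phi> \<in> test_fun_sol \<Omega> ==> b \<in> {0..T} ==> upto (Y \<phi>) b = moment \<phi> 0 - moment \<phi> b"
    and w: "time_test T \<Omega> w"
  shows "(LINT t|I. Y (w t) t - moment (time_test.dw w t) t) = 0"
proof -
  interpret w: time_test T \<Omega> w by (rule w)
  obtain BJ where BJ: "0 < BJ" "!!s t x. norm (jacobian (w t) (at x) - jacobian (w s) (at x)) \<le> BJ * \<bar>t - s\<bar>" using w.jacobian_lipschitz by blast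
  obtain Bd where Bd: "0 < Bd" "!!s t x. norm (w.dw t x - w.dw s x) \<le> Bd * \<bar>t - s\<bar>" using w.dw_lipschitz by blast
  obtain Bt where Bt: "0 < Bt" "!!a b x. a \<le> b ==> norm (w b x - w a x - (b - a) *\<^sub>R w.dw a x) \<le> Bt * (b - a)\<^sup>2" using w.w_taylor by blast
  have w2: "w t \<in> Lp \<Omega> 2" and d2: "w.dw t \<in> Lp \<Omega> 2" for t
    by (rule sol_Lp2[OF w.w_sol], rule test_fun_Lp2[OF finite_Omega w.dw_slice])
  have Yw: "AE t in I. \<forall>s r. \<bar>Y (w s) t - Y (w r) t\<bar> \<le> Z t * (BJ * \<bar>s - r\<bar>)"
    using Yl by eventually_elim (use w.w_sol BJ(2) in blast)
  have fl: "\<bar>t - real_of_int \<lfloor>real (Suc n) * t\<rfloor> / real (Suc n)\<bar> \<le> 1 / real (Suc n)" for t n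
  proof -
    define N where "N = real (Suc n)"
    have N: "0 < N" by (simp add: N_def)
    have "t - real_of_int \<lfloor>N * t\<rfloor> / N = (N * t - real_of_int \<lfloor>N * t\<rfloor>) / N" using N by (simp add: field_simps)
    moreover have "\<bar>(N * t - real_of_int \<lfloor>N * t\<rfloor>) / N\<bar> \<le> 1 / N"
      unfolding abs_divide abs_of_pos[OF N] by (rule divide_right_mono[OF _ less_imp_le[OF N]]) linarith
    ultimately show ?thesis unfolding N_def by (simp only:)
  qed
  \<comment> \<open>\<open>Y (w t) t\<close> depends on \<open>t\<close> twice. Freezing the field
    at the grid time below \<open>t\<close>, which takes countably many values, gives measurable
    approximations.\<close>
  have Ym: "(%t. Y (w t) t) \<in> borel_measurable I"
  proof (rule I.borel_measurable_AE_limit)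
    show "(%t. Y (w (real_of_int \<lfloor>real (Suc n) * t\<rfloor> / real (Suc n))) t) \<in> borel_measurable I" for n
    proof (rule measurable_compose_countable[where f="%i t. Y (w (real_of_int i / real (Suc n))) t" and g="%t. \<lfloor>real (Suc n) * t\<rfloor>"])
      show "(%t. Y (w (real_of_int i / real (Suc n))) t) \<in> borel_measurable I" for i
        using Yi[OF w.w_sol] by (rule borel_measurable_integrable)
      have "(%t. \<lfloor>real (Suc n) * t\<rfloor>) \<in> measurable borel (count_space UNIV)" by measurable
      then show "(%t. \<lfloor>real (Suc n) * t\<rfloor>) \<in> measurable I (count_space UNIV)"
        by (intro measurable_restrict_space1 measurable_completion) simp
    qed
    show "AE t in I. (%n. Y (w (real_of_int \<lfloor>real (Suc n) * t\<rfloor> / real (Suc n))) t) \<longlonglongrightarrow> Y (w t) t"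
      using Yw
    proof eventually_elim
      case (elim t)
      have "(%n. Z t * (BJ * (1 / real (Suc n)))) \<longlonglongrightarrow> Z t * (BJ * 0)"
        by (intro tendsto_intros LIMSEQ_inverse_real_of_nat[unfolded inverse_eq_divide])
      then have g0: "(%n. Z t * (BJ * (1 / real (Suc n)))) \<longlonglongrightarrow> 0" by (simp only: mult_zero_right)
      have nb: "norm (Y (w (real_of_int \<lfloor>real (Suc n) * t\<rfloor> / real (Suc n))) t - Y (w t) t) \<le> Z t * (BJ * (1 / real (Suc n)))" for n
      proof -
        have "\<bar>Y (w (real_of_int \<lfloor>real (Suc n) * t\<rfloor> / real (Suc n))) t - Y (w t) t\<bar>
          \<le> Z t * (BJ * \<bar>real_of_int \<lfloor>real (Suc n) * t\<rfloor> / real (Suc n) - t\<bar>)" using elim by blast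
        also have "\<dots> \<le> Z t * (BJ * (1 / real (Suc n)))"
          using fl[of t n] Z(2)[of t] BJ(1) by (intro mult_left_mono) (auto simp: abs_minus_commute)
        finally show ?thesis by simp
      qed
      have "(%n. Y (w (real_of_int \<lfloor>real (Suc n) * t\<rfloor> / real (Suc n))) t - Y (w t) t) \<longlonglongrightarrow> 0"
        by (rule Lim_null_comparison[OF always_eventually g0]) (rule allI, rule nb)
      then show ?case by (rule LIM_zero_cancel)
    qed
  qed
  have i1: "integrable I (%t. Y (w t) t)"
  proof (rule Bochner_Integration.integrable_bound[OF _ Ym])
    show "integrable I (%t. \<bar>Y (w 0) t\<bar> + Z t * (BJ * T))" using Yi[OF w.w_sol] Z(1) by auto
    show "AE t in I. norm (Y (w t) t) \<le> norm (\<bar>Y (w 0) t\<bar> + Z t * (BJ * T))"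
      using Yw AE_I_times
    proof eventually_elim
      case (elim t)
      have "\<bar>Y (w t) t - Y (w 0) t\<bar> \<le> Z t * (BJ * \<bar>t - 0\<bar>)" using elim by blast
      also have "\<dots> \<le> Z t * (BJ * T)" using elim(2) Z(2)[of t] BJ(1) by (intro mult_left_mono) auto
      finally show ?case by simp
    qed
  qed
  define h where "h t = moment (w.dw t) t" for t
  have db: "(%x. w.dw a x - w.dw b x) \<in> borel_measurable L" for a b
    by (intro borel_measurable_diff) (use d2 in \<open>auto simp: Lp2_iff\<close>)
  have hc: "continuous_on {0..T} h"
    unfolding continuous_on_def
  proof
    fix s assume s: "s \<in> {0..T}"
    have "((%t. vbound * (Bd * \<bar>t - s\<bar>)) \<longlongrightarrow> vbound * (Bd * \<bar>s - s\<bar>)) (at s within {0..T})" by (intro tendsto_intros)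
    then have "((%t. vbound * (Bd * \<bar>t - s\<bar>)) \<longlongrightarrow> 0) (at s within {0..T})" by simp
    then have "((%t. moment (%x. w.dw t x - w.dw s x) t) \<longlongrightarrow> 0) (at s within {0..T})"
    proof (rule Lim_null_comparison[rotated])
      show "\<forall>\<^sub>F t in at s within {0..T}. norm (moment (%x. w.dw t x - w.dw s x) t) \<le> vbound * (Bd * \<bar>t - s\<bar>)"
        using moment_bound[OF _ db Bd(2)] by (auto simp: eventually_at_filter)
    qed
    moreover have "(moment (w.dw s) \<longlongrightarrow> moment (w.dw s) s) (at s within {0..T})"
      using moment_continuous[OF d2[of s]] s by (auto simp: continuous_on_def)
    ultimately have sum: "((%t. moment (%x. w.dw t x - w.dw s x) t + moment (w.dw s) t) \<longlongrightarrow> 0 + moment (w.dw s) s) (at s within {0..T})"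
      by (rule tendsto_add)
    show "(h \<longlongrightarrow> h s) (at s within {0..T})"
    proof (rule Lim_transform_eventually)
      show "((%t. moment (%x. w.dw t x - w.dw s x) t + moment (w.dw s) t) \<longlongrightarrow> h s) (at s within {0..T})"
        using sum by (simp add: h_def)
      show "\<forall>\<^sub>F t in at s within {0..T}. moment (%x. w.dw t x - w.dw s x) t + moment (w.dw s) t = h t"
        unfolding eventually_at_filter by (rule always_eventually) (simp add: moment_diff[OF d2 d2] h_def)
    qed
  qed
  have hm: "integrable I h"
  proof -
    have "integrable (lebesgue_on {0..T}) h"
      using hc by (intro continuous_imp_integrable_real)
    then have "integrable lebesgue (%x. indicator {0..T} x *\<^sub>R h x)" by (subst (asm) integral_lebesgue_on) auto
    then have "integrable lebesgue (%x. indicator {0<..<T} x *\<^sub>R h x)"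
      by (rule complete_measure.integrable_AE_cong[OF complete_lebesgue])
         (use AE_lebesgue_ne[of 0] AE_lebesgue_ne[of T] in \<open>eventually_elim, auto simp: indicator_def\<close>)
    then show ?thesis by (subst integral_lebesgue_on) auto
  qed
  \<comment> \<open>Formally constant: by the product rule the derivative of
    \<open>moment (w t) t\<close> consists of \<open>moment (dw t) t\<close> and minus
    \<open>Y (w t) t\<close>. As \<open>w\<close> vanishes at both end times,
    \<open>G T = G 0\<close> is the claim.\<close>
  define G where "G t = upto (%t. Y (w t) t) t - upto h t + moment (w t) t" for t
  have "G T = G 0"
  proof (rule telescoping_zero[OF T, where \<zeta>="upto Z" and C=BJ])
    show "upto Z a \<le> upto Z b" if "0 \<le> a" "a \<le> b" "b \<le> T" for a b
    proof -
      have "0 \<le> (LINT r|lebesgue_on {a..b}. Z r)" using Z(2) by simp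
      then show ?thesis by (simp add: upto(1)[OF Z(1) that])
    qed
    show "0 \<le> BJ" using BJ by simp
    fix e :: real assume e: "0 < e"
    have "uniformly_continuous_on {0..T} h" by (rule compact_uniformly_continuous[OF hc]) simp
    then obtain \<delta>0 where \<delta>0: "0 < \<delta>0" "!!s t. s \<in> {0..T} ==> t \<in> {0..T} ==> dist t s < \<delta>0 ==> dist (h t) (h s) < e / 2"
      unfolding uniformly_continuous_on_def using e by (metis half_gt_zero)
    define \<delta> where "\<delta> = min \<delta>0 (e / (2 * (vbound * Bt + 1)))"
    have vB: "0 < vbound * Bt + 1" using mult_nonneg_nonneg[OF vbound(1) less_imp_le[OF Bt(1)]] by linarith
    have \<delta>: "0 < \<delta>" using \<delta>0(1) e vB by (simp add: \<delta>_def)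
    show "\<exists>\<delta>>0. \<forall>a b. 0 \<le> a \<longrightarrow> a \<le> b \<longrightarrow> b \<le> T \<longrightarrow> b - a < \<delta> \<longrightarrow>
       \<bar>G b - G a\<bar> \<le> BJ * (b - a) * (upto Z b - upto Z a) + e * (b - a)"
    proof (intro exI[of _ \<delta>] conjI allI impI \<delta>)
      fix a b assume ab: "0 \<le> a" "a \<le> b" "b \<le> T" "b - a < \<delta>"
      have aI: "a \<in> {0..T}" "b \<in> {0..T}" using ab by auto
      let ?R = "lebesgue_on {a..b}"
      interpret fm: finite_measure ?R by (rule finite_measure_lebesgue_on) simp
      have R: "complete_measure ?R" by (rule complete_lebesgue_on) simp
      have iY: "integrable ?R (%t. Y (w t) t)" "integrable ?R (Y (w b))" "integrable ?R Z" "integrable ?R h"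
        by (intro integrable_closed_interval i1 Yi w.w_sol Z hm ab)+
      have A1: "\<bar>(LINT t|?R. Y (w t) t) - (LINT t|?R. Y (w b) t)\<bar> \<le> BJ * (b - a) * (upto Z b - upto Z a)"
      proof -
        have ae: "AE t in ?R. \<bar>Y (w t) t - Y (w b) t\<bar> \<le> Z t * (BJ * (b - a))"
          using AE_closed_interval[OF Yw ab(1,3)] AE_space
        proof eventually_elim
          case (elim t)
          have "\<bar>Y (w t) t - Y (w b) t\<bar> \<le> Z t * (BJ * \<bar>t - b\<bar>)" using elim by blast
          also have "\<dots> \<le> Z t * (BJ * (b - a))" using elim(2) Z(2)[of t] BJ(1) by (intro mult_left_mono) auto
          finally show ?case .
        qed
        have "\<bar>(LINT t|?R. Y (w t) t) - (LINT t|?R. Y (w b) t)\<bar> = \<bar>LINT t|?R. Y (w t) t - Y (w b) t\<bar>" using iY by simp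
        also have "\<dots> \<le> (LINT t|?R. \<bar>Y (w t) t - Y (w b) t\<bar>)" by (rule integral_abs_bound)
        also have "\<dots> \<le> (LINT t|?R. Z t * (BJ * (b - a)))" by (rule integral_mono_AE) (use iY ae in auto)
        also have "\<dots> = BJ * (b - a) * (upto Z b - upto Z a)" by (simp add: upto(1)[OF Z(1) ab(1-3)])
        finally show ?thesis .
      qed
      have A2: "\<bar>(LINT t|?R. h t) - (b - a) * h a\<bar> \<le> e / 2 * (b - a)"
      proof -
        have "\<bar>(LINT t|?R. h t) - (b - a) * h a\<bar> = \<bar>LINT t|?R. h t - h a\<bar>"
          using iY ab by (simp add: measure_restrict_space)
        also have "\<dots> \<le> (LINT t|?R. \<bar>h t - h a\<bar>)" by (rule integral_abs_bound)
        also have "\<dots> \<le> (LINT t|?R. e / 2)"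
        proof (rule integral_mono)
          fix t assume "t \<in> space ?R"
          then have t: "a \<le> t" "t \<le> b" by auto
          then have "dist (h t) (h a) < e / 2" using \<delta>0(2)[of a t] ab by (auto simp: dist_real_def \<delta>_def)
          then show "\<bar>h t - h a\<bar> \<le> e / 2" by (simp add: dist_real_def)
        qed (use iY in auto)
        also have "\<dots> = e / 2 * (b - a)" using ab by (simp add: measure_restrict_space)
        finally show ?thesis .
      qed
      have A3: "\<bar>moment (w b) a - moment (w a) a - (b - a) * h a\<bar> \<le> e / 2 * (b - a)"
      proof -
        have s2: "(%x. (b - a) *\<^sub>R w.dw a x) \<in> Lp \<Omega> 2" by (rule test_fun_Lp2[OF finite_Omega test_fun_scaleR[OF w.dw_slice]])
        have "moment (w b) a - moment (w a) a - (b - a) * h a = moment (%x. w b x - w a x - (b - a) *\<^sub>R w.dw a x) a"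
          using moment_diff[OF Lp2_diff[OF w2[of b] w2[of a]] s2 aI(1)] moment_diff[OF w2[of b] w2[of a] aI(1)]
            moment_linear(2)[OF d2[of a] d2[of a] aI(1), of "b - a"] by (simp add: h_def)
        moreover have "(%x. w b x - w a x - (b - a) *\<^sub>R w.dw a x) \<in> borel_measurable L"
          using Lp2_diff[OF Lp2_diff[OF w2[of b] w2[of a]] s2] by (simp add: Lp2_iff)
        ultimately have "\<bar>moment (w b) a - moment (w a) a - (b - a) * h a\<bar> \<le> vbound * (Bt * (b - a)\<^sup>2)"
          using moment_bound[OF aI(1) _ Bt(2)[OF ab(2)]] by simp
        also have "\<dots> = (vbound * Bt * (b - a)) * (b - a)" by (simp add: power2_eq_square)
        also have "\<dots> \<le> e / 2 * (b - a)"
        proof (rule mult_right_mono)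
          have "vbound * Bt * (b - a) \<le> (vbound * Bt + 1) * (e / (2 * (vbound * Bt + 1)))"
            using ab vbound(1) Bt(1) by (intro mult_mono) (auto simp: \<delta>_def)
          also have "\<dots> = e / 2" using vB by (simp add: field_simps)
          finally show "vbound * Bt * (b - a) \<le> e / 2" .
        qed (use ab in simp)
        finally show ?thesis .
      qed
      \<comment> \<open>The change of \<open>v\<close> is charged to the field frozen at
        \<open>b\<close>, and the change of \<open>w\<close> is measured against \<open>v a\<close>
        alone. This split avoids differentiating \<open>v\<close> in time.\<close>
      have "(LINT t|?R. Y (w b) t) = moment (w b) a - moment (w b) b"
        using upto(1)[OF Yi[OF w.w_sol[of b]] ab(1-3)] Yu[OF w.w_sol aI(1), of b] Yu[OF w.w_sol aI(2), of b] by simp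
      then have "G b - G a = ((LINT t|?R. Y (w t) t) - (LINT t|?R. Y (w b) t)) - ((LINT t|?R. h t) - (b - a) * h a)
         + (moment (w b) a - moment (w a) a - (b - a) * h a)"
        using upto(1)[OF i1 ab(1-3)] upto(1)[OF hm ab(1-3)] by (simp add: G_def)
      then show "\<bar>G b - G a\<bar> \<le> BJ * (b - a) * (upto Z b - upto Z a) + e * (b - a)"
        using A1 A2 A3 by argo
    qed
  qed
  moreover have "moment (w t) t = 0" if "t \<notin> {0<..<T}" for t using w.w_zero[OF that] by (simp add: moment_def)
  ultimately have "upto (%t. Y (w t) t) T - upto h T = 0" by (simp add: G_def upto_0 i1 hm)
  then show ?thesis using i1 hm by (simp add: integral_I_upto[symmetric] h_def[symmetric])
qed

end

section \<open>The measure-valued solution\<close>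

text \<open>\<open>wgrad\<close> is a choice from this predicate. Equality of the predicates makes
  the chosen gradients of \<open>d 0\<close> and \<open>d0\<close> literally the same, so the
  energies of the initial values agree.\<close>

lemma has_weak_grad_AE_cong:
  assumes \<Omega>: "open \<Omega>" and eq: "AE x in lebesgue_on \<Omega>. u x = w x"
  shows "has_weak_grad \<Omega> u = has_weak_grad \<Omega> w"
proof
  fix G
  have le: "has_weak_grad \<Omega> w G" if u: "has_weak_grad \<Omega> u G" and eq: "AE x in lebesgue_on \<Omega>. u x = w x" for u w :: field3
    unfolding has_weak_grad_def
  proof (intro conjI ballI allI)
    interpret complete_measure "lebesgue_on \<Omega>" by (rule lebesgue_on_complete[OF \<Omega>])
    show "loc_int \<Omega> G" using u by (simp add: has_weak_grad_def)
    show "loc_int \<Omega> w"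
      unfolding loc_int_def
    proof (intro allI impI)
      fix C assume C: "compact C \<and> C \<subseteq> \<Omega>"
      then have s: "C \<in> sets lebesgue" by (simp add: compact_imp_closed)
      have 1: "integrable (lebesgue_on C) u" using u C by (simp add: has_weak_grad_def loc_int_def)
      have "AE x in lebesgue. x \<in> \<Omega> \<longrightarrow> u x = w x" using eq \<Omega> by (subst (asm) AE_lebesgue_on_iff) auto
      then have "AE x in lebesgue_on C. u x = w x" using C s by (subst AE_lebesgue_on_iff) (auto elim: eventually_mono)
      then show "integrable (lebesgue_on C) w"
        by (rule complete_measure.integrable_AE_cong[OF complete_lebesgue_on[OF s] 1])
    qed
    fix \<phi> :: "vec3 => real" and i j assume \<phi>: "\<phi> \<in> test_fun \<Omega>"
    have "(LINT x|lebesgue_on \<Omega>. u x $ i * frechet_derivative \<phi> (at x) (axis j 1)) = (LINT x|lebesgue_on \<Omega>. w x $ i * frechet_derivative \<phi> (at x) (axis j 1))"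
      by (rule integral_AE_cong) (use eq in eventually_elim, simp)
    then show "(LINT x|lebesgue_on \<Omega>. w x $ i * frechet_derivative \<phi> (at x) (axis j 1)) = - (LINT x|lebesgue_on \<Omega>. G x $ i $ j * \<phi> x)"
      using u \<phi> by (simp add: has_weak_grad_def)
  qed
  have eq': "AE x in lebesgue_on \<Omega>. w x = u x" using eq by eventually_elim simp
  show "has_weak_grad \<Omega> u G = has_weak_grad \<Omega> w G" using le[OF _ eq] le[OF _ eq'] by blast
qed

context ev_setting
begin

lemma energy_initial: "energy \<Omega> (v 0) (d 0) = energy \<Omega> v0 d0"
proof -
  have "wgrad \<Omega> (d 0) = wgrad \<Omega> d0" unfolding wgrad_def has_weak_grad_AE_cong[OF op d_init] ..
  moreover have "(LINT x|L. (norm (v 0 x))\<^sup>2) = (LINT x|L. (norm (v0 x))\<^sup>2)"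
    by (rule L.integral_AE_cong) (use v_init in eventually_elim, simp)
  ultimately show ?thesis by (simp add: BV_mem_energy)
qed

lemma flux_integrable: "AE t in I. integrable L (%x. flux (fields t x))" "integrable I (%t. LINT x|L. norm (flux (fields t x)))"
proof -
  show "AE t in I. integrable L (%x. flux (fields t x))"
    by (rule integrable_expression(3)[OF continuous_stresses(6) bounds_all(6)])
  have "continuous_on UNIV (%z. norm (flux z))" by (intro continuous_intros continuous_stresses)
  then show "integrable I (%t. LINT x|L. norm (flux (fields t x)))"
    by (rule integral_expression[where C="4 * BC"]) (use bounds_all(6) in \<open>simp add: quadratic_growth_def\<close>)
qed

lemma flux_pairing:
  assumes f: "integrable L (%x. flux (fields t x))" and G: "continuous_on UNIV G" "!!x. norm (G x) \<le> K"
  shows "integrable L (%x. flux (fields t x) \<bullet> G x)" "\<bar>LINT x|L. flux (fields t x) \<bullet> G x\<bar> \<le> (LINT x|L. norm (flux (fields t x))) * K"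
proof -
  have K: "0 \<le> K" using G(2)[of 0] norm_ge_zero order_trans by blast
  have Gm: "G \<in> borel_measurable L" by (intro borel_lebesgue_on borel_measurable_continuous_onI G)
  have le: "\<bar>flux (fields t x) \<bullet> G x\<bar> \<le> norm (flux (fields t x)) * K" for x
    using Cauchy_Schwarz_ineq2[of "flux (fields t x)" "G x"] mult_left_mono[OF G(2)[of x] norm_ge_zero[of "flux (fields t x)"]] by linarith
  show i: "integrable L (%x. flux (fields t x) \<bullet> G x)"
    by (rule Bochner_Integration.integrable_bound[OF integrable_mult_left[OF integrable_norm[OF f], of K] borel_measurable_inner[OF borel_measurable_integrable[OF f] Gm]])
       (use le K in auto)
  have "\<bar>LINT x|L. flux (fields t x) \<bullet> G x\<bar> \<le> (LINT x|L. \<bar>flux (fields t x) \<bullet> G x\<bar>)" by (rule integral_abs_bound)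
  also have "\<dots> \<le> (LINT x|L. norm (flux (fields t x)) * K)"
    by (rule integral_mono) (use i f le in auto)
  finally show "\<bar>LINT x|L. flux (fields t x) \<bullet> G x\<bar> \<le> (LINT x|L. norm (flux (fields t x))) * K" by simp
qed

lemma Jac_continuous: "\<phi> \<in> test_fun_sol \<Omega> ==> continuous_on A (Jac \<phi>)"
  by (rule pull_jacobian_continuous[OF test_fun_sol_test_fun])

lemma jac_continuous: "\<phi> \<in> test_fun_sol \<Omega> ==> continuous_on UNIV (%x. jacobian \<phi> (at x))"
  by (rule continuous_jacobian[OF C1_test_fun[OF test_fun_sol_test_fun]])

lemma measure_valued_solution:
  assumes ne: "\<Omega> \<noteq> {}" and E0: "E 0 = energy \<Omega> v0 d0"
  shows "\<exists>m. mv_solution \<Omega> T lam \<mu>1 \<mu>4 \<mu>5 \<mu>6 v d m \<and> (\<forall>t\<in>{0..T}.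
        1/2 * mat_int \<Omega> (m t) (%_. mat 1) = 1/2 * signed_int \<Omega> (%B. trace (m t B)) (%_. 1) \<and>
        1/2 * signed_int \<Omega> (%B. trace (m t B)) (%_. 1) \<le> E t - energy \<Omega> (v t) (d t))"
proof -
  obtain \<Lambda> c where L: "psd_functional I \<Lambda> c" "!!t. c t \<le> gap_bound" "!!t. t \<in> {0..T} ==> c t \<le> gap t" "c 0 = 0" "integrable I c"
    "!!f. continuous_on {0..1} f ==> integrable I (%t. \<Lambda> t f)"
    "!!\<phi> b. \<phi> \<in> test_fun_sol \<Omega> ==> b \<in> {0..T} ==> upto (%t. \<Lambda> t (Jac \<phi>)) b = resid \<phi> b - resid \<phi> 0"
    using functional_exists by blast
  interpret F: psd_functional I \<Lambda> c by (rule L(1))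
  interpret F: psd_functional_on I \<Lambda> c \<Omega> by unfold_locales (rule ne)
  let ?m = "F.mat_measure"
  \<comment> \<open>The primitive of the functional is the increment of \<open>resid\<close>, which
    consists of moments and the integrated force. Subtracting the force leaves moments
    alone.\<close>
  define Y where "Y \<phi> t = \<Lambda> t (Jac \<phi>) - force \<phi> t" for \<phi> t
  \<comment> \<open>Relative to the uniform norm of the Jacobian, \<open>2 c t\<close> bounds the
    functional and the space integral of the norm of \<open>flux\<close> bounds the force.\<close>
  define Z where "Z t = 2 * c t + (LINT x|L. norm (flux (fields t x)))" for t
  have momentum: "(LINT t|I. Y (w t) t - moment (time_test.dw w t) t) = 0" if w: "time_test T \<Omega> w" for w
  proof (rule momentum_time_dependent[OF _ _ _ _ _ w])
    show "integrable I Z" unfolding Z_def[abs_def] using L(5) flux_integrable(2) by auto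
    show "0 \<le> Z t" for t using F.c_nonneg[of t] by (simp add: Z_def)
    show "integrable I (Y \<phi>)" if "\<phi> \<in> test_fun_sol \<Omega>" for \<phi>
      unfolding Y_def[abs_def] using L(6)[OF Jac_continuous[OF that]] force_integrable(2)[OF that] by auto
    show "AE t in I. \<forall>\<phi>\<in>test_fun_sol \<Omega>. \<forall>\<psi>\<in>test_fun_sol \<Omega>. \<forall>B.
       (\<forall>x. norm (jacobian \<phi> (at x) - jacobian \<psi> (at x)) \<le> B) \<longrightarrow> \<bar>Y \<phi> t - Y \<psi> t\<bar> \<le> Z t * B"
      using flux_integrable(1)
    proof eventually_elim
      case (elim t)
      show ?case
      proof (intro ballI allI impI)
        fix \<phi> \<psi> B assume \<phi>: "\<phi> \<in> test_fun_sol \<Omega>" and \<psi>: "\<psi> \<in> test_fun_sol \<Omega>"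
          and B: "\<forall>x. norm (jacobian \<phi> (at x) - jacobian \<psi> (at x)) \<le> B"
        have B0: "0 \<le> B" using B norm_ge_zero order_trans by blast
        obtain K1 where K1: "!!x. norm (jacobian \<phi> (at x)) \<le> K1" using test_fun_jacobian_bounded[OF test_fun_sol_test_fun[OF \<phi>]] by blast
        obtain K2 where K2: "!!x. norm (jacobian \<psi> (at x)) \<le> K2" using test_fun_jacobian_bounded[OF test_fun_sol_test_fun[OF \<psi>]] by blast
        have cd: "continuous_on UNIV (%x. jacobian \<phi> (at x) - jacobian \<psi> (at x))" by (intro continuous_intros jac_continuous \<phi> \<psi>)
        have "force \<phi> t - force \<psi> t = (LINT x|L. flux (fields t x) \<bullet> (jacobian \<phi> (at x) - jacobian \<psi> (at x)))"
          unfolding force_def using flux_pairing(1)[OF elim jac_continuous[OF \<phi>] K1] flux_pairing(1)[OF elim jac_continuous[OF \<psi>] K2]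
          by (simp add: inner_diff_right)
        then have 1: "\<bar>force \<phi> t - force \<psi> t\<bar> \<le> (LINT x|L. norm (flux (fields t x))) * B"
          using flux_pairing(2)[OF elim cd B[rule_format]] by simp
        have "\<Lambda> t (Jac \<phi>) - \<Lambda> t (Jac \<psi>) = \<Lambda> t (%s. Jac \<phi> s - Jac \<psi> s)" by (simp add: F.diff Jac_continuous \<phi> \<psi>)
        also have "\<bar>\<dots>\<bar> \<le> 2 * c t * B"
        proof (rule F.abs_le)
          show "continuous_on {0..1} (%s. Jac \<phi> s - Jac \<psi> s)" by (intro continuous_intros Jac_continuous \<phi> \<psi>)
        qed (use B B0 in \<open>auto simp: pull_def\<close>)
        finally show "\<bar>Y \<phi> t - Y \<psi> t\<bar> \<le> Z t * B" using 1 unfolding Y_def Z_def distrib_right by linarith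
      qed
    qed
    show "upto (Y \<phi>) b = moment \<phi> 0 - moment \<phi> b" if \<phi>: "\<phi> \<in> test_fun_sol \<Omega>" and b: "b \<in> {0..T}" for \<phi> b
    proof -
      note i = L(6)[OF Jac_continuous[OF \<phi>]] force_integrable(2)[OF \<phi>]
      have "upto (Y \<phi>) b = upto (%t. \<Lambda> t (Jac \<phi>)) b - upto (force \<phi>) b"
        unfolding upto_def Y_def[abs_def] using integrable_closed_interval[OF i(1), of 0 b] integrable_closed_interval[OF i(2), of 0 b] b by simp
      then show ?thesis by (simp add: L(7)[OF \<phi> b] resid_def upto_0[OF i(2)])
    qed
  qed
  have wstar: "?m \<in> Linf_wstar \<Omega> T"
    unfolding Linf_wstar_def
  proof (intro CollectI conjI ballI allI impI exI[of _ gap_bound])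
    show "?m t \<in> psd_measures \<Omega>" for t by (rule F.mat_measure_psd)
    show "(%t. mat_int \<Omega> (?m t) A) \<in> borel_measurable I" if "continuous_on UNIV A \<and> compact (closure {x. A x \<noteq> 0})" for A
      using that by (intro F.mat_int_measurable) auto
    show "AE t in I. \<forall>A. continuous_on UNIV A \<and> compact (closure {x. A x \<noteq> 0}) \<and> (\<forall>x. norm (A x) \<le> 1) \<longrightarrow> \<bar>mat_int \<Omega> (?m t) A\<bar> \<le> gap_bound"
      by (intro AE_I2 allI impI order_trans[OF F.mat_int_bounded L(2)]) auto
  qed
  have tr: "1/2 * mat_int \<Omega> (?m t) (%_. mat 1) \<le> gap t" if "t \<in> {0..T}" for t
    by (rule order_trans[OF F.mat_int_trace_le L(3)[OF that]])
  \<comment> \<open>The defect at time 0 enters the energy inequality with a minus sign, so its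
    nonnegativity lets it be dropped there.\<close>
  have tr0: "0 \<le> mat_int \<Omega> (?m t) (%_. mat 1)" for t by (simp add: F.mat_int_trace)
  have mv: "mv_solution \<Omega> T lam \<mu>1 \<mu>4 \<mu>5 \<mu>6 v d ?m"
    unfolding mv_solution_def
  proof (intro conjI v_weak v_bochner d_weak wstar dir_eq q_bochner allI impI)
    fix w assume "(%(t, x). w t x) \<in> test_fun ({0<..<T} \<times> \<Omega>) \<and> (\<forall>t x. trace (jacobian (w t) (at x)) = 0)"
    then have w: "time_test T \<Omega> w" by (simp add: time_test_def)
    interpret w: time_test T \<Omega> w by (rule w)
    let ?J = "%s x. jacobian (w s) (at x)"
    \<comment> \<open>The factor -1/2 in the Riesz measures cancels the 2 of the momentum balance,
      and taking the symmetric part does not change the value of the functional.\<close>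
    have m: "2 * mat_int \<Omega> (?m s) (%x. msym (?J s x)) = - \<Lambda> s (Jac (w s))" for s
    proof -
      note wt = test_fun_sol_test_fun[OF w.w_sol[of s]]
      have z: "msym 0 = 0" using linear_0[OF linear_msym] .
      have J0: "?J s x = 0" if "x \<notin> \<Omega>" for x
        using test_fun_deriv_support(2)[OF wt] closure_subset[of "{x. ?J s x \<noteq> 0}"] that by blast
      have "mat_int \<Omega> (?m s) (%x. msym (?J s x)) = - (1/2) * \<Lambda> s (pull (%x. msym (?J s x)))"
      proof (rule F.mat_int_supported)
        show "continuous_on UNIV (%x. msym (?J s x))" by (rule continuous_msym[OF jac_continuous[OF w.w_sol]])
        show "compact (closure {x. msym (?J s x) \<noteq> 0})"
          by (rule closed_subset_compact_aux[OF test_fun_deriv_support(1)[OF wt]]) (auto intro!: closure_mono simp: z)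
        show "msym (?J s x) = 0" if "x \<notin> \<Omega>" for x using J0[OF that] z by simp
      qed
      also have "pull (%x. msym (?J s x)) = (%r. msym (Jac (w s) r))" by (auto simp: pull_def z)
      also have "\<Lambda> s (%r. msym (Jac (w s) r)) = \<Lambda> s (Jac (w s))" by (rule F.skew[OF Jac_continuous[OF w.w_sol]])
      finally show ?thesis by simp
    qed
    have "(LINT s|I. (LINT x|L.
              stress_L lam \<mu>1 \<mu>4 \<mu>5 \<mu>6 (d s x) (wgrad \<Omega> (v s) x) (proj_lap \<Omega> (d s) x) \<bullet> ?J s x
              - (tensor (v s x) (v s x) + transpose (wgrad \<Omega> (d s) x) ** wgrad \<Omega> (d s) x) \<bullet> ?J s x
              - v s x \<bullet> vector_derivative (%r. w r x) (at s))
           - 2 * mat_int \<Omega> (?m s) (%x. msym (?J s x))) = (LINT s|I. Y (w s) s - moment (w.dw s) s)"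
      (is "(LINT s|I. ?B s) = _")
    proof (rule I.integral_AE_cong)
      show "AE s in I. ?B s = Y (w s) s - moment (w.dw s) s"
        using flux_integrable(1) AE_I_times
      proof eventually_elim
        case (elim s)
        obtain K where K: "!!x. norm (?J s x) \<le> K" using test_fun_jacobian_bounded[OF test_fun_sol_test_fun[OF w.w_sol[of s]]] by blast
        have "?B s = (LINT x|L. - (flux (fields s x) \<bullet> ?J s x) - v s x \<bullet> w.dw s x) - 2 * mat_int \<Omega> (?m s) (%x. msym (?J s x))"
          unfolding w.dw_eq
          by (intro arg_cong2[where f="(-)"] Bochner_Integration.integral_cong refl)
             (simp add: flux_def conv_stress_def erick_stress_def diss_stress_def elastic_stress_def stress_L_def proj_lap_eq
                inner_add_left inner_diff_left)
        also have "\<dots> = Y (w s) s - moment (w.dw s) s"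
          using flux_pairing(1)[OF elim(1) jac_continuous[OF w.w_sol] K]
            Lp2_inner_integrable(1)[OF v_L2[OF elim(2)] test_fun_Lp2[OF finite_Omega w.dw_slice[of s]]]
          by (simp add: force_def moment_def m Y_def)
        finally show ?case .
      qed
    qed
    then show "(LINT s|I. ?B s) = 0" using momentum[OF w] by simp
  next
    have ds: "stress_D lam \<mu>1 \<mu>4 \<mu>5 \<mu>6 (d s x) (wgrad \<Omega> (v s) x) \<bullet> msym (wgrad \<Omega> (v s) x) + (norm (cross_lap \<Omega> (d s) x))\<^sup>2 = dissipation (fields s x)" for s x
      by (simp add: dissipation_def inner_msym_right[OF stress_D_sym])
    have g: "1/2 * ((Lp_norm \<Omega> 2 (v r))\<^sup>2 + (Lp_norm \<Omega> 2 (wgrad \<Omega> (d r)))\<^sup>2 + mat_int \<Omega> (?m r) (%_. mat 1))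
       = energy \<Omega> (v r) (d r) + 1/2 * mat_int \<Omega> (?m r) (%_. mat 1)" for r
      by (simp add: energy_def)
    show "AE t in I. (let g = (%r. 1/2 * ((Lp_norm \<Omega> 2 (v r))\<^sup>2 + (Lp_norm \<Omega> 2 (wgrad \<Omega> (d r)))\<^sup>2
                              + mat_int \<Omega> (?m r) (%_. mat 1))) in g t - g 0)
        + (LINT s|lebesgue_on {0..t}. LINT x|L.
             stress_D lam \<mu>1 \<mu>4 \<mu>5 \<mu>6 (d s x) (wgrad \<Omega> (v s) x) \<bullet> msym (wgrad \<Omega> (v s) x)
             + (norm (cross_lap \<Omega> (d s) x))\<^sup>2) \<le> 0" (is "AE t in I. ?P t")
    proof (rule AE_I2)
      fix t assume "t \<in> space I"
      then have t: "0 < t" "t < T" by auto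
      have "energy \<Omega> (v t) (d t) + 1/2 * mat_int \<Omega> (?m t) (%_. mat 1) \<le> E t" using tr[of t] t by (simp add: gap_def)
      moreover have "E 0 = energy \<Omega> (v 0) (d 0)" by (simp add: E0 energy_initial)
      ultimately show "?P t"
        unfolding Let_def g ds using energy_dissipation[OF t] tr0[of 0] by linarith
    qed
  qed
  show ?thesis
  proof (intro exI[of _ ?m] conjI mv ballI)
    fix t assume t: "t \<in> {0..T}"
    show "1/2 * mat_int \<Omega> (?m t) (%_. mat 1) = 1/2 * signed_int \<Omega> (%B. trace (?m t B)) (%_. 1)"
      by (simp add: F.mat_int_trace)
    show "1/2 * signed_int \<Omega> (%B. trace (?m t B)) (%_. 1) \<le> E t - energy \<Omega> (v t) (d t)"
      using tr[OF t] by (simp add: F.mat_int_trace gap_def)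
  qed
qed

end

theorem theorem2p4:
  fixes \<Omega> :: "(real^3) set" and T lam \<mu>1 \<mu>4 \<mu>5 \<mu>6 :: real
    and v0 d0 d\<Gamma> :: "real^3 \<Rightarrow> real^3"
    and v d :: "real \<Rightarrow> real^3 \<Rightarrow> real^3" and E :: "real \<Rightarrow> real"
  assumes "open \<Omega>" "connected \<Omega>" "\<Omega> \<noteq> {}" "T > 0"
    and "\<mu>4 > 0" "\<mu>5 + \<mu>6 - lam\<^sup>2 \<ge> 0" "\<mu>1 + lam\<^sup>2 \<ge> 0"
    and "AE x in lebesgue_on \<Omega>. norm (d0 x) = 1"
    and "\<forall>x\<in>frontier \<Omega>. norm (d\<Gamma> x) = 1"
    and "ev_solution \<Omega> T lam \<mu>1 \<mu>4 \<mu>5 \<mu>6 v0 d0 d\<Gamma> (weight_K \<Omega>) (ericksen_TE \<Omega>) v d E"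
    and "E 0 = energy \<Omega> v0 d0"
  shows "\<exists>m. mv_solution \<Omega> T lam \<mu>1 \<mu>4 \<mu>5 \<mu>6 v d m \<and>
    (let bound = (\<lambda>t.
        1/2 * mat_int \<Omega> (m t) (\<lambda>_. mat 1) = 1/2 * signed_int \<Omega> (\<lambda>B. trace (m t B)) (\<lambda>_. 1) \<and>
        1/2 * signed_int \<Omega> (\<lambda>B. trace (m t B)) (\<lambda>_. 1) \<le> E t - energy \<Omega> (v t) (d t))
     in bound 0 \<and> (AE t in lebesgue_on {0<..<T}. bound t))"
proof -
  interpret ev_setting \<Omega> T lam \<mu>1 \<mu>4 \<mu>5 \<mu>6 v0 d0 d\<Gamma> v d E
    using assms by unfold_locales auto
  obtain m where m: "mv_solution \<Omega> T lam \<mu>1 \<mu>4 \<mu>5 \<mu>6 v d m" "!!t. t \<in> {0..T} ==>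
        1/2 * mat_int \<Omega> (m t) (%_. mat 1) = 1/2 * signed_int \<Omega> (%B. trace (m t B)) (%_. 1) \<and>
        1/2 * signed_int \<Omega> (%B. trace (m t B)) (%_. 1) \<le> E t - energy \<Omega> (v t) (d t)"
    using measure_valued_solution assms by blast
  show ?thesis
    unfolding Let_def
    by (intro exI[of _ m] conjI[OF m(1)] conjI[of "_ \<and> _"] m(2) AE_I2) (use T in auto)
qed

end
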